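(* Let $\mathfrak{g}$ be a seven-dimensional real unimodular solvable non-nilpotent Lie algebra with non-trivial center. Then $\mathfrak{g}$ admits closed $\mathrm{G}_2$-structures if and only if it is isomorphic to one of the following Lie algebras: \[ \begin{split} \mathfrak{s}_1 &= (e^{23},-e^{36},e^{26},e^{26}-e^{56},e^{36}+e^{46},0,0), \\ \mathfrak{s}_2 &= (e^{16}+e^{35},-e^{26}+e^{45},e^{36},-e^{46},0,0,0), \\ \mathfrak{s}_3 &= (-e^{16}+e^{25},-e^{15}-e^{26},e^{36}-e^{45},e^{35}+e^{46},0,0,0), \\ \mathfrak{s}_4 &= (0,-e^{13},-e^{12},0,-e^{46},-e^{45},0), \\ \mathfrak{s}_5 &= (e^{15},-e^{25},-e^{35},e^{45},0,0,0), \\ \mathfrak{s}_6 &= (\alpha e^{15}+e^{25},-e^{15}+\alpha e^{25},-\alpha e^{35}+e^{45},-e^{35}-\alpha e^{45},0,0,0),\quad \alpha> 0, \\ \mathfrak{s}_7 &= (e^{25},-e^{15},e^{45},-e^{35},0,0,0), \\ \mathfrak{s}_8 &= (e^{16}+e^{35},-e^{26}+e^{45},e^{36},-e^{46},0,0,e^{34}), \\ \mathfrak{s}_9 &= (-e^{26}+e^{35},e^{16}+e^{45},-e^{46},e^{36},0,0, e^{34}), \\ \mathfrak{s}_{10} &= \left(e^{23},-e^{36},e^{26},e^{26}-e^{56},e^{36}+e^{46},0,2e^{16}+e^{25}-e^{34}+\sqrt{3}\,e^{24} +\sqrt{3}\,e^{35}\right),\\ \mathfrak{s}_{11} &= \left(e^{23},-e^{36},e^{26},e^{26}-e^{56},e^{36}+e^{46},0,2e^{16}+e^{25}-e^{34}-\sqrt{3}\,e^{24}-\sqrt{3}\,e^{35}\right).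 \end{split} \] In particular, if a seven-dimensional real unimodular solvable non-nilpotent Lie algebra $\mathfrak{g}$ with non-trivial center admits closed $\mathrm{G}_2$-structures, then $\mathfrak{g}$ is the contactization of a symplectic Lie algebra if and only if it is isomorphic either to $\mathfrak{s}_{10}$ or to $\mathfrak{s}_{11}$.
   Context: All Lie algebras are real and finite-dimensional; $d$ denotes the Chevalley-Eilenberg differential, with $d\alpha(x,y)=-\alpha([x,y])$ for 1-forms $\alpha$. Notation for Lie algebras: an $n$-tuple lists $(de^1,\ldots,de^n)$ with respect to a basis $(e^1,\ldots,e^n)$ of the dual space, and $e^{ij\cdots}=e^i\wedge e^j\wedge\cdots$. In $\mathfrak{s}_6$ the parameter $\alpha$ ranges over all positive real numbers (a one-parameter family of Lie algebras). A 3-form $\varphi$ on a seven-dimensional vector space $W$ is definite if $\iota_w\varphi$ has rank six for each non-zero $w\in W$. A $\mathrm{G}_2$-structure on a seven-dimensional Lie algebra $\mathfrak{g}$ is a definite 3-form $\varphi\in\Lambda^3\mathfrak{g}^*$; it is closed if $d\varphi=0$. Central extension: given a Lie algebra $(\mathfrak{h},[\cdot,\cdot]_{\mathfrak{h}})$ and a closed 2-form $\omega_0\in\Lambda^2\mathfrak{h}^*$, the central extension of $(\mathfrak{h},\omega_0)$ is $\mathfrak{h}\oplus\mathbb{R}z$ with bracket $[z,\mathfrak{h}]=0$, $[x,y]=-\omega_0(x,y)z+[x,y]_{\mathfrak{h}}$ for $x,y\in\mathfrak{h}$. A symplectic Lie algebra is a pair $(\mathfrak{h},\omega_0)$ with $\omega_0$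 a closed non-degenerate 2-form on $\mathfrak{h}$. When $(\mathfrak{h},\omega_0)$ is symplectic, its central extension is called its contactization (the covector $\theta$ with $\theta(z)=1$, $\theta|_{\mathfrak{h}}=0$ is then a contact form). "$\mathfrak{g}$ is the contactization of a symplectic Lie algebra" means that $\mathfrak{g}$ is isomorphic, as a Lie algebra, to the contactization of some symplectic Lie algebra $(\mathfrak{h},\omega_0)$. *)

theory Defs
  imports "HOL-Analysis.Analysis"
begin

text \<open>
  A Lie algebra is a bracket on a type of class \<open>real_vector\<close>; the underlying vector space is the
  whole type. Finite-dimensionality is expressed through \<open>dim\<close>, which is \<open>0\<close> on
  infinite-dimensional spaces, so that \<open>dim UNIV = 7\<close> does entail finite dimension.
\<close>

definition lie_algebra :: "('a::real_vector \<Rightarrow> 'a \<Rightarrow> 'a) \<Rightarrow> bool" where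
  "lie_algebra br \<longleftrightarrow> bilinear br \<and> (\<forall>x. br x x = 0) \<and>
     (\<forall>x y z. br x (br y z) + br y (br z x) + br z (br x y) = 0)"

definition lie_isomorphic ::
  "('a::real_vector \<Rightarrow> 'a \<Rightarrow> 'a) \<Rightarrow> ('b::real_vector \<Rightarrow> 'b \<Rightarrow> 'b) \<Rightarrow> bool" where
  "lie_isomorphic br br' \<longleftrightarrow>
     (\<exists>f. linear f \<and> bij f \<and> (\<forall>x y. f (br x y) = br' (f x) (f y)))"

definition lie_center :: "('a::real_vector \<Rightarrow> 'a \<Rightarrow> 'a) \<Rightarrow> 'a set" where
  "lie_center br = {z. \<forall>x. br z x = 0}"

definition bracket_span :: "('a::real_vector \<Rightarrow> 'a \<Rightarrow> 'a) \<Rightarrow> 'a set \<Rightarrow> 'a set \<Rightarrow> 'a set" where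
  "bracket_span br A B = span {br x y | x y. x \<in> A \<and> y \<in> B}"

definition lie_solvable :: "('a::real_vector \<Rightarrow> 'a \<Rightarrow> 'a) \<Rightarrow> bool" where
  "lie_solvable br \<longleftrightarrow> (\<exists>k::nat. ((\<lambda>A. bracket_span br A A) ^^ k) UNIV = {0})"

definition lie_nilpotent :: "('a::real_vector \<Rightarrow> 'a \<Rightarrow> 'a) \<Rightarrow> bool" where
  "lie_nilpotent br \<longleftrightarrow> (\<exists>k::nat. ((\<lambda>A. bracket_span br UNIV A) ^^ k) UNIV = {0})"

text \<open>
  Trace of an endomorphism of a finite-dimensional space. \<open>extend_basis {}\<close> is some basis of the
  whole space; the trace of a linear map does not depend on which one.
\<close>

definition linear_trace :: "('a::real_vector \<Rightarrow> 'a) \<Rightarrow> real" where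
  "linear_trace f = (\<Sum>b\<in>extend_basis {}. representation (extend_basis {}) (f b) b)"

definition lie_unimodular :: "('a::real_vector \<Rightarrow> 'a \<Rightarrow> 'a) \<Rightarrow> bool" where
  "lie_unimodular br \<longleftrightarrow> (\<forall>x. linear_trace (br x) = 0)"

definition two_form :: "('a::real_vector \<Rightarrow> 'a \<Rightarrow> real) \<Rightarrow> bool" where
  "two_form \<omega> \<longleftrightarrow> bilinear \<omega> \<and> (\<forall>x. \<omega> x x = 0)"

definition three_form :: "('a::real_vector \<Rightarrow> 'a \<Rightarrow> 'a \<Rightarrow> real) \<Rightarrow> bool" where
  "three_form \<phi> \<longleftrightarrow>
     (\<forall>y z. linear (\<lambda>x. \<phi> x y z)) \<and> (\<forall>x z. linear (\<lambda>y. \<phi> x y z)) \<and> (\<forall>x y. linear (\<phi> x y)) \<and>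
     (\<forall>x y. \<phi> x x y = 0 \<and> \<phi> x y x = 0 \<and> \<phi> y x x = 0)"

text \<open>
  The Chevalley--Eilenberg differential
  \<open>d\<alpha>(x\<^sub>0,...,x\<^sub>k) = (\<Sum>i<j. (-1)^(i+j) \<alpha>([x\<^sub>i,x\<^sub>j], x\<^sub>0, ..., x\<^sub>k))\<close>
  (\<open>x\<^sub>i\<close> and \<open>x\<^sub>j\<close> omitted after the first argument), written out for \<open>k = 2\<close> and \<open>k = 3\<close>.
  For \<open>k = 1\<close> it reads \<open>d\<alpha>(x,y) = - \<alpha>([x,y])\<close>.
\<close>

definition ce_d2 ::
  "('a::real_vector \<Rightarrow> 'a \<Rightarrow> 'a) \<Rightarrow> ('a \<Rightarrow> 'a \<Rightarrow> real) \<Rightarrow> 'a \<Rightarrow> 'a \<Rightarrow> 'a \<Rightarrow> real" where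
  "ce_d2 br \<omega> x y z = - \<omega> (br x y) z + \<omega> (br x z) y - \<omega> (br y z) x"

definition ce_d3 ::
  "('a::real_vector \<Rightarrow> 'a \<Rightarrow> 'a) \<Rightarrow> ('a \<Rightarrow> 'a \<Rightarrow> 'a \<Rightarrow> real) \<Rightarrow> 'a \<Rightarrow> 'a \<Rightarrow> 'a \<Rightarrow> 'a \<Rightarrow> real" where
  "ce_d3 br \<phi> x y z w =
     - \<phi> (br x y) z w + \<phi> (br x z) y w - \<phi> (br x w) y z
     - \<phi> (br y z) x w + \<phi> (br y w) x z - \<phi> (br z w) x y"

text \<open>
  The rank of a 2-form on a finite-dimensional space, i.e. of the map \<open>x \<mapsto> \<omega>(x, \<cdot>)\<close> into the dual
  space: the codimension of its kernel.
\<close>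

definition two_form_rank :: "('a::real_vector \<Rightarrow> 'a \<Rightarrow> real) \<Rightarrow> nat" where
  "two_form_rank \<omega> = dim (UNIV :: 'a set) - dim {x. \<forall>y. \<omega> x y = 0}"

definition definite_three_form :: "('a::real_vector \<Rightarrow> 'a \<Rightarrow> 'a \<Rightarrow> real) \<Rightarrow> bool" where
  "definite_three_form \<phi> \<longleftrightarrow> three_form \<phi> \<and> (\<forall>w. w \<noteq> 0 \<longrightarrow> two_form_rank (\<phi> w) = 6)"

definition admits_closed_G2 :: "('a::real_vector \<Rightarrow> 'a \<Rightarrow> 'a) \<Rightarrow> bool" where
  "admits_closed_G2 br \<longleftrightarrow>
     (\<exists>\<phi>. definite_three_form \<phi> \<and> (\<forall>x y z w. ce_d3 br \<phi> x y z w = 0))"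

definition symplectic_lie_algebra ::
  "('h::real_vector \<Rightarrow> 'h \<Rightarrow> 'h) \<Rightarrow> ('h \<Rightarrow> 'h \<Rightarrow> real) \<Rightarrow> bool" where
  "symplectic_lie_algebra br \<omega> \<longleftrightarrow>
     lie_algebra br \<and> two_form \<omega> \<and> (\<forall>x y z. ce_d2 br \<omega> x y z = 0) \<and>
     (\<forall>x. x \<noteq> 0 \<longrightarrow> (\<exists>y. \<omega> x y \<noteq> 0))"

text \<open>The central vector \<open>z\<close> of the extension is \<open>(0, 1)\<close>.\<close>

definition central_extension ::
  "('h::real_vector \<Rightarrow> 'h \<Rightarrow> 'h) \<Rightarrow> ('h \<Rightarrow> 'h \<Rightarrow> real) \<Rightarrow> 'h \<times> real \<Rightarrow> 'h \<times> real \<Rightarrow> 'h \<times> real" where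
  "central_extension br \<omega> u v = (br (fst u) (fst v), - \<omega> (fst u) (fst v))"

text \<open>
  For a seven-dimensional Lie algebra. A contactization of \<open>\<hh>\<close> has dimension \<open>dim \<hh> + 1\<close>, so
  \<open>\<hh>\<close> must be six-dimensional, and up to isomorphism its underlying space is \<open>\<real>^6\<close>.
\<close>

definition is_contactization7 :: "('a::real_vector \<Rightarrow> 'a \<Rightarrow> 'a) \<Rightarrow> bool" where
  "is_contactization7 br \<longleftrightarrow>
     (\<exists>(brh :: real^6 \<Rightarrow> real^6 \<Rightarrow> real^6) \<omega>.
        symplectic_lie_algebra brh \<omega> \<and> lie_isomorphic br (central_extension brh \<omega>))"

text \<open>
  The bracket on \<open>\<real>^7\<close> with structure equations \<open>(de\<^sup>1, ..., de\<^sup>7)\<close> in the dual of the standard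
  basis; the tuple is a function of \<open>e\<close>, where \<open>e i j\<close> stands for the value of
  \<open>e\<^sup>i \<and> e\<^sup>j\<close> at \<open>(x, y)\<close>. The sign comes from \<open>de\<^sup>k(x,y) = - e\<^sup>k([x,y])\<close>. In the index type \<open>7\<close> the
  numeral \<open>7\<close> equals \<open>0\<close>, and \<open>vector\<close> starts counting at \<open>1\<close>, so the indices \<open>1, ..., 7\<close> are as
  usual.
\<close>

definition structure_eqs7 ::
  "((7 \<Rightarrow> 7 \<Rightarrow> real) \<Rightarrow> real list) \<Rightarrow> real^7 \<Rightarrow> real^7 \<Rightarrow> real^7" where
  "structure_eqs7 D x y = - vector (D (\<lambda>i j. x $ i * y $ j - x $ j * y $ i))"

definition s1 :: "real^7 \<Rightarrow> real^7 \<Rightarrow> real^7" where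
  "s1 = structure_eqs7 (\<lambda>e.
     [e 2 3, - e 3 6, e 2 6, e 2 6 - e 5 6, e 3 6 + e 4 6, 0, 0])"

definition s2 :: "real^7 \<Rightarrow> real^7 \<Rightarrow> real^7" where
  "s2 = structure_eqs7 (\<lambda>e.
     [e 1 6 + e 3 5, - e 2 6 + e 4 5, e 3 6, - e 4 6, 0, 0, 0])"

definition s3 :: "real^7 \<Rightarrow> real^7 \<Rightarrow> real^7" where
  "s3 = structure_eqs7 (\<lambda>e.
     [- e 1 6 + e 2 5, - e 1 5 - e 2 6, e 3 6 - e 4 5, e 3 5 + e 4 6, 0, 0, 0])"

definition s4 :: "real^7 \<Rightarrow> real^7 \<Rightarrow> real^7" where
  "s4 = structure_eqs7 (\<lambda>e.
     [0, - e 1 3, - e 1 2, 0, - e 4 6, - e 4 5, 0])"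

definition s5 :: "real^7 \<Rightarrow> real^7 \<Rightarrow> real^7" where
  "s5 = structure_eqs7 (\<lambda>e.
     [e 1 5, - e 2 5, - e 3 5, e 4 5, 0, 0, 0])"

definition s6 :: "real \<Rightarrow> real^7 \<Rightarrow> real^7 \<Rightarrow> real^7" where
  "s6 \<alpha> = structure_eqs7 (\<lambda>e.
     [\<alpha> * e 1 5 + e 2 5, - e 1 5 + \<alpha> * e 2 5, - \<alpha> * e 3 5 + e 4 5, - e 3 5 - \<alpha> * e 4 5, 0, 0, 0])"

definition s7 :: "real^7 \<Rightarrow> real^7 \<Rightarrow> real^7" where
  "s7 = structure_eqs7 (\<lambda>e.
     [e 2 5, - e 1 5, e 4 5, - e 3 5, 0, 0, 0])"

definition s8 :: "real^7 \<Rightarrow> real^7 \<Rightarrow> real^7" where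
  "s8 = structure_eqs7 (\<lambda>e.
     [e 1 6 + e 3 5, - e 2 6 + e 4 5, e 3 6, - e 4 6, 0, 0, e 3 4])"

definition s9 :: "real^7 \<Rightarrow> real^7 \<Rightarrow> real^7" where
  "s9 = structure_eqs7 (\<lambda>e.
     [- e 2 6 + e 3 5, e 1 6 + e 4 5, - e 4 6, e 3 6, 0, 0, e 3 4])"

definition s10 :: "real^7 \<Rightarrow> real^7 \<Rightarrow> real^7" where
  "s10 = structure_eqs7 (\<lambda>e.
     [e 2 3, - e 3 6, e 2 6, e 2 6 - e 5 6, e 3 6 + e 4 6, 0,
      2 * e 1 6 + e 2 5 - e 3 4 + sqrt 3 * e 2 4 + sqrt 3 * e 3 5])"

definition s11 :: "real^7 \<Rightarrow> real^7 \<Rightarrow> real^7" where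
  "s11 = structure_eqs7 (\<lambda>e.
     [e 2 3, - e 3 6, e 2 6, e 2 6 - e 5 6, e 3 6 + e 4 6, 0,
      2 * e 1 6 + e 2 5 - e 3 4 - sqrt 3 * e 2 4 - sqrt 3 * e 3 5])"

end

theory Submission
  imports Defs
begin

text \<open>
  Let \<open>z\<close> be a central vector and \<open>\<phi>\<close> a closed definite form. The 2-form \<open>\<phi>(z, \<cdot>, \<cdot>)\<close> is closed and nondegenerate
  modulo \<open>z\<close>, and by unimodularity so is every form cohomologous to it. Choose \<open>e\<close> for which the range \<open>W\<close> of
  the Fitting decomposition of \<open>ad e\<close> has maximal dimension; its complement is then a Cartan subalgebra,
  symplectically orthogonal to \<open>W\<close> for a suitable representative \<open>\<omega>\<close>. Hence \<open>W\<close> has dimension 2 or 4.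
  Definiteness means that no \<open>\<phi>(w, \<cdot>, \<cdot>)\<close> with \<open>w \<noteq> 0\<close> has an isotropic 4-plane avoiding \<open>w\<close>. This excludes
  dimension 2. In dimension 4 the Cartan subalgebra is spanned by \<open>x, e, z\<close>, the square of \<open>ad e\<close> is essentially
  self-adjoint for \<open>\<omega>\<close>, and its eigenvalues together with the operator \<open>ad x\<close> leave a short list of normal forms; those
  outside the classification are excluded by isotropic 4-planes or by the fact that the Pfaffian of \<open>\<phi>(y, \<cdot>, \<cdot>)\<close> on a fixed
  4-dimensional space has constant sign. Conversely, closed forms are pulled back from the standard one by explicit
  linear maps. A contactization carries a linear form \<open>\<theta>\<close> for which the kernel of \<open>\<theta>([\<cdot>, \<cdot>])\<close> is a line, which fails for
  \<open>s1\<close> to \<open>s9\<close>, whereas the seventh coordinate is such a form for \<open>s10\<close> and \<open>s11\<close>.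
\<close>

text \<open>The ground field is the obstacle: a solvable real algebra need not have common
  eigenvectors, and \<open>ad e\<close> need not have real eigenvalues. Two substitutes are used.
  Traces replace Lie's theorem: if a commutator that commutes with one of its factors were
  invertible, the identity would have trace 0. Quadratic relations replace weights: an operator of a
  symplectic 4-space that is self-adjoint for the form has a characteristic polynomial that is the
  square of a Pfaffian, and the Pfaffian already annihilates it. Its roots decide between two
  eigenplanes, a single eigenvalue and a complex structure, and a product between eigenspaces
  vanishes unless their eigenvalues satisfy one polynomial resonance relation. Isotropic 4-planes
  are forbidden because \<open>\<phi> w\<close> is symplectic on a 6-dimensional quotient, where
  isotropic subspaces have dimension at most 3. The classification divides according to whether some
  combination of \<open>e\<close> and \<open>x\<close> acts nilpotently on \<open>W\<close>. The
  constant sqrt 3 arises when \<open>[W, W]\<close> reaches \<open>x\<close> and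
  \<open>[x, e]\<close> is not 0: closedness then forces a ratio of structure constants to have
  square 3, and its two signs are \<open>s10\<close> and \<open>s11\<close>.\<close>

lemmas linear_rules = linear_add linear_cmul linear_diff linear_neg linear_0

lemmas bilinear_rules = bilinear_ladd bilinear_radd bilinear_lmul bilinear_rmul bilinear_lzero bilinear_rzero
  bilinear_lneg bilinear_rneg bilinear_lsub bilinear_rsub

lemma alternating_anti:
  fixes f :: "'a::real_vector \<Rightarrow> 'a \<Rightarrow> 'b::real_vector"
  assumes "bilinear f" "\<And>x. f x x = 0"
  shows "f x y = - f y x"
proof -
  have "f (x + y) (x + y) = f x y + f y x" unfolding bilinear_rules(1,2)[OF assms(1)] by (simp add: assms(2))
  then show ?thesis using assms(2) by (simp add: eq_neg_iff_add_eq_0)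
qed

lemma inner_Basis_sum:
  fixes h :: "'a::euclidean_space \<Rightarrow> real"
  assumes "linear h"
  shows "x \<bullet> (\<Sum>c\<in>Basis. h c *\<^sub>R c) = h x"
proof -
  have "h x = h (\<Sum>c\<in>Basis. (x \<bullet> c) *\<^sub>R c)" by (simp add: euclidean_representation)
  also have "\<dots> = (\<Sum>c\<in>Basis. (x \<bullet> c) * h c)" using assms by (simp add: linear_sum linear_cmul)
  finally show ?thesis by (simp add: inner_sum_right mult.commute)
qed

section \<open>Solvable Lie algebras\<close>

text \<open>A trace in the standard basis, for which cyclicity is a direct computation;
  \<open>real7_model\<close> matches it with \<open>linear_trace\<close>.\<close>

definition op_trace :: "('a::euclidean_space \<Rightarrow> 'a) \<Rightarrow> real" where
  "op_trace f = (\<Sum>b\<in>Basis. f b \<bullet> b)"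

lemma op_trace_commute:
  fixes f g :: "'a::euclidean_space \<Rightarrow> 'a"
  assumes "linear f" "linear g"
  shows "op_trace (\<lambda>v. f (g v)) = op_trace (\<lambda>v. g (f v))"
proof -
  have *: "h (k b) \<bullet> b = (\<Sum>c\<in>Basis. (k b \<bullet> c) * (h c \<bullet> b))"
    if "linear h" for h k :: "'a \<Rightarrow> 'a" and b
  proof -
    have "h (k b) = h (\<Sum>c\<in>Basis. (k b \<bullet> c) *\<^sub>R c)" by (simp add: euclidean_representation)
    also have "\<dots> = (\<Sum>c\<in>Basis. (k b \<bullet> c) *\<^sub>R h c)"
      using that by (simp add: linear_sum linear_cmul)
    finally show ?thesis by (simp add: inner_sum_left)
  qed
  have "op_trace (\<lambda>v. f (g v)) = (\<Sum>b\<in>Basis. \<Sum>c\<in>Basis. (g b \<bullet> c) * (f c \<bullet> b))"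
    using *[OF assms(1)] by (simp add: op_trace_def)
  also have "\<dots> = (\<Sum>c\<in>Basis. \<Sum>b\<in>Basis. (f c \<bullet> b) * (g b \<bullet> c))"
    by (subst sum.swap) (simp add: mult.commute)
  also have "\<dots> = op_trace (\<lambda>v. g (f v))"
    using *[OF assms(2)] by (simp add: op_trace_def)
  finally show ?thesis .
qed

lemma op_trace_diff: "op_trace (\<lambda>v. f v - g v) = op_trace f - op_trace g"
  by (simp add: op_trace_def inner_diff_left sum_subtractf)

lemma orthogonal_projection_exists:
  fixes M :: "'a::euclidean_space set"
  assumes "subspace M"
  obtains P where "linear P" "\<And>v. P v \<in> M" "\<And>v. v \<in> M \<Longrightarrow> P v = v"
    "\<And>v w. w \<in> M \<Longrightarrow> (v - P v) \<bullet> w = 0"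
proof -
  define P where "P v = (SOME y. y \<in> M \<and> (\<forall>w\<in>M. (v - y) \<bullet> w = 0))" for v
  have ex: "\<exists>y. y \<in> M \<and> (\<forall>w\<in>M. (v - y) \<bullet> w = 0)" for v
    using orthogonal_subspace_decomp_exists[of M v] assms
    by (metis add_diff_cancel_left' orthogonal_def span_eq_iff)
  have P: "P v \<in> M" "\<And>w. w \<in> M \<Longrightarrow> (v - P v) \<bullet> w = 0" for v
    using someI_ex[OF ex[of v]] unfolding P_def by auto
  have uniq: "P v = y" if "y \<in> M" "\<And>w. w \<in> M \<Longrightarrow> (v - y) \<bullet> w = 0" for v y
  proof -
    have d: "P v - y \<in> M" using P that assms by (simp add: subspace_diff)
    have "(P v - y) \<bullet> (P v - y) = (v - y) \<bullet> (P v - y) - (v - P v) \<bullet> (P v - y)"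
      by (simp add: inner_diff_left)
    also have "\<dots> = 0" using P that d by simp
    finally show ?thesis by simp
  qed
  have "linear P"
  proof (rule linearI)
    fix a b show "P (a + b) = P a + P b"
    proof (rule uniq)
      show "P a + P b \<in> M" using P assms by (simp add: subspace_add)
      fix w assume w: "w \<in> M"
      have "(a + b - (P a + P b)) \<bullet> w = (a - P a) \<bullet> w + (b - P b) \<bullet> w"
        by (simp add: inner_diff_left inner_add_left)
      then show "(a + b - (P a + P b)) \<bullet> w = 0" using P(2)[OF w] by simp
    qed
  next
    fix r b show "P (r *\<^sub>R b) = r *\<^sub>R P b"
    proof (rule uniq)
      show "r *\<^sub>R P b \<in> M" using P assms by (simp add: subspace_scale)
      fix w assume w: "w \<in> M"
      have "(r *\<^sub>R b - r *\<^sub>R P b) \<bullet> w = r * ((b - P b) \<bullet> w)"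
        by (simp add: inner_diff_left right_diff_distrib)
      then show "(r *\<^sub>R b - r *\<^sub>R P b) \<bullet> w = 0" using P(2)[OF w] by simp
    qed
  qed
  moreover have "P v = v" if "v \<in> M" for v using uniq[OF that] by simp
  ultimately show thesis using P that by blast
qed

text \<open>The trace is the sum of the squared lengths of the projected basis vectors.
  \<open>P\<close> stands for the identity of \<open>M\<close>, which thus cannot be a
  commutator.\<close>

lemma op_trace_projection_pos:
  fixes P :: "'a::euclidean_space \<Rightarrow> 'a"
  assumes "linear P" "\<And>v. P v \<in> M" "\<And>v. v \<in> M \<Longrightarrow> P v = v"
    "\<And>v w. w \<in> M \<Longrightarrow> (v - P v) \<bullet> w = 0" and "m \<in> M" "m \<noteq> 0"
  shows "op_trace P > 0"
proof -
  have e: "P b \<bullet> b = P b \<bullet> P b" for b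
    using assms(4)[OF assms(2), of b b] by (simp add: inner_diff_left inner_diff_right inner_commute)
  have "\<exists>b\<in>Basis. P b \<noteq> 0"
  proof (rule ccontr)
    assume "\<not> ?thesis"
    then have "P m = 0"
      using assms(1) euclidean_representation[of m] linear_sum[OF assms(1)]
        linear_cmul[OF assms(1)] by (metis (no_types, lifting) scaleR_zero_right sum.neutral)
    then show False using assms by auto
  qed
  then show ?thesis unfolding op_trace_def e
    by (metis (no_types, lifting) finite_Basis inner_ge_zero inner_gt_zero_iff sum_pos2)
qed

text \<open>Take a non-zero invariant subspace of least dimension. Within it, the kernel of any
  \<open>C\<close> is invariant by commutativity and non-zero by nilpotency, so it is the whole
  subspace, for every \<open>C\<close> at once.\<close>

lemma commuting_nilpotent_kernel:
  fixes F :: "('a::euclidean_space \<Rightarrow> 'a) set"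
  assumes lin: "\<And>C. C \<in> F \<Longrightarrow> linear C"
    and comm: "\<And>B C v. B \<in> F \<Longrightarrow> C \<in> F \<Longrightarrow> v \<in> M \<Longrightarrow> B (C v) = C (B v)"
    and M: "subspace M" "\<And>C v. C \<in> F \<Longrightarrow> v \<in> M \<Longrightarrow> C v \<in> M" "M \<noteq> {0}"
    and nil: "\<And>C v. C \<in> F \<Longrightarrow> v \<in> M \<Longrightarrow> \<exists>n. (C ^^ n) v = 0"
  obtains v where "v \<in> M" "v \<noteq> 0" "\<And>C. C \<in> F \<Longrightarrow> C v = 0"
proof -
  define good where "good S \<longleftrightarrow> subspace S \<and> S \<subseteq> M \<and> S \<noteq> {0} \<and> (\<forall>C\<in>F. \<forall>v\<in>S. C v \<in> S)" for S
  have "good M" using M by (auto simp: good_def)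
  then obtain S where S: "good S" and min: "\<And>S'. good S' \<Longrightarrow> dim S \<le> dim S'"
    using ex_has_least_nat[of good M dim] by blast
  have kill: "C v = 0" if C: "C \<in> F" and v: "v \<in> S" for C v
  proof -
    let ?K = "{v \<in> S. C v = 0}"
    have sub: "subspace ?K"
      using S lin[OF C] unfolding good_def subspace_def
      by (auto simp: linear_0 linear_add linear_cmul)
    obtain w where w: "w \<in> S" "w \<noteq> 0"
      using S subspace_0 unfolding good_def by blast
    define n where "n = (LEAST n. (C ^^ n) w = 0)"
    have n: "(C ^^ n) w = 0" unfolding n_def
      using nil[OF C] w S unfolding good_def by (metis (mono_tags, lifting) LeastI subsetD)
    have "n \<noteq> 0" using n w by (metis funpow_0)
    then obtain k where k: "n = Suc k" using not0_implies_Suc by blast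
    have nz: "(C ^^ k) w \<noteq> 0" using k not_less_Least[of k "\<lambda>n. (C ^^ n) w = 0"] unfolding n_def by auto
    have mem: "(C ^^ j) w \<in> S" for j
      by (induction j) (use S C w in \<open>auto simp: good_def\<close>)
    have "(C ^^ k) w \<in> ?K" using mem n k by auto
    then have "?K \<noteq> {0}" using nz by auto
    moreover have "\<forall>B\<in>F. \<forall>v\<in>?K. B v \<in> ?K"
      using S C lin unfolding good_def by (auto simp: linear_0 comm[OF C])
    ultimately have "good ?K" using sub S unfolding good_def by auto
    then have "dim S \<le> dim ?K" by (rule min)
    then have "?K = S" using sub S subspace_dim_equal[of ?K S] unfolding good_def by auto
    then show ?thesis using v by auto
  qed
  obtain v where "v \<in> S" "v \<noteq> 0" using S subspace_0 unfolding good_def by blast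
  then show thesis using that kill S unfolding good_def by blast
qed

locale lie =
  fixes br :: "'a::euclidean_space \<Rightarrow> 'a \<Rightarrow> 'a"
  assumes lie: "lie_algebra br"
begin

lemma bil: "bilinear br" using lie by (simp add: lie_algebra_def)

lemma lin1: "linear (\<lambda>x. br x y)" using bil by (simp add: bilinear_def)
lemma lin2: "linear (br x)" using bil by (simp add: bilinear_def)

lemmas brs = bilinear_rules[OF bil]

lemma self [simp]: "br x x = 0" using lie by (simp add: lie_algebra_def)

lemma zero [simp]: "br 0 x = 0" "br x 0 = 0" by (simp_all add: brs)

lemma anti: "br x y = - br y x" by (rule alternating_anti[OF bil self])

lemma jacobi: "br x (br y z) = br (br x y) z + br y (br x z)"
proof -
  have "br x (br y z) + br y (br z x) + br z (br x y) = 0"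
    using lie by (simp add: lie_algebra_def)
  moreover have "br y (br z x) = - br y (br x z)" by (subst anti[of z x]) (simp add: brs)
  moreover have "br z (br x y) = - br (br x y) z" by (rule anti)
  ultimately show ?thesis by (simp add: algebra_simps)
qed

definition ideal :: "'a set \<Rightarrow> bool" where
  "ideal U \<longleftrightarrow> subspace U \<and> (\<forall>x. \<forall>u\<in>U. br x u \<in> U)"

abbreviation derived :: "nat \<Rightarrow> 'a set" where
  "derived k \<equiv> ((\<lambda>A. bracket_span br A A) ^^ k) UNIV"

lemma bracket_span_leI:
  assumes "subspace S" "\<And>x y. x \<in> A \<Longrightarrow> y \<in> B \<Longrightarrow> br x y \<in> S"
  shows "bracket_span br A B \<subseteq> S"
  unfolding bracket_span_def by (rule span_minimal) (use assms in auto)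

lemma bracket_span_memI: "x \<in> A \<Longrightarrow> y \<in> B \<Longrightarrow> br x y \<in> bracket_span br A B"
  unfolding bracket_span_def by (rule span_base) auto

lemma subspace_bracket_span: "subspace (bracket_span br A B)"
  unfolding bracket_span_def by (rule subspace_span)

lemma ideal_bracket_span: assumes "ideal A" "ideal B" shows "ideal (bracket_span br A B)"
proof -
  have "br x u \<in> bracket_span br A B" if "u \<in> bracket_span br A B" for x u
  proof -
    have "bracket_span br A B \<subseteq> {u. br x u \<in> bracket_span br A B}"
    proof (rule bracket_span_leI)
      show "subspace {u. br x u \<in> bracket_span br A B}"
        using subspace_bracket_span[of A B] by (auto simp: subspace_def brs)
      fix a b assume "a \<in> A" "b \<in> B"
      then show "br a b \<in> {u. br x u \<in> bracket_span br A B}"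
        using assms by (auto simp: jacobi[of x a b] ideal_def intro!: subspace_add
            subspace_bracket_span bracket_span_memI)
    qed
    then show ?thesis using that by auto
  qed
  then show ?thesis by (simp add: ideal_def subspace_bracket_span)
qed

lemma ideal_UNIV: "ideal UNIV" by (simp add: ideal_def subspace_def)

lemma ideal_derived: "ideal (derived k)"
  by (induction k) (auto simp: ideal_UNIV ideal_bracket_span)

end

section \<open>Irreducible real representations of a solvable Lie algebra\<close>

text \<open>A representation on the subspace \<open>M\<close>, extended to the ambient space:
  \<open>\<rho>_P\<close> makes every operator vanish on the orthogonal complement of
  \<open>M\<close>, so \<open>op_trace\<close> computes traces on \<open>M\<close>.\<close>

locale lie_irreducible_rep = lie br
  for br :: "'a::euclidean_space \<Rightarrow> 'a \<Rightarrow> 'a" +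
  fixes \<rho> :: "'a \<Rightarrow> 'b::euclidean_space \<Rightarrow> 'b" and M :: "'b set" and P :: "'b \<Rightarrow> 'b"
  assumes \<rho>_linear: "linear (\<rho> x)" and \<rho>_linear': "linear (\<lambda>x. \<rho> x v)"
    and \<rho>_M: "\<rho> x v \<in> M" and \<rho>_P: "\<rho> x (P v) = \<rho> x v"
    and \<rho>_br: "\<rho> (br x y) v = \<rho> x (\<rho> y v) - \<rho> y (\<rho> x v)"
    and M: "subspace M" "M \<noteq> {0}"
    and P: "linear P" "\<And>v. P v \<in> M" "\<And>v. v \<in> M \<Longrightarrow> P v = v"
      "\<And>v w. w \<in> M \<Longrightarrow> (v - P v) \<bullet> w = 0"
    and irred: "\<And>S. subspace S \<Longrightarrow> S \<subseteq> M \<Longrightarrow> (\<And>x v. v \<in> S \<Longrightarrow> \<rho> x v \<in> S) \<Longrightarrow> S = {0} \<or> S = M"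
begin

text \<open>Write \<open>C\<close> for the commutator of \<open>X = \<rho> x\<close> and
  \<open>A = \<rho> a\<close>. An inverse of \<open>C\<close> on \<open>M\<close> would commute with
  \<open>A\<close>, and the identity of \<open>M\<close> would be \<open>X A\<close> times the
  inverse minus \<open>A X\<close> times the inverse. By cyclicity both traces agree, whereas the
  identity has positive trace.\<close>

lemma commutator_singular:
  assumes comm: "\<And>v. \<rho> (br x a) (\<rho> a v) = \<rho> a (\<rho> (br x a) v)"
  shows "\<exists>v\<in>M. v \<noteq> 0 \<and> \<rho> (br x a) v = 0"
proof (rule ccontr)
  assume neg: "\<not> ?thesis"
  define C where "C = \<rho> (br x a)"
  have C: "linear C" "\<And>v. C v \<in> M" by (auto simp: C_def \<rho>_linear \<rho>_M)
  have inj: "inj_on C M"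
    using neg M(1) C(1) by (auto simp: inj_on_def C_def[symmetric])
      (metis eq_iff_diff_eq_0 linear_diff subspace_diff)
  have surj: "C ` M = M"
  proof (rule subspace_dim_equal)
    show "subspace (C ` M)" using C M by (simp add: linear_subspace_image)
    show "subspace M" by (rule M)
    show "C ` M \<subseteq> M" using C by auto
    show "dim M \<le> dim (C ` M)"
      using dim_image_eq[OF C(1), of M] inj M by (metis order_refl span_eq_iff)
  qed
  obtain g where g: "linear g" "range g \<subseteq> M" "\<And>v. v \<in> M \<Longrightarrow> g (C v) = v"
    using linear_exists_left_inverse_on[OF C(1) M(1) inj] by auto
  have g2: "C (g v) = v" if "v \<in> M" for v
    using g surj that by (metis imageE)
  define Ci where "Ci v = g (P v)" for v
  have Ci: "linear Ci" using linear_compose[OF P(1) g(1)] by (simp add: Ci_def[abs_def] o_def)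
  have ca: "\<rho> a (Ci v) = Ci (\<rho> a v)" for v
  proof -
    have "C (\<rho> a (Ci v)) = \<rho> a (C (Ci v))" using comm by (simp add: C_def)
    also have "\<dots> = \<rho> a v" by (simp add: Ci_def g2 P \<rho>_P)
    finally have "g (C (\<rho> a (Ci v))) = g (\<rho> a v)" by simp
    then show ?thesis by (simp add: g \<rho>_M Ci_def P)
  qed
  have CP: "C (Ci v) = P v" for v by (simp add: Ci_def g2 P)
  have "op_trace P = op_trace (\<lambda>v. \<rho> x (\<rho> a (Ci v)) - \<rho> a (\<rho> x (Ci v)))"
    by (rule arg_cong[where f = op_trace]) (simp only: fun_eq_iff CP[symmetric] C_def \<rho>_br, simp)
  also have "\<dots> = op_trace (\<lambda>v. \<rho> x (\<rho> a (Ci v))) - op_trace (\<lambda>v. \<rho> a (\<rho> x (Ci v)))"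
    by (rule op_trace_diff)
  also have "op_trace (\<lambda>v. \<rho> a (\<rho> x (Ci v))) = op_trace (\<lambda>v. \<rho> x (Ci (\<rho> a v)))"
    using op_trace_commute[OF \<rho>_linear[of a] linear_compose[OF Ci \<rho>_linear[of x]]] by (simp add: o_def)
  finally have "op_trace P = 0" by (simp add: ca)
  moreover obtain m where "m \<in> M" "m \<noteq> 0" using M subspace_0 by blast
  ultimately show False using op_trace_projection_pos[OF P] by auto
qed

text \<open>The generalized kernel of \<open>C = \<rho> (br x a)\<close> is non-zero by
  \<open>commutator_singular\<close>. It is invariant, because the commutator of any
  \<open>\<rho> y\<close> with \<open>C\<close> comes from the ideal and so commutes with
  \<open>C\<close>. Irreducibility makes it all of \<open>M\<close>.\<close>

lemma commutator_nilpotent: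
  assumes I: "ideal I" and comm: "\<And>a b v. a \<in> I \<Longrightarrow> b \<in> I \<Longrightarrow> \<rho> a (\<rho> b v) = \<rho> b (\<rho> a v)"
    and a: "a \<in> I" and v: "v \<in> M"
  shows "\<exists>n. ((\<rho> (br x a)) ^^ n) v = 0"
proof -
  define C where "C = \<rho> (br x a)"
  define S where "S = {v \<in> M. \<exists>n. (C ^^ n) v = 0}"
  have xa: "br x a \<in> I" using I a by (simp add: ideal_def)
  have C: "linear C" by (simp add: C_def \<rho>_linear)
  have Cn: "linear (C ^^ n)" for n
    by (induction n) (auto simp: id_def intro: linear_ident linear_compose[OF _ C, unfolded o_def])
  have up: "(C ^^ m) u = 0" if "(C ^^ n) u = 0" "n \<le> m" for n m u
    using that Cn[of "m - n"] by (metis comp_apply funpow_add le_add_diff_inverse2 linear_0)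
  have sub: "subspace S"
  proof (unfold subspace_def S_def, intro conjI ballI allI)
    show "0 \<in> {v \<in> M. \<exists>n. (C ^^ n) v = 0}" using M by (auto simp: subspace_0 intro: exI[of _ 0])
    fix u w assume "u \<in> {v \<in> M. \<exists>n. (C ^^ n) v = 0}" "w \<in> {v \<in> M. \<exists>n. (C ^^ n) v = 0}"
    then obtain n m where "u \<in> M" "w \<in> M" "(C ^^ n) u = 0" "(C ^^ m) w = 0" by auto
    then have "(C ^^ max n m) (u + w) = 0" using up[of n u "max n m"] up[of m w "max n m"] Cn by (simp add: linear_add)
    then show "u + w \<in> {v \<in> M. \<exists>n. (C ^^ n) v = 0}" using M \<open>u \<in> M\<close> \<open>w \<in> M\<close> subspace_add by blast
  next
    fix c u assume "u \<in> {v \<in> M. \<exists>n. (C ^^ n) v = 0}"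
    then show "c *\<^sub>R u \<in> {v \<in> M. \<exists>n. (C ^^ n) v = 0}"
      using M Cn by (auto simp: linear_cmul subspace_scale)
  qed
  have inv: "\<rho> y u \<in> S" if "u \<in> S" for y u
  proof -
    obtain n where u: "u \<in> M" "(C ^^ n) u = 0" using \<open>u \<in> S\<close> by (auto simp: S_def)
    have yc: "br y (br x a) \<in> I" using I xa by (simp add: ideal_def)
    define C' where "C' = \<rho> (br y (br x a))"
    have C': "linear C'" by (simp add: C'_def \<rho>_linear)
    have c1: "C (\<rho> y w) = \<rho> y (C w) - C' w" for w by (simp add: C_def C'_def \<rho>_br)
    have c2: "C (C' w) = C' (C w)" for w using comm xa yc by (simp add: C_def C'_def)
    have c3: "(C ^^ m) (C' w) = C' ((C ^^ m) w)" for m w by (induction m) (auto simp: c2)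
    \<comment> \<open>Leibniz formula for moving \<open>\<rho> y\<close> past powers of
      \<open>C\<close>; at \<open>m = 0\<close> the truncated \<open>m - 1\<close> carries the
      coefficient 0.\<close>
    have "(C ^^ m) (\<rho> y w) = \<rho> y ((C ^^ m) w) - of_nat m *\<^sub>R C' ((C ^^ (m - 1)) w)" for m w
    proof (induction m)
      case (Suc m)
      have "(C ^^ Suc m) (\<rho> y w) = C (\<rho> y ((C ^^ m) w)) - of_nat m *\<^sub>R C (C' ((C ^^ (m - 1)) w))"
        by (simp add: Suc linear_diff[OF C] linear_cmul[OF C])
      also have "of_nat m *\<^sub>R C (C' ((C ^^ (m - 1)) w)) = of_nat m *\<^sub>R C' ((C ^^ m) w)"
        by (cases m) (auto simp: c2)
      finally show ?case by (simp add: c1 algebra_simps)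
    qed simp
    from this[of "Suc n" u] have "(C ^^ Suc n) (\<rho> y u) = 0"
      using u by (simp add: linear_0[OF C] linear_0[OF C'] linear_0[OF \<rho>_linear])
    then show ?thesis using \<rho>_M by (auto simp: S_def simp del: funpow.simps)
  qed
  have "S \<noteq> {0}"
  proof -
    obtain u where "u \<in> M" "u \<noteq> 0" "C u = 0"
      using commutator_singular[of x a] comm xa a by (auto simp: C_def)
    then have "u \<in> S" by (auto simp: S_def intro!: exI[of _ 1])
    then show ?thesis using \<open>u \<noteq> 0\<close> by auto
  qed
  moreover have "S \<subseteq> M" by (auto simp: S_def)
  ultimately have "S = M" using irred sub inv by blast
  then show ?thesis using v by (auto simp: S_def C_def)
qed

text \<open>Write \<open>I\<close> for the bracket of \<open>A\<close> and \<open>B\<close>. The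
  operators of \<open>[g, I]\<close> commute and are nilpotent, so their common kernel is a non-zero
  submodule, hence \<open>M\<close>. Consequently every \<open>[x, y]\<close> with \<open>x\<close>
  in \<open>A\<close> and \<open>y\<close> in \<open>B\<close> acts centrally; its kernel is a
  submodule, non-zero by \<open>commutator_singular\<close>, hence \<open>M\<close> again.\<close>

lemma commuting_ideal_trivial:
  assumes A: "ideal A" and B: "ideal B"
    and comm: "\<And>a b v. a \<in> bracket_span br A B \<Longrightarrow> b \<in> bracket_span br A B \<Longrightarrow> \<rho> a (\<rho> b v) = \<rho> b (\<rho> a v)"
    and a: "a \<in> bracket_span br A B"
  shows "\<rho> a v = 0"
proof -
  let ?I = "bracket_span br A B"
  have I: "ideal ?I" using A B by (rule ideal_bracket_span)
  define F where "F = {\<rho> (br x a) | x a. a \<in> ?I}"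
  obtain u where u: "u \<in> M" "u \<noteq> 0" "\<And>C. C \<in> F \<Longrightarrow> C u = 0"
  proof (rule commuting_nilpotent_kernel[of F M])
    show "linear C" if "C \<in> F" for C using that by (auto simp: F_def \<rho>_linear)
    show "B (C v) = C (B v)" if "B \<in> F" "C \<in> F" for B C v
      using that comm I by (auto simp: F_def ideal_def)
    show "\<exists>n. (C ^^ n) v = 0" if "C \<in> F" "v \<in> M" for C v
      using that commutator_nilpotent[OF I comm] by (auto simp: F_def)
  qed (use M \<rho>_M in \<open>auto simp: F_def\<close>)
  define N where "N = {v \<in> M. \<forall>C\<in>F. C v = 0}"
  have Fl: "linear C" if "C \<in> F" for C using that by (auto simp: F_def \<rho>_linear)
  have "subspace N" using M(1) unfolding N_def subspace_def
    by (auto simp: linear_0[OF Fl] linear_add[OF Fl] linear_cmul[OF Fl])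
  moreover have "N \<subseteq> M" by (auto simp: N_def)
  moreover have "\<rho> y v \<in> N" if "v \<in> N" for y v
  proof -
    have "\<rho> (br x a) (\<rho> y v) = 0" if a: "a \<in> ?I" for x a
    proof -
      have "br x a \<in> ?I" using I a by (simp add: ideal_def)
      then have "\<rho> (br y (br x a)) v = 0" "\<rho> (br x a) v = 0"
        using \<open>v \<in> N\<close> a by (auto simp: N_def F_def)
      then show ?thesis using \<rho>_br[of y "br x a" v] by (simp add: linear_0[OF \<rho>_linear])
    qed
    then show ?thesis using \<rho>_M by (auto simp: N_def F_def)
  qed
  ultimately have "N = {0} \<or> N = M" by (rule irred)
  then have NM: "N = M" using u by (auto simp: N_def)
  have z: "\<rho> (br x a) v = 0" if "a \<in> ?I" for x a v
  proof -
    have "P v \<in> N" using NM P by auto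
    then have "\<rho> (br x a) (P v) = 0" using that by (auto simp: N_def F_def)
    then show ?thesis by (simp add: \<rho>_P)
  qed
  have gen: "\<rho> (br x y) v = 0" if "x \<in> A" "y \<in> B" for x y v
  proof -
    have m: "br x y \<in> ?I" using that by (rule bracket_span_memI)
    have cc: "\<rho> (br x y) (\<rho> w v) = \<rho> w (\<rho> (br x y) v)" for w v
      using \<rho>_br[of w "br x y" v] z[OF m] by simp
    define K where "K = {v \<in> M. \<rho> (br x y) v = 0}"
    have "subspace K" using M unfolding K_def subspace_def
      by (auto simp: linear_0[OF \<rho>_linear] linear_add[OF \<rho>_linear] linear_cmul[OF \<rho>_linear])
    moreover have "K \<subseteq> M" by (auto simp: K_def)
    moreover have "\<rho> w v \<in> K" if "v \<in> K" for w v
      using that cc \<rho>_M by (auto simp: K_def linear_0[OF \<rho>_linear])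
    ultimately have "K = {0} \<or> K = M" by (rule irred)
    moreover have "K \<noteq> {0}" using commutator_singular[of x y] cc by (auto simp: K_def)
    ultimately have "P v \<in> K" using P by auto
    then show ?thesis by (simp add: K_def \<rho>_P)
  qed
  have "?I \<subseteq> {a. \<rho> a v = 0}"
    by (rule bracket_span_leI)
      (auto simp: gen subspace_def linear_0[OF \<rho>_linear'] linear_add[OF \<rho>_linear'] linear_cmul[OF \<rho>_linear'])
  then show ?thesis using a by auto
qed

text \<open>The real form of Lie's theorem: an irreducible module of a solvable algebra is a module
  of its abelianization. If one term of the derived series acts by 0, the preceding one acts by
  commuting operators and, being a bracket of ideals, by 0 as well.\<close>

lemma solvable_derived_trivial:
  assumes "lie_solvable br"
  shows "\<rho> (br x y) v = 0"
proof -
  obtain k where k: "derived k = {0}" using assms by (auto simp: lie_solvable_def)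
  \<comment> \<open>Upwards through the derived series: \<open>j = 0\<close> is a zero term and
    \<open>j = k\<close> is the derived algebra, which explains the \<open>Suc\<close>.\<close>
  have "\<forall>a\<in>derived (Suc (k - j)). \<forall>v. \<rho> a v = 0" if "j \<le> k" for j
    using that
  proof (induction j)
    case 0
    have "derived (Suc k) = {0}" 
      by (simp only: funpow.simps o_apply k) (auto simp: bracket_span_def)
    then show ?case by (simp add: linear_0[OF \<rho>_linear'] del: funpow.simps)
  next
    case (Suc j)
    define m where "m = k - Suc j"
    have m: "k - j = Suc m" using Suc by (simp add: m_def)
    let ?I = "bracket_span br (derived m) (derived m)"
    have IH: "\<rho> a v = 0" if "a \<in> bracket_span br ?I ?I" for a v
      using Suc that m by simp
    have "\<rho> a v = 0" if "a \<in> ?I" for a v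
    proof (rule commuting_ideal_trivial[OF ideal_derived ideal_derived _ that])
      fix a b v assume "a \<in> ?I" "b \<in> ?I"
      then have "\<rho> (br a b) v = 0" by (intro IH bracket_span_memI)
      then show "\<rho> a (\<rho> b v) = \<rho> b (\<rho> a v)" by (simp add: \<rho>_br)
    qed
    then show ?case by (simp add: m_def)
  qed
  from this[of k] show ?thesis by (simp add: bracket_span_memI)
qed

end

section \<open>Nilpotency of the derived algebra and Engel's theorem\<close>

context lie
begin

text \<open>The chief factor \<open>U / U'\<close> is modelled on the orthogonal complement
  \<open>M\<close> of \<open>U'\<close> in \<open>U\<close>, with \<open>P\<close> as quotient map.
  A submodule of \<open>M\<close> pulls back to an ideal between \<open>U'\<close> and
  \<open>U\<close>, so the module is irreducible.\<close>

lemma minimal_factor_trivial: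
  assumes sol: "lie_solvable br" and U: "ideal U" and U': "ideal U'" "U' \<subset> U"
    and min: "\<And>S. ideal S \<Longrightarrow> U' \<subseteq> S \<Longrightarrow> S \<subseteq> U \<Longrightarrow> S = U' \<or> S = U"
    and u: "u \<in> U"
  shows "br (br x y) u \<in> U'"
proof -
  have sU: "subspace U" "subspace U'" using U U' by (auto simp: ideal_def)
  define M where "M = {m \<in> U. \<forall>v\<in>U'. m \<bullet> v = 0}"
  have M: "subspace M" using sU unfolding M_def subspace_def by (auto simp: inner_add_left)
  obtain P where P: "linear P" "\<And>v. P v \<in> M" "\<And>v. v \<in> M \<Longrightarrow> P v = v"
    "\<And>v w. w \<in> M \<Longrightarrow> (v - P v) \<bullet> w = 0" using orthogonal_projection_exists[OF M] by blast
  obtain P' where P': "linear P'" "\<And>v. P' v \<in> U'" "\<And>v. v \<in> U' \<Longrightarrow> P' v = v"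
    "\<And>v w. w \<in> U' \<Longrightarrow> (v - P' v) \<bullet> w = 0" using orthogonal_projection_exists[OF sU(2)] by blast
  have dec: "v - P v \<in> U'" if "v \<in> U" for v
  proof -
    have "P' v \<in> U" using P'(2)[of v] U' by auto
    then have "v - P' v \<in> M" using that P' sU by (auto simp: M_def intro: subspace_diff)
    then have m: "v - P' v - P v \<in> M" using M P by (simp add: subspace_diff)
    have "(v - P' v - P v) \<bullet> (v - P' v - P v) = (v - P v) \<bullet> (v - P' v - P v) - (v - P' v - P v) \<bullet> P' v"
      by (simp add: inner_diff_left inner_diff_right inner_commute)
    also have "\<dots> = 0" using m P P' by (simp add: M_def)
    finally have "v - P' v - P v = 0" by (simp only: inner_eq_zero_iff)
    then have "v - P v = P' v" by (simp add: algebra_simps)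
    then show ?thesis using P' by simp
  qed
  have PU: "P v = 0" if "v \<in> U'" for v
  proof -
    have "P v \<bullet> P v = v \<bullet> P v - (v - P v) \<bullet> P v" by (simp add: inner_diff_left)
    also have "\<dots> = 0" using P that P(2)[of v] by (auto simp: M_def inner_commute)
    finally show ?thesis by simp
  qed
  have MU: "P v \<in> U" for v using P(2) by (auto simp: M_def)
  define \<rho> where "\<rho> x v = P (br x (P v))" for x v
  have PP: "P (P v) = P v" for v using P by simp
  have shift: "P (br x (P v)) = P (br x v)" if "v \<in> U" for x v
  proof -
    have "br x (v - P v) \<in> U'" using dec[OF that] U' by (simp add: ideal_def)
    then have "P (br x (v - P v)) = 0" by (rule PU)
    then show ?thesis by (simp add: brs linear_diff[OF P(1)])
  qed
  have iU: "br x v \<in> U" if "v \<in> U" for x v using U that by (simp add: ideal_def)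
  interpret lie_irreducible_rep br \<rho> M P
  proof (intro lie_irreducible_rep.intro lie_axioms lie_irreducible_rep_axioms.intro)
    show "linear (\<rho> x)" for x using linear_compose[OF linear_compose[OF P(1) lin2[of x]] P(1)]
      by (simp add: \<rho>_def[abs_def] o_def)
    show "linear (\<lambda>x. \<rho> x v)" for v using linear_compose[OF lin1[of "P v"] P(1)]
      by (simp add: \<rho>_def[abs_def] o_def)
    show "\<rho> x v \<in> M" for x v by (simp add: \<rho>_def P)
    show "\<rho> x (P v) = \<rho> x v" for x v by (simp add: \<rho>_def PP)
    show "\<rho> (br x y) v = \<rho> x (\<rho> y v) - \<rho> y (\<rho> x v)" for x y v
    proof -
      have "\<rho> x (\<rho> y v) = P (br x (br y (P v)))" for x y
        by (simp add: \<rho>_def PP shift iU MU)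
      then show ?thesis using jacobi[of x y "P v"]
        by (simp add: \<rho>_def linear_diff[OF P(1), symmetric])
    qed
    show "subspace M" by (rule M)
    obtain v where v: "v \<in> U" "v \<notin> U'" using U' by auto
    then have "P v \<noteq> 0" using dec[of v] by auto
    then show "M \<noteq> {0}" using P(2)[of v] by auto
    show "linear P" by (rule P)
    show "P v \<in> M" "v \<in> M \<Longrightarrow> P v = v" "w \<in> M \<Longrightarrow> (v - P v) \<bullet> w = 0" for v w
      using P by auto
    fix S assume S: "subspace S" "S \<subseteq> M" "\<And>x v. v \<in> S \<Longrightarrow> \<rho> x v \<in> S"
    define T where "T = {v \<in> U. P v \<in> S}"
    have "ideal T" unfolding ideal_def
    proof (intro conjI allI ballI)
      show "subspace T" using sU S(1) P(1) unfolding T_def subspace_def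
        by (auto simp: linear_0 linear_add linear_cmul)
      show "br x u \<in> T" if "u \<in> T" for x u
        using that S(3)[of "P u" x] iU by (auto simp: T_def \<rho>_def PP shift)
    qed
    moreover have "U' \<subseteq> T" using U' S PU by (auto simp: T_def subspace_0)
    moreover have "T \<subseteq> U" by (auto simp: T_def)
    ultimately have "T = U' \<or> T = U" by (rule min)
    then show "S = {0} \<or> S = M"
    proof
      assume T: "T = U'"
      have "v = 0" if "v \<in> S" for v
      proof -
        have "v \<in> M" "P v = v" using that S P by auto
        then have "v \<in> T" using that by (auto simp: T_def M_def)
        then show ?thesis using T PU \<open>P v = v\<close> by auto
      qed
      then show ?thesis using S(1) subspace_0 by blast
    next
      assume T: "T = U"
      have "v \<in> S" if "v \<in> M" for v
      proof -
        have "v \<in> T" using that T by (auto simp: M_def)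
        then show ?thesis using P(3)[OF that] by (simp add: T_def)
      qed
      then show ?thesis using S by auto
    qed
  qed
  have "P (br (br x y) u) = 0"
    using solvable_derived_trivial[OF sol, of x y u] shift[OF u] by (simp add: \<rho>_def)
  then show ?thesis using dec[OF iU[OF u], of "br x y"] by simp
qed

lemma maximal_subideal_exists:
  assumes U: "ideal U" "U \<noteq> {0}"
  obtains U' where "ideal U'" "U' \<subset> U" "dim U' < dim U"
    "\<And>S. ideal S \<Longrightarrow> U' \<subseteq> S \<Longrightarrow> S \<subseteq> U \<Longrightarrow> S = U' \<or> S = U"
proof -
  define Q where "Q S \<longleftrightarrow> ideal S \<and> S \<subset> U" for S
  have "ideal {0}" by (simp add: ideal_def subspace_def)
  then have "Q {0}" using U by (auto simp: Q_def ideal_def subspace_0)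
  moreover have "\<forall>S. Q S \<longrightarrow> dim S < Suc (dim U)"
    by (auto simp: Q_def intro: le_imp_less_Suc dim_subset)
  ultimately obtain U' where U': "Q U'" "\<And>S. Q S \<Longrightarrow> dim S \<le> dim U'"
    using ex_has_greatest_nat[of Q "{0}" dim "Suc (dim U)"] by (metis less_imp_le)
  have sub: "subspace S" if "ideal S" for S using that by (simp add: ideal_def)
  have "dim U' < dim U" using U' U subspace_dim_equal[of U' U] sub
    by (metis Q_def less_le_not_le linorder_not_less)
  moreover have "S = U' \<or> S = U" if "ideal S" "U' \<subseteq> S" "S \<subseteq> U" for S
    using that U' subspace_dim_equal[of U' S] sub unfolding Q_def by blast
  ultimately show thesis using that U' unfolding Q_def by blast
qed

text \<open>Induction along a chief series: elements of the derived algebra act by 0 on each factor,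
  so \<open>a\<close> sends \<open>U\<close> into \<open>U'\<close>, where a power of it
  vanishes.\<close>

lemma solvable_derived_nilpotent:
  assumes sol: "lie_solvable br"
    and a: "a \<in> bracket_span br UNIV UNIV"
  shows "\<exists>n. \<forall>v. (br a ^^ n) v = 0"
proof -
  let ?f = "br a"
  have lin: "linear (?f ^^ n)" for n
    by (induction n) (auto simp: id_def intro: linear_ident linear_compose[OF _ lin2, unfolded o_def])
  have "\<forall>U. ideal U \<longrightarrow> dim U = d \<longrightarrow> (\<exists>n. \<forall>v\<in>U. (?f ^^ n) v = 0)" for d
  proof (induction d rule: less_induct)
    case (less d)
    show ?case
    proof (intro allI impI)
      fix U assume U: "ideal U" "dim U = d"
      show "\<exists>n. \<forall>v\<in>U. (?f ^^ n) v = 0"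
      proof (cases "U = {0}")
        case True then show ?thesis by (auto intro: exI[of _ 0])
      next
        case False
        obtain U' where U': "ideal U'" "U' \<subset> U" "dim U' < dim U"
          "\<And>S. ideal S \<Longrightarrow> U' \<subseteq> S \<Longrightarrow> S \<subseteq> U \<Longrightarrow> S = U' \<or> S = U"
          using maximal_subideal_exists[OF U(1) False] by blast
        have "\<exists>n. \<forall>v\<in>U'. (?f ^^ n) v = 0" using less.IH[of "dim U'"] U'(1,3) U(2) by simp
        then obtain n where n: "\<And>v. v \<in> U' \<Longrightarrow> (?f ^^ n) v = 0" by auto
        have "bracket_span br UNIV UNIV \<subseteq> {a. br a v \<in> U'}" if "v \<in> U" for v
          by (rule bracket_span_leI)
            (use minimal_factor_trivial[OF sol U(1) U'(1,2,4) that] U'(1) in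
              \<open>auto simp: subspace_def brs ideal_def\<close>)
        then have "br a v \<in> U'" if "v \<in> U" for v using that a by blast
        then have "(?f ^^ Suc n) v = 0" if "v \<in> U" for v
          using n that by (simp del: funpow.simps add: funpow_Suc_right)
        then show ?thesis by blast
      qed
    qed
  qed
  then show ?thesis using ideal_UNIV by blast
qed

text \<open>On a chief factor the commutators act by 0, so the vectors that \<open>x\<close> sends
  into \<open>U'\<close> form an ideal \<open>K\<close>. If \<open>K\<close> were \<open>U'\<close>,
  then \<open>x\<close> would be injective on the factor, against its nilpotency; so
  \<open>K = U\<close>, and the lower central series descends through the chief series.\<close>

lemma solvable_engel:
  assumes sol: "lie_solvable br" and nil: "\<And>x v. \<exists>n. (br x ^^ n) v = 0"
  shows "lie_nilpotent br"
proof -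
  let ?T = "\<lambda>A. bracket_span br UNIV A"
  have mono: "(?T ^^ n) A \<subseteq> (?T ^^ n) B" if "A \<subseteq> B" for A B n
  proof (induction n)
    case (Suc n)
    then show ?case unfolding funpow.simps o_apply bracket_span_def by (intro span_mono) blast
  qed (use that in simp)
  have "\<forall>U. ideal U \<longrightarrow> dim U = d \<longrightarrow> (\<exists>n. (?T ^^ n) U \<subseteq> {0})" for d
  proof (induction d rule: less_induct)
    case (less d)
    show ?case
    proof (intro allI impI)
      fix U assume U: "ideal U" "dim U = d"
      show "\<exists>n. (?T ^^ n) U \<subseteq> {0}"
      proof (cases "U = {0}")
        case True then show ?thesis by (auto intro: exI[of _ 0])
      next
        case False
        obtain U' where U': "ideal U'" "U' \<subset> U" "dim U' < dim U"
          "\<And>S. ideal S \<Longrightarrow> U' \<subseteq> S \<Longrightarrow> S \<subseteq> U \<Longrightarrow> S = U' \<or> S = U"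
          using maximal_subideal_exists[OF U(1) False] by blast
        obtain n where n: "(?T ^^ n) U' \<subseteq> {0}" using less.IH[of "dim U'"] U'(1,3) U(2) by auto
        have step: "br x u \<in> U'" if u: "u \<in> U" for x u
        proof -
          define K where "K = {u \<in> U. br x u \<in> U'}"
          have s: "subspace U" "subspace U'" using U U' by (auto simp: ideal_def)
          have "ideal K" unfolding ideal_def
          proof (intro conjI allI ballI)
            show "subspace K" using s unfolding K_def subspace_def by (auto simp: brs)
            fix y v assume v: "v \<in> K"
            have "br (br x y) v \<in> U'"
              using v minimal_factor_trivial[OF sol U(1) U'(1,2,4)] by (auto simp: K_def)
            moreover have "br y (br x v) \<in> U'" using v U' by (auto simp: K_def ideal_def)
            ultimately have "br x (br y v) \<in> U'" using jacobi[of x y v] s by (simp add: subspace_add)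
            then show "br y v \<in> K" using v U by (auto simp: K_def ideal_def)
          qed
          moreover have "U' \<subseteq> K" using U' by (auto simp: K_def ideal_def)
          moreover have "K \<subseteq> U" by (auto simp: K_def)
          ultimately have "K = U' \<or> K = U" by (rule U'(4))
          moreover have "K \<noteq> U'"
          proof
            assume K: "K = U'"
            obtain v where v: "v \<in> U" "v \<notin> U'" using U' by auto
            have "(br x ^^ m) v \<in> U \<and> (br x ^^ m) v \<notin> U'" for m
            proof (induction m)
              case (Suc m)
              then have "(br x ^^ Suc m) v \<in> U" using U by (auto simp: ideal_def)
              moreover have "(br x ^^ m) v \<notin> K" using Suc K by simp
              ultimately show ?case using Suc by (auto simp: K_def)
            qed (use v in simp)
            moreover obtain m where "(br x ^^ m) v = 0" using nil by blast
            ultimately show False using s(2) subspace_0 by metis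
          qed
          ultimately show ?thesis using u by (auto simp: K_def)
        qed
        have "?T U \<subseteq> U'" by (rule bracket_span_leI) (use step U' in \<open>auto simp: ideal_def\<close>)
        then have "(?T ^^ Suc n) U \<subseteq> {0}" using mono[of "?T U" U' n] n
          by (simp del: funpow.simps add: funpow_Suc_right)
        then show ?thesis by blast
      qed
    qed
  qed
  then obtain n where n: "(?T ^^ n) UNIV \<subseteq> {0}" using ideal_UNIV by blast
  moreover have "0 \<in> (?T ^^ n) UNIV"
    by (induction n) (auto simp: bracket_span_def span_zero)
  ultimately show ?thesis unfolding lie_nilpotent_def by blast
qed

end

section \<open>Determinants along a line and cohomologous 2-forms\<close>

lemma has_derivative_det_line:
  fixes A K :: "real^'n^'n"
  shows "((\<lambda>s. det (A + s *\<^sub>R K)) has_real_derivative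
    (\<Sum>p | p permutes UNIV. of_int (sign p) *
       (\<Sum>i\<in>UNIV. K $ i $ p i * (\<Prod>j\<in>UNIV - {i}. (A + t *\<^sub>R K) $ j $ p j)))) (at t)"
  unfolding det_def
proof (rule DERIV_sum, rule DERIV_cmult)
  fix p :: "'n \<Rightarrow> 'n"
  show "((\<lambda>s. \<Prod>i\<in>UNIV. (A + s *\<^sub>R K) $ i $ p i) has_real_derivative
      (\<Sum>i\<in>UNIV. K $ i $ p i * (\<Prod>j\<in>UNIV - {i}. (A + t *\<^sub>R K) $ j $ p j))) (at t)"
    by (rule has_field_derivative_prod) (auto intro!: derivative_eq_intros)
qed

text \<open>Only the identity permutation contributes: any other one moves at least two indices, so
  a product with one factor deleted still contains an off-diagonal 0.\<close>

lemma has_derivative_det_identity: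
  fixes K :: "real^'n^'n"
  shows "((\<lambda>s. det (mat 1 + s *\<^sub>R K)) has_real_derivative trace K) (at 0)"
proof -
  have "(\<Sum>i\<in>UNIV. K $ i $ p i * (\<Prod>j\<in>UNIV - {i}. (mat 1 + 0 *\<^sub>R K) $ j $ p j))
      = (if p = id then trace K else 0)" if p: "p permutes UNIV" for p :: "'n \<Rightarrow> 'n"
  proof (cases "p = id")
    case True
    then show ?thesis by (simp add: trace_def mat_def)
  next
    case False
    have "(\<Prod>j\<in>UNIV - {i}. (mat 1 + 0 *\<^sub>R K) $ j $ p j) = 0" for i
    proof -
      obtain k where k: "p k \<noteq> k" using False by (auto simp: fun_eq_iff)
      have "p (p k) \<noteq> p k" using k p by (metis permutes_inverses(2))
      then obtain j where "p j \<noteq> j" "j \<noteq> i" using k by metis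
      then show ?thesis by (intro prod_zero) (auto simp: mat_def intro!: bexI[of _ j])
    qed
    then show ?thesis using False by (simp only: mult_zero_right sum.neutral_const if_False)
  qed
  then have "(\<Sum>p | p permutes UNIV. of_int (sign p) *
       (\<Sum>i\<in>UNIV. K $ i $ p i * (\<Prod>j\<in>UNIV - {i}. (mat 1 + 0 *\<^sub>R K) $ j $ p j)))
     = (\<Sum>p | p permutes (UNIV :: 'n set). of_int (sign p) * (if p = id then trace K else 0))"
    by (intro sum.cong) auto
  also have "\<dots> = (\<Sum>p | p permutes (UNIV :: 'n set). if p = id then trace K else 0)"
    by (intro sum.cong) (auto simp: sign_id)
  also have "\<dots> = trace K" by (simp add: sum.delta permutes_id)
  finally show ?thesis using has_derivative_det_line[of "mat 1" K 0] by simp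
qed

lemma trace_matrix: "trace (matrix (f :: real^'n \<Rightarrow> real^'n)) = op_trace f"
  unfolding trace_def op_trace_def Basis_vec_def
  by (subst sum.reindex_bij_betw[where h = "\<lambda>i. axis i 1" and S = UNIV, symmetric])
    (auto simp: matrix_def inner_axis bij_betw_def inj_on_def axis_eq_axis)

text \<open>Where the determinant \<open>d\<close> is non-zero, its derivative is \<open>d\<close>
  times the trace of \<open>k\<close> followed by the inverse operator. That trace is 0 by
  hypothesis, so \<open>d\<close> is constant and invertibility passes from \<open>t = 0\<close> to
  \<open>t = 1\<close>.\<close>

lemma det_matrix_line_constant:
  fixes f k :: "real^'n \<Rightarrow> real^'n"
  assumes lin: "linear f" "linear k" and inj: "inj f"
    and tr: "\<And>t g. inj (\<lambda>v. f v + t *\<^sub>R k v) \<Longrightarrow> linear g \<Longrightarrow>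
      (\<And>v. g (f v + t *\<^sub>R k v) = v) \<Longrightarrow> (\<And>v. f (g v) + t *\<^sub>R k (g v) = v) \<Longrightarrow>
      op_trace (\<lambda>v. g (k v)) = 0"
  shows "inj (\<lambda>v. f v + k v)"
proof -
  define h where "h t v = f v + t *\<^sub>R k v" for t v
  have hl: "linear (h t)" for t
    unfolding h_def by (intro linear_compose_add linear_compose_scale_right lin)
  have hm: "matrix (h t) = matrix f + t *\<^sub>R matrix k" for t
    by (simp add: vec_eq_iff matrix_def h_def)
  define d where "d t = det (matrix (h t))" for t
  have der: "\<exists>D. (d has_real_derivative D) (at t)" for t
    using has_derivative_det_line[of "matrix f" "matrix k" t] unfolding d_def[abs_def] hm by blast
  have d0: "(d has_real_derivative 0) (at t)" if "d t \<noteq> 0" for t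
  proof -
    have i: "inj (h t)" using that det_nz_iff_inj[OF hl] by (simp add: d_def)
    obtain g where g: "linear g" "g \<circ> h t = id"
      using linear_injective_left_inverse[OF hl i] by auto
    then have g2: "h t \<circ> g = id" using linear_inverse_left[OF g(1) hl] by simp
    have "op_trace (\<lambda>v. g (k v)) = 0"
    proof (rule tr[of t g])
      show "inj (\<lambda>v. f v + t *\<^sub>R k v)" using i by (simp add: h_def[abs_def])
      show "g (f v + t *\<^sub>R k v) = v" "f (g v) + t *\<^sub>R k (g v) = v" for v
        using fun_cong[OF g(2), of v] fun_cong[OF g2, of v] by (simp_all add: h_def)
    qed (rule g)
    then have T: "trace (matrix (\<lambda>v. g (k v))) = 0" by (simp add: trace_matrix)
    have "d (t + s) = d t * det (mat 1 + s *\<^sub>R matrix (\<lambda>v. g (k v)))" for s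
    proof -
      have gk: "linear (\<lambda>v. v + s *\<^sub>R g (k v))"
        using linear_compose[OF lin(2) g(1)]
        by (intro linear_compose_add linear_compose_scale_right linear_ident) (simp add: o_def)
      have "h (t + s) = h t \<circ> (\<lambda>v. v + s *\<^sub>R g (k v))"
      proof
        fix v
        have "h t (g (k v)) = k v" using fun_cong[OF g2, of "k v"] by simp
        then show "h (t + s) v = (h t \<circ> (\<lambda>v. v + s *\<^sub>R g (k v))) v"
          by (simp add: linear_add[OF hl] linear_cmul[OF hl]) (simp add: h_def algebra_simps)
      qed
      then have "matrix (h (t + s)) = matrix (h t) ** matrix (\<lambda>v. v + s *\<^sub>R g (k v))"
        using matrix_compose[OF gk hl] by simp
      moreover have "matrix (\<lambda>v. v + s *\<^sub>R g (k v)) = mat 1 + s *\<^sub>R matrix (\<lambda>v. g (k v))"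
        by (simp add: vec_eq_iff matrix_def mat_def axis_def)
      ultimately show ?thesis by (simp add: d_def det_mul)
    qed
    then have "((\<lambda>s. d (t + s)) has_real_derivative 0) (at 0)"
      using DERIV_cmult[OF has_derivative_det_identity[of "matrix (\<lambda>v. g (k v))"], of "d t"] T by simp
    then show ?thesis using DERIV_shift[of d 0 0 t] by (simp add: add.commute)
  qed
  \<comment> \<open>Squaring settles the zeros of \<open>d\<close>: there the product has derivative
    0 whatever the derivative of \<open>d\<close> is.\<close>
  have "((\<lambda>t. d t * d t) has_real_derivative 0) (at t)" for t
  proof (cases "d t = 0")
    case True
    obtain D where "(d has_real_derivative D) (at t)" using der by blast
    from DERIV_mult[OF this this] show ?thesis using True by simp
  next
    case False
    from DERIV_mult[OF d0[OF this] d0[OF this]] show ?thesis by simp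
  qed
  then have "d 1 * d 1 = d 0 * d 0" using DERIV_isconst_all[of "\<lambda>t. d t * d t" 1 0] by blast
  moreover have "d 0 \<noteq> 0" using det_nz_iff_inj[OF hl, of 0] inj by (simp add: d_def h_def[abs_def])
  ultimately have "d 1 \<noteq> 0" by auto
  then show ?thesis using det_nz_iff_inj[OF hl, of 1] by (simp add: d_def h_def[abs_def])
qed

text \<open>On the quotient by \<open>z\<close> the two forms even have the same Pfaffian: the derivative of the Pfaffian along an
  exact form is the trace of an inner derivation.\<close>

lemma cohomologous_nondegenerate:
  fixes br :: "real^'n \<Rightarrow> real^'n \<Rightarrow> real^'n" and \<omega> :: "real^'n \<Rightarrow> real^'n \<Rightarrow> real"
  assumes lie: "lie_algebra br" and uni: "\<And>x. op_trace (br x) = 0"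
    and \<omega>: "bilinear \<omega>" "\<And>x. \<omega> x x = 0"
    and closed: "\<And>x y w. \<omega> (br x y) w + \<omega> (br y w) x + \<omega> (br w x) y = 0"
    and z: "z \<noteq> 0" "\<And>x. br z x = 0" "\<And>x. \<omega> z x = 0"
    and nd: "\<And>x. (\<And>y. \<omega> x y = 0) \<Longrightarrow> x \<in> span {z}"
    and \<eta>: "linear \<eta>" "\<eta> z = 0"
    and x: "\<And>y. \<omega> x y + \<eta> (br x y) = 0"
  shows "x \<in> span {z}"
proof -
  interpret lie br using lie by unfold_locales
  define \<zeta> where "\<zeta> = (1 / (z \<bullet> z)) *\<^sub>R z"
  have \<zeta>z: "\<zeta> \<bullet> z = 1" using z by (simp add: \<zeta>_def)
  define b where "b t x y = \<omega> x y + t * \<eta> (br x y)" for t x y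
  note w = bilinear_rules[OF \<omega>(1)]
  note e = linear_rules[OF \<eta>(1)]
  note \<omega>_anti = alternating_anti[OF \<omega>]
  have bz: "b t z y = 0" "b t y z = 0" for t y
  proof -
    show "b t z y = 0" using z \<eta> by (simp add: b_def linear_0)
    have "\<omega> y z = 0" using z(3) \<omega>_anti[of y z] by simp
    then show "b t y z = 0" using z \<eta> by (simp add: b_def anti[of y z] linear_0)
  qed
  have banti: "b t x y = - b t y x" for t x y
    using \<omega>_anti[of x y] by (simp add: b_def anti[of x y] e)
  have blin: "linear (\<lambda>x. b t x y)" "linear (b t x)" for t x y
    by (auto intro!: linearI simp: b_def w brs e algebra_simps)
  have bclosed: "b t v (br x y) = b t (br v x) y + b t x (br v y)" for t v x y
  proof -
    have "\<eta> (br v (br x y)) = \<eta> (br (br v x) y) + \<eta> (br x (br v y))" by (subst jacobi) (simp add: e)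
    moreover have "\<omega> v (br x y) = \<omega> (br v x) y + \<omega> x (br v y)"
    proof -
      have "\<omega> (br y v) x = \<omega> x (br v y)" using \<omega>_anti[of "br y v" x] anti[of y v] by (simp add: w)
      then show ?thesis using closed[of v x y] \<omega>_anti[of v "br x y"] by simp
    qed
    ultimately show ?thesis by (simp add: b_def algebra_simps)
  qed
  \<comment> \<open>\<open>\<omega>\<close> is degenerate along \<open>z\<close>. Adding the square
    of the covector of \<open>\<zeta>\<close>, which is 1 on \<open>z\<close>, gives an invertible
    operator \<open>f\<close>; \<open>k\<close> represents the exact form.\<close>
  define f where "f v = (\<Sum>c\<in>Basis. (\<omega> c v + (\<zeta> \<bullet> c) * (\<zeta> \<bullet> v)) *\<^sub>R c)" for v
  define k where "k v = (\<Sum>c\<in>Basis. \<eta> (br c v) *\<^sub>R c)" for v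
  note rep = inner_Basis_sum
  have fk: "x \<bullet> (f v + t *\<^sub>R k v) = b t x v + (\<zeta> \<bullet> x) * (\<zeta> \<bullet> v)" for t x v
  proof -
    have "x \<bullet> f v = \<omega> x v + (\<zeta> \<bullet> x) * (\<zeta> \<bullet> v)" unfolding f_def
      by (rule rep) (auto intro!: linearI simp: w algebra_simps inner_simps)
    moreover have "x \<bullet> k v = \<eta> (br x v)" unfolding k_def
      by (rule rep) (auto intro!: linearI simp: brs e)
    ultimately show ?thesis by (simp add: b_def inner_add_right)
  qed
  have lf: "linear f" "linear k" unfolding f_def k_def
    by (auto intro!: linearI simp: w brs e algebra_simps inner_simps sum.distrib scaleR_sum_right)
  have inj: "inj f"
  proof (rule linear_injective_0[OF lf(1), THEN iffD2], intro allI impI)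
    fix v assume "f v = 0"
    then have h: "b 0 x v + (\<zeta> \<bullet> x) * (\<zeta> \<bullet> v) = 0" for x using fk[of x v 0] by simp
    from h[of z] have v: "\<zeta> \<bullet> v = 0" by (simp add: bz \<zeta>z)
    have "\<omega> v x = 0" for x using h[of x] v banti[of 0 x v] by (simp add: b_def)
    then obtain c where "v = c *\<^sub>R z" using nd[of v] by (auto simp: span_singleton)
    then show "v = 0" using v \<zeta>z by simp
  qed
  have "inj (\<lambda>v. f v + k v)"
  proof (rule det_matrix_line_constant[OF lf inj])
    fix t g assume g: "linear g" "\<And>v. g (f v + t *\<^sub>R k v) = v" "\<And>v. f (g v) + t *\<^sub>R k (g v) = v"
    define m where "m v = f v + t *\<^sub>R k v" for v
    have ml: "linear m" unfolding m_def by (intro linear_compose_add linear_compose_scale_right lf)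
    have gm: "g (m v) = v" and mg: "m (g v) = v" for v using g by (auto simp: m_def)
    have mb: "x \<bullet> m v = b t x v + (\<zeta> \<bullet> x) * (\<zeta> \<bullet> v)" for x v using fk by (simp add: m_def)
    define r where "r = (\<Sum>c\<in>Basis. \<eta> c *\<^sub>R c)"
    have r: "x \<bullet> r = \<eta> x" for x unfolding r_def by (rule rep) (rule \<eta>)
    \<comment> \<open>\<open>v\<close> is dual to \<open>\<eta>\<close>, so the exact form is the
      infinitesimal action of \<open>ad v\<close> on \<open>b t\<close>. This is how an inner
      derivation enters the trace.\<close>
    define v where "v = - g r"
    have v0: "b t x (g r) + (\<zeta> \<bullet> x) * (\<zeta> \<bullet> g r) = \<eta> x" for x
      using mb[of x "g r"] by (simp add: mg r)
    from v0[of z] have vz: "\<zeta> \<bullet> g r = 0" by (simp add: bz \<zeta>z \<eta>)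
    have v: "b t v y = \<eta> y" for y
      using v0[of y] banti[of t y "g r"] by (simp add: vz v_def linear_neg[OF blin(1)])
    define A where "A = br v"
    have A: "linear A" by (simp add: A_def lin2)
    have Az: "A z = 0" using anti[of v z] z by (simp add: A_def)
    have aA: "x \<bullet> adjoint A y = A x \<bullet> y" for x y using adjoint_works[OF A] .
    have lA: "linear (adjoint A)" by (rule adjoint_linear[OF A])
    have kk: "k y = adjoint A (m y) - (\<zeta> \<bullet> y) *\<^sub>R adjoint A \<zeta> + m (A y) - (\<zeta> \<bullet> A y) *\<^sub>R \<zeta>" for y
    proof (rule vector_eq_ldot[THEN iffD1], rule allI)
      fix x
      have "x \<bullet> k y = \<eta> (br x y)" using fk[of x y 1] fk[of x y 0] by (simp add: b_def inner_add_right)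
      also have "\<dots> = b t (A x) y + b t x (A y)" using v[of "br x y"] bclosed[of t v x y] by (simp add: A_def)
      finally show "x \<bullet> k y = x \<bullet> (adjoint A (m y) - (\<zeta> \<bullet> y) *\<^sub>R adjoint A \<zeta> + m (A y) - (\<zeta> \<bullet> A y) *\<^sub>R \<zeta>)"
        by (simp add: inner_simps aA mb) (simp add: inner_commute)
    qed
    have g\<zeta>: "g \<zeta> = z"
    proof -
      have "m z = \<zeta>" by (rule vector_eq_ldot[THEN iffD1]) (simp add: mb bz \<zeta>z inner_commute)
      then show ?thesis using gm[of z] by simp
    qed
    have \<zeta>g: "\<zeta> \<bullet> g y = z \<bullet> y" for y using mb[of z "g y"] by (simp add: mg bz \<zeta>z)
    have gA: "linear (\<lambda>y. g (adjoint A y))" using linear_compose[OF lA g(1)] by (simp add: o_def)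
    have tr1: "op_trace (\<lambda>y. (\<zeta> \<bullet> y) *\<^sub>R u) = \<zeta> \<bullet> u" for u
      by (simp add: op_trace_def euclidean_inner[of \<zeta> u])
    \<comment> \<open>Two of the terms have the trace of \<open>A = ad v\<close>, which is 0 by
      unimodularity; all corrections containing \<open>\<zeta>\<close> vanish because
      \<open>A z = 0\<close>.\<close>
    have "op_trace (\<lambda>y. g (k y)) = op_trace (\<lambda>y. g (adjoint A (m y)) - (\<zeta> \<bullet> y) *\<^sub>R g (adjoint A \<zeta>)
        - ((\<zeta> \<bullet> A y) *\<^sub>R z - A y))"
      by (simp add: kk linear_add[OF g(1)] linear_diff[OF g(1)] linear_cmul[OF g(1)] gm g\<zeta> algebra_simps)
    also have "\<dots> = op_trace (\<lambda>y. g (adjoint A (m y))) - \<zeta> \<bullet> g (adjoint A \<zeta>)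
        - (op_trace (\<lambda>y. (\<zeta> \<bullet> A y) *\<^sub>R z) - op_trace A)"
      unfolding op_trace_diff tr1 ..
    also have "op_trace (\<lambda>y. g (adjoint A (m y))) = op_trace (\<lambda>y. m (g (adjoint A y)))"
      by (rule op_trace_commute[OF gA ml])
    also have "\<dots> = op_trace A" by (simp add: mg op_trace_def aA inner_commute)
    also have "op_trace (\<lambda>y. (\<zeta> \<bullet> A y) *\<^sub>R z) = op_trace (\<lambda>y. A ((\<zeta> \<bullet> y) *\<^sub>R z))"
      by (rule op_trace_commute[OF _ A]) (auto intro!: linearI simp: inner_simps algebra_simps)
    also have "\<dots> = 0" by (simp add: linear_cmul[OF A] Az op_trace_def)
    also have "\<zeta> \<bullet> g (adjoint A \<zeta>) = 0" by (simp add: \<zeta>g aA Az)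
    finally show "op_trace (\<lambda>y. g (k y)) = 0" using uni[of v] by (simp add: A_def)
  qed
  moreover define s where "s = - (\<zeta> \<bullet> x)"
  ultimately have i: "inj (\<lambda>v. f v + k v)" by simp
  have "b 1 (x + s *\<^sub>R z) y = 0" "\<zeta> \<bullet> (x + s *\<^sub>R z) = 0" for y
    using x[of y] by (simp_all add: linear_add[OF blin(1)] linear_cmul[OF blin(1)] bz \<zeta>z s_def
        inner_simps del: scaleR_minus_left) (simp add: b_def)
  then have "y \<bullet> (f (x + s *\<^sub>R z) + k (x + s *\<^sub>R z)) = 0" for y
    using fk[of y "x + s *\<^sub>R z" 1] banti[of 1 y "x + s *\<^sub>R z"] by simp
  then have "f (x + s *\<^sub>R z) + k (x + s *\<^sub>R z) = 0" by (metis inner_eq_zero_iff)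
  then have "x + s *\<^sub>R z = 0"
    using linear_injective_0[OF linear_compose_add[OF lf]] i by blast
  then have "x = (- s) *\<^sub>R z" by (simp add: eq_neg_iff_add_eq_0)
  then show ?thesis by (metis singletonI span_base span_scale)
qed

section \<open>Fitting decompositions\<close>

text \<open>The exponent \<open>DIM('a)\<close> stands for every large exponent: by
  \<open>nilpotent_vector_bound\<close> the kernels of the powers no longer grow beyond it.\<close>

definition fitting_null :: "('a::euclidean_space \<Rightarrow> 'a) \<Rightarrow> 'a set" where
  "fitting_null f = {v. (f ^^ DIM('a)) v = 0}"

definition fitting_range :: "('a::euclidean_space \<Rightarrow> 'a) \<Rightarrow> 'a set" where
  "fitting_range f = range (f ^^ DIM('a))"

lemma linear_funpow: "linear f \<Longrightarrow> linear (f ^^ n)" for f :: "'a::real_vector \<Rightarrow> 'a"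
  by (induction n) (auto simp: id_def intro: linear_ident linear_compose)

lemma subspace_kernel_funpow:
  fixes f :: "'a::real_vector \<Rightarrow> 'a"
  assumes "linear f" shows "subspace {v. (f ^^ n) v = 0}"
  by (rule linear_subspace_kernel[OF linear_funpow[OF assms]])

lemma subspace_fitting:
  assumes "linear f" shows "subspace (fitting_null f)" "subspace (fitting_range f)"
  using linear_funpow[OF assms] linear_subspace_image[OF _ subspace_UNIV]
  unfolding fitting_null_def fitting_range_def by (auto intro: linear_subspace_kernel)

lemma funpow_zero_mono:
  fixes f :: "'a::real_vector \<Rightarrow> 'a"
  assumes "linear f" "(f ^^ n) v = 0" "n \<le> m" shows "(f ^^ m) v = 0"
  using assms linear_funpow[OF assms(1), of "m - n"]
  by (metis comp_apply funpow_add le_add_diff_inverse2 linear_0)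

lemma nilpotent_square_eigenvalue:
  fixes f :: "'a::real_vector \<Rightarrow> 'a"
  assumes f: "linear f" and u: "(f ^^ n) u = 0" "u \<noteq> 0" and s: "f (f u) = s *\<^sub>R u"
  shows "s = 0"
proof -
  have "(f ^^ (2 * k)) u = s ^ k *\<^sub>R u" for k
    by (induction k) (simp_all add: linear_cmul[OF f] s mult.commute)
  from this[of n] have "s ^ n *\<^sub>R u = 0" using funpow_zero_mono[OF f u(1), of "2 * n"] by simp
  then show ?thesis using u by auto
qed

text \<open>Up to the nilpotency index of \<open>v\<close> the kernels of the powers increase
  strictly, witnessed by iterates of \<open>v\<close>, so the index is at most a dimension.\<close>

lemma nilpotent_vector_bound:
  fixes f :: "'a::euclidean_space \<Rightarrow> 'a"
  assumes f: "linear f" and v: "(f ^^ m) v = 0"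
  shows "(f ^^ DIM('a)) v = 0"
proof -
  define n where "n = (LEAST n. (f ^^ n) v = 0)"
  have n: "(f ^^ n) v = 0" unfolding n_def using v by (rule LeastI)
  have min: "(f ^^ j) v \<noteq> 0" if "j < n" for j using not_less_Least that unfolding n_def by blast
  have "k \<le> dim {v. (f ^^ k) v = 0}" if "k \<le> n" for k
    using that
  proof (induction k)
    case (Suc k)
    let ?K = "\<lambda>k. {v. (f ^^ k) v = 0}"
    have "?K k \<subseteq> ?K (Suc k)" using funpow_zero_mono[OF f, of k _ "Suc k"] by auto
    moreover have "(f ^^ (n - Suc k)) v \<in> ?K (Suc k) - ?K k"
    proof -
      have "(f ^^ Suc k) ((f ^^ (n - Suc k)) v) = (f ^^ n) v"
        using Suc.prems by (simp only: funpow_add[symmetric, THEN fun_cong, unfolded o_apply] le_add_diff_inverse)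
      moreover have "(f ^^ k) ((f ^^ (n - Suc k)) v) = (f ^^ (n - 1)) v"
        using Suc.prems by (simp add: funpow_add[symmetric, THEN fun_cong, unfolded o_apply])
      ultimately show ?thesis using n min[of "n - 1"] Suc.prems by simp
    qed
    ultimately have "?K k \<subset> ?K (Suc k)" by auto
    then have "dim (?K k) < dim (?K (Suc k))"
      by (intro dim_psubset) (metis f span_eq_iff subspace_kernel_funpow)
    then show ?case using Suc by simp
  qed simp
  then have "n \<le> dim {v. (f ^^ n) v = 0}" by simp
  also have "\<dots> \<le> DIM('a)" by (rule dim_subset_UNIV)
  finally show ?thesis using funpow_zero_mono[OF f n] by simp
qed

lemma fitting_invariant:
  assumes "linear f"
  shows "v \<in> fitting_null f \<Longrightarrow> f v \<in> fitting_null f" "v \<in> fitting_range f \<Longrightarrow> f v \<in> fitting_range f"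
proof -
  have c: "f ((f ^^ n) v) = (f ^^ n) (f v)" for n v by (simp add: funpow_swap1)
  show "v \<in> fitting_null f \<Longrightarrow> f v \<in> fitting_null f"
    using assms by (simp add: fitting_null_def c[symmetric] linear_0)
  show "v \<in> fitting_range f \<Longrightarrow> f v \<in> fitting_range f"
    by (auto simp: fitting_range_def c)
qed

lemma fitting_Int: 
  assumes "linear f" "v \<in> fitting_null f" "v \<in> fitting_range f" shows "v = 0"
proof -
  obtain u where u: "v = (f ^^ DIM('a)) u" using assms by (auto simp: fitting_range_def)
  then have "(f ^^ (DIM('a) + DIM('a))) u = 0" using assms(2) by (simp add: fitting_null_def funpow_add)
  then show ?thesis using nilpotent_vector_bound[OF assms(1)] u by blast
qed

lemma injective_on_subspace_onto:
  fixes f :: "'a::euclidean_space \<Rightarrow> 'a"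
  assumes f: "linear f" and U: "subspace U" and inv: "\<And>v. v \<in> U \<Longrightarrow> f v \<in> U"
    and inj: "\<And>v. v \<in> U \<Longrightarrow> f v = 0 \<Longrightarrow> v = 0"
  shows "f ` U = U"
proof (rule subspace_dim_equal)
  have i: "inj_on f U" using linear_injective_on_subspace_0[OF f U] inj by blast
  show "subspace (f ` U)" by (rule linear_subspace_image[OF f U])
  show "dim U \<le> dim (f ` U)" using dim_image_eq[OF f, of U] i U by (metis order_refl span_eq_iff)
qed (use assms in auto)

lemma fitting_range_onto:
  assumes "linear f"
  shows "f ` fitting_range f = fitting_range f" "(f ^^ n) ` fitting_range f = fitting_range f"
proof -
  show 1: "f ` fitting_range f = fitting_range f"
  proof (rule injective_on_subspace_onto[OF assms subspace_fitting(2)[OF assms] fitting_invariant(2)[OF assms]])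
    fix v assume v: "v \<in> fitting_range f" "f v = 0"
    have "(f ^^ 1) v = 0" using v by simp
    then have "v \<in> fitting_null f" unfolding fitting_null_def using nilpotent_vector_bound[OF assms] by blast
    then show "v = 0" using fitting_Int[OF assms] v by blast
  qed
  show "(f ^^ n) ` fitting_range f = fitting_range f"
    by (induction n) (use 1 in \<open>simp_all only: funpow.simps image_comp[symmetric] image_id id_apply image_ident\<close>)
qed

lemma fitting_decomp:
  fixes f :: "'a::euclidean_space \<Rightarrow> 'a"
  assumes "linear f"
  obtains a b where "a \<in> fitting_null f" "b \<in> fitting_range f" "v = a + b"
proof -
  have "(f ^^ DIM('a)) v \<in> fitting_range f" by (simp add: fitting_range_def)
  then obtain w where w: "w \<in> fitting_range f" "(f ^^ DIM('a)) v = (f ^^ DIM('a)) w"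
    using fitting_range_onto(2)[OF assms, of "DIM('a)"] by (metis imageE)
  have "v - w \<in> fitting_null f"
    using w linear_diff[OF linear_funpow[OF assms]] by (simp add: fitting_null_def)
  then show thesis using that[of "v - w" w] w by simp
qed

lemma fitting_dim:
  fixes f :: "'a::euclidean_space \<Rightarrow> 'a"
  assumes "linear f"
  shows "dim (fitting_null f) + dim (fitting_range f) = DIM('a)"
proof -
  have "{x + y |x y. x \<in> fitting_null f \<and> y \<in> fitting_range f} = UNIV"
    using fitting_decomp[OF assms] by blast
  moreover have "fitting_null f \<inter> fitting_range f = {0}"
    using fitting_Int[OF assms] subspace_fitting[OF assms] by (auto simp: subspace_0)
  ultimately show ?thesis using dim_sums_Int[OF subspace_fitting[OF assms]] by simp
qed

lemma fitting_range_maximal: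
  assumes f: "linear f" and Z: "subspace Z" "Z \<subseteq> f ` Z"
  shows "Z \<subseteq> fitting_range f"
proof -
  have "Z \<subseteq> (f ^^ n) ` Z" for n
  proof (induction n)
    case (Suc n)
    have "Z \<subseteq> f ` Z" by (rule Z)
    also have "\<dots> \<subseteq> f ` (f ^^ n) ` Z" using Suc by (rule image_mono)
    finally show ?case by (simp add: image_comp)
  qed simp
  then show ?thesis unfolding fitting_range_def by blast
qed

section \<open>Fitting components of inner derivations\<close>

context lie
begin

abbreviation Null :: "'a \<Rightarrow> 'a set" where "Null e \<equiv> fitting_null (br e)"
abbreviation Range :: "'a \<Rightarrow> 'a set" where "Range e \<equiv> fitting_range (br e)"

text \<open>Leibniz rule: if powers \<open>i\<close> and \<open>j\<close> of \<open>ad e\<close>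
  annihilate two vectors, the power \<open>i + j\<close> annihilates their bracket.\<close>

lemma Null_Null: assumes "x \<in> Null e" "y \<in> Null e" shows "br x y \<in> Null e"
proof -
  have "\<forall>i j x y. i + j \<le> m \<longrightarrow> (br e ^^ i) x = 0 \<longrightarrow> (br e ^^ j) y = 0 \<longrightarrow> (br e ^^ m) (br x y) = 0" for m
  proof (induction m)
    case (Suc m)
    show ?case
    proof (intro allI impI)
      fix i j x y assume h: "i + j \<le> Suc m" "(br e ^^ i) x = 0" "(br e ^^ j) y = 0"
      show "(br e ^^ Suc m) (br x y) = 0"
      proof (cases "i = 0 \<or> j = 0")
        case True
        then have "br x y = 0" using h by auto
        then show ?thesis using linear_0[OF linear_funpow[OF lin2]] by metis
      next
        case False
        then obtain i' j' where ij: "i = Suc i'" "j = Suc j'" by (metis not0_implies_Suc)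
        have "(br e ^^ m) (br (br e x) y) = 0"
          using Suc.IH h ij by (metis add_Suc comp_apply funpow_Suc_right not_less_eq_eq)
        moreover have "(br e ^^ m) (br x (br e y)) = 0"
          using Suc.IH h ij by (metis add_Suc_right comp_apply funpow_Suc_right not_less_eq_eq)
        ultimately have "(br e ^^ m) (br e (br x y)) = 0"
          by (simp add: jacobi[of e x y] linear_add[OF linear_funpow[OF lin2]])
        then show ?thesis by (simp add: funpow_swap1)
      qed
    qed
  qed auto
  from this[of "DIM('a) + DIM('a)"] have "(br e ^^ (DIM('a) + DIM('a))) (br x y) = 0"
    using assms by (auto simp: fitting_null_def)
  then show ?thesis using nilpotent_vector_bound[OF lin2] by (auto simp: fitting_null_def)
qed

text \<open>Induction on the order of nilpotency of \<open>y\<close>. Let \<open>Z\<close> be the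
  range plus its bracket with \<open>y\<close>. Since \<open>[e, [y, w']]\<close> and
  \<open>[y, [e, w']]\<close> differ by \<open>[[e, y], w']\<close>, which lies in the range by
  induction, \<open>ad e\<close> still maps \<open>Z\<close> onto at least \<open>Z\<close>, and
  maximality of the range applies.\<close>

lemma Null_Range: assumes "y \<in> Null e" "w \<in> Range e" shows "br y w \<in> Range e"
proof -
  have W: "subspace (Range e)" by (rule subspace_fitting[OF lin2])
  have "\<forall>y. (br e ^^ k) y = 0 \<longrightarrow> (\<forall>w\<in>Range e. br y w \<in> Range e)" for k
  proof (induction k)
    case 0
    then show ?case using W by (simp add: subspace_0)
  next
    case (Suc k)
    show ?case
    proof (intro allI impI)
      fix y assume y: "(br e ^^ Suc k) y = 0"
      have IH: "br (br e y) w \<in> Range e" if "w \<in> Range e" for w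
        using Suc y that by (metis comp_apply funpow_Suc_right)
      define Z where "Z = {a + b | a b. a \<in> Range e \<and> b \<in> br y ` Range e}"
      have sZ: "subspace Z" unfolding Z_def
        by (intro subspace_sums W linear_subspace_image lin2)
      have "Z \<subseteq> br e ` Z"
      proof
        fix v assume "v \<in> Z"
        then obtain a w where v: "v = a + br y w" "a \<in> Range e" "w \<in> Range e" by (auto simp: Z_def)
        obtain w' where w': "w' \<in> Range e" "w = br e w'"
          using v fitting_range_onto(1)[OF lin2, of e] by (metis imageE)
        have "br e (br y w') = br (br e y) w' + br y w" by (subst jacobi) (simp add: w')
        then have "v = (a - br (br e y) w') + br e (br y w')" by (simp add: v)
        moreover have "a - br (br e y) w' \<in> Range e" using IH v w' W by (simp add: subspace_diff)
        then obtain a' where "a' \<in> Range e" "a - br (br e y) w' = br e a'"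
          using fitting_range_onto(1)[OF lin2, of e] by (metis imageE)
        ultimately have "v = br e (a' + br y w')" "a' + br y w' \<in> Z"
          using w' by (auto simp: brs Z_def)
        then show "v \<in> br e ` Z" by blast
      qed
      then have "Z \<subseteq> Range e" by (rule fitting_range_maximal[OF lin2 sZ])
      moreover have "br y w \<in> Z" if "w \<in> Range e" for w
        using that subspace_0[OF W] unfolding Z_def by (metis (mono_tags, lifting) add_0 imageI mem_Collect_eq)
      ultimately show "\<forall>w\<in>Range e. br y w \<in> Range e" by auto
    qed
  qed
  then show ?thesis using assms by (auto simp: fitting_null_def)
qed

lemma self_Null: "e \<in> Null e"
proof -
  have "(br e ^^ 1) e = 0" by simp
  then show ?thesis unfolding fitting_null_def using nilpotent_vector_bound[OF lin2] by blast
qed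

lemma center_Null: assumes "\<And>x. br z x = 0" shows "z \<in> Null e"
proof -
  have "(br e ^^ 1) z = 0" using assms[of e] anti[of e z] by simp
  then show ?thesis unfolding fitting_null_def using nilpotent_vector_bound[OF lin2] by blast
qed

text \<open>A polynomial in \<open>s\<close> that is 0 on an interval has zero top coefficient; this
  is how nilpotency near \<open>e\<close> is transferred to \<open>y\<close>.\<close>

lemma power_pencil_expansion:
  "\<exists>c. (\<forall>s. (br (e + s *\<^sub>R y) ^^ k) v = (\<Sum>j\<le>k. s ^ j *\<^sub>R c j)) \<and> c k = (br y ^^ k) v"
proof (induction k)
  case 0
  then show ?case by (intro exI[of _ "\<lambda>_. v"]) simp
next
  case (Suc k)
  then obtain c where c: "\<And>s. (br (e + s *\<^sub>R y) ^^ k) v = (\<Sum>j\<le>k. s ^ j *\<^sub>R c j)"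
    "c k = (br y ^^ k) v" by auto
  define d where "d j = (if j \<le> k then br e (c j) else 0) + (if j = 0 then 0 else br y (c (j - 1)))" for j
  have "(br (e + s *\<^sub>R y) ^^ Suc k) v = (\<Sum>j\<le>Suc k. s ^ j *\<^sub>R d j)" for s
  proof -
    have "(br (e + s *\<^sub>R y) ^^ Suc k) v = (\<Sum>j\<le>k. s ^ j *\<^sub>R br e (c j)) + (\<Sum>j\<le>k. s ^ Suc j *\<^sub>R br y (c j))"
      
      by (simp add: c(1) brs linear_sum[OF lin2] scaleR_sum_right sum.distrib[symmetric] scaleR_add_right mult.commute)
    also have "(\<Sum>j\<le>k. s ^ Suc j *\<^sub>R br y (c j)) = (\<Sum>j\<le>Suc k. s ^ j *\<^sub>R (if j = 0 then 0 else br y (c (j - 1))))"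
      by (subst sum.atMost_Suc_shift) simp
    also have "(\<Sum>j\<le>k. s ^ j *\<^sub>R br e (c j)) = (\<Sum>j\<le>Suc k. s ^ j *\<^sub>R (if j \<le> k then br e (c j) else 0))"
      by simp
    finally show ?thesis by (simp only: d_def sum.distrib[symmetric] scaleR_add_right)
  qed
  moreover have "d (Suc k) = (br y ^^ Suc k) v" by (simp add: d_def c(2))
  ultimately show ?case by blast
qed

text \<open>Hence the Fitting null space is a Cartan subalgebra.\<close>

lemma maximal_Range_Null_nilpotent:
  assumes max: "\<And>e'. dim (Range e') \<le> dim (Range e)" and y: "y \<in> Null e" and v: "v \<in> Null e"
  shows "(br y ^^ DIM('a)) v = 0"
proof -
  let ?W = "Range e" and ?N = "DIM('a)"
  have W: "subspace ?W" and N: "subspace (Null e)" by (auto intro: subspace_fitting lin2)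
  have "\<forall>x\<in>?W. br e x = 0 \<longrightarrow> x = 0"
  proof (intro ballI impI)
    fix x assume x: "x \<in> ?W" "br e x = 0"
    have "(br e ^^ 1) x = 0" using x by simp
    then have "x \<in> Null e" unfolding fitting_null_def using nilpotent_vector_bound[OF lin2] by blast
    then show "x = 0" using fitting_Int[OF lin2] x by blast
  qed
  \<comment> \<open>Quantitative injectivity of \<open>ad e\<close> on its range: adding
    \<open>s\<close> times \<open>ad y\<close> keeps it injective as long as
    \<open>s < m / K\<close>.\<close>
  then obtain m where m: "m > 0" "\<And>x. x \<in> ?W \<Longrightarrow> m * norm x \<le> norm (br e x)"
    using injective_imp_isometric[OF closed_subspace[OF W] W, of "br e"] lin2[of e]
    by (auto simp: linear_conv_bounded_linear)
  obtain K where K: "K > 0" "\<And>x. norm (br y x) \<le> K * norm x"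
    using linear_bounded_pos[OF lin2] by blast
  \<comment> \<open>For small \<open>s\<close> the range of \<open>e + s y\<close> still contains
    that of \<open>e\<close>. A vector of the null space on which \<open>e + s y\<close> is not
    nilpotent would enlarge it, against the maximality of the dimension.\<close>
  have zero: "(br (e + s *\<^sub>R y) ^^ ?N) v = 0" if s: "0 < s" "s < m / K" for s
  proof (rule ccontr)
    assume nz: "(br (e + s *\<^sub>R y) ^^ ?N) v \<noteq> 0"
    define e' where "e' = e + s *\<^sub>R y"
    have eN: "e' \<in> Null e" unfolding e'_def
      using N self_Null y by (intro subspace_add subspace_scale) auto
    have inv: "br e' x \<in> ?W" if "x \<in> ?W" for x using Null_Range[OF eN that] .
    have inj: "x = 0" if x: "x \<in> ?W" "br e' x = 0" for x
    proof (rule ccontr)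
      assume "x \<noteq> 0"
      have "m * norm x \<le> norm (br e x)" using m x by blast
      also have "br e x = - (s *\<^sub>R br y x)" using x by (simp add: e'_def brs eq_neg_iff_add_eq_0)
      also have "norm \<dots> \<le> s * (K * norm x)" using K s by simp
      also have "\<dots> < m * norm x" using s K \<open>x \<noteq> 0\<close> by (simp add: field_simps)
      finally show False by simp
    qed
    have "br e' ` ?W = ?W" by (rule injective_on_subspace_onto[OF lin2 W inv inj])
    then have sub: "?W \<subseteq> Range e'" using fitting_range_maximal[OF lin2 W] by simp
    define u where "u = (br e' ^^ ?N) v"
    have "u \<in> Range e'" by (simp add: u_def fitting_range_def)
    moreover have "(br e' ^^ n) v \<in> Null e" for n
      by (induction n) (use v eN Null_Null in auto)
    then have "u \<in> Null e" by (simp add: u_def)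
    then have "u \<notin> ?W" using fitting_Int[OF lin2] nz by (auto simp: u_def e'_def)
    ultimately have "?W \<subset> Range e'" using sub by blast
    then have "dim ?W < dim (Range e')"
      by (intro dim_psubset) (metis span_eq_iff subspace_fitting(2)[OF lin2])
    then show False using max[of e'] by simp
  qed
  obtain c where c: "\<And>s. (br (e + s *\<^sub>R y) ^^ ?N) v = (\<Sum>j\<le>?N. s ^ j *\<^sub>R c j)" "c ?N = (br y ^^ ?N) v"
    using power_pencil_expansion by blast
  have "c ?N \<bullet> b = 0" for b
  proof (rule ccontr)
    assume "c ?N \<bullet> b \<noteq> 0"
    then have fin: "finite {s. (\<Sum>j\<le>?N. (c j \<bullet> b) * s ^ j) = 0}" by (subst polyfun_finite_roots) auto
    have "(\<Sum>j\<le>?N. (c j \<bullet> b) * s ^ j) = (\<Sum>j\<le>?N. s ^ j *\<^sub>R c j) \<bullet> b" for s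
      by (simp add: inner_sum_left mult.commute)
    then have "{0<..<m/K} \<subseteq> {s. (\<Sum>j\<le>?N. (c j \<bullet> b) * s ^ j) = 0}" using zero c(1) by auto
    then have "finite {0<..<m/K}" using fin finite_subset by blast
    moreover have "infinite {0<..<m/K}" using m K by (intro infinite_Ioo) simp
    ultimately show False by blast
  qed
  then have "c ?N = 0" using inner_eq_zero_iff by blast
  then show ?thesis using c(2) by simp
qed

lemma Range_memI: "x \<in> Range e \<Longrightarrow> \<exists>y \<in> Range e. x = br e y"
  using fitting_range_onto(1)[OF lin2, of e] by (metis imageE)

end

section \<open>Independent tuples and symplectic bases\<close>

text \<open>Independence of a tuple: a repeated entry must destroy it, which independence of the
  underlying set alone would not notice.\<close>

definition frame :: "'a::real_vector list \<Rightarrow> bool" where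
  "frame fs \<longleftrightarrow> distinct fs \<and> independent (set fs)"

lemma frame_Nil: "frame []" by (simp add: frame_def independent_empty)

lemma frame_Cons: "frame (a # fs) \<longleftrightarrow> frame fs \<and> a \<notin> span (set fs)"
  unfolding frame_def using independent_insert[of a "set fs"] span_base[of a "set fs"] by auto

lemma frame_subset: "frame fs \<Longrightarrow> distinct gs \<Longrightarrow> set gs \<subseteq> set fs \<Longrightarrow> frame gs"
  unfolding frame_def using independent_mono by blast

lemma frame_permute: "frame fs \<Longrightarrow> set gs = set fs \<Longrightarrow> length gs = length fs \<Longrightarrow> frame gs"
  unfolding frame_def by (metis card_distinct distinct_card)

lemma frame_add_span: "frame (a # fs) \<Longrightarrow> b \<in> span (set fs) \<Longrightarrow> frame ((a + b) # fs)"
  by (simp add: frame_Cons span_add_eq2)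

lemma frame_append:
  assumes "frame xs" "frame ys" "span (set xs) \<inter> span (set ys) \<subseteq> {0}"
  shows "frame (xs @ ys)"
  using assms
proof (induction xs)
  case (Cons a xs)
  have a: "a \<notin> span (set xs)" "frame xs" using Cons.prems by (auto simp: frame_Cons)
  have mono: "span (set xs) \<subseteq> span (set (a # xs))" by (intro span_mono) auto
  have "a \<notin> span (set xs \<union> set ys)"
  proof
    assume "a \<in> span (set xs \<union> set ys)"
    then obtain u v where uv: "u \<in> span (set xs)" "v \<in> span (set ys)" "a = u + v"
      by (auto simp: span_Un)
    have "a - u \<in> span (set (a # xs))" using uv mono by (intro span_diff) (auto intro: span_base)
    moreover have "a - u = v" using uv by simp
    ultimately have "v = 0" using uv(2) Cons.prems(3) by auto
    then show False using uv a by auto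
  qed
  moreover have "frame (xs @ ys)" using Cons.IH a Cons.prems(2,3) mono by blast
  ultimately show ?case by (simp add: frame_Cons)
qed simp

fun lincomb :: "real list \<Rightarrow> 'a::real_vector list \<Rightarrow> 'a" where
  "lincomb (c # cs) (f # fs) = c *\<^sub>R f + lincomb cs fs"
| "lincomb _ _ = 0"

lemma span_lincomb: "x \<in> span (set fs) \<longleftrightarrow> (\<exists>cs. length cs = length fs \<and> x = lincomb cs fs)"
proof (induction fs arbitrary: x)
  case (Cons f fs)
  show ?case
  proof
    assume "x \<in> span (set (f # fs))"
    then obtain k where "x - k *\<^sub>R f \<in> span (set fs)" by (auto simp: span_insert)
    then obtain cs where "length cs = length fs" "x - k *\<^sub>R f = lincomb cs fs" using Cons by blast
    then show "\<exists>cs. length cs = length (f # fs) \<and> x = lincomb cs (f # fs)"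
      by (intro exI[of _ "k # cs"]) (auto simp: algebra_simps)
  next
    assume "\<exists>cs. length cs = length (f # fs) \<and> x = lincomb cs (f # fs)"
    then obtain k cs where cs: "length cs = length fs" "x = k *\<^sub>R f + lincomb cs fs"
      by (metis length_Suc_conv lincomb.simps(1) list.size(4) add.commute plus_1_eq_Suc length_Cons)
    then have "x - k *\<^sub>R f \<in> span (set fs)" using Cons by auto
    then show "x \<in> span (set (f # fs))" by (auto simp: span_insert)
  qed
qed simp

lemma frame_lincomb:
  "frame fs \<longleftrightarrow> (\<forall>cs. length cs = length fs \<longrightarrow> lincomb cs fs = 0 \<longrightarrow> set cs \<subseteq> {0})"
proof (induction fs)
  case Nil
  then show ?case by (simp add: frame_Nil)
next
  case (Cons f fs)
  show ?case
  proof
    assume fr: "frame (f # fs)"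
    show "\<forall>cs. length cs = length (f # fs) \<longrightarrow> lincomb cs (f # fs) = 0 \<longrightarrow> set cs \<subseteq> {0}"
    proof (intro allI impI)
      fix cs assume l: "length cs = length (f # fs)" and z: "lincomb cs (f # fs) = 0"
      obtain k cs' where cs: "cs = k # cs'" "length cs' = length fs" using l by (cases cs) auto
      have k: "k = 0"
      proof (rule ccontr)
        assume "k \<noteq> 0"
        have "k *\<^sub>R f = - lincomb cs' fs" using z cs by (simp add: eq_neg_iff_add_eq_0)
        moreover have "lincomb cs' fs \<in> span (set fs)" using cs span_lincomb by blast
        ultimately have "k *\<^sub>R f \<in> span (set fs)" by (simp add: span_neg)
        then have "(1 / k) *\<^sub>R k *\<^sub>R f \<in> span (set fs)" by (rule span_scale)
        then show False using fr \<open>k \<noteq> 0\<close> by (simp add: frame_Cons)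
      qed
      then show "set cs \<subseteq> {0}" using Cons fr z cs by (auto simp: frame_Cons)
    qed
  next
    assume h: "\<forall>cs. length cs = length (f # fs) \<longrightarrow> lincomb cs (f # fs) = 0 \<longrightarrow> set cs \<subseteq> {0}"
    have "frame fs" unfolding Cons
    proof (intro allI impI)
      fix cs assume "length cs = length fs" "lincomb cs fs = 0"
      then show "set cs \<subseteq> {0}" using h[rule_format, of "0 # cs"] by simp
    qed
    moreover have "f \<notin> span (set fs)"
    proof
      assume "f \<in> span (set fs)"
      then obtain cs where "length cs = length fs" "f = lincomb cs fs" using span_lincomb by blast
      moreover have "lincomb (map uminus cs) gs = - lincomb cs gs" for cs and gs :: "'a list"
        by (induction cs gs rule: lincomb.induct) auto
      ultimately have "lincomb (1 # map uminus cs) (f # fs) = 0" by simp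
      then show False using h[rule_format, of "1 # map uminus cs"] \<open>length cs = length fs\<close> by simp
    qed
    ultimately show "frame (f # fs)" by (simp add: frame_Cons)
  qed
qed

lemma all_list_Suc: "(\<forall>xs. length xs = Suc n \<longrightarrow> P xs) \<longleftrightarrow> (\<forall>x xs. length xs = n \<longrightarrow> P (x # xs))"
  by (metis length_Suc_conv)

lemma frame_explicit:
  "frame [a, b] \<longleftrightarrow> (\<forall>s t. s *\<^sub>R a + t *\<^sub>R b = 0 \<longrightarrow> s = 0 \<and> t = 0)"
  "frame [a, b, c] \<longleftrightarrow> (\<forall>s t u. s *\<^sub>R a + t *\<^sub>R b + u *\<^sub>R c = 0 \<longrightarrow> s = 0 \<and> t = 0 \<and> u = 0)"
  "frame [a, b, c, d] \<longleftrightarrow> (\<forall>s t u v. s *\<^sub>R a + t *\<^sub>R b + u *\<^sub>R c + v *\<^sub>R d = 0 \<longrightarrow>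
     s = 0 \<and> t = 0 \<and> u = 0 \<and> v = 0)"
  by (simp_all add: frame_lincomb all_list_Suc add.assoc)

lemma frame7:
  "frame [f1, f2, f3, f4, f5, f6, f7] \<longleftrightarrow> (\<forall>t1 t2 t3 t4 t5 t6 t7.
     t1 *\<^sub>R f1 + t2 *\<^sub>R f2 + t3 *\<^sub>R f3 + t4 *\<^sub>R f4 + t5 *\<^sub>R f5 + t6 *\<^sub>R f6 + t7 *\<^sub>R f7 = 0 \<longrightarrow>
     t1 = 0 \<and> t2 = 0 \<and> t3 = 0 \<and> t4 = 0 \<and> t5 = 0 \<and> t6 = 0 \<and> t7 = 0)"
  by (simp add: frame_lincomb all_list_Suc add.assoc)

lemma frame_dim: "frame fs \<Longrightarrow> dim (span (set fs)) = length fs"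
  unfolding frame_def by (simp add: dim_span dim_eq_card_independent distinct_card)

lemma frame_spans:
  fixes fs :: "'a::euclidean_space list"
  assumes "frame fs" "set fs \<subseteq> W" "subspace W" "dim W \<le> length fs"
  shows "span (set fs) = W"
  using assms frame_dim[OF assms(1)] subspace_dim_equal[of "span (set fs)" W]
  by (simp add: span_minimal)

lemma frame_UNIV:
  fixes fs :: "'a::euclidean_space list"
  assumes "frame fs" "length fs = DIM('a)"
  shows "span (set fs) = UNIV"
  using frame_spans[OF assms(1), of UNIV] assms by simp

lemma frame_length_le:
  fixes fs :: "'a::euclidean_space list"
  assumes "frame fs" "set fs \<subseteq> W" "subspace W"
  shows "length fs \<le> dim W"
  using frame_dim[OF assms(1)] assms dim_subset[of "span (set fs)" W] by (simp add: span_minimal)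

lemma frame_extend:
  fixes fs :: "'a::euclidean_space list"
  assumes "frame fs" "set fs \<subseteq> W" "subspace W" "length fs < dim W"
  obtains a where "a \<in> W" "frame (a # fs)"
proof -
  have "\<not> W \<subseteq> span (set fs)"
    using frame_dim[OF assms(1)] assms dim_subset[of W "span (set fs)"] by fastforce
  then show thesis using that assms by (auto simp: frame_Cons)
qed

lemma symplectic_split:
  fixes W :: "'a::euclidean_space set" and \<Omega> :: "'a \<Rightarrow> 'a \<Rightarrow> real"
  assumes W: "subspace W" "W \<noteq> {0}" and \<Omega>: "bilinear \<Omega>" "\<And>x. \<Omega> x x = 0"
    and nd: "\<And>w. w \<in> W \<Longrightarrow> (\<And>v. v \<in> W \<Longrightarrow> \<Omega> w v = 0) \<Longrightarrow> w = 0"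
  obtains a b W' where "a \<in> W" "b \<in> W" "\<Omega> a b = 1" "subspace W'" "W' \<subseteq> W" "dim W = dim W' + 2"
    "W' = {w \<in> W. \<Omega> w a = 0 \<and> \<Omega> w b = 0}"
    "\<forall>w\<in>W'. (\<forall>v\<in>W'. \<Omega> w v = 0) \<longrightarrow> w = 0"
proof -
  note w = bilinear_rules[OF \<Omega>(1)]
  note anti = alternating_anti[OF \<Omega>]
  obtain a where a: "a \<in> W" "a \<noteq> 0" using W subspace_0 by blast
  then obtain b' where b': "b' \<in> W" "\<Omega> a b' \<noteq> 0" using nd by blast
  define b where "b = (1 / \<Omega> a b') *\<^sub>R b'"
  have b: "b \<in> W" "\<Omega> a b = 1" using b' W by (auto simp: b_def w subspace_scale)
  have ba: "\<Omega> b a = -1" using anti[of b a] b by simp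
  define W' where "W' = {w \<in> W. \<Omega> w a = 0 \<and> \<Omega> w b = 0}"
  have W': "subspace W'" "W' \<subseteq> W" using W unfolding W'_def subspace_def by (auto simp: w)
  have proj: "v - \<Omega> v b *\<^sub>R a + \<Omega> v a *\<^sub>R b \<in> W'" if "v \<in> W" for v
    using that W a b by (auto simp: W'_def w \<Omega>(2) ba intro!: subspace_add subspace_diff subspace_scale)
  have fr: "frame [a, b]"
    unfolding frame_explicit
  proof (intro allI impI)
    fix s t assume st: "s *\<^sub>R a + t *\<^sub>R b = 0"
    have "\<Omega> (s *\<^sub>R a + t *\<^sub>R b) b = s" "\<Omega> (s *\<^sub>R a + t *\<^sub>R b) a = - t" by (simp_all add: w \<Omega>(2) b ba)
    then show "s = 0 \<and> t = 0" unfolding st by (simp add: w)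
  qed
  have sp: "x \<in> span {a, b} \<longleftrightarrow> (\<exists>s t. x = s *\<^sub>R a + t *\<^sub>R b)" for x
    by (auto simp: span_insert algebra_simps)
  have "{x + y |x y. x \<in> span {a, b} \<and> y \<in> W'} = W" (is "?S = W")
  proof
    show "?S \<subseteq> W" using a b W W'(2) by (auto simp: sp intro!: subspace_add subspace_scale)
    show "W \<subseteq> ?S"
    proof
      fix v assume v: "v \<in> W"
      have "v = (\<Omega> v b *\<^sub>R a + (- \<Omega> v a) *\<^sub>R b) + (v - \<Omega> v b *\<^sub>R a + \<Omega> v a *\<^sub>R b)" by simp
      then show "v \<in> ?S" using proj[OF v] sp by blast
    qed
  qed
  moreover have "span {a, b} \<inter> W' = {0}"
  proof -
    have "x = 0" if xs: "x \<in> span {a, b}" "x \<in> W'" for x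
    proof -
      obtain s t where x: "x = s *\<^sub>R a + t *\<^sub>R b" using xs(1) sp by blast
      have "\<Omega> x b = s" "\<Omega> x a = - t" by (simp_all add: x w \<Omega>(2) b ba)
      then show ?thesis using that x by (auto simp: W'_def)
    qed
    then show ?thesis using W'(1) by (auto simp: span_zero subspace_0)
  qed
  ultimately have "dim W = dim W' + 2"
    using dim_sums_Int[OF subspace_span W'(1), of "{a, b}"] frame_dim[OF fr] by simp
  moreover have "w = 0" if w': "w \<in> W'" "\<And>v. v \<in> W' \<Longrightarrow> \<Omega> w v = 0" for w
  proof (rule nd)
    show "w \<in> W" using w' W' by auto
    fix v assume "v \<in> W"
    have "\<Omega> w (v - \<Omega> v b *\<^sub>R a + \<Omega> v a *\<^sub>R b) = 0" using w' proj[OF \<open>v \<in> W\<close>] by blast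
    then show "\<Omega> w v = 0" using w' by (simp add: w W'_def)
  qed
  ultimately show thesis using that[OF a(1) b W' _ W'_def] by metis
qed

lemma symplectic_dim_even:
  fixes W :: "'a::euclidean_space set" and \<Omega> :: "'a \<Rightarrow> 'a \<Rightarrow> real"
  assumes "subspace W" and \<Omega>: "bilinear \<Omega>" "\<And>x. \<Omega> x x = 0"
    and "\<And>w. w \<in> W \<Longrightarrow> (\<And>v. v \<in> W \<Longrightarrow> \<Omega> w v = 0) \<Longrightarrow> w = 0"
  shows "even (dim W)"
  using assms(1,4)
proof (induction "dim W" arbitrary: W rule: less_induct)
  case less
  show ?case
  proof (cases "W = {0}")
    case False
    show ?thesis
    proof (rule symplectic_split[OF less.prems(1) False \<Omega> less.prems(2)])
      fix a b W' assume "subspace W'" "dim W = dim W' + 2"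
        "\<forall>w\<in>W'. (\<forall>v\<in>W'. \<Omega> w v = 0) \<longrightarrow> w = 0"
      then show "even (dim W)" using less.hyps[of W'] by simp
    qed
  qed simp
qed

lemma symplectic_basis4:
  fixes W :: "'a::euclidean_space set" and \<Omega> :: "'a \<Rightarrow> 'a \<Rightarrow> real"
  assumes W: "subspace W" "dim W = 4" and \<Omega>: "bilinear \<Omega>" "\<And>x. \<Omega> x x = 0"
    and nd: "\<And>w. w \<in> W \<Longrightarrow> (\<And>v. v \<in> W \<Longrightarrow> \<Omega> w v = 0) \<Longrightarrow> w = 0"
  obtains a b c d where "frame [a, b, c, d]" "span {a, b, c, d} = W"
    "\<Omega> a b = 1" "\<Omega> c d = 1" "\<Omega> a c = 0" "\<Omega> a d = 0" "\<Omega> b c = 0" "\<Omega> b d = 0"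
proof -
  note w = bilinear_rules[OF \<Omega>(1)]
  note anti = alternating_anti[OF \<Omega>]
  have "W \<noteq> {0}" using W by auto
  obtain a b W' where 1: "a \<in> W" "b \<in> W" "\<Omega> a b = 1" "subspace W'" "W' \<subseteq> W" "dim W = dim W' + 2"
    "W' = {w \<in> W. \<Omega> w a = 0 \<and> \<Omega> w b = 0}"
    "\<forall>w\<in>W'. (\<forall>v\<in>W'. \<Omega> w v = 0) \<longrightarrow> w = 0"
    by (rule symplectic_split[OF W(1) \<open>W \<noteq> {0}\<close> \<Omega> nd]) 
  have "W' \<noteq> {0}" using W(2) 1(6) by auto
  obtain c d where 2: "c \<in> W'" "d \<in> W'" "\<Omega> c d = 1"
    by (rule symplectic_split[OF 1(4) \<open>W' \<noteq> {0}\<close> \<Omega>]) (use 1(8) in auto)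
  have o: "\<Omega> c a = 0" "\<Omega> c b = 0" "\<Omega> d a = 0" "\<Omega> d b = 0" using 2(1,2) unfolding 1(7) by auto
  have o': "\<Omega> a c = 0" "\<Omega> b c = 0" "\<Omega> a d = 0" "\<Omega> b d = 0" "\<Omega> b a = -1" "\<Omega> d c = -1"
    using o anti[of a c] anti[of b c] anti[of a d] anti[of b d] anti[of b a] anti[of d c] 1(3) 2(3) by auto
  have fr: "frame [a, b, c, d]"
    unfolding frame_explicit
  proof (intro allI impI)
    fix s t u v assume st: "s *\<^sub>R a + t *\<^sub>R b + u *\<^sub>R c + v *\<^sub>R d = 0"
    let ?x = "s *\<^sub>R a + t *\<^sub>R b + u *\<^sub>R c + v *\<^sub>R d"
    have "\<Omega> ?x b = s" "\<Omega> ?x a = - t" "\<Omega> ?x d = u" "\<Omega> ?x c = - v"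
      by (simp_all add: w \<Omega>(2) o o' 1(3) 2(3))
    then show "s = 0 \<and> t = 0 \<and> u = 0 \<and> v = 0" unfolding st by (simp add: w)
  qed
  have "span (set [a, b, c, d]) = W"
    by (rule frame_spans[OF fr _ W(1)]) (use 1(1,2,5) 2(1,2) W in auto)
  then show thesis using that[OF fr _ 1(3) 2(3)] o' by simp
qed

section \<open>Closed definite forms on a Lie algebra with center\<close>

locale g2 = lie br for br :: "real^7 \<Rightarrow> real^7 \<Rightarrow> real^7" +
  fixes \<phi> :: "real^7 \<Rightarrow> real^7 \<Rightarrow> real^7 \<Rightarrow> real" and z :: "real^7"
  assumes uni: "\<And>x. op_trace (br x) = 0"
    and sol: "lie_solvable br"
    and def: "definite_three_form \<phi>"
    and closed: "\<And>x y v w. ce_d3 br \<phi> x y v w = 0"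
    and z0: "z \<noteq> 0" and zc [simp]: "\<And>x. br z x = 0"
begin

lemma zc2 [simp]: "br x z = 0" using anti[of x z] by simp

lemma \<phi>_linear: "linear (\<lambda>x. \<phi> x y v)" "linear (\<lambda>y. \<phi> x y v)" "linear (\<phi> x y)"
  using def by (auto simp: definite_three_form_def three_form_def)

lemmas \<phi>s = linear_rules[OF \<phi>_linear(1)] linear_rules[OF \<phi>_linear(2)] linear_rules[OF \<phi>_linear(3)]

lemma \<phi>0 [simp]: "\<phi> 0 x y = 0" "\<phi> x 0 y = 0" "\<phi> x y 0 = 0"
  by (simp_all only: \<phi>s)

lemma \<phi>_self [simp]: "\<phi> x x y = 0" "\<phi> x y x = 0" "\<phi> y x x = 0"
  using def by (auto simp: definite_three_form_def three_form_def)

lemma \<phi>_anti: "\<phi> x y v = - \<phi> y x v" "\<phi> x y v = - \<phi> x v y"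
  using \<phi>_linear by (intro alternating_anti; simp add: bilinear_def)+

lemma \<phi>_cyc: "\<phi> x y v = \<phi> y v x"
  using \<phi>_anti(1)[of x y v] \<phi>_anti(2)[of y x v] by simp

lemma closed4: "\<phi> (br x y) v w - \<phi> (br x v) y w + \<phi> (br x w) y v
     + \<phi> (br y v) x w - \<phi> (br y w) x v + \<phi> (br v w) x y = 0"
  using closed[of x y v w] by (simp add: ce_d3_def)

lemma kernel: "w \<noteq> 0 \<Longrightarrow> (\<And>y. \<phi> w x y = 0) \<Longrightarrow> x \<in> span {w}"
proof -
  assume w: "w \<noteq> 0" and x: "\<And>y. \<phi> w x y = 0"
  define K where "K = {x. \<forall>y. \<phi> w x y = 0}"
  have K: "subspace K" unfolding K_def subspace_def by (auto simp: \<phi>s)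
  have "two_form_rank (\<phi> w) = 6" using def w by (simp add: definite_three_form_def)
  then have "dim K = 1" by (simp add: two_form_rank_def K_def)
  moreover have "span {w} \<subseteq> K" using K by (intro span_minimal) (auto simp: K_def)
  moreover have "dim (span {w}) = 1" using w frame_dim[of "[w]"] by (simp add: frame_def)
  ultimately have "span {w} = K" using subspace_dim_equal[OF subspace_span K] by simp
  then show ?thesis using x by (auto simp: K_def)
qed

text \<open>The operator \<open>T\<close> of \<open>\<phi> w\<close> is injective on the span
  \<open>U\<close> of the four vectors, as its kernel is the line of \<open>w\<close>, which
  \<open>U\<close> avoids. Isotropy puts the image into the orthogonal complement of the
  5-dimensional span of \<open>w\<close> and \<open>U\<close>, of dimension 2 only.\<close>

lemma isotropic:
  assumes fr: "frame [w, u1, u2, u3, u4]"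
    and "\<phi> w u1 u2 = 0" "\<phi> w u1 u3 = 0" "\<phi> w u1 u4 = 0" "\<phi> w u2 u3 = 0" "\<phi> w u2 u4 = 0" "\<phi> w u3 u4 = 0"
  shows False
proof -
  let ?U = "span {u1, u2, u3, u4}" and ?S = "span {w, u1, u2, u3, u4}"
  define T where "T y = (\<Sum>c\<in>Basis. \<phi> w c y *\<^sub>R c)" for y
  have T: "x \<bullet> T y = \<phi> w x y" for x y unfolding T_def by (rule inner_Basis_sum[OF \<phi>_linear(2)])
  have lT: "linear T" unfolding T_def
    by (auto intro!: linearI simp: \<phi>s algebra_simps sum.distrib scaleR_sum_right)
  have w: "w \<noteq> 0" using fr by (auto simp: frame_Cons span_zero)
  have fU: "frame [u1, u2, u3, u4]" using fr by (simp add: frame_Cons)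
  have inj: "inj_on T ?U"
  proof (rule linear_injective_on_subspace_0[OF lT subspace_span, THEN iffD2], intro ballI impI)
    fix y assume y: "y \<in> ?U" "T y = 0"
    have "\<phi> w y v = 0" for v using T[of v y] y \<phi>_anti(2)[of w y v] by simp
    then have "y \<in> span {w}" using kernel[OF w] by blast
    then obtain k where k: "y = k *\<^sub>R w" by (auto simp: span_singleton)
    show "y = 0"
    proof (rule ccontr)
      assume "y \<noteq> 0"
      then have "k \<noteq> 0" using k by auto
      have "(1 / k) *\<^sub>R y \<in> ?U" using y by (intro span_scale)
      then have "w \<in> ?U" using k \<open>k \<noteq> 0\<close> by simp
      then show False using fr by (simp add: frame_Cons)
    qed
  qed
  have iso: "\<phi> w s u = 0" if "s \<in> ?S" "u \<in> ?U" for s u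
  proof -
    have 1: "\<phi> w s u = 0" if s: "s \<in> {w, u1, u2, u3, u4}" and u: "u \<in> {u1, u2, u3, u4}" for s u
      using s u assms(2-) \<phi>_anti(2)[of w u2 u1] \<phi>_anti(2)[of w u3 u1] \<phi>_anti(2)[of w u4 u1]
        \<phi>_anti(2)[of w u3 u2] \<phi>_anti(2)[of w u4 u2] \<phi>_anti(2)[of w u4 u3] by auto
    have "?U \<subseteq> {u. \<phi> w s u = 0}" if "s \<in> {w, u1, u2, u3, u4}" for s
      by (rule span_minimal) (use 1[OF that] in \<open>auto simp: subspace_def \<phi>s\<close>)
    then have 2: "\<And>s. s \<in> {w, u1, u2, u3, u4} \<Longrightarrow> \<phi> w s u = 0" using that by blast
    have "?S \<subseteq> {s. \<phi> w s u = 0}"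
      by (rule span_minimal) (use 2 in \<open>auto simp: subspace_def \<phi>s\<close>)
    then show ?thesis using that by blast
  qed
  have "T ` ?U \<subseteq> {y \<in> UNIV. \<forall>x\<in>?S. orthogonal x y}" using iso T by (auto simp: orthogonal_def)
  then have "dim (T ` ?U) \<le> dim {y \<in> UNIV. \<forall>x\<in>?S. orthogonal x y}" by (rule dim_subset)
  moreover have "dim (T ` ?U) = 4"
    using dim_image_eq[OF lT, of ?U] inj frame_dim[OF fU] by (simp add: span_span)
  moreover have "dim {y \<in> UNIV. \<forall>x\<in>?S. orthogonal x y} + dim ?S = dim (UNIV :: (real^7) set)"
    by (rule dim_subspace_orthogonal_to_vectors) auto
  moreover have "dim ?S = 5" using frame_dim[OF fr] by simp
  ultimately show False by simp
qed

text \<open>Closedness is written cyclically. With radical exactly the line of \<open>z\<close>,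
  such a form is symplectic on the quotient by \<open>z\<close>.\<close>

definition closed_form :: "(real^7 \<Rightarrow> real^7 \<Rightarrow> real) \<Rightarrow> bool" where
  "closed_form \<omega> \<longleftrightarrow> bilinear \<omega> \<and> (\<forall>x. \<omega> x x = 0) \<and>
     (\<forall>x y w. \<omega> (br x y) w + \<omega> (br y w) x + \<omega> (br w x) y = 0) \<and>
     (\<forall>x. (\<forall>y. \<omega> x y = 0) \<longleftrightarrow> x \<in> span {z})"

lemma closed_form_\<phi>: "closed_form (\<phi> z)"
proof -
  have "\<phi> z (br x y) w + \<phi> z (br y w) x + \<phi> z (br w x) y = 0" for x y w
    using closed4[of z x y w] \<phi>_anti(1)[of "br x y" z w] \<phi>_anti(1)[of "br x w" z y]
      \<phi>_anti(1)[of "br y w" z x] anti[of w x] by (simp add: \<phi>s)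
  moreover have "\<phi> z x y = 0" if "x \<in> span {z}" for x y
    using that by (auto simp: span_singleton \<phi>s)
  ultimately show ?thesis unfolding closed_form_def
    using kernel[OF z0] \<phi>_linear by (auto simp: bilinear_def)
qed

end

section \<open>The representative adapted to a Fitting decomposition\<close>

context g2
begin

lemma non_nilpotent_element:
  assumes "\<not> lie_nilpotent br"
  obtains e where "Range e \<noteq> {0}" "\<And>e'. dim (Range e') \<le> dim (Range e)"
proof -
  obtain x v where xv: "\<And>n. (br x ^^ n) v \<noteq> 0" using solvable_engel[OF sol] assms by blast
  have "\<forall>e. dim (Range e) < Suc (dim (UNIV :: (real^7) set))"
    using le_imp_less_Suc[OF dim_subset[OF subset_UNIV]] by blast
  then have "\<exists>e. \<forall>e'. dim (Range e') \<le> dim (Range e)"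
    using ex_has_greatest_nat[of "\<lambda>_. True" x "\<lambda>e. dim (Range e)"] by auto
  then obtain e where e: "\<And>e'. dim (Range e') \<le> dim (Range e)" by blast
  have "(br x ^^ 7) v \<in> Range x" by (simp add: fitting_range_def)
  then have "dim (Range x) \<noteq> 0" using xv[of 7] by auto
  then have "dim (Range e) \<noteq> 0" using e[of x] by linarith
  moreover have "dim {0 :: real^7} = 0" by simp
  ultimately have "Range e \<noteq> {0}" by metis
  then show thesis by (rule that) (rule e)
qed

text \<open>On the range, where \<open>ad e\<close> is invertible,
  \<open>\<eta> [e, w] = - \<phi> z e w\<close> can be solved; on the null space
  \<open>\<eta>\<close> is set to 0. Adding \<open>\<eta>\<close> of the bracket to
  \<open>\<phi> z\<close> yields the form, and \<open>cohomologous_nondegenerate\<close> preserves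
  its radical.\<close>

lemma adapted_form:
  obtains \<omega> where "closed_form \<omega>" "\<And>w. w \<in> Range e \<Longrightarrow> \<omega> e w = 0"
    "\<And>x y. br x y \<in> Null e \<Longrightarrow> \<omega> x y = \<phi> z x y"
proof -
  let ?f = "br e"
  have l8: "linear (?f ^^ 8)" by (rule linear_funpow[OF lin2])
  have "inj_on (?f ^^ 8) (Range e)"
  proof (rule linear_injective_on_subspace_0[OF l8 subspace_fitting(2)[OF lin2], THEN iffD2], intro ballI impI)
    fix w assume w: "w \<in> Range e" "(?f ^^ 8) w = 0"
    then have "w \<in> Null e" unfolding fitting_null_def using nilpotent_vector_bound[OF lin2] by blast
    then show "w = 0" using w fitting_Int[OF lin2] by blast
  qed
  then obtain g where g: "linear g" "\<And>w. w \<in> Range e \<Longrightarrow> g ((?f ^^ 8) w) = w"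
    using linear_exists_left_inverse_on[OF l8 subspace_fitting(2)[OF lin2]] by blast
  \<comment> \<open>The seventh power of \<open>ad e\<close> annihilates the null space, and on
    \<open>[e, w]\<close> it is the eighth power applied to \<open>w\<close>, which \<open>g\<close>
    inverts; hence the two exponents.\<close>
  define \<eta> where "\<eta> v = - \<phi> z e (g ((?f ^^ 7) v))" for v
  have \<eta>: "linear \<eta>"
  proof (rule linearI)
    show "\<eta> (a + b) = \<eta> a + \<eta> b" for a b
      by (simp only: \<eta>_def linear_add[OF linear_funpow[OF lin2]] linear_add[OF g(1)] \<phi>s minus_add_distrib)
    show "\<eta> (c *\<^sub>R a) = c *\<^sub>R \<eta> a" for c a
      by (simp only: \<eta>_def linear_cmul[OF linear_funpow[OF lin2]] linear_cmul[OF g(1)] \<phi>s scaleR_minus_right)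
  qed
  have \<eta>N: "\<eta> v = 0" if "v \<in> Null e" for v
    using that by (simp add: fitting_null_def \<eta>_def linear_0[OF g(1)])
  have \<eta>W: "\<eta> (br e w) = - \<phi> z e w" if "w \<in> Range e" for w
  proof -
    have "(?f ^^ 7) (br e w) = (?f ^^ 8) w" by (simp add: funpow_swap1 eval_nat_numeral)
    then show ?thesis using g(2)[OF that] by (simp add: \<eta>_def)
  qed
  define \<omega> where "\<omega> x y = \<phi> z x y + \<eta> (br x y)" for x y
  have cf: "bilinear (\<phi> z)" "\<And>x. \<phi> z x x = 0"
    "\<And>x y w. \<phi> z (br x y) w + \<phi> z (br y w) x + \<phi> z (br w x) y = 0"
    "\<And>x. (\<And>y. \<phi> z x y = 0) \<Longrightarrow> x \<in> span {z}" "\<And>x y. x \<in> span {z} \<Longrightarrow> \<phi> z x y = 0"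
    using closed_form_\<phi> unfolding closed_form_def by auto
  have \<eta>z: "\<eta> z = 0" by (rule \<eta>N) (rule center_Null, simp)
  have "closed_form \<omega>" unfolding closed_form_def
  proof (intro conjI allI)
    show "bilinear \<omega>"
      unfolding bilinear_def by (auto intro!: linearI simp: \<omega>_def \<phi>s brs linear_add[OF \<eta>] linear_cmul[OF \<eta>] algebra_simps)
    show "\<omega> x x = 0" for x by (simp add: \<omega>_def linear_0[OF \<eta>])
    show "\<omega> (br x y) w + \<omega> (br y w) x + \<omega> (br w x) y = 0" for x y w
    proof -
      have "br (br x y) w + br (br y w) x + br (br w x) y = 0"
        using jacobi[of x y w] anti[of "br y w" x] anti[of w x] anti[of "br w x" y] by (simp add: brs)
      then have "\<eta> (br (br x y) w) + \<eta> (br (br y w) x) + \<eta> (br (br w x) y) = 0"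
        by (simp add: linear_add[OF \<eta>, symmetric] linear_0[OF \<eta>])
      then show ?thesis using cf(3)[of x y w] by (simp add: \<omega>_def)
    qed
    show "(\<forall>y. \<omega> x y = 0) \<longleftrightarrow> x \<in> span {z}" for x
    proof
      assume "\<forall>y. \<omega> x y = 0"
      then show "x \<in> span {z}"
        by (intro cohomologous_nondegenerate[OF lie uni cf(1,2,3) z0 zc _ cf(4) \<eta> \<eta>z])
          (auto simp: \<omega>_def)
    next
      assume x: "x \<in> span {z}"
      then have "br x y = 0" for y by (auto simp: span_singleton brs)
      then show "\<forall>y. \<omega> x y = 0" using cf(5)[OF x] by (simp add: \<omega>_def linear_0[OF \<eta>])
    qed
  qed
  moreover have "\<omega> e w = 0" if "w \<in> Range e" for w using \<eta>W[OF that] by (simp add: \<omega>_def)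
  moreover have "\<omega> x y = \<phi> z x y" if "br x y \<in> Null e" for x y using \<eta>N[OF that] by (simp add: \<omega>_def)
  ultimately show thesis by (rule that)
qed

end

text \<open>Among the forms cohomologous to \<open>\<phi> z\<close>, \<open>\<omega>\<close> is one that makes the Fitting components of \<open>ad e\<close> orthogonal.\<close>

locale g2_adapted = g2 +
  fixes e :: "real^7" and \<omega> :: "real^7 \<Rightarrow> real^7 \<Rightarrow> real"
  assumes maximal: "\<And>e'. dim (Range e') \<le> dim (Range e)"
    and Range_nz: "Range e \<noteq> {0}"
    and \<omega>: "closed_form \<omega>" and \<omega>_e: "\<And>w. w \<in> Range e \<Longrightarrow> \<omega> e w = 0"
    and \<omega>_\<phi>: "\<And>x y. br x y \<in> Null e \<Longrightarrow> \<omega> x y = \<phi> z x y"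
begin

lemma \<omega>_bil: "bilinear \<omega>" and \<omega>_self [simp]: "\<omega> x x = 0"
  and \<omega>_closed: "\<omega> (br x y) w + \<omega> (br y w) x + \<omega> (br w x) y = 0"
  and \<omega>_kernel: "(\<forall>y. \<omega> x y = 0) \<longleftrightarrow> x \<in> span {z}"
  using \<omega> by (auto simp: closed_form_def)

lemmas \<omega>s = bilinear_rules[OF \<omega>_bil]

lemma \<omega>_anti: "\<omega> x y = - \<omega> y x" by (rule alternating_anti[OF \<omega>_bil \<omega>_self])

lemma \<omega>_z [simp]: "\<omega> z y = 0" "\<omega> y z = 0"
  using \<omega>_kernel[of z] \<omega>_anti[of y z] by (auto simp: span_base)

lemma sW: "subspace (Range e)" and sN: "subspace (Null e)"
  by (auto intro: subspace_fitting lin2)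

lemma zN: "z \<in> Null e" by (rule center_Null) simp

lemma NW: "v \<in> Null e \<Longrightarrow> v \<in> Range e \<Longrightarrow> v = 0"
  using fitting_Int[OF lin2] by blast

text \<open>Induction on the order of nilpotency of \<open>n\<close>. With
  \<open>w = [e, v]\<close>, closedness on \<open>e, n, v\<close> reduces
  \<open>\<omega> n w\<close> to \<open>\<omega> [e, n] v\<close>, which is 0 by induction, and to
  \<open>\<omega> [n, v] e\<close>, which is 0 by the choice of \<open>\<omega>\<close>.\<close>

lemma \<omega>_Null_Range: assumes "n \<in> Null e" "w \<in> Range e" shows "\<omega> n w = 0"
proof -
  have "\<forall>n\<in>Null e. (br e ^^ k) n = 0 \<longrightarrow> (\<forall>w\<in>Range e. \<omega> n w = 0)" for k
  proof (induction k)
    case (Suc k)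
    show ?case
    proof (intro ballI impI)
      fix n w assume n: "n \<in> Null e" "(br e ^^ Suc k) n = 0" and w: "w \<in> Range e"
      obtain v where v: "v \<in> Range e" "w = br e v" using Range_memI[OF w] by blast
      have "(br e ^^ k) (br e n) = 0" using n(2) by (simp add: funpow_swap1)
      moreover have "br e n \<in> Null e" by (rule Null_Null[OF self_Null n(1)])
      ultimately have "\<omega> (br e n) v = 0" using Suc v(1) by blast
      moreover have "\<omega> (br n v) e = 0"
        using \<omega>_e[OF Null_Range[OF n(1) v(1)]] \<omega>_anti[of "br n v" e] by simp
      ultimately have "\<omega> (br v e) n = 0" using \<omega>_closed[of e n v] by simp
      then show "\<omega> n w = 0" using v anti[of v e] \<omega>_anti[of n w] by (simp add: \<omega>s)
    qed
  qed (simp add: \<omega>s)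
  then show ?thesis using assms by (auto simp: fitting_null_def)
qed

lemma \<omega>_Range_Null: assumes "n \<in> Null e" "w \<in> Range e" shows "\<omega> w n = 0"
  using \<omega>_Null_Range[OF assms] \<omega>_anti[of w n] by simp

lemma decomp: obtains a b where "a \<in> Null e" "b \<in> Range e" "v = a + b"
  by (rule fitting_decomp[OF lin2])

lemma \<omega>_nd_Range: assumes "w \<in> Range e" "\<And>v. v \<in> Range e \<Longrightarrow> \<omega> w v = 0" shows "w = 0"
proof -
  have "\<omega> w y = 0" for y
  proof -
    obtain a b where ab: "a \<in> Null e" "b \<in> Range e" "y = a + b" by (rule decomp)
    have "\<omega> w a = 0" using \<omega>_Range_Null ab assms(1) by blast
    then show ?thesis using ab assms by (simp add: \<omega>s)
  qed
  then obtain k where "w = k *\<^sub>R z" using \<omega>_kernel[of w] by (auto simp: span_singleton)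
  then have "w \<in> Null e" using zN sN by (simp add: subspace_scale)
  then show ?thesis using assms NW by blast
qed

lemma \<omega>_nd_Null: assumes "n \<in> Null e" "\<And>v. v \<in> Null e \<Longrightarrow> \<omega> n v = 0" shows "n \<in> span {z}"
proof -
  have "\<omega> n y = 0" for y
  proof -
    obtain a b where ab: "a \<in> Null e" "b \<in> Range e" "y = a + b" by (rule decomp)
    have "\<omega> n b = 0" using \<omega>_Null_Range ab assms(1) by blast
    then show ?thesis using ab assms by (simp add: \<omega>s)
  qed
  then show ?thesis using \<omega>_kernel[of n] by auto
qed

lemma inj_e: "w \<in> Range e \<Longrightarrow> br e w = 0 \<Longrightarrow> w = 0"
proof -
  assume w: "w \<in> Range e" "br e w = 0"
  have "(br e ^^ 1) w = 0" using w by simp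
  then have "w \<in> Null e" unfolding fitting_null_def using nilpotent_vector_bound[OF lin2] by blast
  then show "w = 0" using NW w by blast
qed

lemma e_notin: "e \<notin> span {z}"
proof
  assume "e \<in> span {z}"
  then have "br e w = 0" for w by (auto simp: span_singleton brs)
  then have "Range e = {0}" using inj_e sW subspace_0 by blast
  then show False using Range_nz by simp
qed

lemma frame_ze: "frame [e, z]"
  using e_notin z0 by (simp add: frame_Cons frame_Nil)

lemma dim_sum: "dim (Null e) + dim (Range e) = 7"
  using fitting_dim[OF lin2, of e] by simp

text \<open>The range is symplectic, hence of even dimension, and the independent vectors
  \<open>e, z\<close> of the null space bound it by 5.\<close>

lemma dim_Range: "dim (Range e) = 2 \<or> dim (Range e) = 4"
proof -
  have "even (dim (Range e))" by (rule symplectic_dim_even[OF sW \<omega>_bil \<omega>_self \<omega>_nd_Range])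
  moreover have "dim (Range e) \<noteq> 0" using Range_nz subspace_0[OF sW] by auto
  moreover have "2 \<le> dim (Null e)"
    using frame_length_le[OF frame_ze _ sN] self_Null zN by simp
  moreover have "even r \<Longrightarrow> r \<noteq> 0 \<Longrightarrow> 2 \<le> s \<Longrightarrow> s + r = 7 \<Longrightarrow> r = 2 \<or> r = 4" for r s :: nat
    by presburger
  ultimately show ?thesis using dim_sum by blast
qed

lemma nil_Null: "y \<in> Null e \<Longrightarrow> v \<in> Null e \<Longrightarrow> (br y ^^ 7) v = 0"
  using maximal_Range_Null_nilpotent[of e y v] maximal by simp

text \<open>Modulo \<open>S\<close>, the n-th power of \<open>ad y\<close> multiplies
  \<open>v\<close> by \<open>k ^ n\<close>, while the seventh power annihilates
  \<open>v\<close>.\<close>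

lemma nil_eigen: assumes y: "y \<in> Null e" and v: "v \<in> Null e" and S: "subspace S" "v \<notin> S"
    "\<And>s. s \<in> S \<Longrightarrow> br y s \<in> S" and ev: "br y v - k *\<^sub>R v \<in> S"
  shows "k = 0"
proof (rule ccontr)
  assume k: "k \<noteq> 0"
  have "(br y ^^ n) v - k ^ n *\<^sub>R v \<in> S" for n
  proof (induction n)
    case (Suc n)
    have "br y ((br y ^^ n) v - k ^ n *\<^sub>R v) \<in> S" using S Suc by blast
    moreover have "k ^ n *\<^sub>R (br y v - k *\<^sub>R v) \<in> S" using S ev by (simp add: subspace_scale)
    ultimately have "br y ((br y ^^ n) v - k ^ n *\<^sub>R v) + k ^ n *\<^sub>R (br y v - k *\<^sub>R v) \<in> S"
      using S by (simp add: subspace_add)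
    moreover have "br y ((br y ^^ n) v - k ^ n *\<^sub>R v) + k ^ n *\<^sub>R (br y v - k *\<^sub>R v) = (br y ^^ Suc n) v - k ^ Suc n *\<^sub>R v"
      by (simp add: brs algebra_simps)
    ultimately show ?case by simp
  qed (use S in \<open>simp add: subspace_0\<close>)
  from this[of 7] have "- (k ^ 7 *\<^sub>R v) \<in> S" using nil_Null[OF y v] by simp
  then have "(- 1 / k ^ 7) *\<^sub>R (- (k ^ 7 *\<^sub>R v)) \<in> S" using S by (intro subspace_scale)
  then show False using k S by simp
qed

text \<open>By \<open>nil_eigen\<close> the bracket \<open>[e, x]\<close> has no
  \<open>x\<close>-coefficient and then no \<open>e\<close>-coefficient. If
  \<open>\<omega> x e\<close> were 0, \<open>x\<close> would lie in the radical of
  \<open>\<omega>\<close>.\<close>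

lemma Null3:
  assumes "dim (Range e) = 4"
  obtains x c where "x \<in> Null e" "frame [x, e, z]" "span {x, e, z} = Null e" "br x e = c *\<^sub>R z" "\<omega> x e \<noteq> 0"
    "\<omega> x e = \<phi> z x e"
proof -
  have d: "dim (Null e) = 3" using dim_sum assms by simp
  obtain x where x: "x \<in> Null e" "frame [x, e, z]"
    by (rule frame_extend[OF frame_ze _ sN]) (use self_Null zN d in auto)
  have "span (set [x, e, z]) = Null e"
    by (rule frame_spans[OF x(2) _ sN]) (use x self_Null zN d in auto)
  then have sp: "span {x, e, z} = Null e" by simp
  have ez: "y \<in> span {e, z} \<longleftrightarrow> (\<exists>s t. y = s *\<^sub>R e + t *\<^sub>R z)" for y
    by (auto simp: span_insert algebra_simps)
  have "br e x \<in> Null e" using Null_Null[OF self_Null x(1)] .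
  then have "br e x \<in> span {x, e, z}" by (simp add: sp)
  then obtain k where k: "br e x - k *\<^sub>R x \<in> span {e, z}" by (auto simp: span_insert[of x])
  have "k = 0"
  proof (rule nil_eigen[OF self_Null x(1) subspace_span _ _ k])
    show "x \<notin> span {e, z}" using x(2) by (simp add: frame_Cons)
    show "br e s \<in> span {e, z}" if "s \<in> span {e, z}" for s
      using that by (auto simp: ez brs intro!: exI[of _ 0])
  qed
  then obtain s t where st: "br e x = s *\<^sub>R e + t *\<^sub>R z" using k ez by auto
  have xe: "br x e = (- s) *\<^sub>R e + (- t) *\<^sub>R z" using anti[of x e] st by simp
  have "- s = 0"
  proof (rule nil_eigen[OF x(1) self_Null subspace_span[of "{z}"]])
    show "e \<notin> span {z}" by (rule e_notin)
    show "br x y \<in> span {z}" if "y \<in> span {z}" for y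
      using that by (auto simp: span_singleton brs intro!: exI[of _ 0])
    show "br x e - (- s) *\<^sub>R e \<in> span {z}" using xe by (simp add: span_neg span_base span_scale)
  qed
  then have c: "br x e = (- t) *\<^sub>R z" using xe by simp
  have "\<omega> x e \<noteq> 0"
  proof
    assume 0: "\<omega> x e = 0"
    have "\<omega> x v = 0" if "v \<in> Null e" for v
    proof -
      have "span {x, e, z} \<subseteq> {v. \<omega> x v = 0}"
        by (rule span_minimal) (use 0 in \<open>auto simp: subspace_def \<omega>s\<close>)
      then show ?thesis using that sp by auto
    qed
    then have "x \<in> span {z}" by (rule \<omega>_nd_Null[OF x(1)])
    moreover have "span {z} \<subseteq> span {e, z}" by (intro span_mono) auto
    ultimately have "x \<in> span {e, z}" by blast
    then show False using x(2) by (simp add: frame_Cons)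
  qed
  moreover have "\<omega> x e = \<phi> z x e"
    by (rule \<omega>_\<phi>) (use zN sN in \<open>simp add: c subspace_scale subspace_neg\<close>)
  ultimately show thesis using that[OF x sp c] by blast
qed

end

section \<open>Exclusion of a two-dimensional Fitting range\<close>

context g2_adapted
begin

lemma span_cancel:
  assumes "a \<in> span S" "b \<in> span S" "a - v - c *\<^sub>R b \<in> span S"
  shows "v \<in> span S"
proof -
  have "a - c *\<^sub>R b - (a - v - c *\<^sub>R b) \<in> span S" 
    by (rule span_diff[OF span_diff[OF assms(1) span_scale[OF assms(2)]] assms(3)])
  then show ?thesis by simp
qed

lemma br_br: "br (br x y) v = br x (br y v) - br y (br x v)"
  using jacobi[of x y v] by simp

text \<open>Work modulo forms \<open>L([., .])\<close> on \<open>m\<close>, and let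
  \<open>\<delta>\<close> be the action of \<open>ad e\<close> on 2-forms. Closedness reads
  \<open>\<phi> [e, w] = - \<delta> (\<phi> w)\<close>; used twice it gives
  \<open>r \<phi> w = \<delta> (\<delta> (\<phi> w))\<close>. Since \<open>\<delta>\<close> is
  nilpotent and \<open>r\<close> is not 0, iteration makes \<open>\<phi> w\<close> itself
  trivial.\<close>

lemma two_form_in_bracket_image:
  assumes m: "\<And>y. y \<in> m \<Longrightarrow> br e y \<in> m" "m \<subseteq> Null e" and r: "r \<noteq> 0"
    and mW: "\<And>y w. y \<in> m \<Longrightarrow> w \<in> Range e \<Longrightarrow> br y w = 0"
    and D: "\<And>w. w \<in> Range e \<Longrightarrow> br e (br e w) = r *\<^sub>R w"
    and w: "w \<in> Range e"
  shows "\<exists>L. linear L \<and> (\<forall>x\<in>m. \<forall>y\<in>m. \<phi> w x y = (L (br x y) :: real))"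
proof -
  define R where "R f \<longleftrightarrow> (\<exists>L. linear L \<and> (\<forall>x\<in>m. \<forall>y\<in>m. f x y = (L (br x y) :: real)))" for f
  define \<delta> where "\<delta> f x y = f (br e x) y + (f x (br e y) :: real)" for f x y
  have R_add: "R (\<lambda>x y. f x y + c * g x y)" if fg: "R f" "R g" for f g c
  proof -
    obtain L K where "linear L" "\<forall>x\<in>m. \<forall>y\<in>m. f x y = L (br x y)" "linear K" "\<forall>x\<in>m. \<forall>y\<in>m. g x y = K (br x y)"
      using fg unfolding R_def by blast
    then show ?thesis unfolding R_def
      by (intro exI[of _ "\<lambda>x. L x + c * K x"]) (auto intro!: linearI simp: linear_add linear_cmul algebra_simps)
  qed
  have R_\<delta>: "R (\<delta> f)" if f: "R f" for f
  proof -
    obtain L where L: "linear L" "\<forall>x\<in>m. \<forall>y\<in>m. f x y = L (br x y)" using f unfolding R_def by blast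
    have "linear (\<lambda>x. L (br e x))" using linear_compose[OF lin2 L(1)] by (simp add: o_def)
    moreover have "\<forall>x\<in>m. \<forall>y\<in>m. \<delta> f x y = L (br e (br x y))"
      using L m by (simp add: \<delta>_def jacobi[of e] linear_add)
    ultimately show ?thesis unfolding R_def by blast
  qed
  have step1: "R (\<lambda>x y. \<phi> (br e w) x y + \<delta> (\<phi> w) x y)" if w: "w \<in> Range e" for w
  proof -
    have "\<phi> (br e w) x y + \<delta> (\<phi> w) x y = - \<phi> (br x y) e w" if xy: "x \<in> m" "y \<in> m" for x y
    proof -
      have "br w x = 0" "br w y = 0" using mW[OF xy(1) w] mW[OF xy(2) w] anti[of w x] anti[of w y] by auto
      then show ?thesis
        using closed4[of e w x y] \<phi>_anti(1)[of "br e x" w y] \<phi>_cyc[of "br e y" w x]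
        by (simp add: \<delta>_def)
    qed
    then show ?thesis unfolding R_def
      by (intro exI[of _ "\<lambda>v. - \<phi> v e w"]) (auto intro!: linearI simp: \<phi>s)
  qed
  have step2: "R (\<lambda>x y. r * \<phi> w x y - \<delta> (\<delta> (\<phi> w)) x y)"
  proof -
    have ew: "br e w \<in> Range e" using fitting_invariant(2)[OF lin2 w] .
    have "R (\<lambda>x y. (\<phi> (br e (br e w)) x y + \<delta> (\<phi> (br e w)) x y)
        + (- 1) * \<delta> (\<lambda>x y. \<phi> (br e w) x y + \<delta> (\<phi> w) x y) x y)"
      by (rule R_add[OF step1[OF ew] R_\<delta>[OF step1[OF w]]])
    then show ?thesis by (simp add: D[OF w] \<phi>s \<delta>_def algebra_simps)
  qed
  have \<delta>d: "\<delta> (\<lambda>x y. a * f x y - b * g x y) = (\<lambda>x y. a * \<delta> f x y - b * \<delta> g x y)" for f g a b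
    by (simp add: fun_eq_iff \<delta>_def algebra_simps)
  have comm: "\<delta> ((\<delta> ^^ n) f) = (\<delta> ^^ n) (\<delta> f)" for n f by (simp add: funpow_swap1)
  have step3: "R (\<lambda>x y. r ^ k * \<phi> w x y - (\<delta> ^^ (2 * k)) (\<phi> w) x y)" for k
  proof (induction k)
    case 0
    have "R (\<lambda>x y. 0)" unfolding R_def by (intro exI[of _ "\<lambda>_. 0"]) (auto intro: linear_zero)
    then show ?case by simp
  next
    case (Suc k)
    have 1: "R (\<delta> (\<delta> (\<lambda>x y. r ^ k * \<phi> w x y - 1 * (\<delta> ^^ (2 * k)) (\<phi> w) x y)))"
      using R_\<delta>[OF R_\<delta>[OF Suc]] by simp
    have "(\<lambda>x y. \<delta> (\<delta> (\<lambda>x y. r ^ k * \<phi> w x y - 1 * (\<delta> ^^ (2 * k)) (\<phi> w) x y)) x y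
        + r ^ k * (r * \<phi> w x y - \<delta> (\<delta> (\<phi> w)) x y))
      = (\<lambda>x y. r ^ Suc k * \<phi> w x y - (\<delta> ^^ (2 * Suc k)) (\<phi> w) x y)"
      unfolding \<delta>d by (simp add: fun_eq_iff algebra_simps)
    then show ?case using R_add[OF 1 step2, of "r ^ k"] by simp
  qed
  have z0: "(\<delta> ^^ n) (\<phi> w) 0 y = 0" "(\<delta> ^^ n) (\<phi> w) y 0 = 0" for n y
    by (induction n arbitrary: y) (auto simp: \<delta>_def)
  have vanish: "\<forall>i j x y. i + j \<le> n \<longrightarrow> (br e ^^ i) x = 0 \<longrightarrow> (br e ^^ j) y = 0 \<longrightarrow> (\<delta> ^^ n) (\<phi> w) x y = 0" for n
  proof (induction n)
    case (Suc n)
    show ?case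
    proof (intro allI impI)
      fix i j x y assume h: "i + j \<le> Suc n" "(br e ^^ i) x = 0" "(br e ^^ j) y = 0"
      show "(\<delta> ^^ Suc n) (\<phi> w) x y = 0"
      proof (cases "i = 0 \<or> j = 0")
        case True
        then show ?thesis using h z0[of "Suc n"] by (auto simp del: funpow.simps simp: funpow_0)
      next
        case False
        then obtain i' j' where ij: "i = Suc i'" "j = Suc j'" by (metis not0_implies_Suc)
        have "(br e ^^ i') (br e x) = 0" "(br e ^^ j') (br e y) = 0"
          using h ij by (simp_all add: funpow_swap1)
        then have "(\<delta> ^^ n) (\<phi> w) (br e x) y = 0" "(\<delta> ^^ n) (\<phi> w) x (br e y) = 0"
          using Suc h ij by (metis add_Suc not_less_eq_eq, metis add_Suc_right not_less_eq_eq)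
        then show ?thesis by (simp add: \<delta>_def)
      qed
    qed
  qed simp
  \<comment> \<open>Each of the two arguments is annihilated by the seventh power of
    \<open>ad e\<close>, so the power 14 = 7 + 7 of \<open>\<delta>\<close> is 0.\<close>
  have "R (\<lambda>x y. r ^ 7 * \<phi> w x y)"
  proof -
    obtain L where L: "linear L" "\<And>x y. x \<in> m \<Longrightarrow> y \<in> m \<Longrightarrow> r ^ 7 * \<phi> w x y - (\<delta> ^^ 14) (\<phi> w) x y = L (br x y)"
      using step3[of 7] unfolding R_def by auto
    have "(\<delta> ^^ 14) (\<phi> w) x y = 0" if "x \<in> m" "y \<in> m" for x y
      using vanish[of 14, rule_format, of 7 7 x y] that m(2) by (auto simp: fitting_null_def)
    then show ?thesis unfolding R_def using L by (intro exI[of _ L]) auto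
  qed
  then obtain L where L: "linear L" "\<And>x y. x \<in> m \<Longrightarrow> y \<in> m \<Longrightarrow> r ^ 7 * \<phi> w x y = L (br x y)"
    unfolding R_def by blast
  have "\<phi> w x y = L (br x y) / r ^ 7" if "x \<in> m" "y \<in> m" for x y
    using L(2)[OF that] r by (simp add: field_simps)
  moreover have "linear (\<lambda>v. L v / r ^ 7)"
    using L(1) by (auto intro!: linearI simp: linear_add linear_cmul add_divide_distrib)
  ultimately show ?thesis by blast
qed

text \<open>For skew \<open>Y\<close> the form \<open>\<omega> w (Y v)\<close> is symmetric. If it
  vanished on the diagonal, polarization and nondegeneracy would give \<open>Y = 0\<close> on
  \<open>C\<close>.\<close>

lemma skew_vector:
  assumes C: "subspace C" and Y: "linear Y" "\<And>w. w \<in> C \<Longrightarrow> Y w \<in> C" "\<exists>w\<in>C. Y w \<noteq> 0"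
    and sk: "\<And>u v. u \<in> C \<Longrightarrow> v \<in> C \<Longrightarrow> \<omega> (Y u) v = - \<omega> u (Y v)"
    and nd: "\<And>w. w \<in> C \<Longrightarrow> (\<And>v. v \<in> C \<Longrightarrow> \<omega> w v = 0) \<Longrightarrow> w = 0"
  shows "\<exists>w\<in>C. \<omega> w (Y w) \<noteq> 0"
proof (rule ccontr)
  assume "\<not> ?thesis"
  then have d: "\<omega> w (Y w) = 0" if "w \<in> C" for w using that by blast
  obtain w where w: "w \<in> C" "Y w \<noteq> 0" using Y by blast
  have "\<omega> (Y w) v = 0" if v: "v \<in> C" for v
  proof -
    have "\<omega> (w + v) (Y (w + v)) = 0" using d subspace_add[OF C w(1) v] by blast
    then have "\<omega> w (Y v) + \<omega> v (Y w) = 0" using d[OF w(1)] d[OF v] by (simp add: linear_add[OF Y(1)] \<omega>s)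
    then show ?thesis using sk[OF w(1) v] \<omega>_anti[of v "Y w"] by auto
  qed
  then show False using nd Y(2) w by blast
qed

lemma frame_pair:
  assumes "\<omega> a b \<noteq> 0" shows "frame [a, b]"
  unfolding frame_explicit
proof (intro allI impI)
  fix s t assume st: "s *\<^sub>R a + t *\<^sub>R b = 0"
  have "\<omega> (s *\<^sub>R a + t *\<^sub>R b) b = s * \<omega> a b" "\<omega> (s *\<^sub>R a + t *\<^sub>R b) a = - t * \<omega> a b"
    using \<omega>_anti[of b a] by (simp_all add: \<omega>s)
  then show "s = 0 \<and> t = 0" unfolding st using assms by (simp add: \<omega>s)
qed

lemma frame_orthogonal_planes:
  assumes "\<omega> u u' \<noteq> 0" "\<omega> v v' \<noteq> 0" "\<omega> u v = 0" "\<omega> u v' = 0" "\<omega> u' v = 0" "\<omega> u' v' = 0"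
  shows "frame [u, u', v, v']"
  unfolding frame_explicit
proof (intro allI impI)
  fix a1 a2 a3 a4 assume h: "a1 *\<^sub>R u + a2 *\<^sub>R u' + a3 *\<^sub>R v + a4 *\<^sub>R v' = 0"
  let ?w = "a1 *\<^sub>R u + a2 *\<^sub>R u' + a3 *\<^sub>R v + a4 *\<^sub>R v'"
  have "\<omega> ?w u = - a2 * \<omega> u u'" "\<omega> ?w u' = a1 * \<omega> u u'" "\<omega> ?w v = - a4 * \<omega> v v'" "\<omega> ?w v' = a3 * \<omega> v v'"
    using assms \<omega>_anti[of v u] \<omega>_anti[of v u'] \<omega>_anti[of v' u] \<omega>_anti[of v' u'] \<omega>_anti[of u' u] \<omega>_anti[of v' v]
    by (simp_all add: \<omega>s)
  then show "a1 = 0 \<and> a2 = 0 \<and> a3 = 0 \<and> a4 = 0" unfolding h using assms by (auto simp: \<omega>s)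
qed

text \<open>\<open>ad e\<close> multiplies \<open>[a, b]\<close> by its own trace on
  \<open>W\<close>. That trace is 0, by \<open>nil_eigen\<close> if \<open>[a, b]\<close> has a null
  component and by closedness otherwise. A traceless 2 x 2 matrix squares to a scalar, and
  \<open>skew_vector\<close> supplies a cyclic vector \<open>u\<close>.\<close>

lemma Range2_normal:
  assumes d: "dim (Range e) = 2"
  obtains u v r where "span {u, v} = Range e" "frame [u, v]" "br e u = v" "br e v = r *\<^sub>R u" "r \<noteq> 0"
    "\<omega> u v \<noteq> 0" "br u v \<in> Null e" "br e (br u v) = 0"
proof -
  obtain a b W' where ab: "a \<in> Range e" "b \<in> Range e" "\<omega> a b = 1"
    by (rule symplectic_split[OF sW Range_nz \<omega>_bil \<omega>_self \<omega>_nd_Range])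
  have ba: "\<omega> b a = -1" using \<omega>_anti[of b a] ab by simp
  have fr: "frame [a, b]" by (rule frame_pair) (simp add: ab)
  have "span (set [a, b]) = Range e" by (rule frame_spans[OF fr _ sW]) (use ab d in auto)
  then have W: "Range e = {s *\<^sub>R a + t *\<^sub>R b | s t. True}" by (auto simp: span_insert algebra_simps)
  have inv: "br e w \<in> Range e" if "w \<in> Range e" for w using fitting_invariant(2)[OF lin2 that] .
  obtain \<alpha> \<beta> where ea: "br e a = \<alpha> *\<^sub>R a + \<beta> *\<^sub>R b" using inv[OF ab(1)] unfolding W by auto
  obtain \<gamma> \<delta> where eb: "br e b = \<gamma> *\<^sub>R a + \<delta> *\<^sub>R b" using inv[OF ab(2)] unfolding W by auto
  obtain n w where nw: "n \<in> Null e" "w \<in> Range e" "br a b = n + w" by (rule decomp)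
  have be: "br b a = - br a b" by (rule anti)
  have eab: "br e (br a b) = (\<alpha> + \<delta>) *\<^sub>R br a b"
    by (simp add: jacobi[of e a b] ea eb brs be algebra_simps)
  then have "br e n - (\<alpha> + \<delta>) *\<^sub>R n = (\<alpha> + \<delta>) *\<^sub>R w - br e w" by (simp add: nw brs algebra_simps)
  moreover have "br e n - (\<alpha> + \<delta>) *\<^sub>R n \<in> Null e"
    using nw(1) sN Null_Null[OF self_Null] by (intro subspace_diff subspace_scale) auto
  moreover have "(\<alpha> + \<delta>) *\<^sub>R w - br e w \<in> Range e"
    using nw(2) sW inv by (intro subspace_diff subspace_scale) auto
  ultimately have n0: "br e n - (\<alpha> + \<delta>) *\<^sub>R n = 0" and "(\<alpha> + \<delta>) *\<^sub>R w - br e w = 0"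
    using NW by metis+
  then have w0: "br e w = (\<alpha> + \<delta>) *\<^sub>R w" by simp
  have "\<omega> (br e a) b + \<omega> (br a b) e + \<omega> (br b e) a = 0" by (rule \<omega>_closed)
  moreover have "\<omega> (br a b) e = \<omega> n e" using \<omega>_Range_Null[OF self_Null nw(2)] by (simp add: nw \<omega>s)
  ultimately have tr: "\<alpha> + \<delta> + \<omega> n e = 0"
    using anti[of b e] by (simp add: ea eb \<omega>s ab ba)
  have T: "\<alpha> + \<delta> = 0"
  proof (cases "n = 0")
    case True
    then show ?thesis using tr by (simp add: \<omega>s)
  next
    case False
    show ?thesis
      by (rule nil_eigen[OF self_Null nw(1) subspace_single_0]) (use False n0 in auto)
  qed
  have "w = 0" using w0 T inj_e[OF nw(2)] by simp
  then have abN: "br a b \<in> Null e" "br e (br a b) = 0" using nw eab T by auto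
  define r where "r = \<alpha>\<^sup>2 + \<beta> * \<gamma>"
  have \<delta>: "\<delta> = - \<alpha>" using T by simp
  have e2: "br e (br e a) = r *\<^sub>R a" "br e (br e b) = r *\<^sub>R b"
    by (simp_all add: ea eb brs \<delta> r_def algebra_simps power2_eq_square)
  have r0: "r \<noteq> 0"
  proof
    assume "r = 0"
    then have "br e (br e a) = 0" using e2 by simp
    then have "a = 0" using inj_e ab inv by blast
    then show False using ab by (simp add: \<omega>s)
  qed
  have Wst: "\<exists>s t. w = s *\<^sub>R a + t *\<^sub>R b" if "w \<in> Range e" for w using that W by blast
  have "\<exists>u\<in>Range e. \<omega> u (br e u) \<noteq> 0"
  proof (rule skew_vector[OF sW lin2 inv])
    show "\<exists>w\<in>Range e. br e w \<noteq> 0" using inj_e[OF ab(1)] ab by (intro bexI[of _ a]) (auto simp: \<omega>s)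
    show "\<omega> (br e x) y = - \<omega> x (br e y)" if xy: "x \<in> Range e" "y \<in> Range e" for x y
    proof -
      obtain s t s' t' where "x = s *\<^sub>R a + t *\<^sub>R b" "y = s' *\<^sub>R a + t' *\<^sub>R b" using Wst[OF xy(1)] Wst[OF xy(2)] by blast
      then show ?thesis by (simp add: brs ea eb \<delta> \<omega>s ab ba algebra_simps)
    qed
  qed (use \<omega>_nd_Range in auto)
  then obtain u where u: "u \<in> Range e" "\<omega> u (br e u) \<noteq> 0" by blast
  define v where "v = br e u"
  have sp: "span (set [u, v]) = Range e"
    by (rule frame_spans[OF _ _ sW]) (use u inv d in \<open>auto simp: v_def intro!: frame_pair\<close>)
  obtain s t where st: "u = s *\<^sub>R a + t *\<^sub>R b" using u W by auto
  have v: "br e v = r *\<^sub>R u" by (simp add: v_def st brs e2 algebra_simps)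
  have v2: "v = (s * \<alpha> + t * \<gamma>) *\<^sub>R a + (s * \<beta> - t * \<alpha>) *\<^sub>R b"
    by (simp add: v_def st brs ea eb \<delta> algebra_simps)
  define k where "k = s * (s * \<beta> - t * \<alpha>) - t * (s * \<alpha> + t * \<gamma>)"
  have uv: "br u v = k *\<^sub>R br a b"
    by (simp add: v2) (simp add: st brs be k_def vec_eq_iff algebra_simps)
  have "br u v \<in> Null e" "br e (br u v) = 0"
    using abN sN by (auto simp: uv brs subspace_scale)
  moreover have "frame [u, v]" "br e u = v" "span {u, v} = Range e" "\<omega> u v \<noteq> 0" using u sp by (simp_all add: v_def frame_pair)
  ultimately show thesis using that[of u v r] v r0 by blast
qed

text \<open>Modulo \<open>p\<close> and \<open>z\<close> the iterates of \<open>ad p\<close> on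
  \<open>q\<close> obey a recursion of order two, whose coefficients must be 0 by nilpotency. A
  surviving \<open>p\<close>-coefficient would be, up to sign, an eigenvalue of
  \<open>ad [p, q]\<close>.\<close>

lemma second_center:
  assumes m: "subspace m" "m \<subseteq> Null e" and p: "p \<in> m" "q \<in> m" and fr: "frame [p, q, br p q, z]"
    and sp: "span {p, q, br p q, z} = m" and cl: "br p (br p q) \<in> m"
  shows "br p (br p q) \<in> span {z}"
proof -
  let ?f = "br p" and ?S = "span {p, z}"
  define d where "d = br p q"
  have S: "y \<in> ?S \<longleftrightarrow> (\<exists>s t. y = s *\<^sub>R p + t *\<^sub>R z)" for y by (auto simp: span_insert algebra_simps)
  have fS: "?f y \<in> ?S" if "y \<in> ?S" for y using that by (auto simp: S brs intro!: exI[of _ 0])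
  have pN: "p \<in> Null e" "q \<in> Null e" "d \<in> Null e" using p m sp by (auto simp: d_def span_base)
  have "br p d \<in> span {p, q, d, z}" using cl sp by (simp add: d_def)
  then obtain \<alpha> \<beta> \<gamma> \<delta> where pd: "br p d = \<alpha> *\<^sub>R p + \<beta> *\<^sub>R q + \<gamma> *\<^sub>R d + \<delta> *\<^sub>R z"
    by (auto simp: span_insert span_singleton algebra_simps)
  have fd: "frame [p, q, d, z]" using fr by (simp add: d_def)
  have qS: "q \<notin> ?S" "d \<notin> ?S"
  proof -
    have "frame [d, p, z]" "frame [q, p, z]"
      by (rule frame_subset[OF fd]; use fd in \<open>auto simp: frame_def\<close>)+
    then show "q \<notin> ?S" "d \<notin> ?S" by (auto simp: frame_Cons)
  qed
  have rel: "(?f ^^ (n + 2)) q - \<beta> *\<^sub>R (?f ^^ n) q - \<gamma> *\<^sub>R (?f ^^ (n + 1)) q \<in> ?S" for n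
  proof (induction n)
    case 0
    have "br p d - \<beta> *\<^sub>R q - \<gamma> *\<^sub>R d = \<alpha> *\<^sub>R p + \<delta> *\<^sub>R z" by (simp add: pd)
    then show ?case unfolding S by (auto simp: d_def eval_nat_numeral)
  next
    case (Suc n)
    have "?f ((?f ^^ (n + 2)) q - \<beta> *\<^sub>R (?f ^^ n) q - \<gamma> *\<^sub>R (?f ^^ (n + 1)) q) \<in> ?S" by (rule fS[OF Suc])
    then show ?case by (simp add: brs)
  qed
  have "\<beta> = 0"
  proof (rule ccontr)
    assume b: "\<beta> \<noteq> 0"
    define k where "k = (LEAST n. (?f ^^ n) q \<in> ?S)"
    have "(?f ^^ 7) q \<in> ?S" using nil_Null[OF pN(1,2)] by (simp add: span_zero)
    then have k: "(?f ^^ k) q \<in> ?S" unfolding k_def by (rule LeastI)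
    have "k \<noteq> 0" using k qS(1) by (metis funpow_0)
    then obtain j where j: "k = Suc j" using not0_implies_Suc by blast
    have k2: "(?f ^^ (k + 1)) q \<in> ?S" using fS[OF k] by simp
    have "\<beta> *\<^sub>R (?f ^^ j) q \<in> ?S"
      by (rule span_cancel[OF _ _ rel[of j]]) (use k k2 j in auto)
    then have "(1 / \<beta>) *\<^sub>R \<beta> *\<^sub>R (?f ^^ j) q \<in> ?S" by (rule span_scale)
    then have "(?f ^^ j) q \<in> ?S" using b by simp
    then show False using not_less_Least[of j "\<lambda>n. (?f ^^ n) q \<in> ?S"] j unfolding k_def by simp
  qed
  moreover from this have "\<gamma> = 0"
  proof -
    have "br p d - \<gamma> *\<^sub>R d = \<alpha> *\<^sub>R p + \<delta> *\<^sub>R z" using \<open>\<beta> = 0\<close> by (simp add: pd)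
    then have "br p d - \<gamma> *\<^sub>R d \<in> ?S" unfolding S by blast
    then show ?thesis using nil_eigen[OF pN(1) pN(3) subspace_span qS(2) fS] by blast
  qed
  ultimately have pd': "br p d = \<alpha> *\<^sub>R p + \<delta> *\<^sub>R z" by (simp add: pd)
  have "- \<alpha> = 0"
  proof (rule nil_eigen[OF pN(3) pN(1) subspace_span[of "{z}"]])
    have "frame [p, z]" by (rule frame_subset[OF fd]) (use fd in \<open>auto simp: frame_def\<close>)
    then show "p \<notin> span {z}" by (simp add: frame_Cons)
    show "br d y \<in> span {z}" if "y \<in> span {z}" for y
      using that by (auto simp: span_singleton brs intro!: exI[of _ 0])
    have "br d p - (- \<alpha>) *\<^sub>R p = (- \<delta>) *\<^sub>R z" using anti[of d p] pd' by simp
    then show "br d p - (- \<alpha>) *\<^sub>R p \<in> span {z}" by (metis span_base singletonI span_scale)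
  qed
  then show ?thesis using pd' by (auto simp: d_def span_singleton)
qed

text \<open>The null space acts on the plane \<open>W\<close> by multiples of \<open>ad e\<close>.
  The kernel \<open>m\<close> of this action has dimension 4, and by
  \<open>two_form_in_bracket_image\<close> the forms \<open>\<phi> w\<close> on it are determined by
  its few brackets; some \<open>w + t z\<close> then has \<open>m\<close> as an isotropic
  4-plane.\<close>

lemma Range2_False:
  assumes d: "dim (Range e) = 2"
  shows False
proof -
  obtain u v r where uv: "span {u, v} = Range e" "frame [u, v]" "br e u = v" "br e v = r *\<^sub>R u" "r \<noteq> 0"
    "\<omega> u v \<noteq> 0" "br u v \<in> Null e" "br e (br u v) = 0" by (rule Range2_normal[OF d])
  have uW: "u \<in> Range e" "v \<in> Range e" unfolding uv(1)[symmetric] by (rule span_base, simp)+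
  have W: "w \<in> Range e \<longleftrightarrow> (\<exists>s t. w = s *\<^sub>R u + t *\<^sub>R v)" for w
    unfolding uv(1)[symmetric] by (auto simp: span_insert algebra_simps)
  have D2: "br e (br e w) = r *\<^sub>R w" if "w \<in> Range e" for w
    using that unfolding W by (auto simp: brs uv algebra_simps)
  have NWc: "br y w \<in> Range e" if "y \<in> Null e" "w \<in> Range e" for y w using Null_Range[OF that] .
  \<comment> \<open>If \<open>D^2 = r\<close>, the commutator with \<open>D\<close> satisfies
    \<open>K^3 = 4 r K\<close> on operators of \<open>W\<close>. Since the iterates of
    \<open>ad e\<close> on \<open>y\<close> reach 0 while \<open>r\<close> is not 0, already
    \<open>[e, y]\<close> acts by 0.\<close>
  have comm: "br (br e y) w = 0" if y: "y \<in> Null e" and w: "w \<in> Range e" for y w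
  proof -
    let ?a = "\<lambda>k. (br e ^^ k) y"
    have aN: "?a k \<in> Null e" for k by (induction k) (use y Null_Null[OF self_Null] in auto)
    have rec: "br (?a (k + 3)) w = (4 * r) *\<^sub>R br (?a (k + 1)) w" if w: "w \<in> Range e" for k w
    proof -
      define x where "x = ?a k"
      have x: "x \<in> Null e" by (simp add: x_def aN)
      have ew: "br e w \<in> Range e" using NWc[OF self_Null w] .
      have "br (br e (br e (br e x))) w = (4 * r) *\<^sub>R br (br e x) w"
        using D2[OF w] D2[OF ew] D2[OF NWc[OF x w]] D2[OF NWc[OF x ew]] 
        by (simp add: br_br brs algebra_simps scaleR_2[symmetric])
      then show ?thesis by (simp add: x_def eval_nat_numeral)
    qed
    have "br (?a 7) w = (4 * r) *\<^sub>R (4 * r) *\<^sub>R (4 * r) *\<^sub>R br (?a 1) w"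
      using rec[OF w, of 4] rec[OF w, of 2] rec[OF w, of 0] by simp
    moreover have "?a 7 = 0" using y by (simp add: fitting_null_def)
    ultimately show ?thesis using uv(5) by simp
  qed
  \<comment> \<open>An operator of the plane commuting with \<open>D\<close> is
    \<open>p + q D\<close>, and \<open>2 p\<close> is its trace, which vanishes for the same reasons
    as the trace of \<open>ad e\<close>.\<close>
  have "\<exists>q. \<forall>w\<in>Range e. br y w = q *\<^sub>R br e w" if y: "y \<in> Null e" for y
  proof -
    obtain p q where yu: "br y u = p *\<^sub>R u + q *\<^sub>R v" using NWc[OF y uW(1)] W by auto
    have yv: "br y v = p *\<^sub>R v + (q * r) *\<^sub>R u"
    proof -
      have "br y (br e u) = br e (br y u)" using comm[OF y uW(1)] by (simp add: br_br)
      then show ?thesis by (simp add: yu uv brs)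
    qed
    have "\<omega> (br y u) v + \<omega> (br u v) y + \<omega> (br v y) u = 0" by (rule \<omega>_closed)
    then have 1: "2 * p * \<omega> u v + \<omega> (br u v) y = 0"
      using anti[of v y] \<omega>_anti[of v u] by (simp add: yu yv \<omega>s)
    have 2: "br y (br u v) = (2 * p) *\<^sub>R br u v"
      using anti[of v u] by (simp add: jacobi[of y u v] yu yv brs scaleR_2[symmetric])
    have "2 * p = 0"
    proof (cases "br u v = 0")
      case True
      then show ?thesis using 1 uv by (simp add: \<omega>s)
    next
      case False
      show ?thesis by (rule nil_eigen[OF y uv(7) subspace_single_0]) (use False 2 in auto)
    qed
    then have "br y w = q *\<^sub>R br e w" if "w \<in> Range e" for w
      using that unfolding W by (auto simp: brs yu yv uv algebra_simps)
    then show ?thesis by blast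
  qed
  then obtain \<xi> where \<xi>: "\<And>y w. y \<in> Null e \<Longrightarrow> w \<in> Range e \<Longrightarrow> br y w = \<xi> y *\<^sub>R br e w" by metis
  define m where "m = {y \<in> Null e. \<forall>w\<in>Range e. br y w = 0}"
  have sm: "subspace m" using sN unfolding m_def subspace_def by (auto simp: brs)
  have mN: "m \<subseteq> Null e" by (auto simp: m_def)
  have mW: "br y w = 0" "br w y = 0" if "y \<in> m" "w \<in> Range e" for y w
    using that anti[of w y] by (auto simp: m_def)
  have mm: "br y y' \<in> m" if "y \<in> Null e" "y' \<in> Null e" for y y'
  proof -
    have "br (br y y') w = 0" if w: "w \<in> Range e" for w
      using \<xi>[OF \<open>y \<in> Null e\<close>] \<xi>[OF \<open>y' \<in> Null e\<close>] w NWc[OF self_Null w]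
      by (simp add: br_br brs)
    then show ?thesis using Null_Null[OF that] by (simp add: m_def)
  qed
  have em: "br e y \<in> m" if "y \<in> m" for y using mm[OF self_Null] that mN by blast
  have v0: "v \<noteq> 0" "u \<noteq> 0" using uv(2) by (auto simp: frame_Cons span_zero)
  have dN: "dim (Null e) = 5" using dim_sum d by simp
  have e_m: "e \<notin> m" using uW uv v0 by (auto simp: m_def)
  have "Null e = {a + b | a b. a \<in> span {e} \<and> b \<in> m}"
  proof
    show "Null e \<subseteq> {a + b | a b. a \<in> span {e} \<and> b \<in> m}"
    proof
      fix y assume y: "y \<in> Null e"
      have "y - \<xi> y *\<^sub>R e \<in> m" using y \<xi>[OF y] sN self_Null
        by (auto simp: m_def brs intro!: subspace_diff subspace_scale)
      moreover have "y = \<xi> y *\<^sub>R e + (y - \<xi> y *\<^sub>R e)" by simp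
      moreover have "\<xi> y *\<^sub>R e \<in> span {e}" by (simp add: span_base span_scale)
      ultimately show "y \<in> {a + b | a b. a \<in> span {e} \<and> b \<in> m}" by blast
    qed
    show "{a + b | a b. a \<in> span {e} \<and> b \<in> m} \<subseteq> Null e"
      using mN sN self_Null by (auto simp: span_singleton intro!: subspace_add subspace_scale)
  qed
  moreover have "span {e} \<inter> m = {0}"
  proof -
    have "y = 0" if y: "y \<in> span {e}" "y \<in> m" for y
    proof -
      obtain k where k: "y = k *\<^sub>R e" using y by (auto simp: span_singleton)
      then have "k *\<^sub>R v = 0" using mW(1)[OF y(2) uW(1)] by (simp add: brs uv)
      then show ?thesis using v0 k by simp
    qed
    then show ?thesis using subspace_0[OF sm] by (auto simp: span_zero)
  qed
  moreover have "dim (span {e}) = 1"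
  proof -
    have "e \<noteq> 0" using e_m subspace_0[OF sm] by auto
    then show ?thesis using frame_dim[of "[e]"] by (simp add: frame_def)
  qed
  ultimately have dm: "dim m = 4" using dim_sums_Int[OF subspace_span[of "{e}"] sm] dN by simp
  have zm: "z \<in> m" using zN by (simp add: m_def)
  \<comment> \<open>As a commutator \<open>[u, v]\<close> is ad-nilpotent, but it acts on
    \<open>W\<close> as a multiple of \<open>D\<close>, whose square is the non-zero scalar
    \<open>r\<close>.\<close>
  have cm: "br u v \<in> m"
  proof -
    have c: "br (br u v) w = \<xi> (br u v) *\<^sub>R br e w" if "w \<in> Range e" for w using \<xi>[OF uv(7) that] .
    obtain n where n: "\<And>x. (br (br u v) ^^ n) x = 0" using solvable_derived_nilpotent[OF sol bracket_span_memI, of u v] by blast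
    have "br (br u v) (br (br u v) u) = (\<xi> (br u v) ^ 2 * r) *\<^sub>R u"
      by (simp add: brs c uW uv power2_eq_square)
    from nilpotent_square_eigenvalue[OF lin2 n v0(2) this] have "\<xi> (br u v) ^ 2 * r = 0" .
    then have "\<xi> (br u v) = 0" using v0 uv(5) by auto
    then show ?thesis using c uv(7) by (simp add: m_def)
  qed
  have cN: "br y (br u v) = 0" if y: "y \<in> Null e" for y
    using \<xi>[OF y uW(1)] \<xi>[OF y uW(2)] by (simp add: jacobi[of y u v] uv brs)
  have F: "\<exists>L. linear L \<and> (\<forall>x\<in>m. \<forall>y\<in>m. \<phi> w x y = (L (br x y) :: real))" if "w \<in> Range e" for w
    by (rule two_form_in_bracket_image[OF em mN uv(5) mW(1) D2 that])
  have noiso: False if w: "w \<in> Range e" "w \<noteq> 0" and fr: "frame [a, b, c, z]" and sub: "set [a, b, c, z] \<subseteq> m"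
    and "\<phi> (w + t *\<^sub>R z) a b = 0" "\<phi> (w + t *\<^sub>R z) a c = 0" "\<phi> (w + t *\<^sub>R z) b c = 0" for w a b c t
  proof (rule isotropic[of "w + t *\<^sub>R z" a b c z])
    have "span (set [a, b, c, z]) \<subseteq> m" by (rule span_minimal[OF sub sm])
    moreover have "w + t *\<^sub>R z \<notin> m"
    proof
      assume "w + t *\<^sub>R z \<in> m"
      then have "w + t *\<^sub>R z - t *\<^sub>R z \<in> m" using zm sm by (intro subspace_diff subspace_scale)
      then show False using w NW mN by auto
    qed
    ultimately show "frame [w + t *\<^sub>R z, a, b, c, z]" using fr by (auto simp: frame_Cons)
    obtain L where L: "linear L" "\<And>x y. x \<in> m \<Longrightarrow> y \<in> m \<Longrightarrow> \<phi> w x y = (L (br x y) :: real)"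
      using F[OF w(1)] by blast
    have "\<phi> (w + t *\<^sub>R z) x z = 0" if "x \<in> m" for x
      using L(2)[OF that zm] linear_0[OF L(1)] \<phi>_anti(2)[of z x z] by (simp add: \<phi>s)
    then show "\<phi> (w + t *\<^sub>R z) a z = 0" "\<phi> (w + t *\<^sub>R z) b z = 0" "\<phi> (w + t *\<^sub>R z) c z = 0"
      using sub by auto
  qed (use that in auto)
  have pick: "\<exists>w\<in>Range e. w \<noteq> 0 \<and> f w = 0" if "linear f" for f :: "real^7 \<Rightarrow> real"
  proof (cases "f u = 0")
    case True
    then show ?thesis using uW v0 by blast
  next
    case False
    let ?w = "f v *\<^sub>R u + (- f u) *\<^sub>R v"
    have "?w \<noteq> 0" using uv(2) False unfolding frame_explicit by fastforce
    moreover have "f ?w = 0" using that by (simp add: linear_diff linear_cmul)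
    moreover have "?w \<in> Range e" using W by blast
    ultimately show ?thesis by blast
  qed
  \<comment> \<open>If the brackets of \<open>m\<close> lie on a line, all \<open>\<phi> w\<close>
    restrict to multiples of one form on \<open>m\<close>; one linear condition on the plane
    \<open>W\<close> makes this multiple 0.\<close>
  have case1: False if one: "\<And>x y. x \<in> m \<Longrightarrow> y \<in> m \<Longrightarrow> br x y \<in> span {y0}" for y0
  proof -
    obtain f :: "real^7 \<Rightarrow> real" where f: "linear f" "\<And>w x y. w \<in> Range e \<Longrightarrow> f w = 0 \<Longrightarrow> x \<in> m \<Longrightarrow> y \<in> m \<Longrightarrow> \<phi> w x y = (0::real)"
    proof (cases "\<exists>p\<in>m. \<exists>q\<in>m. br p q \<noteq> 0")
      case True
      then obtain p q where pq: "p \<in> m" "q \<in> m" "br p q \<noteq> 0" by blast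
      obtain k where k: "br p q = k *\<^sub>R y0" using one[OF pq(1,2)] by (auto simp: span_singleton)
      have "\<phi> w x y = 0" if wxy: "w \<in> Range e" "\<phi> w p q = 0" "x \<in> m" "y \<in> m" for w x y
      proof -
        obtain L where L: "linear L" "\<And>x y. x \<in> m \<Longrightarrow> y \<in> m \<Longrightarrow> \<phi> w x y = (L (br x y) :: real)"
          using F[OF \<open>w \<in> Range e\<close>] by blast
        obtain l where l: "br x y = l *\<^sub>R y0" using one[OF wxy(3,4)] by (auto simp: span_singleton)
        have "L (br p q) = 0" using L(2)[OF pq(1,2)] wxy(2) by simp
        then have "L y0 = 0" using pq(3) by (simp add: k linear_cmul[OF L(1)])
        then show ?thesis using L(2)[OF wxy(3,4)] by (simp add: l linear_cmul[OF L(1)])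
      qed
      then show ?thesis using that[of "\<lambda>w. \<phi> w p q"] \<phi>_linear(1) by blast
    next
      case False
      have "\<phi> w x y = 0" if "w \<in> Range e" "x \<in> m" "y \<in> m" for w x y
        using F[OF that(1)] False that(2,3) linear_0 by metis
      then show ?thesis using that[of "\<lambda>_. 0"] by (simp add: linear_zero)
    qed
    obtain w where w: "w \<in> Range e" "w \<noteq> 0" "f w = 0" using pick[OF f(1)] by blast
    have "frame [z]" using z0 by (simp add: frame_def)
    then obtain c where c: "c \<in> m" "frame [c, z]" by (rule frame_extend[OF _ _ sm]) (use zm dm in auto)
    obtain b where b: "b \<in> m" "frame [b, c, z]" by (rule frame_extend[OF c(2) _ sm]) (use zm c dm in auto)
    obtain a where a: "a \<in> m" "frame [a, b, c, z]" by (rule frame_extend[OF b(2) _ sm]) (use zm c b dm in auto)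
    have "\<phi> (w + 0 *\<^sub>R z) x y = 0" if "x \<in> m" "y \<in> m" for x y using f(2)[OF w(1,3) that] by simp
    then show False using noiso[OF w(1,2) a(2), of 0] a b c zm by auto
  qed
  have "\<exists>p\<in>m. \<exists>q\<in>m. br p q \<notin> span {z}" using case1 by blast
  then obtain p q where pq: "p \<in> m" "q \<in> m" "br p q \<notin> span {z}" by blast
  define m3 where "m3 = br p q"
  have m3: "m3 \<in> m" using mm pq mN by (auto simp: m3_def)
  have qp: "br q p = - m3" using anti[of q p] by (simp add: m3_def)
  have noev: False if y: "y \<in> m" and k: "k *\<^sub>R br y m3 = m3" for y k
  proof -
    have "m3 \<noteq> 0" using pq by (auto simp: m3_def span_zero)
    then have "k \<noteq> 0" using k by auto
    have "br y m3 = (1 / k) *\<^sub>R k *\<^sub>R br y m3" using \<open>k \<noteq> 0\<close> by simp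
    then have "br y m3 - (1 / k) *\<^sub>R m3 = 0" using k by simp
    then have "1 / k = 0"
      using nil_eigen[of y m3 "{0}" "1 / k"] y m3 mN \<open>m3 \<noteq> 0\<close> subspace_single_0 by auto
    then show False using \<open>k \<noteq> 0\<close> by simp
  qed
  have fr: "frame [p, q, m3, z]" unfolding frame_explicit
  proof (intro allI impI)
    fix \<alpha> \<beta> \<gamma> \<delta> assume rel: "\<alpha> *\<^sub>R p + \<beta> *\<^sub>R q + \<gamma> *\<^sub>R m3 + \<delta> *\<^sub>R z = 0"
    have "br p (\<alpha> *\<^sub>R p + \<beta> *\<^sub>R q + \<gamma> *\<^sub>R m3 + \<delta> *\<^sub>R z) = \<beta> *\<^sub>R m3 + \<gamma> *\<^sub>R br p m3" by (simp add: brs m3_def)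
    then have 1: "\<beta> *\<^sub>R m3 + \<gamma> *\<^sub>R br p m3 = 0" using rel by simp
    have "br q (\<alpha> *\<^sub>R p + \<beta> *\<^sub>R q + \<gamma> *\<^sub>R m3 + \<delta> *\<^sub>R z) = - \<alpha> *\<^sub>R m3 + \<gamma> *\<^sub>R br q m3" by (simp add: brs qp)
    then have 2: "- \<alpha> *\<^sub>R m3 + \<gamma> *\<^sub>R br q m3 = 0" using rel by simp
    have "\<beta> = 0"
    proof (rule ccontr)
      assume b: "\<beta> \<noteq> 0"
      have "(- \<gamma> / \<beta>) *\<^sub>R br p m3 = (1 / \<beta>) *\<^sub>R \<beta> *\<^sub>R m3"
        using 1 b by (simp add: eq_neg_iff_add_eq_0[symmetric] divide_inverse_commute scaleR_scaleR[symmetric] del: scaleR_scaleR)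
      then show False using noev[OF pq(1), of "- \<gamma> / \<beta>"] b by simp
    qed
    moreover have "\<alpha> = 0"
    proof (rule ccontr)
      assume b: "\<alpha> \<noteq> 0"
      have "(\<gamma> / \<alpha>) *\<^sub>R br q m3 = (1 / \<alpha>) *\<^sub>R \<alpha> *\<^sub>R m3"
        using 2 b by (simp add: divide_inverse_commute scaleR_scaleR[symmetric] del: scaleR_scaleR)
      then show False using noev[OF pq(2), of "\<gamma> / \<alpha>"] b by simp
    qed
    ultimately have r2: "\<gamma> *\<^sub>R m3 = (- \<delta>) *\<^sub>R z" using rel by (simp add: eq_neg_iff_add_eq_0)
    have "\<gamma> = 0"
    proof (rule ccontr)
      assume g: "\<gamma> \<noteq> 0"
      have "m3 = (1 / \<gamma>) *\<^sub>R \<gamma> *\<^sub>R m3" using g by simp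
      also have "\<dots> = (1 / \<gamma>) *\<^sub>R (- \<delta>) *\<^sub>R z" by (simp only: r2)
      also have "\<dots> \<in> span {z}" by (intro span_scale span_base) simp
      finally show False using pq(3) by (simp add: m3_def)
    qed
    then show "\<alpha> = 0 \<and> \<beta> = 0 \<and> \<gamma> = 0 \<and> \<delta> = 0" using r2 \<open>\<alpha> = 0\<close> \<open>\<beta> = 0\<close> z0 by auto
  qed
  have sp: "span {p, q, m3, z} = m"
    using frame_spans[OF fr _ sm] pq m3 zm dm by simp
  have pN: "p \<in> Null e" "q \<in> Null e" "m3 \<in> Null e" using pq m3 mN by auto
  have "br p m3 \<in> span {z}" unfolding m3_def
    by (rule second_center[OF sm mN pq(1,2)])
      (use fr sp mm[OF pN(1,3)] in \<open>simp_all add: m3_def\<close>)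
  then obtain \<delta> where pd: "br p m3 = \<delta> *\<^sub>R z" by (auto simp: span_singleton)
  obtain \<delta>' where qd: "br q m3 = \<delta>' *\<^sub>R z"
  proof -
    have f': "frame [q, p, br q p, z]" unfolding qp frame_explicit
    proof (intro allI impI)
      fix a b c t assume "a *\<^sub>R q + b *\<^sub>R p + c *\<^sub>R - m3 + t *\<^sub>R z = 0"
      then have "b *\<^sub>R p + a *\<^sub>R q + (- c) *\<^sub>R m3 + t *\<^sub>R z = 0" by (simp add: algebra_simps)
      then have "b = 0 \<and> a = 0 \<and> - c = 0 \<and> t = 0" using fr unfolding frame_explicit by blast
      then show "a = 0 \<and> b = 0 \<and> c = 0 \<and> t = 0" by simp
    qed
    have sp': "span {q, p, br q p, z} = m"
    proof -
      have "br q p \<in> m" using qp m3 sm by (simp add: subspace_neg)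
      then show ?thesis using frame_spans[OF f' _ sm] pq zm dm by simp
    qed
    have "br q (br q p) \<in> span {z}"
      by (rule second_center[OF sm mN pq(2,1) f' sp']) (use mm[OF pN(2,3)] sm in \<open>simp add: qp brs subspace_neg\<close>)
    then have "br q m3 \<in> span {z}" using span_neg by (fastforce simp: qp brs)
    then show ?thesis using that by (auto simp: span_singleton)
  qed
  have coord: "y \<in> m \<Longrightarrow> \<exists>a b c t. y = a *\<^sub>R p + b *\<^sub>R q + c *\<^sub>R m3 + t *\<^sub>R z" for y
    unfolding sp[symmetric] by (auto simp: span_insert span_singleton algebra_simps)
  have dd: "\<delta> \<noteq> 0 \<or> \<delta>' \<noteq> 0"
  proof (rule ccontr)
    assume "\<not> ?thesis"
    then have z': "br p m3 = 0" "br q m3 = 0" "br m3 p = 0" "br m3 q = 0"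
      using pd qd anti[of m3 p] anti[of m3 q] by auto
    have "br x y \<in> span {m3}" if xy: "x \<in> m" "y \<in> m" for x y
    proof -
      obtain a b c t a' b' c' t' where "x = a *\<^sub>R p + b *\<^sub>R q + c *\<^sub>R m3 + t *\<^sub>R z"
        "y = a' *\<^sub>R p + b' *\<^sub>R q + c' *\<^sub>R m3 + t' *\<^sub>R z" using coord xy by metis
      then have "br x y = (a * b' - b * a') *\<^sub>R m3"
        by (simp add: brs z' qp m3_def[symmetric] algebra_simps)
      then show ?thesis by (simp add: span_base span_scale)
    qed
    then show False by (rule case1)
  qed
  have md: "br m3 p = - (\<delta> *\<^sub>R z)" "br m3 q = - (\<delta>' *\<^sub>R z)"
    using pd qd anti[of m3 p] anti[of m3 q] by auto
  \<comment> \<open>The null space centralizes \<open>[u, v]\<close>, and an element of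
    \<open>m\<close> commuting with \<open>p\<close>, \<open>q\<close> and \<open>m3\<close> is a
    multiple of \<open>z\<close>.\<close>
  obtain \<kappa> where c: "br u v = \<kappa> *\<^sub>R z"
  proof -
    obtain a b c t where y: "br u v = a *\<^sub>R p + b *\<^sub>R q + c *\<^sub>R m3 + t *\<^sub>R z" using coord[OF cm] by blast
    have "br p (br u v) = 0" "br q (br u v) = 0" "br m3 (br u v) = 0" using cN pN by auto
    then have "b *\<^sub>R m3 + (c * \<delta>) *\<^sub>R z = 0" "(- a) *\<^sub>R m3 + (c * \<delta>') *\<^sub>R z = 0"
      by (simp_all add: y brs pd qd qp m3_def[symmetric])
    moreover have "frame [m3, z]" by (rule frame_subset[OF fr]) (use fr in \<open>auto simp: frame_def\<close>)
    ultimately have "b = 0" "c * \<delta> = 0" "a = 0" "c * \<delta>' = 0" unfolding frame_explicit by fastforce+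
    then show thesis using that[of t] y dd by auto
  qed
  have cl: "\<kappa> * \<phi> z x y + \<phi> (br x y) u v = 0" if "x \<in> m" "y \<in> m" for x y
    using closed4[of u v x y] mW[OF that(1) uW(1)] mW[OF that(1) uW(2)] mW[OF that(2) uW(1)] mW[OF that(2) uW(2)]
    by (simp add: c \<phi>s)
  have A: "\<phi> z u v \<noteq> 0" using uv(6) \<omega>_\<phi>[OF uv(7)] by simp
  have cp: "\<kappa> * \<phi> z p m3 = - \<delta> * \<phi> z u v" and cq: "\<kappa> * \<phi> z q m3 = - \<delta>' * \<phi> z u v"
    using cl[OF pq(1) m3] cl[OF pq(2) m3] by (auto simp: pd qd \<phi>s)
  have \<kappa>: "\<kappa> \<noteq> 0" using cp cq A dd by auto
  define B where "B = - \<phi> z u v / \<kappa>"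
  have B: "B \<noteq> 0" "\<phi> z p m3 = \<delta> * B" "\<phi> z q m3 = \<delta>' * B"
    using A \<kappa> cp cq by (auto simp: B_def field_simps)
  \<comment> \<open>The values of \<open>\<phi> w\<close> and of \<open>\<phi> z\<close> on the
    pairs \<open>p, m3\<close> and \<open>q, m3\<close> are both proportional to
    \<open>(\<delta>, \<delta>')\<close>, so one multiple \<open>f w\<close> of \<open>z\<close>
    cancels both. Only the pair \<open>p, q\<close> is left, and \<open>pick\<close> takes care of
    it.\<close>
  define f where "f w = (if \<delta> \<noteq> 0 then \<phi> w p m3 / (\<delta> * B) else \<phi> w q m3 / (\<delta>' * B))" for w
  have f: "linear f" unfolding f_def by (auto intro!: linearI simp: \<phi>s add_divide_distrib)
  define h where "h w = \<phi> w p q - f w * \<phi> z p q" for w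
  have "linear h" unfolding h_def
    by (auto intro!: linearI simp: \<phi>s linear_add[OF f] linear_cmul[OF f] algebra_simps)
  then obtain w where w: "w \<in> Range e" "w \<noteq> 0" "h w = 0" using pick by blast
  obtain L where L: "linear L" "\<And>x y. x \<in> m \<Longrightarrow> y \<in> m \<Longrightarrow> \<phi> w x y = (L (br x y) :: real)"
    using F[OF w(1)] by blast
  have "\<phi> w p m3 = \<delta> * L z" "\<phi> w q m3 = \<delta>' * L z"
    using L(2)[OF pq(1) m3] L(2)[OF pq(2) m3] by (simp_all add: pd qd linear_cmul[OF L(1)])
  moreover from this have "f w = L z / B" using dd B by (auto simp: f_def)
  ultimately have "\<phi> (w + (- f w) *\<^sub>R z) p m3 = 0" "\<phi> (w + (- f w) *\<^sub>R z) q m3 = 0"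
    using B by (simp_all add: \<phi>s)
  moreover have "\<phi> (w + (- f w) *\<^sub>R z) p q = 0" using w(3) by (simp add: \<phi>s h_def)
  ultimately show False using noiso[OF w(1,2) fr, of "- f w"] pq m3 zm by auto
qed

end

section \<open>Self-adjoint operators and equivariant products\<close>

text \<open>In a symplectic basis self-adjointness makes the diagonal 2 x 2 blocks scalar and ties
  the two off-diagonal ones together. \<open>?t\<close> and \<open>?d\<close> are the coefficients
  of the Pfaffian polynomial, whose square is the characteristic polynomial.\<close>

lemma self_adjoint_quadratic:
  fixes W :: "(real^7) set" and \<Omega> :: "real^7 \<Rightarrow> real^7 \<Rightarrow> real" and A :: "real^7 \<Rightarrow> real^7"
  assumes W: "subspace W" "dim W = 4" and \<Omega>: "bilinear \<Omega>" "\<And>x. \<Omega> x x = 0"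
    and nd: "\<And>w. w \<in> W \<Longrightarrow> (\<And>v. v \<in> W \<Longrightarrow> \<Omega> w v = 0) \<Longrightarrow> w = 0"
    and A: "linear A" "\<And>w. w \<in> W \<Longrightarrow> A w \<in> W"
    and sa: "\<And>u v. u \<in> W \<Longrightarrow> v \<in> W \<Longrightarrow> \<Omega> (A u) v = \<Omega> u (A v)"
  obtains \<tau> \<delta> where "\<And>w. w \<in> W \<Longrightarrow> A (A w) = \<tau> *\<^sub>R A w - \<delta> *\<^sub>R w"
proof -
  obtain a b c d where fr: "frame [a, b, c, d]" "span {a, b, c, d} = W"
    "\<Omega> a b = 1" "\<Omega> c d = 1" "\<Omega> a c = 0" "\<Omega> a d = 0" "\<Omega> b c = 0" "\<Omega> b d = 0"
    by (rule symplectic_basis4[OF W \<Omega> nd])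
  note w = bilinear_rules[OF \<Omega>(1)]
  note anti = alternating_anti[OF \<Omega>]
  have rv: "\<Omega> b a = -1" "\<Omega> d c = -1" "\<Omega> c a = 0" "\<Omega> d a = 0" "\<Omega> c b = 0" "\<Omega> d b = 0"
    using fr anti[of b a] anti[of d c] anti[of c a] anti[of d a] anti[of c b] anti[of d b] by auto
  note val = fr(3-) rv \<Omega>(2)
  have co: "\<exists>s t u v. w = s *\<^sub>R a + t *\<^sub>R b + u *\<^sub>R c + v *\<^sub>R d" if "w \<in> W" for w
    using that unfolding fr(2)[symmetric] by (auto simp: span_insert span_singleton algebra_simps)
  have mem: "a \<in> W" "b \<in> W" "c \<in> W" "d \<in> W" unfolding fr(2)[symmetric] by (rule span_base, simp)+
  obtain a1 a2 a3 a4 where Aa: "A a = a1 *\<^sub>R a + a2 *\<^sub>R b + a3 *\<^sub>R c + a4 *\<^sub>R d" using co[OF A(2)[OF mem(1)]] by blast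
  obtain b1 b2 b3 b4 where Ab: "A b = b1 *\<^sub>R a + b2 *\<^sub>R b + b3 *\<^sub>R c + b4 *\<^sub>R d" using co[OF A(2)[OF mem(2)]] by blast
  obtain c1 c2 c3 c4 where Ac: "A c = c1 *\<^sub>R a + c2 *\<^sub>R b + c3 *\<^sub>R c + c4 *\<^sub>R d" using co[OF A(2)[OF mem(3)]] by blast
  obtain d1 d2 d3 d4 where Ad: "A d = d1 *\<^sub>R a + d2 *\<^sub>R b + d3 *\<^sub>R c + d4 *\<^sub>R d" using co[OF A(2)[OF mem(4)]] by blast
  have alt: "\<Omega> (A u) u = 0" if "u \<in> W" for u using sa[OF that that] anti[of u "A u"] by simp
  have e1: "a2 = 0" using alt[OF mem(1)] by (simp add: Aa w val)
  have e2: "b1 = 0" using alt[OF mem(2)] by (simp add: Ab w val)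
  have e3: "c4 = 0" using alt[OF mem(3)] by (simp add: Ac w val)
  have e4: "d3 = 0" using alt[OF mem(4)] by (simp add: Ad w val)
  have e5: "b2 = a1" using sa[OF mem(1,2)] by (simp add: Aa Ab w val)
  have e6: "d4 = c3" using sa[OF mem(3,4)] by (simp add: Ac Ad w val)
  have e7: "c2 = - a4" using sa[OF mem(1,3)] by (simp add: Aa Ac w val)
  have e8: "d2 = a3" using sa[OF mem(1,4)] by (simp add: Aa Ad w val)
  have e9: "c1 = b4" using sa[OF mem(2,3)] by (simp add: Ab Ac w val)
  have e10: "d1 = - b3" using sa[OF mem(2,4)] by (simp add: Ab Ad w val)
  note es = e1 e2 e3 e4 e5 e6 e7 e8 e9 e10
  let ?t = "a1 + c3" and ?d = "a1 * c3 - (a3 * b4 - a4 * b3)"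
  have "A (A w) = ?t *\<^sub>R A w - ?d *\<^sub>R w" if ww: "w \<in> W" for w
  proof -
    obtain s t u v where wc: "w = s *\<^sub>R a + t *\<^sub>R b + u *\<^sub>R c + v *\<^sub>R d" using co[OF ww] by blast
    show ?thesis
      by (simp add: wc linear_rules[OF A(1)] Aa Ab Ac Ad es)
        (simp add: vec_eq_iff algebra_simps)
  qed
  then show thesis by (rule that)
qed

text \<open>Equivariance adds eigenvalues, and those of \<open>S\<close>, \<open>S'\<close> and
  \<open>T\<close> have squares \<open>r\<close>, \<open>r'\<close> and \<open>r''\<close>. A sum of
  square roots of \<open>r\<close> and \<open>r'\<close> has square \<open>r''\<close> only if
  \<open>(r'' - r - r')^2 = 4 r r'\<close>; this form of the condition avoids roots that may not be
  real.\<close>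

lemma semisimple_equivariant_zero:
  fixes t :: "'a \<Rightarrow> 'b \<Rightarrow> 'c::real_vector"
  assumes r: "r \<noteq> 0" and S: "\<And>u. u \<in> U \<Longrightarrow> S u \<in> U" "\<And>v. v \<in> V \<Longrightarrow> S' v \<in> V"
    and tr: "\<And>u v. u \<in> U \<Longrightarrow> v \<in> V \<Longrightarrow> t (S (S u)) v = r *\<^sub>R t u v"
    "\<And>u v. u \<in> U \<Longrightarrow> v \<in> V \<Longrightarrow> t u (S' (S' v)) = r' *\<^sub>R t u v"
    and eq: "\<And>u v. u \<in> U \<Longrightarrow> v \<in> V \<Longrightarrow> T (t u v) = t (S u) v + t u (S' v)"
    and T: "\<And>x y. T (x + y) = T x + T y"
      "\<And>u v. u \<in> U \<Longrightarrow> v \<in> V \<Longrightarrow> T (T (t u v)) = r'' *\<^sub>R t u v"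
    and res: "(r'' - r - r')\<^sup>2 \<noteq> 4 * r * r'"
    and uv: "u \<in> U" "v \<in> V"
  shows "t u v = 0"
proof -
  have s: "2 *\<^sub>R t (S u) (S' v) = (r'' - r - r') *\<^sub>R t u v" if "u \<in> U" "v \<in> V" for u v
  proof -
    have "r'' *\<^sub>R t u v = T (t (S u) v + t u (S' v))" using that T(2) eq by metis
    also have "\<dots> = (t (S (S u)) v + t (S u) (S' v)) + (t (S u) (S' v) + t u (S' (S' v)))"
      using that S eq T(1) by metis
    also have "\<dots> = (r + r') *\<^sub>R t u v + 2 *\<^sub>R t (S u) (S' v)"
      using that tr by (simp add: scaleR_2 algebra_simps)
    finally show ?thesis by (simp add: algebra_simps)
  qed
  have "(r'' - r - r') *\<^sub>R (r'' - r - r') *\<^sub>R t u v = (r'' - r - r') *\<^sub>R 2 *\<^sub>R t (S u) (S' v)"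
    by (simp only: s[OF uv])
  also have "\<dots> = 2 *\<^sub>R (r'' - r - r') *\<^sub>R t (S u) (S' v)" by (simp add: mult.commute)
  also have "\<dots> = 2 *\<^sub>R 2 *\<^sub>R t (S (S u)) (S' (S' v))" using s[of "S u" "S' v"] S uv by simp
  also have "\<dots> = (4 * r * r') *\<^sub>R t u v" using tr(1)[of u "S' (S' v)"] tr(2)[of u v] S uv by simp
  finally have "((r'' - r - r') * (r'' - r - r')) *\<^sub>R t u v = (4 * r * r') *\<^sub>R t u v" by simp
  then show ?thesis using res by (simp add: power2_eq_square)
qed

section \<open>Three-dimensional Cartan subalgebras\<close>

locale g2_cartan = g2_adapted +
  fixes x :: "real^7" and c :: real
  assumes dim4: "dim (Range e) = 4"
    and xN: "x \<in> Null e" and fr_xez: "frame [x, e, z]" and sp_xez: "span {x, e, z} = Null e"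
    and xe: "br x e = c *\<^sub>R z" and E0: "\<omega> x e \<noteq> 0"
begin

abbreviation "W \<equiv> Range e"
definition "E = \<omega> x e"

lemma ex: "br e x = - (c *\<^sub>R z)" using anti[of e x] xe by simp

lemma E_nz: "E \<noteq> 0" using E0 by (simp add: E_def)

lemma z_Null: "s *\<^sub>R z \<in> Null e" using zN sN by (rule subspace_scale[rotated])

lemma E_\<phi>: "\<phi> z x e = E" "\<phi> z e x = - E"
  using \<omega>_\<phi>[of x e] z_Null \<phi>_anti(2)[of z e x] by (auto simp: xe E_def)

lemma eW: "w \<in> W \<Longrightarrow> br e w \<in> W" using Null_Range[OF self_Null] .
lemma xW: "w \<in> W \<Longrightarrow> br x w \<in> W" using Null_Range[OF xN] .

lemma comm_xe: "br x (br e v) = br e (br x v)"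
  using br_br[of x e v] by (simp add: xe brs)

definition pr :: "real^7 \<Rightarrow> real^7" where "pr v = (THE w. w \<in> W \<and> v - w \<in> Null e)"

lemma pr_eq: "w \<in> W \<Longrightarrow> v - w \<in> Null e \<Longrightarrow> pr v = w"
  unfolding pr_def
proof (rule the_equality)
  fix w' assume w: "w \<in> W" "v - w \<in> Null e" and w': "w' \<in> W \<and> v - w' \<in> Null e"
  have "v - w - (v - w') \<in> Null e" using w w' sN subspace_diff by blast
  then have "w' - w \<in> Null e" by simp
  moreover have "w' - w \<in> W" using w w' sW by (intro subspace_diff) auto
  ultimately show "w' = w" using NW by fastforce
qed simp

lemma pr: "pr v \<in> W" "v - pr v \<in> Null e"
proof -
  obtain a b where "a \<in> Null e" "b \<in> W" "v = a + b" by (rule decomp)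
  moreover from this have "pr v = b" by (intro pr_eq) auto
  ultimately show "pr v \<in> W" "v - pr v \<in> Null e" by auto
qed

lemma pr_linear: "linear pr"
proof (rule linearI)
  fix a b show "pr (a + b) = pr a + pr b"
  proof (rule pr_eq)
    show "pr a + pr b \<in> W" using pr sW by (intro subspace_add) auto
    have "(a - pr a) + (b - pr b) \<in> Null e" using pr sN by (intro subspace_add) auto
    then show "a + b - (pr a + pr b) \<in> Null e" by (simp add: algebra_simps)
  qed
next
  fix r b show "pr (r *\<^sub>R b) = r *\<^sub>R pr b"
  proof (rule pr_eq)
    show "r *\<^sub>R pr b \<in> W" using pr sW by (intro subspace_scale) auto
    have "r *\<^sub>R (b - pr b) \<in> Null e" using pr sN by (intro subspace_scale) auto
    then show "r *\<^sub>R b - r *\<^sub>R pr b \<in> Null e" by (simp add: algebra_simps)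
  qed
qed

lemmas prs = linear_rules[OF pr_linear]

lemma pr_W: "w \<in> W \<Longrightarrow> pr w = w" by (rule pr_eq) (use sN in \<open>auto simp: subspace_0\<close>)
lemma pr_N: "n \<in> Null e \<Longrightarrow> pr n = 0" by (rule pr_eq) (use sW in \<open>auto simp: subspace_0\<close>)

lemma pr_e: "pr (br e v) = br e (pr v)"
proof (rule pr_eq)
  show "br e (pr v) \<in> W" using pr eW by auto
  have "br e (v - pr v) \<in> Null e" using Null_Null[OF self_Null] pr by auto
  then show "br e v - br e (pr v) \<in> Null e" by (simp add: brs)
qed

lemma pr_x: "pr (br x v) = br x (pr v)"
proof (rule pr_eq)
  show "br x (pr v) \<in> W" using pr xW by auto
  have "br x (v - pr v) \<in> Null e" using Null_Null[OF xN] pr by auto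
  then show "br x v - br x (pr v) \<in> Null e" by (simp add: brs)
qed

definition pbr :: "real^7 \<Rightarrow> real^7 \<Rightarrow> real^7" where "pbr u v = pr (br u v)"

lemma pbr_bil: "bilinear pbr"
  unfolding bilinear_def by (auto intro!: linearI simp: pbr_def brs prs)

lemmas pbrs = bilinear_rules[OF pbr_bil]

lemma pbr_W: "pbr u v \<in> W" and pbr_self: "pbr u u = 0"
  by (simp_all add: pbr_def pr prs)

lemma pbr_anti: "pbr u v = - pbr v u" by (rule alternating_anti[OF pbr_bil pbr_self])

text \<open>\<open>ca\<close>, \<open>cp\<close>, \<open>cq\<close> are the coordinates along
  \<open>e\<close>, \<open>x\<close> and \<open>z\<close>. As \<open>\<omega>\<close> vanishes
  between the null space and \<open>W\<close> and \<open>E\<close> is not 0, the first two can be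
  read off from \<open>\<omega>\<close>.\<close>

definition ca :: "real^7 \<Rightarrow> real" where "ca v = \<omega> x v / E"
definition cp :: "real^7 \<Rightarrow> real" where "cp v = \<omega> v e / E"
definition cq :: "real^7 \<Rightarrow> real" where
  "cq v = (v - pr v - ca v *\<^sub>R e - cp v *\<^sub>R x) \<bullet> z / (z \<bullet> z)"

lemma ca_linear: "linear ca" unfolding ca_def[abs_def]
  by (auto intro!: linearI simp: \<omega>s add_divide_distrib)
lemma cp_linear: "linear cp" unfolding cp_def[abs_def]
  by (auto intro!: linearI simp: \<omega>s add_divide_distrib)
lemmas cas = linear_rules[OF ca_linear]
lemmas cps = linear_rules[OF cp_linear]

lemma cq_linear: "linear cq" unfolding cq_def[abs_def]
  by (rule linearI)
    (simp_all add: prs cas cps inner_simps algebra_simps add_divide_distrib diff_divide_distrib)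

lemmas cqs = linear_rules[OF cq_linear]

lemma coords_basis [simp]: "ca e = 1" "cp e = 0" "ca x = 0" "cp x = 1" "ca z = 0" "cp z = 0"
  using E_nz by (auto simp: ca_def cp_def E_def)

lemma coords_W: assumes "w \<in> W" shows "ca w = 0" "cp w = 0" "cq w = 0"
proof -
  show 1: "ca w = 0" "cp w = 0"
    using \<omega>_Null_Range[OF xN assms] \<omega>_Range_Null[OF self_Null assms] by (auto simp: ca_def cp_def)
  show "cq w = 0" using 1 pr_W[OF assms] by (simp add: cq_def)
qed

lemma cq_basis [simp]: "cq e = 0" "cq x = 0" "cq z = 1"
  using pr_N[OF self_Null] pr_N[OF xN] pr_N[OF zN] z0 by (auto simp: cq_def)

lemma Null_coords: "n \<in> Null e \<Longrightarrow> n = ca n *\<^sub>R e + cp n *\<^sub>R x + cq n *\<^sub>R z"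
proof -
  assume "n \<in> Null e"
  then have "n \<in> span {x, e, z}" using sp_xez by simp
  then obtain s t u where n: "n = s *\<^sub>R x + t *\<^sub>R e + u *\<^sub>R z"
    by (auto simp: span_insert span_singleton algebra_simps)
  show ?thesis by (simp add: n cas cps cqs)
qed

lemma coords: "v = ca v *\<^sub>R e + cp v *\<^sub>R x + cq v *\<^sub>R z + pr v"
proof -
  have "v - pr v = ca (v - pr v) *\<^sub>R e + cp (v - pr v) *\<^sub>R x + cq (v - pr v) *\<^sub>R z"
    using Null_coords pr(2) by blast
  then show ?thesis
    using coords_W[OF pr(1)[of v]]
    by (simp add: cas cps cqs algebra_simps)
qed

lemma coords_e: "ca (br e v) = 0" "cp (br e v) = 0" "cq (br e v) = - c * cp v"
proof -
  have "br e v = (- c * cp v) *\<^sub>R z + br e (pr v)"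
    by (subst coords[of v]) (simp add: brs ex)
  moreover have "br e (pr v) \<in> W" using pr eW by auto
  ultimately show "ca (br e v) = 0" "cp (br e v) = 0" "cq (br e v) = - c * cp v"
    by (simp_all add: cas cps cqs coords_W)
qed

lemma coords_x: "ca (br x v) = 0" "cp (br x v) = 0" "cq (br x v) = c * ca v"
proof -
  have "br x v = (c * ca v) *\<^sub>R z + br x (pr v)"
    by (subst coords[of v]) (simp add: brs xe)
  moreover have "br x (pr v) \<in> W" using pr xW by auto
  ultimately show "ca (br x v) = 0" "cp (br x v) = 0" "cq (br x v) = c * ca v"
    by (simp_all add: cas cps cqs coords_W)
qed

text \<open>Closedness with one argument \<open>e\<close>: the failure of \<open>ad e\<close> to be
  skew for \<open>\<omega>\<close> is measured by the \<open>x\<close>-component of the bracket.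
  \<open>\<omega>_x_adj\<close> is the same with \<open>x\<close> and \<open>e\<close>
  exchanged.\<close>

lemma \<omega>_e_adj: "\<omega> (br e u) v + \<omega> u (br e v) = - E * cp (br u v)"
  using \<omega>_closed[of e u v] anti[of v e] \<omega>_anti[of "br e v" u] E_nz by (simp add: cp_def \<omega>s)

lemma \<omega>_x_adj: "\<omega> (br x u) v + \<omega> u (br x v) = E * ca (br u v)"
  using \<omega>_closed[of x u v] anti[of v x] \<omega>_anti[of "br x v" u] \<omega>_anti[of "br u v" x] E_nz by (simp add: ca_def \<omega>s)

lemma p_e: "cp (br (br e u) v) + cp (br u (br e v)) = 0"
  using coords_e(2)[of "br u v"] by (simp add: jacobi[of e u v] cps)

lemma q_e: "cq (br (br e u) v) + cq (br u (br e v)) = - c * cp (br u v)"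
  using coords_e(3)[of "br u v"] by (simp add: jacobi[of e u v] cqs)

lemma q_x: "cq (br (br x u) v) + cq (br u (br x v)) = c * ca (br u v)"
  using coords_x(3)[of "br u v"] by (simp add: jacobi[of x u v] cqs)

lemma t_e: "br e (pr (br u v)) = pr (br (br e u) v) + pr (br u (br e v))"
  using pr_e[of "br u v"] by (simp add: jacobi[of e u v] prs)

lemma t_x: "br x (pr (br u v)) = pr (br (br x u) v) + pr (br u (br x v))"
  using pr_x[of "br u v"] by (simp add: jacobi[of x u v] prs)

lemma W_nz: "\<exists>w\<in>W. w \<noteq> 0" using Range_nz sW subspace_0 by blast

lemma W_nil: "w \<in> W \<Longrightarrow> \<exists>n. \<forall>v. (br w ^^ n) v = 0"
proof -
  assume "w \<in> W"
  then obtain u where "w = br e u" using Range_memI by blast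
  then show ?thesis using solvable_derived_nilpotent[OF sol bracket_span_memI] by blast
qed

text \<open>\<open>W = [e, W]\<close> lies in the derived algebra, hence so does the null component
  of a bracket, which is therefore ad-nilpotent; its central part does not act.\<close>

lemma Null_part_nil: assumes "u \<in> W" "v \<in> W" shows "\<exists>n. \<forall>w. (br (ca (br u v) *\<^sub>R e + cp (br u v) *\<^sub>R x) ^^ n) w = 0"
proof -
  let ?S = "bracket_span br UNIV UNIV"
  have "br u v \<in> ?S" by (rule bracket_span_memI) auto
  moreover obtain w where "pr (br u v) = br e w" using Range_memI pr by blast
  then have "pr (br u v) \<in> ?S" using bracket_span_memI[of e UNIV w UNIV] by simp
  ultimately have "br u v - pr (br u v) \<in> ?S" using subspace_bracket_span by (rule subspace_diff[rotated])
  then obtain n where n: "\<And>w. (br (br u v - pr (br u v)) ^^ n) w = 0"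
    using solvable_derived_nilpotent[OF sol] by blast
  have "br u v - pr (br u v) = (ca (br u v) *\<^sub>R e + cp (br u v) *\<^sub>R x) + cq (br u v) *\<^sub>R z"
    using coords[of "br u v"] by (simp add: algebra_simps)
  then have "br (br u v - pr (br u v)) = br (ca (br u v) *\<^sub>R e + cp (br u v) *\<^sub>R x)"
    by (simp add: fun_eq_iff brs)
  then show ?thesis using n by auto
qed

text \<open>The two operators commute and thus have a common kernel vector in \<open>W\<close>, on which \<open>ad e\<close> is injective.\<close>

lemma nilpotent_pencil:
  assumes x: "\<And>w. w \<in> W \<Longrightarrow> \<exists>n. (br x ^^ n) w = 0"
    and y: "\<And>w. w \<in> W \<Longrightarrow> \<exists>n. (br (s *\<^sub>R e + t *\<^sub>R x) ^^ n) w = 0"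
  shows "s = 0"
proof -
  let ?y = "s *\<^sub>R e + t *\<^sub>R x"
  have yW: "br ?y v \<in> W" if "v \<in> W" for v
    by (simp add: brs subspace_add[OF sW] subspace_scale[OF sW] xW[OF that] eW[OF that])
  have nil: "\<forall>C\<in>{br x, br ?y}. \<forall>v\<in>W. \<exists>n. (C ^^ n) v = 0"
    unfolding ball_simps(7,5) using x y by blast
  obtain v where v: "v \<in> W" "v \<noteq> 0" "\<And>C. C \<in> {br x, br ?y} \<Longrightarrow> C v = 0"
  proof (rule commuting_nilpotent_kernel[of "{br x, br ?y}" W])
    show "linear C" if "C \<in> {br x, br ?y}" for C using that lin2[of x] lin2[of ?y] by fast
    show "B (C v) = C (B v)" if "B \<in> {br x, br ?y}" "C \<in> {br x, br ?y}" for B C v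
      using that comm_xe by (auto simp: brs)
    show "C v \<in> W" if "C \<in> {br x, br ?y}" "v \<in> W" for C v
      using that yW xW by fast
    show "\<exists>n. (C ^^ n) v = 0" if "C \<in> {br x, br ?y}" "v \<in> W" for C v
      using nil that by blast
    show "W \<noteq> {0}" by (rule Range_nz)
  qed (use sW in auto)
  have "br x v = 0" "br ?y v = 0" using v(3) by auto
  then have "s *\<^sub>R br e v = 0" by (simp add: brs)
  then show "s = 0" using inj_e v by auto
qed

lemma frame_Null_W:
  assumes "frame ws" "set ws \<subseteq> W" shows "frame ([x, e, z] @ ws)"
proof (rule frame_append[OF fr_xez assms(1)])
  have "span (set ws) \<subseteq> W" by (rule span_minimal[OF assms(2) sW])
  then show "span (set [x, e, z]) \<inter> span (set ws) \<subseteq> {0}" using sp_xez NW by auto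
qed

lemma W_coords:
  assumes "frame [a, b, s, t]" "a \<in> W" "b \<in> W" "s \<in> W" "t \<in> W" "w \<in> W"
  obtains c1 c2 c3 c4 where "w = c1 *\<^sub>R a + c2 *\<^sub>R b + c3 *\<^sub>R s + c4 *\<^sub>R t"
proof -
  have "span (set [a, b, s, t]) = W" by (rule frame_spans[OF assms(1) _ sW]) (use assms dim4 in auto)
  then have "w \<in> span {a, b, s, t}" using assms by simp
  then show thesis using that by (auto simp: span_insert span_singleton algebra_simps)
qed

lemma flat_on_basis:
  assumes fr: "frame [a, b, s, t]" and mem: "a \<in> W" "b \<in> W" "s \<in> W" "t \<in> W"
    and 0: "pbr a b = 0" "pbr a s = 0" "pbr a t = 0" "pbr b s = 0" "pbr b t = 0" "pbr s t = 0"
    and uv: "u \<in> W" "v \<in> W"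
  shows "pr (br u v) = 0"
proof -
  obtain c1 c2 c3 c4 where u: "u = c1 *\<^sub>R a + c2 *\<^sub>R b + c3 *\<^sub>R s + c4 *\<^sub>R t" by (rule W_coords[OF fr mem uv(1)])
  obtain d1 d2 d3 d4 where v: "v = d1 *\<^sub>R a + d2 *\<^sub>R b + d3 *\<^sub>R s + d4 *\<^sub>R t" by (rule W_coords[OF fr mem uv(2)])
  have "pbr u v = 0"
    using 0 pbr_anti[of b a] pbr_anti[of s a] pbr_anti[of t a] pbr_anti[of s b] pbr_anti[of t b] pbr_anti[of t s]
    by (simp add: u v pbrs pbr_self)
  then show ?thesis by (simp add: pbr_def)
qed

lemma frame7_W:
  assumes "frame [a, b, s, t]" "a \<in> W" "b \<in> W" "s \<in> W" "t \<in> W"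
  shows "frame [x, e, z, a, b, s, t]"
  using frame_Null_W[OF assms(1)] assms by simp

end

text \<open>Brackets of \<open>W\<close> reach neither \<open>e\<close> nor \<open>x\<close>, so
  both act on \<open>W\<close> by elements of the symplectic Lie algebra of
  \<open>\<omega>\<close>.\<close>

locale g2_torus = g2_cartan +
  assumes ca0: "\<And>u v. u \<in> W \<Longrightarrow> v \<in> W \<Longrightarrow> ca (br u v) = 0"
    and cp0: "\<And>u v. u \<in> W \<Longrightarrow> v \<in> W \<Longrightarrow> cp (br u v) = 0"
begin

lemma D_skew: "u \<in> W \<Longrightarrow> v \<in> W \<Longrightarrow> \<omega> (br e u) v = - \<omega> u (br e v)"
  using \<omega>_e_adj[of u v] cp0 by simp

lemma X_skew: "u \<in> W \<Longrightarrow> v \<in> W \<Longrightarrow> \<omega> (br x u) v = - \<omega> u (br x v)"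
  using \<omega>_x_adj[of u v] ca0 by simp

end

context g2_torus
begin

lemma plane_vector:
  assumes C: "C \<subseteq> W" "subspace C" "C \<noteq> {0}" "\<And>w. w \<in> C \<Longrightarrow> br e w \<in> C"
    and nd: "\<And>w. w \<in> C \<Longrightarrow> (\<And>v. v \<in> C \<Longrightarrow> \<omega> w v = 0) \<Longrightarrow> w = 0"
  shows "\<exists>w\<in>C. \<omega> w (br e w) \<noteq> 0"
proof (rule skew_vector[OF C(2) lin2 C(4) _ _ nd])
  show "\<exists>w\<in>C. br e w \<noteq> 0" using C subspace_0[OF C(2)] inj_e by blast
  show "\<omega> (br e u) v = - \<omega> u (br e v)" if "u \<in> C" "v \<in> C" for u v using D_skew that C(1) by blast
qed

text \<open>Orthogonality makes both summands symplectic, so each has a cyclic vector for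
  \<open>D = ad e\<close>. On its plane \<open>ad x\<close> commutes with \<open>D\<close>, hence is
  \<open>p + x1 D\<close>, and skewness removes the scalar.\<close>

lemma orthogonal_plane_basis:
  assumes C1: "C1 \<subseteq> W" "subspace C1" "C1 \<noteq> {0}" "\<And>w. w \<in> C1 \<Longrightarrow> br e w \<in> C1" "\<And>w. w \<in> C1 \<Longrightarrow> br x w \<in> C1"
      "\<And>w. w \<in> C1 \<Longrightarrow> br e (br e w) = r1 *\<^sub>R w"
    and C2: "C2 \<subseteq> W" "subspace C2" "C2 \<noteq> {0}" "\<And>w. w \<in> C2 \<Longrightarrow> br e w \<in> C2" "\<And>w. w \<in> C2 \<Longrightarrow> br x w \<in> C2"
      "\<And>w. w \<in> C2 \<Longrightarrow> br e (br e w) = r2 *\<^sub>R w"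
    and sum: "\<And>w. w \<in> W \<Longrightarrow> \<exists>a\<in>C1. \<exists>b\<in>C2. w = a + b"
    and orth: "\<And>a b. a \<in> C1 \<Longrightarrow> b \<in> C2 \<Longrightarrow> \<omega> a b = 0"
  obtains u v x1 x2 where "u \<in> C1" "v \<in> C2" "\<omega> u (br e u) \<noteq> 0" "\<omega> v (br e v) \<noteq> 0"
    "frame [u, br e u, v, br e v]" "br x u = x1 *\<^sub>R br e u" "br x v = x2 *\<^sub>R br e v"
proof -
  have orth': "\<omega> b a = 0" if "a \<in> C1" "b \<in> C2" for a b using orth[OF that] \<omega>_anti[of b a] by simp
  have nd1: "w = 0" if "w \<in> C1" "\<And>v. v \<in> C1 \<Longrightarrow> \<omega> w v = 0" for w
  proof (rule \<omega>_nd_Range)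
    show "w \<in> W" using that C1 by auto
    fix v assume "v \<in> W"
    then obtain a b where "a \<in> C1" "b \<in> C2" "v = a + b" using sum by blast
    then show "\<omega> w v = 0" using that orth by (simp add: \<omega>s)
  qed
  have nd2: "w = 0" if "w \<in> C2" "\<And>v. v \<in> C2 \<Longrightarrow> \<omega> w v = 0" for w
  proof (rule \<omega>_nd_Range)
    show "w \<in> W" using that C2 by auto
    fix v assume "v \<in> W"
    then obtain a b where "a \<in> C1" "b \<in> C2" "v = a + b" using sum by blast
    then show "\<omega> w v = 0" using that orth' by (simp add: \<omega>s)
  qed
  obtain u where u: "u \<in> C1" "\<omega> u (br e u) \<noteq> 0" using plane_vector[OF C1(1-4) nd1] by blast
  obtain v where v: "v \<in> C2" "\<omega> v (br e v) \<noteq> 0" using plane_vector[OF C2(1-4) nd2] by blast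
  define u' where "u' = br e u"
  define v' where "v' = br e v"
  define g1 where "g1 = \<omega> u u'"
  define g2 where "g2 = \<omega> v v'"
  have mC: "u \<in> C1" "u' \<in> C1" "v \<in> C2" "v' \<in> C2" using u v C1(4) C2(4) by (auto simp: u'_def v'_def)
  then have mem: "u \<in> W" "u' \<in> W" "v \<in> W" "v' \<in> W" using C1(1) C2(1) by auto
  have g: "g1 \<noteq> 0" "g2 \<noteq> 0" using u v by (auto simp: g1_def g2_def u'_def v'_def)
  have om: "\<omega> u v = 0" "\<omega> u v' = 0" "\<omega> u' v = 0" "\<omega> u' v' = 0" "\<omega> u u' = g1" "\<omega> v v' = g2"
    using orth mC by (auto simp: g1_def g2_def)
  have rev: "\<omega> v u = 0" "\<omega> v' u = 0" "\<omega> v u' = 0" "\<omega> v' u' = 0" "\<omega> u' u = - g1" "\<omega> v' v = - g2"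
    using orth' mC \<omega>_anti[of u' u] \<omega>_anti[of v' v] om by auto
  have fr: "frame [u, u', v, v']" by (rule frame_orthogonal_planes) (use om g in auto)
  have D: "br e u = u'" "br e u' = r1 *\<^sub>R u" "br e v = v'" "br e v' = r2 *\<^sub>R v"
    using C1(6)[OF mC(1)] C2(6)[OF mC(3)] by (simp_all add: u'_def v'_def)
  obtain p1 x1 a3 a4 where Xu: "br x u = p1 *\<^sub>R u + x1 *\<^sub>R u' + a3 *\<^sub>R v + a4 *\<^sub>R v'"
    by (rule W_coords[OF fr mem xW[OF mem(1)]])
  have "\<omega> (br x u) v = 0" "\<omega> (br x u) v' = 0" using orth C1(5) mC by auto
  then have a34: "a3 = 0" "a4 = 0" using g by (simp_all add: Xu \<omega>s om rev)
  have Xu': "br x u' = p1 *\<^sub>R u' + (x1 * r1) *\<^sub>R u"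
    using comm_xe[of u] by (simp add: D Xu a34 brs)
  have "\<omega> (br x u) u' = - \<omega> u (br x u')" by (rule X_skew[OF mem(1,2)])
  then have p1: "p1 = 0" using g by (simp add: Xu Xu' a34 \<omega>s om)
  obtain a1 a2 p2 x2 where Xv: "br x v = a1 *\<^sub>R u + a2 *\<^sub>R u' + p2 *\<^sub>R v + x2 *\<^sub>R v'"
    by (rule W_coords[OF fr mem xW[OF mem(3)]])
  have "\<omega> (br x v) u = 0" "\<omega> (br x v) u' = 0" using orth' C2(5) mC by auto
  then have a12: "a1 = 0" "a2 = 0" using g by (simp_all add: Xv \<omega>s om rev)
  have Xv': "br x v' = p2 *\<^sub>R v' + (x2 * r2) *\<^sub>R v"
    using comm_xe[of v] by (simp add: D Xv a12 brs)
  have "\<omega> (br x v) v' = - \<omega> v (br x v')" by (rule X_skew[OF mem(3,4)])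
  then have p2: "p2 = 0" using g by (simp add: Xv Xv' a12 \<omega>s om)
  show thesis
    using that[of u v x1 x2] mC g om fr Xu Xv a34 a12 p1 p2 by (simp add: u'_def v'_def)
qed

end

section \<open>Eigenspaces of the square of ad e\<close>

context g2_cartan
begin

definition L :: "real \<Rightarrow> (real^7) set" where "L r = {w \<in> W. br e (br e w) = r *\<^sub>R w}"

lemma L_W: "w \<in> L r \<Longrightarrow> w \<in> W" and L_D2: "w \<in> L r \<Longrightarrow> br e (br e w) = r *\<^sub>R w"
  by (auto simp: L_def)

lemma L_sub: "subspace (L r)"
  using sW unfolding L_def subspace_def by (auto simp: brs algebra_simps)

lemma L_e: "w \<in> L r \<Longrightarrow> br e w \<in> L r"
  using eW by (auto simp: L_def brs)

lemma L_x: "w \<in> L r \<Longrightarrow> br x w \<in> L r"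
  using xW by (auto simp: L_def brs comm_xe[symmetric])

lemma L_Int: "w \<in> L r \<Longrightarrow> w \<in> L r' \<Longrightarrow> r \<noteq> r' \<Longrightarrow> w = 0"
  by (auto simp: L_def)

text \<open>Applying \<open>D^2 - r1'\<close> to the product leaves the component on which
  \<open>D^2\<close> is \<open>r2'\<close>. It is equivariant, so it vanishes without
  resonance.\<close>

lemma pr_L_component:
  assumes r: "r \<noteq> 0" and r1: "(r2' - r - r')\<^sup>2 \<noteq> 4 * r * r'"
    and split: "\<And>w. w \<in> W \<Longrightarrow> br e (br e (br e (br e w) - r1' *\<^sub>R w)) = r2' *\<^sub>R (br e (br e w) - r1' *\<^sub>R w)"
    and uv: "u \<in> L r" "v \<in> L r'"
  shows "pr (br u v) \<in> L r1'"
proof -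
  define t where "t u v = br e (br e (pr (br u v))) - r1' *\<^sub>R pr (br u v)" for u v
  have "t u v = 0"
  proof (rule semisimple_equivariant_zero[of r "L r" "br e" "L r'" "br e" t r' "br e" r2'])
    show "t (br e (br e u)) v = r *\<^sub>R t u v" if "u \<in> L r" "v \<in> L r'" for u v
      using L_D2[OF that(1)] by (simp add: t_def brs prs algebra_simps)
    show "t u (br e (br e v)) = r' *\<^sub>R t u v" if "u \<in> L r" "v \<in> L r'" for u v
      using L_D2[OF that(2)] by (simp add: t_def brs prs algebra_simps)
    show "br e (t u v) = t (br e u) v + t u (br e v)" for u v
      by (simp add: t_def t_e[of u v] brs scaleR_right_distrib)
    show "br e (br e (t u v)) = r2' *\<^sub>R t u v" for u v
      unfolding t_def using split[OF pr(1)] .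
  qed (use assms L_e in \<open>auto simp: brs\<close>)
  then show ?thesis using pr(1) by (simp add: t_def L_def)
qed

end

text \<open>The nilradical has codimension one.\<close>

locale g2_A = g2_cartan +
  assumes xnil: "\<And>w. w \<in> W \<Longrightarrow> \<exists>n. (br x ^^ n) w = 0"
begin

lemma ca0: "u \<in> W \<Longrightarrow> v \<in> W \<Longrightarrow> ca (br u v) = 0"
  using Null_part_nil[of u v] by (intro nilpotent_pencil[OF xnil, of "ca (br u v)" "cp (br u v)"]) blast+

lemma \<omega>_x_skew: "u \<in> W \<Longrightarrow> v \<in> W \<Longrightarrow> \<omega> (br x u) v + \<omega> u (br x v) = 0"
  using \<omega>_x_adj ca0 by simp

end

text \<open>The nilradical has codimension two.\<close>

locale g2_B = g2_cartan +
  assumes nonil: "\<And>s t. (\<And>w. w \<in> W \<Longrightarrow> \<exists>n. (br (s *\<^sub>R e + t *\<^sub>R x) ^^ n) w = 0) \<Longrightarrow> s = 0 \<and> t = 0"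
begin

lemma ca0: "u \<in> W \<Longrightarrow> v \<in> W \<Longrightarrow> ca (br u v) = 0"
  and cp0: "u \<in> W \<Longrightarrow> v \<in> W \<Longrightarrow> cp (br u v) = 0"
  using Null_part_nil[of u v] nonil[of "ca (br u v)" "cp (br u v)"] by blast+

sublocale g2_torus by unfold_locales (use ca0 cp0 in auto)

end

locale g2_split = g2_torus +
  fixes r1 r2
  assumes r12: "r1 \<noteq> r2" and W_split: "\<And>w. w \<in> W \<Longrightarrow> \<exists>a\<in>L r1. \<exists>b\<in>L r2. w = a + b"
    and L_nz: "L r1 \<noteq> {0}" "L r2 \<noteq> {0}"
begin

lemma r_nz: "r1 \<noteq> 0" "r2 \<noteq> 0"
proof -
  have "r \<noteq> 0" if Lr: "L r \<noteq> {0}" for r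
  proof
    assume "r = 0"
    obtain a where a: "a \<in> L r" "a \<noteq> 0" using Lr subspace_0[OF L_sub] by blast
    then have "br e (br e a) = 0" using \<open>r = 0\<close> L_D2[OF a(1)] by simp
    then have "br e a = 0" using inj_e eW L_W a by blast
    then show False using inj_e L_W a by blast
  qed
  then show "r1 \<noteq> 0" "r2 \<noteq> 0" using L_nz by auto
qed

text \<open>Moving \<open>ad e\<close> from one argument to the other twice gives
  \<open>r1 f a b = r2 f a b\<close>.\<close>

lemma skew_pair_zero:
  assumes "\<And>a b. a \<in> A \<Longrightarrow> b \<in> L r2 \<Longrightarrow> f (br e a) b + f a (br e b) = (0 :: real)"
    and A: "A \<subseteq> L r1" "\<And>a. a \<in> A \<Longrightarrow> br e a \<in> A"
    and lin: "\<And>s a b. f (s *\<^sub>R a) b = s * f a b" "\<And>s a b. f a (s *\<^sub>R b) = s * f a b"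
    and ab: "a \<in> A" "b \<in> L r2"
  shows "f a b = 0"
proof -
  have "f (br e (br e a)) b = - f (br e a) (br e b)" using assms(1)[of "br e a" b] A ab by (simp add: eq_neg_iff_add_eq_0)
  also have "\<dots> = f a (br e (br e b))" using assms(1)[of a "br e b"] ab L_e by (simp add: eq_neg_iff_add_eq_0 add.commute)
  finally have "(r1 - r2) * f a b = 0" using L_D2[of a r1] L_D2[of b r2] ab A(1) by (auto simp: lin algebra_simps)
  then show ?thesis using r12 by simp
qed

lemma \<omega>_orth: "a \<in> L r1 \<Longrightarrow> b \<in> L r2 \<Longrightarrow> \<omega> a b = 0"
  by (rule skew_pair_zero[of "L r1"]) (use D_skew L_W L_e in \<open>auto simp: \<omega>s\<close>)

lemma plane_basis:
  obtains u v x1 x2 where "u \<in> L r1" "v \<in> L r2" "\<omega> u (br e u) \<noteq> 0" "\<omega> v (br e v) \<noteq> 0"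
    "frame [u, br e u, v, br e v]" "br x u = x1 *\<^sub>R br e u" "br x v = x2 *\<^sub>R br e v"
  by (rule orthogonal_plane_basis[of "L r1" r1 "L r2" r2])
    (use L_W L_D2 L_sub L_e L_x L_nz W_split \<omega>_orth in auto)

lemma split_poly:
  "w \<in> W \<Longrightarrow> br e (br e (br e (br e w) - r1 *\<^sub>R w)) = r2 *\<^sub>R (br e (br e w) - r1 *\<^sub>R w)"
  "w \<in> W \<Longrightarrow> br e (br e (br e (br e w) - r2 *\<^sub>R w)) = r1 *\<^sub>R (br e (br e w) - r2 *\<^sub>R w)"
proof -
  assume "w \<in> W"
  then obtain a b where ab: "a \<in> L r1" "b \<in> L r2" "w = a + b" using W_split by blast
  show "br e (br e (br e (br e w) - r1 *\<^sub>R w)) = r2 *\<^sub>R (br e (br e w) - r1 *\<^sub>R w)"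
    using L_D2[OF ab(1)] L_D2[OF ab(2)] by (simp add: ab(3) brs algebra_simps)
  show "br e (br e (br e (br e w) - r2 *\<^sub>R w)) = r1 *\<^sub>R (br e (br e w) - r2 *\<^sub>R w)"
    using L_D2[OF ab(1)] L_D2[OF ab(2)] by (simp add: ab(3) brs algebra_simps)
qed

lemma cq_L12: "a \<in> L r1 \<Longrightarrow> b \<in> L r2 \<Longrightarrow> cq (br a b) = 0"
  by (rule skew_pair_zero[of "L r1" "\<lambda>a b. cq (br a b)"])
    (use q_e cp0 L_W L_e in \<open>auto simp: brs cqs\<close>)

end

locale g2_split_A = g2_split + g2_A
begin

lemma nilpotent_multiple:
  assumes u: "u \<in> L r" "u \<noteq> 0" and X: "br x u = s *\<^sub>R br e u" and r: "r \<noteq> 0"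
  shows "s = 0"
proof -
  obtain m where m: "(br x ^^ m) u = 0" using xnil L_W u by blast
  have "br x (br x u) = (s * s * r) *\<^sub>R u" using comm_xe[of u] L_D2[OF u(1)] by (simp add: X brs)
  then show ?thesis using nilpotent_square_eigenvalue[OF lin2 m u(2)] r by fastforce
qed

lemma x_zero: assumes "w \<in> W" shows "br x w = 0"
proof -
  obtain u v x1 x2 where uv: "u \<in> L r1" "v \<in> L r2" "\<omega> u (br e u) \<noteq> 0" "\<omega> v (br e v) \<noteq> 0"
    "frame [u, br e u, v, br e v]" "br x u = x1 *\<^sub>R br e u" "br x v = x2 *\<^sub>R br e v" by (rule plane_basis)
  have "u \<noteq> 0" "v \<noteq> 0" using uv by (auto simp: \<omega>s)
  then have "x1 = 0" "x2 = 0" using nilpotent_multiple uv r_nz by blast+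
  then have X: "br x u = 0" "br x (br e u) = 0" "br x v = 0" "br x (br e v) = 0"
    using uv(6,7) by (simp_all add: comm_xe brs)
  have "u \<in> W" "br e u \<in> W" "v \<in> W" "br e v \<in> W" using uv L_W eW by auto
  then obtain a b s t where "w = a *\<^sub>R u + b *\<^sub>R br e u + s *\<^sub>R v + t *\<^sub>R br e v" using W_coords[OF uv(5) _ _ _ _ assms] by metis
  then show ?thesis by (simp add: X brs)
qed

text \<open>Without the resonance, \<open>[L r1, L r2]\<close> lies in \<open>L r1\<close> and
  \<open>[L r2, L r2]\<close> on the line of \<open>z\<close>. The operators \<open>ad b\<close>
  with \<open>b\<close> in \<open>L r2\<close> then commute and are nilpotent on
  \<open>L r1\<close>. For a common kernel vector \<open>a\<close>, some \<open>a + s z\<close> has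
  the isotropic 4-plane \<open>z, x, b, b'\<close>.\<close>

lemma False_if_not_resonant:
  assumes res: "r1 \<noteq> 4 * r2"
  shows False
proof -
  have r12': "r1 \<noteq> r2" by (rule r12)
  have r12: "r1 * r1 \<noteq> 4 * r1 * r2" using res r_nz by simp
  have t12: "pr (br a b) \<in> L r1" if "a \<in> L r1" "b \<in> L r2" for a b
    by (rule pr_L_component[OF r_nz(1) _ split_poly(1) that])
      (use r12 in \<open>auto simp: power2_eq_square algebra_simps\<close>)
  have t22: "pr (br b b') = 0" if "b \<in> L r2" "b' \<in> L r2" for b b'
  proof (rule L_Int[OF _ _ r12'])
    show "pr (br b b') \<in> L r1"
      by (rule pr_L_component[OF r_nz(2) _ split_poly(1) that])
        (use r_nz in \<open>auto simp: power2_eq_square algebra_simps\<close>)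
    show "pr (br b b') \<in> L r2"
      by (rule pr_L_component[OF r_nz(2) _ split_poly(2) that])
        (use r12 in \<open>auto simp: power2_eq_square algebra_simps\<close>)
  qed
  have b12: "br a b \<in> L r1" if "a \<in> L r1" "b \<in> L r2" for a b
  proof -
    have "br a b = pr (br a b)"
      using coords[of "br a b"] ca0[OF L_W[OF that(1)] L_W[OF that(2)]] cp0[OF L_W[OF that(1)] L_W[OF that(2)]] cq_L12[OF that]
      by simp
    then show ?thesis using t12[OF that] by simp
  qed
  have b22: "br b b' = cq (br b b') *\<^sub>R z" if "b \<in> L r2" "b' \<in> L r2" for b b'
    using coords[of "br b b'"] ca0[OF L_W[OF that(1)] L_W[OF that(2)]] cp0[OF L_W[OF that(1)] L_W[OF that(2)]] t22[OF that]
    by simp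
  obtain a where a: "a \<in> L r1" "a \<noteq> 0" "\<And>C. C \<in> {br b | b. b \<in> L r2} \<Longrightarrow> C a = 0"
  proof (rule commuting_nilpotent_kernel[of "{br b | b. b \<in> L r2}" "L r1"])
    show "linear C" if "C \<in> {br b | b. b \<in> L r2}" for C using that lin2 by blast
    show "B (C v) = C (B v)" if "B \<in> {br b | b. b \<in> L r2}" "C \<in> {br b | b. b \<in> L r2}" for B C v
    proof -
      obtain b b' where "B = br b" "b \<in> L r2" "C = br b'" "b' \<in> L r2" using \<open>B \<in> _\<close> \<open>C \<in> _\<close> by blast
      moreover from this have "br (br b b') v = 0" by (subst b22) (auto simp: brs)
      ultimately show ?thesis using jacobi[of b b' v] by simp
    qed
    show "C v \<in> L r1" if CC: "C \<in> {br b | b. b \<in> L r2}" and v: "v \<in> L r1" for C v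
    proof -
      obtain b where b: "C = br b" "b \<in> L r2" using CC by blast
      then show ?thesis using b12[OF v b(2)] anti[of b v] subspace_neg[OF L_sub] by simp
    qed
    show "\<exists>n. (C ^^ n) v = 0" if CC: "C \<in> {br b | b. b \<in> L r2}" for C v
    proof -
      obtain b where b: "C = br b" "b \<in> L r2" using CC by blast
      then show ?thesis using W_nil[OF L_W[OF b(2)]] by blast
    qed
  qed (use L_sub L_nz in auto)
  define A where "A = {a \<in> L r1. \<forall>b\<in>L r2. br a b = 0}"
  have aA: "a \<in> A"
  proof -
    have "br a b = 0" if "b \<in> L r2" for b using a(3)[of "br b"] that anti[of a b] by auto
    then show ?thesis using a by (simp add: A_def)
  qed
  have Ae: "br e a \<in> A" if "a \<in> A" for a
  proof -
    have "br (br e a) b = 0" if "b \<in> L r2" for b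
      using \<open>a \<in> A\<close> that L_e[of b r2] by (simp add: A_def br_br)
    then show ?thesis using that L_e by (simp add: A_def)
  qed
  have AL: "A \<subseteq> L r1" by (auto simp: A_def)
  have zx: "\<phi> z x w = 0" if "w \<in> W" for w
    using \<omega>_\<phi>[of x w] x_zero[OF that] \<omega>_Null_Range[OF xN that] subspace_0[OF sN] by simp
  have zab: "\<phi> z a b = 0" if "a \<in> A" "b \<in> L r2" for a b
    using \<omega>_\<phi>[of a b] that \<omega>_orth[of a b] subspace_0[OF sN] by (auto simp: A_def)
  have xab: "\<phi> x a b = 0" if ab: "a \<in> A" "b \<in> L r2" for a b
  proof (rule skew_pair_zero[of A "\<phi> x", OF _ AL Ae _ _ ab])
    fix a b assume ab: "a \<in> A" "b \<in> L r2"
    have W: "a \<in> W" "b \<in> W" using ab AL L_W by auto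
    have "br a b = 0" using ab by (simp add: A_def)
    then show "\<phi> x (br e a) b + \<phi> x a (br e b) = 0"
      using closed4[of e x a b] zab[OF ab] x_zero[OF W(1)] x_zero[OF W(2)]
        \<phi>_anti(1)[of "br e a" x b] \<phi>_cyc[of "br e b" x a] by (simp add: ex \<phi>s)
  qed (auto simp: \<phi>s)
  obtain u v x1 x2 where uv: "u \<in> L r1" "v \<in> L r2" "\<omega> u (br e u) \<noteq> 0" "\<omega> v (br e v) \<noteq> 0"
    "frame [u, br e u, v, br e v]" "br x u = x1 *\<^sub>R br e u" "br x v = x2 *\<^sub>R br e v" by (rule plane_basis)
  define b where "b = v"
  define b' where "b' = (1 / \<omega> v (br e v)) *\<^sub>R br e v"
  have b: "b \<in> L r2" "b' \<in> L r2" "\<omega> b b' = 1"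
    using uv L_e subspace_scale[OF L_sub] by (auto simp: b_def b'_def \<omega>s)
  have zb: "\<phi> z b b' = 1" using \<omega>_\<phi>[of b b'] b22[OF b(1,2)] z_Null b(3) by metis
  define s where "s = - \<phi> a b b'"
  have frb: "frame [b, b']" by (rule frame_pair) (simp add: b)
  have "a \<notin> span (set [b, b'])"
  proof
    assume "a \<in> span (set [b, b'])"
    moreover have "span (set [b, b']) \<subseteq> L r2" by (rule span_minimal) (use b L_sub in auto)
    ultimately show False using a L_Int r12' by blast
  qed
  then have "frame [a, b, b']" using frb by (simp add: frame_Cons)
  then have "frame ([x, e, z] @ [a, b, b'])" by (rule frame_Null_W) (use a b L_W in auto)
  then have fr: "frame [a, z, x, b, b']" by (rule frame_subset) (use \<open>frame ([x, e, z] @ [a, b, b'])\<close> in \<open>auto simp: frame_def\<close>)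
  have fr': "frame [a + s *\<^sub>R z, z, x, b, b']"
    by (rule frame_add_span[OF fr]) (intro span_scale span_base, simp)
  show False
  proof (rule isotropic[OF fr'])
    have aW: "a \<in> W" "b \<in> W" "b' \<in> W" using a b L_W by auto
    show "\<phi> (a + s *\<^sub>R z) z x = 0" using zx[OF aW(1)] \<phi>_cyc[of a z x] by (simp add: \<phi>s)
    show "\<phi> (a + s *\<^sub>R z) z b = 0" "\<phi> (a + s *\<^sub>R z) z b' = 0"
      using zab[OF aA b(1)] zab[OF aA b(2)] \<phi>_anti(1)[of a z b] \<phi>_anti(1)[of a z b'] by (simp_all add: \<phi>s)
    show "\<phi> (a + s *\<^sub>R z) x b = 0" "\<phi> (a + s *\<^sub>R z) x b' = 0"
      using xab[OF aA b(1)] xab[OF aA b(2)] \<phi>_anti(1)[of a x b] \<phi>_anti(1)[of a x b']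
        zx[OF aW(2)] zx[OF aW(3)] by (simp_all add: \<phi>s)
    show "\<phi> (a + s *\<^sub>R z) b b' = 0" by (simp add: \<phi>s zb s_def)
  qed
qed

end

text \<open>The relations \<open>r1 = 4 r2\<close> and \<open>r2 = 4 r1\<close> exclude each other
  for non-zero eigenvalues, so one ordering of the eigenspaces is free of resonance.\<close>

lemma (in g2_split_A) split_A_False: False
proof (cases "r1 = 4 * r2")
  case False
  then show ?thesis by (rule False_if_not_resonant)
next
  case True
  interpret sw: g2_split_A br \<phi> z e \<omega> x c r2 r1
  proof unfold_locales
    show "\<exists>a\<in>L r2. \<exists>b\<in>L r1. w = a + b" if "w \<in> W" for w
      using W_split[OF that] by (metis add.commute)
  qed (use ca0 cp0 r12 L_nz in auto)
  have "r2 \<noteq> 4 * r1" using True r_nz by auto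
  then show ?thesis by (rule sw.False_if_not_resonant)
qed

section \<open>Pfaffians of a definite form\<close>

context g2
begin

text \<open>The Pfaffian of the 4 x 4 matrix of \<open>\<phi> y\<close> on
  \<open>a, b, c, d\<close>.\<close>

definition pf :: "real^7 \<Rightarrow> real^7 \<Rightarrow> real^7 \<Rightarrow> real^7 \<Rightarrow> real^7 \<Rightarrow> real" where
  "pf a b c d y = \<phi> y a b * \<phi> y c d - \<phi> y a c * \<phi> y b d + \<phi> y a d * \<phi> y b c"

text \<open>A zero Pfaffian yields a vector \<open>w\<close> of the 4-space with
  \<open>\<phi> y w\<close> zero on it. As \<open>\<phi>\<close> itself vanishes on the 4-space,
  \<open>y\<close> together with three further directions is isotropic for
  \<open>\<phi> w\<close>.\<close>

lemma pf_nonzero: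
  assumes fr: "frame [y, a, b, c, d]"
    and co: "\<phi> a b c = 0" "\<phi> a b d = 0" "\<phi> a c d = 0" "\<phi> b c d = 0"
  shows "pf a b c d y \<noteq> 0"
proof
  assume pf: "pf a b c d y = 0"
  let ?W = "span {a, b, c, d}"
  have fW: "frame [a, b, c, d]" and yW: "y \<notin> ?W" using fr by (auto simp: frame_Cons)
  have dW: "dim ?W = 4" using frame_dim[OF fW] by simp
  have Wz: "\<phi> u v w = 0" if "u \<in> ?W" "v \<in> ?W" "w \<in> ?W" for u v w
  proof -
    have g: "\<phi> u v w = 0" if "u \<in> {a, b, c, d}" "v \<in> {a, b, c, d}" "w \<in> {a, b, c, d}" for u v w
    proof -
      have p: "\<phi> u w v = 0 \<and> \<phi> v u w = 0 \<and> \<phi> v w u = 0 \<and> \<phi> w u v = 0 \<and> \<phi> w v u = 0" if "\<phi> u v w = 0" for u v w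
        using that \<phi>_anti(2)[of u w v] \<phi>_anti(1)[of v u w] \<phi>_cyc[of u v w] \<phi>_cyc[of w u v]
          \<phi>_anti(1)[of w v u] \<phi>_cyc[of v u w] by simp
      show ?thesis using that co p[OF co(1)] p[OF co(2)] p[OF co(3)] p[OF co(4)] by auto
    qed
    have "?W \<subseteq> {w. \<phi> u v w = 0}" if "u \<in> {a, b, c, d}" "v \<in> {a, b, c, d}" for u v
      by (rule span_minimal) (use g[OF that] in \<open>auto simp: subspace_def \<phi>s\<close>)
    then have "?W \<subseteq> {v. \<phi> u v w = 0}" if "u \<in> {a, b, c, d}" "w \<in> ?W" for u w
      by (intro span_minimal) (use that in \<open>auto simp: subspace_def \<phi>s\<close>)
    then have "?W \<subseteq> {u. \<phi> u v w = 0}" if "v \<in> ?W" "w \<in> ?W" for v w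
      by (intro span_minimal) (use that in \<open>auto simp: subspace_def \<phi>s\<close>)
    then show ?thesis using that by blast
  qed
  have "\<exists>w\<in>?W. w \<noteq> 0 \<and> (\<forall>v\<in>?W. \<phi> y w v = 0)"
  proof -
    have ker: ?thesis if w: "w \<in> ?W" "w \<noteq> 0" "\<phi> y w a = 0" "\<phi> y w b = 0" "\<phi> y w c = 0" "\<phi> y w d = 0" for w
    proof -
      have "?W \<subseteq> {v. \<phi> y w v = 0}"
        by (rule span_minimal) (use w in \<open>auto simp: subspace_def \<phi>s\<close>)
      then show ?thesis using w by blast
    qed
    have sw: "\<phi> y b a = - \<phi> y a b" "\<phi> y c a = - \<phi> y a c" "\<phi> y d a = - \<phi> y a d"
      "\<phi> y c b = - \<phi> y b c" "\<phi> y d b = - \<phi> y b d" "\<phi> y d c = - \<phi> y c d" by (rule \<phi>_anti(2))+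
    have mem: "s *\<^sub>R a + t *\<^sub>R b + u *\<^sub>R c + v *\<^sub>R d \<in> ?W" for s t u v
      by (intro span_add span_scale span_base) auto
    have nz: "s *\<^sub>R a + t *\<^sub>R b + u *\<^sub>R c + v *\<^sub>R d \<noteq> 0" if "s \<noteq> 0 \<or> t \<noteq> 0 \<or> u \<noteq> 0 \<or> v \<noteq> 0" for s t u v
      using fW that unfolding frame_explicit by blast
    \<comment> \<open>Kernel candidates are the rows of the Pfaffian adjoint, whose product with the
      matrix is a multiple of the Pfaffian; one of them is non-zero unless the matrix is 0.\<close>
    have row: ?thesis if "s \<noteq> 0 \<or> t \<noteq> 0 \<or> u \<noteq> 0 \<or> v \<noteq> 0"
      "- t * \<phi> y a b - u * \<phi> y a c - v * \<phi> y a d = 0" "s * \<phi> y a b - u * \<phi> y b c - v * \<phi> y b d = 0"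
      "s * \<phi> y a c + t * \<phi> y b c - v * \<phi> y c d = 0" "s * \<phi> y a d + t * \<phi> y b d + u * \<phi> y c d = 0" for s t u v
      by (rule ker[OF mem nz[OF that(1)]]) (use that(2-) in \<open>auto simp: \<phi>s sw\<close>)
    have P: "\<phi> y a b * \<phi> y c d = \<phi> y a c * \<phi> y b d - \<phi> y a d * \<phi> y b c"
      using pf by (simp add: pf_def)
    consider "\<phi> y c d \<noteq> 0 \<or> \<phi> y b d \<noteq> 0 \<or> \<phi> y b c \<noteq> 0" | "\<phi> y a d \<noteq> 0 \<or> \<phi> y a c \<noteq> 0 \<or> \<phi> y a b \<noteq> 0"
      | "\<phi> y c d = 0" "\<phi> y b d = 0" "\<phi> y b c = 0" "\<phi> y a d = 0" "\<phi> y a c = 0" "\<phi> y a b = 0" by blast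
    then show ?thesis
    proof cases
      case 1
      show ?thesis by (rule row[of 0 "\<phi> y c d" "- \<phi> y b d" "\<phi> y b c"]) (use 1 P in \<open>auto simp: algebra_simps\<close>)
    next
      case 2
      show ?thesis
      proof (cases "\<phi> y c d = 0")
        case True
        show ?thesis
        proof (cases "\<phi> y a d = 0 \<and> \<phi> y a c = 0")
          case False
          then show ?thesis using True P
            by (intro row[of "- \<phi> y c d" 0 "\<phi> y a d" "- \<phi> y a c"]) (auto simp: algebra_simps)
        next
          case True
          then show ?thesis using 2 P \<open>\<phi> y c d = 0\<close>
            by (intro row[of "\<phi> y b d" "- \<phi> y a d" 0 "\<phi> y a b"]) (auto simp: algebra_simps)
        qed
      next
        case False
        then show ?thesis using P
          by (intro row[of "- \<phi> y c d" 0 "\<phi> y a d" "- \<phi> y a c"]) (auto simp: algebra_simps)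
      qed
    next
      case 3
      show ?thesis by (rule row[of 1 0 0 0]) (use 3 in auto)
    qed
  qed
  then obtain w where w: "w \<in> ?W" "w \<noteq> 0" "\<And>v. v \<in> ?W \<Longrightarrow> \<phi> y w v = 0" by blast
  have f1: "frame [w]" using w by (simp add: frame_def)
  obtain u1 where u1: "u1 \<in> ?W" "frame [u1, w]" by (rule frame_extend[OF f1 _ subspace_span[of "{a, b, c, d}"]]) (use w dW in auto)
  obtain u2 where u2: "u2 \<in> ?W" "frame [u2, u1, w]" by (rule frame_extend[OF u1(2) _ subspace_span[of "{a, b, c, d}"]]) (use w u1 dW in auto)
  obtain u3 where u3: "u3 \<in> ?W" "frame [u3, u2, u1, w]" by (rule frame_extend[OF u2(2) _ subspace_span[of "{a, b, c, d}"]]) (use w u1 u2 dW in auto)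
  have "span (set [u3, u2, u1, w]) \<subseteq> ?W" by (rule span_minimal) (use w u1 u2 u3 in auto)
  then have "frame [y, u3, u2, u1, w]" using u3 yW by (auto simp: frame_Cons)
  then have "frame [w, y, u1, u2, u3]" by (rule frame_permute) auto
  then show False
    by (rule isotropic) (use w u1 u2 u3 Wz \<phi>_anti(1)[of w y] in auto)
qed

text \<open>The line through \<open>y1\<close> and \<open>y2\<close> avoids the 4-space, so
  \<open>pf\<close> has no zero on it, and the intermediate value theorem fixes its sign.\<close>

lemma pf_sign:
  assumes fr: "frame [y1, y2, a, b, c, d]"
    and co: "\<phi> a b c = 0" "\<phi> a b d = 0" "\<phi> a c d = 0" "\<phi> b c d = 0"
  shows "pf a b c d y1 * pf a b c d y2 > 0"
proof (rule ccontr)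
  assume neg: "\<not> ?thesis"
  define g where "g t = pf a b c d ((1 - t) *\<^sub>R y1 + t *\<^sub>R y2)" for t :: real
  have nz: "g t \<noteq> 0" for t
    unfolding g_def
  proof (rule pf_nonzero[OF _ co])
    let ?y = "(1 - t) *\<^sub>R y1 + t *\<^sub>R y2" and ?W = "span {a, b, c, d}"
    have y: "y1 \<notin> span {y2, a, b, c, d}" "y2 \<notin> ?W" "frame [a, b, c, d]" using fr by (auto simp: frame_Cons)
    have mono: "?W \<subseteq> span {y2, a, b, c, d}" by (intro span_mono) auto
    have "?y \<notin> ?W"
    proof
      assume h: "?y \<in> ?W"
      have "t = 1"
      proof (rule ccontr)
        assume "t \<noteq> 1"
        have "?y - t *\<^sub>R y2 \<in> span {y2, a, b, c, d}"
          using h mono by (intro span_diff span_scale) (auto intro: span_base)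
        then have "(1 - t) *\<^sub>R y1 \<in> span {y2, a, b, c, d}" by simp
        from span_scale[OF this, of "1 / (1 - t)"] show False using y \<open>t \<noteq> 1\<close> by simp
      qed
      then show False using h y by simp
    qed
    then show "frame [?y, a, b, c, d]" using y by (simp add: frame_Cons)
  qed
  have cont: "continuous_on {0..1} g" unfolding g_def pf_def \<phi>s by (intro continuous_intros)
  have 01: "g 0 = pf a b c d y1" "g 1 = pf a b c d y2" by (simp_all add: g_def)
  have "\<exists>t. g t = 0"
  proof (cases "g 0 \<le> 0")
    case True
    then have "g 1 \<ge> 0" using neg nz[of 0] 01 by (metis less_eq_real_def linorder_not_less mult_neg_neg)
    then show ?thesis using IVT'[of g 0 0 1] True cont by auto
  next
    case False
    then have "g 1 \<le> 0" using neg 01 by (simp add: zero_less_mult_iff)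
    then show ?thesis using IVT2'[of g 1 0 0] False cont by auto
  qed
  then show False using nz by blast
qed

end

context g2_cartan
begin

text \<open>\<open>ad e\<close> is skew, hence its square is self-adjoint and satisfies a quadratic
  equation. A scalar square is counted under \<open>double\<close>, even if the quadratic has
  distinct roots.\<close>

lemma trichotomy:
  assumes cp0: "\<And>u v. u \<in> W \<Longrightarrow> v \<in> W \<Longrightarrow> cp (br u v) = 0"
  obtains (split) r1 r2 where "r1 \<noteq> r2" "\<And>w. w \<in> W \<Longrightarrow> \<exists>a\<in>L r1. \<exists>b\<in>L r2. w = a + b" "L r1 \<noteq> {0}" "L r2 \<noteq> {0}"
  | (complex) \<tau> \<delta> where "\<tau>\<^sup>2 < 4 * \<delta>"
      "\<And>w. w \<in> W \<Longrightarrow> br e (br e (br e (br e w))) = \<tau> *\<^sub>R br e (br e w) - \<delta> *\<^sub>R w"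
  | (double) r where "r \<noteq> 0"
      "\<And>w. w \<in> W \<Longrightarrow> br e (br e (br e (br e w) - r *\<^sub>R w)) = r *\<^sub>R (br e (br e w) - r *\<^sub>R w)"
proof -
  have skew: "\<omega> (br e u) v = - \<omega> u (br e v)" if "u \<in> W" "v \<in> W" for u v
    using \<omega>_e_adj[of u v] cp0[OF that] by simp
  have l2: "linear (\<lambda>w. br e (br e w))" using linear_compose[OF lin2 lin2] by (simp add: o_def)
  obtain \<tau> \<delta> where A: "\<And>w. w \<in> W \<Longrightarrow> br e (br e (br e (br e w))) = \<tau> *\<^sub>R br e (br e w) - \<delta> *\<^sub>R w"
    by (rule self_adjoint_quadratic[OF sW dim4 \<omega>_bil \<omega>_self \<omega>_nd_Range l2])
      (use eW skew in auto)
  have inj2: "w = 0" if "w \<in> W" "br e (br e w) = 0" for w using inj_e eW that by blast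
  show thesis
  proof (cases "\<tau>\<^sup>2 < 4 * \<delta>")
    case True
    then show ?thesis using complex A by blast
  next
    case False
    define s where "s = sqrt (\<tau>\<^sup>2 - 4 * \<delta>)"
    have s: "s * s = \<tau> * \<tau> - 4 * \<delta>" using False by (simp add: s_def power2_eq_square)
    define r1 where "r1 = (\<tau> + s) / 2"
    define r2 where "r2 = (\<tau> - s) / 2"
    have rs: "r1 + r2 = \<tau>" "r1 * r2 = \<delta>" using s by (auto simp: r1_def r2_def field_simps)
    have A': "br e (br e (br e (br e w) - r1 *\<^sub>R w)) = r2 *\<^sub>R (br e (br e w) - r1 *\<^sub>R w)"
      "br e (br e (br e (br e w) - r2 *\<^sub>R w)) = r1 *\<^sub>R (br e (br e w) - r2 *\<^sub>R w)" if "w \<in> W" for w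
      using A[OF that] by (auto simp: brs rs[symmetric] algebra_simps)
    have mem: "br e (br e w) - r *\<^sub>R w \<in> W" if "w \<in> W" for w r
      using that eW sW by (intro subspace_diff subspace_scale) auto
    have scalar: thesis if "\<And>w. w \<in> W \<Longrightarrow> br e (br e w) = r *\<^sub>R w" for r
    proof (rule double[of r])
      show "r \<noteq> 0" using inj2 that W_nz by (metis scaleR_zero_left)
      show "br e (br e (br e (br e w) - r *\<^sub>R w)) = r *\<^sub>R (br e (br e w) - r *\<^sub>R w)" if "w \<in> W" for w
        using \<open>\<And>w. w \<in> W \<Longrightarrow> br e (br e w) = r *\<^sub>R w\<close>[OF that] by simp
    qed
    show ?thesis
    proof (cases "s = 0")
      case True
      then have r: "r1 = r2" by (simp add: r1_def r2_def)
      have "r1 \<noteq> 0"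
      proof
        assume "r1 = 0"
        obtain w where w: "w \<in> W" "w \<noteq> 0" using W_nz by blast
        have "br e (br e (br e (br e w))) = 0" using A'(1)[OF w(1)] r \<open>r1 = 0\<close> by simp
        then show False using inj2 eW w by blast
      qed
      then show ?thesis using double[of r1] A'(1) r by simp
    next
      case False
      then have ne: "r1 \<noteq> r2" by (simp add: r1_def r2_def)
      have sp: "\<exists>a\<in>L r1. \<exists>b\<in>L r2. w = a + b" if "w \<in> W" for w
      proof (intro bexI)
        let ?a = "(1 / (r1 - r2)) *\<^sub>R (br e (br e w) - r2 *\<^sub>R w)"
        let ?b = "(- (1 / (r1 - r2))) *\<^sub>R (br e (br e w) - r1 *\<^sub>R w)"
        show "?a \<in> L r1" "?b \<in> L r2"
          using A'[OF that] mem[OF that] sW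
          by (auto simp: L_def brs subspace_scale subspace_neg simp del: scaleR_minus_left)
        have "k *\<^sub>R (a - r2 *\<^sub>R w) + (- k) *\<^sub>R (a - r1 *\<^sub>R w) = (k * (r1 - r2)) *\<^sub>R w" for k a
          by (simp add: algebra_simps)
        from this[of "1 / (r1 - r2)" "br e (br e w)"] show "w = ?a + ?b" using ne by simp
      qed
      show ?thesis
      proof (cases "L r1 = {0} \<or> L r2 = {0}")
        case False
        then show ?thesis using split[of r1 r2] ne sp by blast
      next
        case True
        then show ?thesis
        proof
          assume "L r1 = {0}"
          then have "br e (br e w) = r2 *\<^sub>R w" if "w \<in> W" for w using sp[OF that] by (auto simp: L_def)
          then show ?thesis by (rule scalar)
        next
          assume "L r2 = {0}"
          then have "br e (br e w) = r1 *\<^sub>R w" if "w \<in> W" for w using sp[OF that] by (auto simp: L_def)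
          then show ?thesis by (rule scalar)
        qed
      qed
    qed
  qed
qed

end

section \<open>A single eigenvalue: the Jordan decomposition of ad e\<close>

locale g2_double = g2_cartan +
  fixes r
  assumes r0: "r \<noteq> 0"
    and double: "\<And>w. w \<in> W \<Longrightarrow> br e (br e (br e (br e w) - r *\<^sub>R w)) = r *\<^sub>R (br e (br e w) - r *\<^sub>R w)"
begin

text \<open>The nilpotent Jordan part as a polynomial in \<open>D = ad e\<close>: if
  \<open>D = S + N\<close> with commuting \<open>S\<close>, \<open>N\<close> and
  \<open>S^2 = r\<close>, \<open>N^2 = 0\<close>, then \<open>D^2 - r = 2 S N\<close> and
  \<open>D (D^2 - r) = 2 r N\<close>.\<close>

definition NN :: "real^7 \<Rightarrow> real^7" where "NN w = (1 / (2 * r)) *\<^sub>R br e (br e (br e w) - r *\<^sub>R w)"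
definition SS :: "real^7 \<Rightarrow> real^7" where "SS w = br e w - NN w"

lemma D_SN: "br e w = SS w + NN w" by (simp add: SS_def)

lemma NN_linear: "linear NN" unfolding NN_def[abs_def] by (rule linearI) (simp_all add: brs algebra_simps)
lemma SS_linear: "linear SS" unfolding SS_def[abs_def] by (rule linearI) (simp_all add: brs linear_rules[OF NN_linear] algebra_simps)

lemmas SNs = linear_rules[OF NN_linear] linear_rules[OF SS_linear]

lemma M_W: "w \<in> W \<Longrightarrow> br e (br e w) - r *\<^sub>R w \<in> W"
  using eW sW by (intro subspace_diff subspace_scale) auto

lemma NN_W: "w \<in> W \<Longrightarrow> NN w \<in> W" using M_W eW sW by (auto simp: NN_def intro: subspace_scale)
lemma SS_W: "w \<in> W \<Longrightarrow> SS w \<in> W" using NN_W eW sW by (auto simp: SS_def intro: subspace_diff)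

lemma D2_NN: "w \<in> W \<Longrightarrow> br e (br e (NN w)) = r *\<^sub>R NN w"
  using double[of w] by (simp only: NN_def brs(4) brs(10)) (simp add: brs algebra_simps)

lemma NN_NN: "w \<in> W \<Longrightarrow> NN (NN w) = 0"
  using D2_NN[of w] by (simp add: NN_def[of "NN w"])

lemma NN_e: "NN (br e w) = br e (NN w)" by (simp add: NN_def brs)
lemma NN_x: "NN (br x w) = br x (NN w)" by (simp add: NN_def brs comm_xe[symmetric])
lemma SS_x: "SS (br x w) = br x (SS w)" by (simp add: SS_def NN_x brs comm_xe[symmetric])
lemma SN_comm: "SS (NN w) = NN (SS w)" by (simp add: SS_def SNs NN_e)

lemma SS_NN: "w \<in> W \<Longrightarrow> SS (NN w) = br e (NN w)" by (simp add: SS_def NN_NN)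

lemma D_NN: "w \<in> W \<Longrightarrow> 2 *\<^sub>R br e (NN w) = br e (br e w) - r *\<^sub>R w"
proof -
  assume w: "w \<in> W"
  have "br e (br e (br e (br e w) - r *\<^sub>R w)) = r *\<^sub>R (br e (br e w) - r *\<^sub>R w)" by (rule double[OF w])
  then have "2 *\<^sub>R br e (NN w) = (2 * (1 / (2 * r)) * r) *\<^sub>R (br e (br e w) - r *\<^sub>R w)"
    by (simp add: NN_def brs(4))
  then show ?thesis using r0 by simp
qed

lemma SS_SS: "w \<in> W \<Longrightarrow> SS (SS w) = r *\<^sub>R w"
proof -
  assume w: "w \<in> W"
  have "SS (SS w) = br e (br e w) - br e (NN w) - SS (NN w)"
    by (simp add: SS_def SNs NN_e brs)
  also have "\<dots> = br e (br e w) - 2 *\<^sub>R br e (NN w)" using SS_NN[OF w] by (simp add: scaleR_2)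
  finally show ?thesis using D_NN[OF w] by simp
qed

text \<open>Here all three squares are \<open>r\<close>, and resonance would mean
  \<open>r^2 = 4 r^2\<close>.\<close>

lemma semisimple_zero:
  assumes "\<And>u v. u \<in> W \<Longrightarrow> v \<in> W \<Longrightarrow> f u v \<in> W"
    and "\<And>u v. u \<in> W \<Longrightarrow> v \<in> W \<Longrightarrow> SS (f u v) = f (SS u) v + f u (SS v)"
    and "\<And>a u v. f (a *\<^sub>R u) v = a *\<^sub>R f u v" "\<And>a u v. f u (a *\<^sub>R v) = a *\<^sub>R f u v"
    and "u \<in> W" "v \<in> W"
  shows "f u v = 0"
proof (rule semisimple_equivariant_zero[of r W SS W SS f r SS r])
  show "SS (SS (f u v)) = r *\<^sub>R f u v" if "u \<in> W" "v \<in> W" for u v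
    by (rule SS_SS[OF assms(1)[OF that]])
  show "f (SS (SS u)) v = r *\<^sub>R f u v" if "u \<in> W" for u v by (simp add: SS_SS[OF that] assms(3))
  show "f u (SS (SS v)) = r *\<^sub>R f u v" if "v \<in> W" for u v by (simp add: SS_SS[OF that] assms(4))
  show "SS (f u v) = f (SS u) v + f u (SS v)" if "u \<in> W" "v \<in> W" for u v by (rule assms(2)[OF that])
qed (use assms(5,6) SS_W r0 in \<open>auto simp: SNs power2_eq_square\<close>)

text \<open>The product is equivariant for \<open>D = SS + NN\<close>, while
  \<open>semisimple_zero\<close> needs equivariance for \<open>SS\<close>. Composites with more
  copies of \<open>NN\<close> vanish, which removes the \<open>NN\<close>-terms from the equation
  for those with fewer.\<close>

lemma pr_zero:
  assumes "u \<in> W" "v \<in> W" shows "pr (br u v) = 0"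
proof -
  define t where "t = pbr"
  note tW = pbr_W[folded t_def] and ts = pbrs[folded t_def]
  have EQ: "SS (t u v) + NN (t u v) = t (SS u) v + t (NN u) v + (t u (SS v) + t u (NN v))" for u v
    using t_e[of u v] by (simp add: t_def pbr_def D_SN brs prs)
  have NEQ: "SS (NN (t u v)) = NN (t (SS u) v) + NN (t (NN u) v) + (NN (t u (SS v)) + NN (t u (NN v)))" for u v
    using arg_cong[OF EQ[of u v], of NN] NN_NN[OF tW] by (simp add: SNs SN_comm)
  note fin = NN_W SS_W tW NN_NN SN_comm[symmetric] SNs ts
  \<comment> \<open>The three digits say whether \<open>NN\<close> is applied to the output, to the
    first and to the second argument.\<close>
  have 111: "NN (t (NN u) (NN v)) = 0" if "u \<in> W" "v \<in> W" for u v
    by (rule semisimple_zero[of "\<lambda>u v. NN (t (NN u) (NN v))", OF _ _ _ _ that])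
      (auto simp: fin NEQ)
  have 110: "NN (t (NN u) v) = 0" if "u \<in> W" "v \<in> W" for u v
    by (rule semisimple_zero[of "\<lambda>u v. NN (t (NN u) v)", OF _ _ _ _ that])
      (auto simp: fin NEQ 111)
  have 101: "NN (t u (NN v)) = 0" if "u \<in> W" "v \<in> W" for u v
    by (rule semisimple_zero[of "\<lambda>u v. NN (t u (NN v))", OF _ _ _ _ that])
      (auto simp: fin NEQ 111)
  have 100: "NN (t u v) = 0" if "u \<in> W" "v \<in> W" for u v
    by (rule semisimple_zero[of "\<lambda>u v. NN (t u v)", OF _ _ _ _ that])
      (auto simp: fin NEQ 110 101)
  have SEQ: "SS (t u v) = t (SS u) v + t (NN u) v + (t u (SS v) + t u (NN v))" if "u \<in> W" "v \<in> W" for u v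
    using EQ[of u v] 100[OF that] by simp
  have 011: "t (NN u) (NN v) = 0" if "u \<in> W" "v \<in> W" for u v
    by (rule semisimple_zero[of "\<lambda>u v. t (NN u) (NN v)", OF _ _ _ _ that])
      (auto simp: fin SEQ)
  have 010: "t (NN u) v = 0" if "u \<in> W" "v \<in> W" for u v
    by (rule semisimple_zero[of "\<lambda>u v. t (NN u) v", OF _ _ _ _ that])
      (auto simp: fin SEQ 011)
  have 001: "t u (NN v) = 0" if "u \<in> W" "v \<in> W" for u v
    by (rule semisimple_zero[of "\<lambda>u v. t u (NN v)", OF _ _ _ _ that])
      (auto simp: fin SEQ 011)
  have "t u v = 0"
    by (rule semisimple_zero[of t, OF _ _ _ _ assms]) (auto simp: fin SEQ 010 001)
  then show ?thesis by (simp add: t_def pbr_def)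
qed

end

section \<open>Recognizing the Lie algebras in the list\<close>

lemma exhaust_7:
  fixes x :: 7
  shows "x = 1 \<or> x = 2 \<or> x = 3 \<or> x = 4 \<or> x = 5 \<or> x = 6 \<or> x = 7"
proof (induct x)
  case (of_int z)
  then have "z = 0 \<or> z = 1 \<or> z = 2 \<or> z = 3 \<or> z = 4 \<or> z = 5 \<or> z = 6" by fastforce
  then show ?case by auto
qed

lemma forall_7: "(\<forall>i::7. P i) \<longleftrightarrow> P 1 \<and> P 2 \<and> P 3 \<and> P 4 \<and> P 5 \<and> P 6 \<and> P 7"
  by (metis exhaust_7)

lemma UNIV_7: "UNIV = {1, 2, 3, 4, 5, 6, 7::7}"
  using exhaust_7 by auto

lemma sum_7: "sum f (UNIV::7 set) = f 1 + f 2 + f 3 + f 4 + f 5 + f 6 + f 7"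
  unfolding UNIV_7 by (simp add: ac_simps)

lemma vector_7:
  "(vector [a, b, c, d, e, f, g] :: real^7) $ 1 = a"
  "(vector [a, b, c, d, e, f, g] :: real^7) $ 2 = b"
  "(vector [a, b, c, d, e, f, g] :: real^7) $ 3 = c"
  "(vector [a, b, c, d, e, f, g] :: real^7) $ 4 = d"
  "(vector [a, b, c, d, e, f, g] :: real^7) $ 5 = e"
  "(vector [a, b, c, d, e, f, g] :: real^7) $ 6 = f"
  "(vector [a, b, c, d, e, f, g] :: real^7) $ 7 = g"
  unfolding vector_def by simp_all

lemmas algebra_defs = s1_def s2_def s3_def s4_def s5_def s6_def s7_def s8_def s9_def s10_def s11_def

definition frame_map ::
  "real^7 \<Rightarrow> real^7 \<Rightarrow> real^7 \<Rightarrow> real^7 \<Rightarrow> real^7 \<Rightarrow> real^7 \<Rightarrow> real^7 \<Rightarrow> real^7 \<Rightarrow> real^7" where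
  "frame_map f1 f2 f3 f4 f5 f6 f7 x = x $ 1 *\<^sub>R f1 + x $ 2 *\<^sub>R f2 + x $ 3 *\<^sub>R f3 + x $ 4 *\<^sub>R f4 + x $ 5 *\<^sub>R f5 +
     x $ 6 *\<^sub>R f6 + x $ 7 *\<^sub>R f7"

lemma frame_map_linear: "linear (frame_map f1 f2 f3 f4 f5 f6 f7)"
  unfolding frame_map_def[abs_def] by (rule linearI) (simp_all add: algebra_simps)

lemma frame_map_bij:
  assumes "frame [f1, f2, f3, f4, f5, f6, f7]"
  shows "bij (frame_map f1 f2 f3 f4 f5 f6 f7)"
proof -
  let ?F = "frame_map f1 f2 f3 f4 f5 f6 f7"
  have "inj ?F"
  proof (rule linear_injective_0[OF frame_map_linear, THEN iffD2], intro allI impI)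
    fix x assume "?F x = 0"
    then have "x $ 1 = 0 \<and> x $ 2 = 0 \<and> x $ 3 = 0 \<and> x $ 4 = 0 \<and> x $ 5 = 0 \<and> x $ 6 = 0 \<and> x $ 7 = 0"
      using assms unfolding frame7 frame_map_def by blast
    then show "x = 0" by (simp add: vec_eq_iff forall_7)
  qed
  moreover have "surj ?F" by (rule linear_inj_imp_surj[OF frame_map_linear \<open>inj ?F\<close>])
  ultimately show ?thesis by (simp add: bij_def)
qed

lemma isomorphic_by_frame:
  assumes fr: "frame [f1, f2, f3, f4, f5, f6, f7]"
    and br: "\<And>x y. br (frame_map f1 f2 f3 f4 f5 f6 f7 x) (frame_map f1 f2 f3 f4 f5 f6 f7 y) =
      frame_map f1 f2 f3 f4 f5 f6 f7 (s x y)"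
  shows "lie_isomorphic br s"
proof -
  let ?F = "frame_map f1 f2 f3 f4 f5 f6 f7"
  have inj: "inj ?F" using frame_map_bij[OF fr] by (simp add: bij_def)
  obtain g where g: "linear g" "g \<circ> ?F = id"
    using linear_injective_left_inverse[OF frame_map_linear inj] by auto
  have g1: "g (?F x) = x" for x using fun_cong[OF g(2), of x] by simp
  have g2: "?F (g x) = x" for x
    using frame_map_bij[OF fr] g1 by (metis bij_pointE)
  have "bij g" by (rule o_bij[of ?F]) (auto simp: fun_eq_iff g1 g2)
  moreover have "g (br x y) = s (g x) (g y)" for x y
    using br[of "g x" "g y"] g1 g2 by metis
  ultimately show ?thesis unfolding lie_isomorphic_def using g by blast
qed

context g2
begin

lemma frame_map_bracket:
  "br (frame_map f1 f2 f3 f4 f5 f6 f7 x) (frame_map f1 f2 f3 f4 f5 f6 f7 y) =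
     (x $ 1 * y $ 2 - x $ 2 * y $ 1) *\<^sub>R br f1 f2 + (x $ 1 * y $ 3 - x $ 3 * y $ 1) *\<^sub>R br f1 f3 +
     (x $ 1 * y $ 4 - x $ 4 * y $ 1) *\<^sub>R br f1 f4 + (x $ 1 * y $ 5 - x $ 5 * y $ 1) *\<^sub>R br f1 f5 +
     (x $ 1 * y $ 6 - x $ 6 * y $ 1) *\<^sub>R br f1 f6 + (x $ 1 * y $ 7 - x $ 7 * y $ 1) *\<^sub>R br f1 f7 +
     (x $ 2 * y $ 3 - x $ 3 * y $ 2) *\<^sub>R br f2 f3 + (x $ 2 * y $ 4 - x $ 4 * y $ 2) *\<^sub>R br f2 f4 +
     (x $ 2 * y $ 5 - x $ 5 * y $ 2) *\<^sub>R br f2 f5 + (x $ 2 * y $ 6 - x $ 6 * y $ 2) *\<^sub>R br f2 f6 +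
     (x $ 2 * y $ 7 - x $ 7 * y $ 2) *\<^sub>R br f2 f7 + (x $ 3 * y $ 4 - x $ 4 * y $ 3) *\<^sub>R br f3 f4 +
     (x $ 3 * y $ 5 - x $ 5 * y $ 3) *\<^sub>R br f3 f5 + (x $ 3 * y $ 6 - x $ 6 * y $ 3) *\<^sub>R br f3 f6 +
     (x $ 3 * y $ 7 - x $ 7 * y $ 3) *\<^sub>R br f3 f7 + (x $ 4 * y $ 5 - x $ 5 * y $ 4) *\<^sub>R br f4 f5 +
     (x $ 4 * y $ 6 - x $ 6 * y $ 4) *\<^sub>R br f4 f6 + (x $ 4 * y $ 7 - x $ 7 * y $ 4) *\<^sub>R br f4 f7 +
     (x $ 5 * y $ 6 - x $ 6 * y $ 5) *\<^sub>R br f5 f6 + (x $ 5 * y $ 7 - x $ 7 * y $ 5) *\<^sub>R br f5 f7 +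
     (x $ 6 * y $ 7 - x $ 7 * y $ 6) *\<^sub>R br f6 f7"
  (is "?l = ?r")
proof -
  note rev = anti[of f2 f1] anti[of f3 f1] anti[of f4 f1] anti[of f5 f1] anti[of f6 f1] anti[of f7 f1] anti[of f3 f2]
    anti[of f4 f2] anti[of f5 f2] anti[of f6 f2] anti[of f7 f2] anti[of f4 f3] anti[of f5 f3] anti[of f6 f3]
    anti[of f7 f3] anti[of f5 f4] anti[of f6 f4] anti[of f7 f4] anti[of f6 f5] anti[of f7 f5] anti[of f7 f6]
  show ?thesis
    unfolding frame_map_def brs(1-4) rev self by (simp add: vec_eq_iff algebra_simps)
qed

text \<open>In this table and the following ones a term \<open>e i j\<close> in position
  \<open>k\<close> of the structure equations contributes minus the k-th frame vector to the bracket
  of the i-th and j-th.\<close>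

lemma s1_I:
  assumes fr: "frame [f1, f2, f3, f4, f5, f6, f7]"
    and br:
    "br f1 f2 = 0" "br f1 f3 = 0" "br f1 f4 = 0" "br f1 f5 = 0" "br f1 f6 = 0"
    "br f2 f3 = - f1" "br f2 f4 = 0" "br f2 f5 = 0" "br f2 f6 = - f3 + - f4"
    "br f3 f4 = 0" "br f3 f5 = 0" "br f3 f6 = f2 + - f5"
    "br f4 f5 = 0" "br f4 f6 = - f5"
    "br f5 f6 = f4"
    "\<And>y. br y f7 = 0"
  shows "lie_isomorphic br s1"
  by (rule isomorphic_by_frame[OF fr], unfold frame_map_bracket br)
    (simp add: frame_map_def s1_def structure_eqs7_def vector_7 vec_eq_iff algebra_simps)

lemma s2_I:
  assumes fr: "frame [f1, f2, f3, f4, f5, f6, f7]"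
    and br:
    "br f1 f2 = 0" "br f1 f3 = 0" "br f1 f4 = 0" "br f1 f5 = 0" "br f1 f6 = - f1"
    "br f2 f3 = 0" "br f2 f4 = 0" "br f2 f5 = 0" "br f2 f6 = f2"
    "br f3 f4 = 0" "br f3 f5 = - f1" "br f3 f6 = - f3"
    "br f4 f5 = - f2" "br f4 f6 = f4"
    "br f5 f6 = 0"
    "\<And>y. br y f7 = 0"
  shows "lie_isomorphic br s2"
  by (rule isomorphic_by_frame[OF fr], unfold frame_map_bracket br)
    (simp add: frame_map_def s2_def structure_eqs7_def vector_7 vec_eq_iff algebra_simps)

lemma s3_I:
  assumes fr: "frame [f1, f2, f3, f4, f5, f6, f7]"
    and br:
    "br f1 f2 = 0" "br f1 f3 = 0" "br f1 f4 = 0" "br f1 f5 = f2" "br f1 f6 = f1"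
    "br f2 f3 = 0" "br f2 f4 = 0" "br f2 f5 = - f1" "br f2 f6 = f2"
    "br f3 f4 = 0" "br f3 f5 = - f4" "br f3 f6 = - f3"
    "br f4 f5 = f3" "br f4 f6 = - f4"
    "br f5 f6 = 0"
    "\<And>y. br y f7 = 0"
  shows "lie_isomorphic br s3"
  by (rule isomorphic_by_frame[OF fr], unfold frame_map_bracket br)
    (simp add: frame_map_def s3_def structure_eqs7_def vector_7 vec_eq_iff algebra_simps)

lemma s4_I:
  assumes fr: "frame [f1, f2, f3, f4, f5, f6, f7]"
    and br:
    "br f1 f2 = f3" "br f1 f3 = f2" "br f1 f4 = 0" "br f1 f5 = 0" "br f1 f6 = 0"
    "br f2 f3 = 0" "br f2 f4 = 0" "br f2 f5 = 0" "br f2 f6 = 0"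
    "br f3 f4 = 0" "br f3 f5 = 0" "br f3 f6 = 0"
    "br f4 f5 = f6" "br f4 f6 = f5"
    "br f5 f6 = 0"
    "\<And>y. br y f7 = 0"
  shows "lie_isomorphic br s4"
  by (rule isomorphic_by_frame[OF fr], unfold frame_map_bracket br)
    (simp add: frame_map_def s4_def structure_eqs7_def vector_7 vec_eq_iff algebra_simps)

lemma s5_I:
  assumes fr: "frame [f1, f2, f3, f4, f5, f6, f7]"
    and br:
    "br f1 f2 = 0" "br f1 f3 = 0" "br f1 f4 = 0" "br f1 f5 = - f1" "br f1 f6 = 0"
    "br f2 f3 = 0" "br f2 f4 = 0" "br f2 f5 = f2" "br f2 f6 = 0"
    "br f3 f4 = 0" "br f3 f5 = f3" "br f3 f6 = 0"
    "br f4 f5 = - f4" "br f4 f6 = 0"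
    "br f5 f6 = 0"
    "\<And>y. br y f7 = 0"
  shows "lie_isomorphic br s5"
  by (rule isomorphic_by_frame[OF fr], unfold frame_map_bracket br)
    (simp add: frame_map_def s5_def structure_eqs7_def vector_7 vec_eq_iff algebra_simps)

lemma s6_I:
  assumes fr: "frame [f1, f2, f3, f4, f5, f6, f7]"
    and br:
    "br f1 f2 = 0" "br f1 f3 = 0" "br f1 f4 = 0" "br f1 f5 = (- \<alpha>) *\<^sub>R f1 + f2" "br f1 f6 = 0"
    "br f2 f3 = 0" "br f2 f4 = 0" "br f2 f5 = - f1 + (- \<alpha>) *\<^sub>R f2" "br f2 f6 = 0"
    "br f3 f4 = 0" "br f3 f5 = (\<alpha>) *\<^sub>R f3 + f4" "br f3 f6 = 0"
    "br f4 f5 = - f3 + (\<alpha>) *\<^sub>R f4" "br f4 f6 = 0"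
    "br f5 f6 = 0"
    "\<And>y. br y f7 = 0"
  shows "lie_isomorphic br (s6 \<alpha>)"
  by (rule isomorphic_by_frame[OF fr], unfold frame_map_bracket br)
    (simp add: frame_map_def s6_def structure_eqs7_def vector_7 vec_eq_iff algebra_simps)

lemma s7_I:
  assumes fr: "frame [f1, f2, f3, f4, f5, f6, f7]"
    and br:
    "br f1 f2 = 0" "br f1 f3 = 0" "br f1 f4 = 0" "br f1 f5 = f2" "br f1 f6 = 0"
    "br f2 f3 = 0" "br f2 f4 = 0" "br f2 f5 = - f1" "br f2 f6 = 0"
    "br f3 f4 = 0" "br f3 f5 = f4" "br f3 f6 = 0"
    "br f4 f5 = - f3" "br f4 f6 = 0"
    "br f5 f6 = 0"
    "\<And>y. br y f7 = 0"
  shows "lie_isomorphic br s7"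
  by (rule isomorphic_by_frame[OF fr], unfold frame_map_bracket br)
    (simp add: frame_map_def s7_def structure_eqs7_def vector_7 vec_eq_iff algebra_simps)

lemma s8_I:
  assumes fr: "frame [f1, f2, f3, f4, f5, f6, f7]"
    and br:
    "br f1 f2 = 0" "br f1 f3 = 0" "br f1 f4 = 0" "br f1 f5 = 0" "br f1 f6 = - f1"
    "br f2 f3 = 0" "br f2 f4 = 0" "br f2 f5 = 0" "br f2 f6 = f2"
    "br f3 f4 = - f7" "br f3 f5 = - f1" "br f3 f6 = - f3"
    "br f4 f5 = - f2" "br f4 f6 = f4"
    "br f5 f6 = 0"
    "\<And>y. br y f7 = 0"
  shows "lie_isomorphic br s8"
  by (rule isomorphic_by_frame[OF fr], unfold frame_map_bracket br)
    (simp add: frame_map_def s8_def structure_eqs7_def vector_7 vec_eq_iff algebra_simps)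

lemma s9_I:
  assumes fr: "frame [f1, f2, f3, f4, f5, f6, f7]"
    and br:
    "br f1 f2 = 0" "br f1 f3 = 0" "br f1 f4 = 0" "br f1 f5 = 0" "br f1 f6 = - f2"
    "br f2 f3 = 0" "br f2 f4 = 0" "br f2 f5 = 0" "br f2 f6 = f1"
    "br f3 f4 = - f7" "br f3 f5 = - f1" "br f3 f6 = - f4"
    "br f4 f5 = - f2" "br f4 f6 = f3"
    "br f5 f6 = 0"
    "\<And>y. br y f7 = 0"
  shows "lie_isomorphic br s9"
  by (rule isomorphic_by_frame[OF fr], unfold frame_map_bracket br)
    (simp add: frame_map_def s9_def structure_eqs7_def vector_7 vec_eq_iff algebra_simps)

lemma s10_I:
  assumes fr: "frame [f1, f2, f3, f4, f5, f6, f7]"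
    and br:
    "br f1 f2 = 0" "br f1 f3 = 0" "br f1 f4 = 0" "br f1 f5 = 0" "br f1 f6 = (-2) *\<^sub>R f7"
    "br f2 f3 = - f1" "br f2 f4 = (- sqrt 3) *\<^sub>R f7" "br f2 f5 = - f7" "br f2 f6 = - f3 + - f4"
    "br f3 f4 = f7" "br f3 f5 = (- sqrt 3) *\<^sub>R f7" "br f3 f6 = f2 + - f5"
    "br f4 f5 = 0" "br f4 f6 = - f5"
    "br f5 f6 = f4"
    "\<And>y. br y f7 = 0"
  shows "lie_isomorphic br s10"
  by (rule isomorphic_by_frame[OF fr], unfold frame_map_bracket br)
    (simp add: frame_map_def s10_def structure_eqs7_def vector_7 vec_eq_iff algebra_simps)

lemma s11_I:
  assumes fr: "frame [f1, f2, f3, f4, f5, f6, f7]"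
    and br:
    "br f1 f2 = 0" "br f1 f3 = 0" "br f1 f4 = 0" "br f1 f5 = 0" "br f1 f6 = (-2) *\<^sub>R f7"
    "br f2 f3 = - f1" "br f2 f4 = (sqrt 3) *\<^sub>R f7" "br f2 f5 = - f7" "br f2 f6 = - f3 + - f4"
    "br f3 f4 = f7" "br f3 f5 = (sqrt 3) *\<^sub>R f7" "br f3 f6 = f2 + - f5"
    "br f4 f5 = 0" "br f4 f6 = - f5"
    "br f5 f6 = f4"
    "\<And>y. br y f7 = 0"
  shows "lie_isomorphic br s11"
  by (rule isomorphic_by_frame[OF fr], unfold frame_map_bracket br)
    (simp add: frame_map_def s11_def structure_eqs7_def vector_7 vec_eq_iff algebra_simps)

end

section \<open>Brackets of W with a component along x\<close>

context g2_cartan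
begin

lemma frame_by_pairing:
  assumes "\<omega> k1 v2 = P" "\<omega> v1 k2 = P" "P \<noteq> 0"
    "\<omega> k1 v1 = 0" "\<omega> k2 v2 = 0" "\<omega> k1 k2 = 0"
  shows "frame [v1, v2, k1, k2]"
  unfolding frame_explicit
proof (intro allI impI)
  fix a b s t assume h: "a *\<^sub>R v1 + b *\<^sub>R v2 + s *\<^sub>R k1 + t *\<^sub>R k2 = 0"
  let ?w = "a *\<^sub>R v1 + b *\<^sub>R v2 + s *\<^sub>R k1 + t *\<^sub>R k2"
  have rv: "\<omega> v2 k1 = - P" "\<omega> k2 v1 = - P" "\<omega> v1 k1 = 0" "\<omega> v2 k2 = 0" "\<omega> k2 k1 = 0"
    using assms \<omega>_anti[of v2 k1] \<omega>_anti[of k2 v1] \<omega>_anti[of v1 k1] \<omega>_anti[of v2 k2] \<omega>_anti[of k2 k1] by auto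
  have "\<omega> ?w k1 = - b * P" "\<omega> ?w k2 = a * P" by (simp_all add: \<omega>s rv assms)
  then have ab: "a = 0" "b = 0" unfolding h using assms by (auto simp: \<omega>s)
  have "\<omega> ?w v1 = - t * P" "\<omega> ?w v2 = s * P" by (simp_all add: \<omega>s rv assms ab)
  then show "a = 0 \<and> b = 0 \<and> s = 0 \<and> t = 0" unfolding h using assms ab by (auto simp: \<omega>s)
qed

end

context g2_A
begin

text \<open>Let \<open>p\<close> be the \<open>x\<close>-component of brackets and \<open>Q\<close>
  its operator with respect to \<open>\<omega>\<close>. The defect of skewness of
  \<open>D = ad e\<close> reads \<open>Q D = D Q + E Q^2\<close>; together with the quadratic
  equation of the self-adjoint \<open>Q\<close> this forces \<open>Q^2 = 0\<close>. The basis
  consists of \<open>v1\<close>, \<open>D v1\<close> and their images under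
  \<open>Q\<close>.\<close>

lemma P_normal:
  assumes "\<exists>u\<in>W. \<exists>v\<in>W. cp (br u v) \<noteq> 0"
  obtains v1 v2 k1 k2 r m l y P where
    "v1 \<in> W" "v2 \<in> W" "k1 \<in> W" "k2 \<in> W" "frame [v1, v2, k1, k2]"
    "br e v1 = v2" "br e v2 = r *\<^sub>R v1 + m *\<^sub>R k1 + l *\<^sub>R k2" "br e k1 = k2" "br e k2 = r *\<^sub>R k1"
    "br x v1 = y *\<^sub>R k2" "br x v2 = (y * r) *\<^sub>R k1" "br x k1 = 0" "br x k2 = 0"
    "r \<noteq> 0" "P \<noteq> 0" "cp (br v1 v2) = P" "\<forall>w\<in>W. cp (br k1 w) = 0" "\<forall>w\<in>W. cp (br k2 w) = 0"
    "\<omega> k1 v2 = P" "\<omega> v1 k2 = P" "\<omega> v1 k1 = 0" "\<omega> v2 k2 = 0" "\<omega> k1 k2 = 0"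
    "l = - E" "\<forall>u\<in>W. \<forall>v\<in>W. pr (br u v) = 0"
proof -
  define p where "p u v = cp (br u v)" for u v
  have ps: "p (u + u') v = p u v + p u' v" "p u (v + v') = p u v + p u v'" "p (s *\<^sub>R u) v = s * p u v"
    "p u (s *\<^sub>R v) = s * p u v" "p u u = 0" "p 0 v = 0" for u u' v v' s by (simp_all add: p_def brs cps)
  have panti: "p u v = - p v u" for u v using anti[of u v] by (simp add: p_def cps)
  obtain a b s t where sb: "frame [a, b, s, t]" "span {a, b, s, t} = W"
    "\<omega> a b = 1" "\<omega> s t = 1" "\<omega> a s = 0" "\<omega> a t = 0" "\<omega> b s = 0" "\<omega> b t = 0"
    by (rule symplectic_basis4[OF sW dim4 \<omega>_bil \<omega>_self \<omega>_nd_Range])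
  have mem: "a \<in> W" "b \<in> W" "s \<in> W" "t \<in> W" unfolding sb(2)[symmetric] by (rule span_base, simp)+
  define Q where "Q u = p u b *\<^sub>R a + (- p u a) *\<^sub>R b + p u t *\<^sub>R s + (- p u s) *\<^sub>R t" for u
  have Qlin: "linear Q" unfolding Q_def[abs_def] by (rule linearI) (simp_all add: ps algebra_simps)
  note Qs = linear_rules[OF Qlin]
  have QW: "Q u \<in> W" for u unfolding Q_def using mem sW by (intro subspace_add subspace_scale) auto
  have Q: "\<omega> (Q u) v = p u v" if vW: "v \<in> W" for u v
  proof -
    obtain c1 c2 c3 c4 where v: "v = c1 *\<^sub>R a + c2 *\<^sub>R b + c3 *\<^sub>R s + c4 *\<^sub>R t" by (rule W_coords[OF sb(1) mem vW])
    show ?thesis using \<omega>_anti[of b a] \<omega>_anti[of t s] \<omega>_anti[of s a] \<omega>_anti[of t a] \<omega>_anti[of s b] \<omega>_anti[of t b] sb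
      by (simp add: v Q_def \<omega>s ps algebra_simps)
  qed
  have Qsa: "\<omega> (Q u) v = \<omega> u (Q v)" if "u \<in> W" "v \<in> W" for u v
    using Q[OF that(2), of u] Q[OF that(1), of v] panti[of u v] \<omega>_anti[of u "Q v"] by simp
  have eqW: "u = v" if "u \<in> W" "v \<in> W" "\<And>w. w \<in> W \<Longrightarrow> \<omega> u w = \<omega> v w" for u v
  proof -
    have "u - v \<in> W" using that sW by (intro subspace_diff)
    then have "u - v = 0" by (rule \<omega>_nd_Range) (simp add: \<omega>s that)
    then show ?thesis by simp
  qed
  obtain \<tau> \<delta> where Q2: "\<And>w. w \<in> W \<Longrightarrow> Q (Q w) = \<tau> *\<^sub>R Q w - \<delta> *\<^sub>R w"
    by (rule self_adjoint_quadratic[OF sW dim4 \<omega>_bil \<omega>_self \<omega>_nd_Range Qlin]) (use QW Qsa in auto)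
  have QD: "Q (br e u) = br e (Q u) + E *\<^sub>R Q (Q u)" if "u \<in> W" for u
  proof (rule eqW)
    show "Q (br e u) \<in> W" by (rule QW)
    show "br e (Q u) + E *\<^sub>R Q (Q u) \<in> W" using QW eW sW by (intro subspace_add subspace_scale) auto
    fix v assume v: "v \<in> W"
    have "\<omega> (Q (br e u)) v = - \<omega> (Q u) (br e v)"
      using p_e[of u v] Q[OF v, of "br e u"] Q[OF eW[OF v], of u] by (simp add: p_def)
    also have "\<dots> = \<omega> (br e (Q u)) v + E * p (Q u) v" using \<omega>_e_adj[of "Q u" v] by (simp add: p_def)
    finally show "\<omega> (Q (br e u)) v = \<omega> (br e (Q u) + E *\<^sub>R Q (Q u)) v" using Q[OF v, of "Q u"] by (simp add: \<omega>s)
  qed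
  obtain u0 v0 where uv0: "u0 \<in> W" "v0 \<in> W" "p u0 v0 \<noteq> 0" using assms by (auto simp: p_def)
  have Qnz: "Q u0 \<noteq> 0" using Q[OF uv0(2), of u0] uv0(3) by (auto simp: \<omega>s)
  \<comment> \<open>\<open>Q^2 D\<close> is computed in two ways: by moving \<open>D\<close> past
    \<open>Q\<close> twice, and by the quadratic equation.\<close>
  have Q3: "2 *\<^sub>R Q (Q (Q w)) = \<tau> *\<^sub>R Q (Q w)" if w: "w \<in> W" for w
  proof -
    have ew: "br e w \<in> W" using eW w by blast
    have "Q (Q (br e w)) = br e (Q (Q w)) + (2 * E) *\<^sub>R Q (Q (Q w))"
      using QD[OF w] QD[OF QW[of w]] by (simp add: Qs algebra_simps scaleR_2[symmetric])
    moreover have "Q (Q (br e w)) = br e (Q (Q w)) + (\<tau> * E) *\<^sub>R Q (Q w)"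
    proof -
      have "Q (Q (br e w)) = \<tau> *\<^sub>R (br e (Q w) + E *\<^sub>R Q (Q w)) - \<delta> *\<^sub>R br e w"
        using Q2[OF ew] QD[OF w] by simp
      moreover have "br e (Q (Q w)) = \<tau> *\<^sub>R br e (Q w) - \<delta> *\<^sub>R br e w" by (simp add: Q2[OF w] brs)
      ultimately show ?thesis by (simp only: scaleR_add_right scaleR_scaleR) simp
    qed
    ultimately have "E *\<^sub>R (2 *\<^sub>R Q (Q (Q w)) - \<tau> *\<^sub>R Q (Q w)) = 0" by (simp add: algebra_simps)
    then show ?thesis using E_nz by simp
  qed
  have lin2: "(\<tau>\<^sup>2 - 2 * \<delta>) *\<^sub>R Q w = (\<tau> * \<delta>) *\<^sub>R w" if w: "w \<in> W" for w
  proof -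
    have "Q (Q (Q w)) = \<tau> *\<^sub>R Q (Q w) - \<delta> *\<^sub>R Q w" using Q2[OF QW[of w]] .
    then have "2 *\<^sub>R (\<tau> *\<^sub>R Q (Q w) - \<delta> *\<^sub>R Q w) = \<tau> *\<^sub>R Q (Q w)" using Q3[OF w] by simp
    then show ?thesis unfolding Q2[OF w] by (simp add: vec_eq_iff algebra_simps power2_eq_square)
  qed
  \<comment> \<open>Otherwise \<open>Q\<close> would be a scalar, hence commute with
    \<open>D\<close>, and \<open>E Q^2 = 0\<close> would follow.\<close>
  have td: "\<tau>\<^sup>2 - 2 * \<delta> = 0"
  proof (rule ccontr)
    assume nz: "\<tau>\<^sup>2 - 2 * \<delta> \<noteq> 0"
    define k where "k = \<tau> * \<delta> / (\<tau>\<^sup>2 - 2 * \<delta>)"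
    have Qk: "Q w = k *\<^sub>R w" if "w \<in> W" for w
    proof -
      have "(1 / (\<tau>\<^sup>2 - 2 * \<delta>)) *\<^sub>R (\<tau>\<^sup>2 - 2 * \<delta>) *\<^sub>R Q w = (1 / (\<tau>\<^sup>2 - 2 * \<delta>)) *\<^sub>R (\<tau> * \<delta>) *\<^sub>R w"
        using lin2[OF that] by simp
      then show ?thesis using nz by (simp add: k_def)
    qed
    have "E *\<^sub>R Q (Q u0) = 0" using QD[OF uv0(1)] Qk[OF uv0(1)] Qk[OF eW[OF uv0(1)]] by (simp add: brs)
    then have "k * k = 0" using E_nz Qk[OF uv0(1)] Qk[OF QW[of u0]] Qnz by auto
    then show False using Qk[OF uv0(1)] Qnz by simp
  qed
  have "\<tau> * \<delta> = 0"
    using lin2[OF uv0(1)] td Qnz by (auto simp: Qs)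
  then have "\<tau> = 0" "\<delta> = 0" using td by auto
  then have QQ: "Q (Q w) = 0" if "w \<in> W" for w using Q2[OF that] by simp
  have QD': "Q (br e w) = br e (Q w)" if "w \<in> W" for w using QD[OF that] QQ[OF that] by simp
  have pQ: "p (Q u) v = 0" "p v (Q u) = 0" if "u \<in> W" "v \<in> W" for u v
  proof -
    show "p (Q u) v = 0" using Q[OF that(2), of "Q u"] QQ[OF that(1)] by (simp add: \<omega>s)
    then show "p v (Q u) = 0" using panti[of v "Q u"] by simp
  qed
  have wQQ: "\<omega> (Q u) (Q v) = 0" if "u \<in> W" "v \<in> W" for u v
    using Q[OF QW[of v], of u] pQ(2)[OF that(2,1)] by simp
  text \<open>The form \<open>p\<close> descends to the quotient of \<open>W\<close> by the image of \<open>Q\<close>, on which \<open>ad e\<close> is traceless and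
    hence not scalar.\<close>
  have "\<exists>v\<in>W. p v (br e v) \<noteq> 0"
  proof (rule ccontr)
    assume "\<not> ?thesis"
    then have z: "p v (br e v) = 0" if "v \<in> W" for v using that by blast
    have fr: "frame [u0, v0, Q u0, Q v0]"
    proof (rule frame_by_pairing[of _ _ "p u0 v0"])
      show "\<omega> (Q u0) v0 = p u0 v0" using Q uv0 by blast
      show "\<omega> u0 (Q v0) = p u0 v0" using Qsa[OF uv0(1,2)] Q[OF uv0(2)] by simp
      show "\<omega> (Q u0) u0 = 0" "\<omega> (Q v0) v0 = 0" using Q uv0 ps(5) by auto
      show "\<omega> (Q u0) (Q v0) = 0" using wQQ uv0 by blast
    qed (rule uv0)
    obtain a1 a2 a3 a4 where a: "br e u0 = a1 *\<^sub>R u0 + a2 *\<^sub>R v0 + a3 *\<^sub>R Q u0 + a4 *\<^sub>R Q v0"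
      by (rule W_coords[OF fr uv0(1,2) QW QW eW[OF uv0(1)]])
    obtain b1 b2 b3 b4 where b: "br e v0 = b1 *\<^sub>R u0 + b2 *\<^sub>R v0 + b3 *\<^sub>R Q u0 + b4 *\<^sub>R Q v0"
      by (rule W_coords[OF fr uv0(1,2) QW QW eW[OF uv0(2)]])
    note pq = pQ[OF uv0(1,1)] pQ[OF uv0(1,2)] pQ[OF uv0(2,1)] pQ[OF uv0(2,2)]
    have "a2 = 0" using z[OF uv0(1)] uv0(3) by (simp add: a ps pq)
    moreover have "b1 = 0" using z[OF uv0(2)] uv0(3) panti[of v0 u0] by (simp add: b ps pq)
    moreover have "a1 + b2 = 0"
    proof -
      have "p (br e u0) v0 + p u0 (br e v0) = 0" using p_e by (simp add: p_def)
      then have "(a1 + b2) * p u0 v0 = 0" by (simp add: a b ps pq algebra_simps)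
      then show ?thesis using uv0(3) by simp
    qed
    moreover have "a1 - b2 = 0"
    proof -
      have uv: "u0 + v0 \<in> W" using uv0 sW by (intro subspace_add)
      have "p (u0 + v0) (br e (u0 + v0)) = (b2 - a1) * p u0 v0"
        using \<open>a2 = 0\<close> \<open>b1 = 0\<close> panti[of v0 u0] by (simp add: brs a b ps pq algebra_simps)
      then show ?thesis using z[OF uv] uv0(3) by simp
    qed
    ultimately have 0: "a1 = 0" "a2 = 0" "b1 = 0" "b2 = 0" by auto
    have "br e (Q u0) = Q (br e u0)" using QD' uv0 by simp
    also have "\<dots> = 0" using 0 uv0 QQ by (simp add: a Qs)
    finally show False using inj_e[OF QW[of u0]] Qnz by simp
  qed
  then obtain v1 where v1: "v1 \<in> W" "p v1 (br e v1) \<noteq> 0" by blast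
  define v2 where "v2 = br e v1"
  define k1 where "k1 = Q v1"
  define k2 where "k2 = br e k1"
  define P where "P = p v1 v2"
  have v2: "v2 \<in> W" using eW v1 by (simp add: v2_def)
  have kW: "k1 \<in> W" "k2 \<in> W" using QW eW by (auto simp: k1_def k2_def)
  have k2: "k2 = Q v2" using QD'[OF v1(1)] by (simp add: k2_def k1_def v2_def)
  have P: "P \<noteq> 0" using v1 by (simp add: P_def v2_def)
  have om: "\<omega> k1 v2 = P" "\<omega> v1 k2 = P" "\<omega> k1 v1 = 0" "\<omega> k2 v2 = 0" "\<omega> k1 k2 = 0"
    using Q[OF v2, of v1] Q[OF v1(1), of v1] Q[OF v2, of v2] Qsa[OF v1(1) v2] wQQ[OF v1(1) v2] ps(5)
    by (auto simp: k1_def k2 P_def)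
  have fr: "frame [v1, v2, k1, k2]" by (rule frame_by_pairing[OF om(1,2) P om(3,4,5)])
  obtain r b m l where ev2: "br e v2 = r *\<^sub>R v1 + b *\<^sub>R v2 + m *\<^sub>R k1 + l *\<^sub>R k2"
    by (rule W_coords[OF fr v1(1) v2 kW eW[OF v2]])
  have pk: "p k1 w = 0" "p k2 w = 0" "p w k1 = 0" "p w k2 = 0" if "w \<in> W" for w
    using pQ[OF v1(1) that] pQ[OF v2 that] by (auto simp: k1_def k2)
  have "p (br e v1) v2 + p v1 (br e v2) = 0" using p_e by (simp add: p_def)
  then have "b * P = 0" using ps(5) by (simp add: v2_def[symmetric] ev2 ps pk[OF v1(1)] P_def)
  then have b: "b = 0" using P by simp
  have ek2: "br e k2 = r *\<^sub>R k1"
    using QD'[OF v2] QQ[OF v1(1)] QQ[OF v2] by (simp add: ev2 b Qs k2 k1_def)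
  have r: "r \<noteq> 0"
  proof
    assume "r = 0"
    then have "k2 = 0" using ek2 inj_e kW by simp
    then show False using om P by (simp add: \<omega>s)
  qed
  have l: "l = - E"
  proof -
    have "\<omega> (br e v1) v2 + \<omega> v1 (br e v2) = - E * P" using \<omega>_e_adj[of v1 v2] by (simp add: p_def P_def)
    then have "(l + E) * P = 0" using om \<omega>_anti[of v1 k1] by (simp add: v2_def[symmetric] ev2 b \<omega>s algebra_simps)
    then show ?thesis using P by simp
  qed
  interpret dbl: g2_double br \<phi> z e \<omega> x c r
  proof unfold_locales
    show "r \<noteq> 0" by (rule r)
    fix w assume "w \<in> W"
    then obtain c1 c2 c3 c4 where w: "w = c1 *\<^sub>R v1 + c2 *\<^sub>R v2 + c3 *\<^sub>R k1 + c4 *\<^sub>R k2" by (rule W_coords[OF fr v1(1) v2 kW])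
    show "br e (br e (br e (br e w) - r *\<^sub>R w)) = r *\<^sub>R (br e (br e w) - r *\<^sub>R w)"
      by (simp add: w brs v2_def[symmetric] ev2 b k2_def[symmetric] ek2) (simp add: vec_eq_iff algebra_simps)
  qed
  \<comment> \<open>Jacobi identity on \<open>v1, v2, k\<close>: \<open>[v1, v2]\<close> is
    \<open>P x\<close> modulo the line of \<open>z\<close>, while \<open>[v1, k]\<close> and
    \<open>[v2, k]\<close> lie on that line.\<close>
  have xk: "br x k = 0" if k: "k = k1 \<or> k = k2" for k
  proof -
    have kw: "k \<in> W" using k kW by auto
    have pkk: "p k w = 0" "p w k = 0" if "w \<in> W" for w using pk[OF that] k by auto
    have exp: "br u v = p u v *\<^sub>R x + cq (br u v) *\<^sub>R z" if "u \<in> W" "v \<in> W" for u v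
      using coords[of "br u v"] ca0[OF that] dbl.pr_zero[OF that] by (simp add: p_def)
    have z: "br (s *\<^sub>R z) w = 0" for s w by (simp add: brs)
    have "br (br v1 v2) k = P *\<^sub>R br x k" by (subst exp[OF v1(1) v2]) (simp add: P_def brs z)
    moreover have "br (br v2 k) v1 = 0" by (subst exp[OF v2 kw]) (simp add: pkk v2 z)
    moreover have "br (br v1 k) v2 = 0" by (subst exp[OF v1(1) kw]) (simp add: pkk v1 z)
    moreover have "br (br v1 v2) k + br (br v2 k) v1 - br (br v1 k) v2 = 0"
      using jacobi[of v1 v2 k] anti[of "br v2 k" v1] anti[of "br v1 k" v2] by simp
    ultimately have "P *\<^sub>R br x k = 0" by simp
    then show ?thesis using P by simp
  qed
  obtain s1 s2 y1 y where xv1: "br x v1 = s1 *\<^sub>R v1 + s2 *\<^sub>R v2 + y1 *\<^sub>R k1 + y *\<^sub>R k2"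
    by (rule W_coords[OF fr v1(1) v2 kW xW[OF v1(1)]])
  have sk: "\<omega> (br x v1) k = 0" if "k = k1 \<or> k = k2" for k
    using \<omega>_x_skew[of v1 k] v1 kW that xk by (auto simp: \<omega>s)
  have "s2 = 0" using sk[of k1] om P \<omega>_anti[of v2 k1] \<omega>_anti[of v1 k1] \<omega>_anti[of k2 k1] by (simp add: xv1 \<omega>s)
  moreover have "s1 = 0" using sk[of k2] om P \<omega>_anti[of v2 k2] by (simp add: xv1 \<omega>s)
  ultimately have xv1': "br x v1 = y1 *\<^sub>R k1 + y *\<^sub>R k2" using xv1 by simp
  have xv2: "br x v2 = y1 *\<^sub>R k2 + (y * r) *\<^sub>R k1"
    using comm_xe[of v1] by (simp add: v2_def[symmetric] xv1' brs k2_def[symmetric] ek2)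
  have "\<omega> (br x v1) v2 + \<omega> v1 (br x v2) = 0" using \<omega>_x_skew v1 v2 by blast
  then have "2 * (y1 * P) = 0" using om \<omega>_anti[of v1 k1] by (auto simp: xv1' xv2 \<omega>s)
  then have "y1 = 0" using P by simp
  show thesis
  proof (rule that[of v1 v2 k1 k2 r m l y P])
    show "\<forall>w\<in>W. cp (br k1 w) = 0" "\<forall>w\<in>W. cp (br k2 w) = 0" using pk by (auto simp: p_def)
  qed (use dbl.pr_zero v1 v2 kW fr ev2 b ek2 xv1' xv2 \<open>y1 = 0\<close> xk r P om l \<omega>_anti[of v1 k1] \<omega>_anti[of v2 k2]
      in \<open>auto simp: v2_def[symmetric] k2_def[symmetric] P_def p_def\<close>)
qed

end

text \<open>Brackets of \<open>W\<close> lie in the span of \<open>x\<close> and \<open>z\<close>;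
  then \<open>\<omega>\<close> and \<open>\<phi> z\<close> agree on \<open>W\<close>, and closedness
  of \<open>\<phi>\<close> becomes a set of scalar identities.\<close>

locale g2_flat = g2_cartan +
  assumes ca0: "\<And>u v. u \<in> W \<Longrightarrow> v \<in> W \<Longrightarrow> ca (br u v) = 0"
    and flat: "\<And>u v. u \<in> W \<Longrightarrow> v \<in> W \<Longrightarrow> pr (br u v) = 0"
begin

lemma br_W: "u \<in> W \<Longrightarrow> v \<in> W \<Longrightarrow> br u v = cp (br u v) *\<^sub>R x + cq (br u v) *\<^sub>R z"
  using coords[of "br u v"] ca0 flat by simp

lemma \<omega>_\<phi>_W: "u \<in> W \<Longrightarrow> v \<in> W \<Longrightarrow> \<omega> u v = \<phi> z u v"
proof (rule \<omega>_\<phi>)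
  assume "u \<in> W" "v \<in> W"
  then show "br u v \<in> Null e" using pr(2)[of "br u v"] flat by simp
qed

lemma closed_exuv: assumes "u \<in> W" "v \<in> W"
  shows "c * \<omega> u v - (\<phi> x (br e u) v + \<phi> x u (br e v)) + (\<phi> e (br x u) v + \<phi> e u (br x v)) + E * cq (br u v) = 0"
proof -
  have 1: "\<phi> (br u v) e x = - E * cq (br u v)"
    by (subst br_W[OF assms]) (simp add: \<phi>s E_\<phi>)
  show ?thesis
    using closed4[of e x u v] \<phi>_anti(1)[of "br e u" x v] \<phi>_cyc[of "br e v" x u]
      \<phi>_anti(1)[of "br x u" e v] \<phi>_cyc[of "br x v" e u] \<omega>_\<phi>_W[OF assms]
    by (simp add: 1 ex \<phi>s)
qed

text \<open>With \<open>p\<close> and \<open>q\<close> the \<open>x\<close>- and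
  \<open>z\<close>-components of brackets, this is the vanishing of the 4-form
  \<open>p \<and> \<phi> x + q \<and> \<omega>\<close> on \<open>W\<close>, a part of
  \<open>d \<phi> = 0\<close>.\<close>

lemma closed_W4: assumes "a \<in> W" "b \<in> W" "u \<in> W" "v \<in> W"
  shows "cp (br a b) * \<phi> x u v - cp (br a u) * \<phi> x b v + cp (br a v) * \<phi> x b u
    + cp (br b u) * \<phi> x a v - cp (br b v) * \<phi> x a u + cp (br u v) * \<phi> x a b
    + cq (br a b) * \<omega> u v - cq (br a u) * \<omega> b v + cq (br a v) * \<omega> b u
    + cq (br b u) * \<omega> a v - cq (br b v) * \<omega> a u + cq (br u v) * \<omega> a b = 0"
proof -
  have 1: "\<phi> (br s t) p q = cp (br s t) * \<phi> x p q + cq (br s t) * \<omega> p q" if "s \<in> W" "t \<in> W" "p \<in> W" "q \<in> W" for s t p q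
    by (subst br_W[OF that(1,2)]) (simp add: \<phi>s \<omega>_\<phi>_W[OF that(3,4)])
  show ?thesis using closed4[of a b u v] by (simp add: 1 assms)
qed

end

lemma frame_change:
  fixes fs gs :: "'a::euclidean_space list"
  assumes "frame gs" "length fs = length gs" "set gs \<subseteq> span (set fs)"
  shows "frame fs"
proof -
  have d: "dim (span (set gs)) = length fs" using frame_dim[OF assms(1)] assms(2) by simp
  have "dim (span (set gs)) \<le> dim (span (set fs))"
    using span_minimal[OF assms(3) subspace_span] by (intro dim_subset) simp
  then have le: "length fs \<le> dim (span (set fs))" using d by simp
  also have "\<dots> \<le> card (set fs)" using dim_le_card[of "span (set fs)" "set fs"] by simp
  finally have "card (set fs) = length fs" using card_length[of fs] by simp
  moreover have "independent (set fs)"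
    by (rule card_le_dim_spanning[of _ "span (set fs)"]) (use le card_length[of fs] in \<open>auto intro: span_base\<close>)
  ultimately show ?thesis by (simp add: frame_def card_distinct)
qed

lemma frame_scale:
  fixes fs :: "'a::euclidean_space list"
  assumes "frame fs" "length ks = length fs" "0 \<notin> set ks"
  shows "frame (map2 scaleR ks fs)"
proof (rule frame_change[OF assms(1)])
  show "set fs \<subseteq> span (set (map2 scaleR ks fs))"
  proof
    fix f assume "f \<in> set fs"
    then obtain i where i: "i < length fs" "f = fs ! i" by (metis in_set_conv_nth)
    then have "ks ! i *\<^sub>R f \<in> set (map2 scaleR ks fs)"
      using assms(2) by (force simp: set_conv_nth)
    then have "(1 / ks ! i) *\<^sub>R ks ! i *\<^sub>R f \<in> span (set (map2 scaleR ks fs))" by (intro span_scale span_base)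
    moreover have "ks ! i \<noteq> 0" using assms(2,3) i by (metis nth_mem)
    ultimately show "f \<in> span (set (map2 scaleR ks fs))" by simp
  qed
qed (use assms in simp)

context g2_flat
begin

text \<open>This excludes real eigenvalues of \<open>ad e\<close> next to a Jordan block. For the
  eigenvector \<open>w1\<close>, closedness with argument \<open>e\<close> multiplies the values not
  already known to be 0 by non-zero sums of eigenvalues, so \<open>z, x, w1', w2\<close> become
  isotropic.\<close>

lemma resonant_False:
  assumes fr: "frame [w1, z, x, w1', w2]" and wW: "w1 \<in> W" "w1' \<in> W" "w2 \<in> W"
    and D: "br e w1 = \<rho> *\<^sub>R w1" "br e w1' = - \<rho> *\<^sub>R w1'" "br e w2 = \<rho> *\<^sub>R w2 + K" and \<rho>: "\<rho> \<noteq> 0" and c0: "c = 0"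
    and bw: "br w1 w1' = 0" "br w1 w2 = 0" "br w1' w2 = 0" and xw: "br x w1 = 0" "br x w2 = 0"
    and om: "\<omega> w1 w1' = 0" "\<omega> w1 w2 = 0" and f: "\<phi> x w1 w1' = 0" "\<phi> x w1 K = 0" "\<phi> w1 w1' K = 0"
  shows False
proof (rule isotropic[OF fr])
  show "\<phi> w1 z x = 0"
    using \<omega>_\<phi>[of x w1] \<omega>_Null_Range[OF xN wW(1)] sN \<phi>_cyc[of w1 z x] by (simp add: xw subspace_0)
  show "\<phi> w1 z w1' = 0" using \<omega>_\<phi>_W[OF wW(1,2)] \<phi>_anti(1)[of w1 z w1'] om by simp
  show "\<phi> w1 z w2 = 0" using \<omega>_\<phi>_W[OF wW(1,3)] \<phi>_anti(1)[of w1 z w2] om by simp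
  show "\<phi> w1 x w1' = 0" using f \<phi>_anti(1)[of w1 x w1'] by simp
  have "\<phi> x (br e w1) w2 + \<phi> x w1 (br e w2) = 0"
    using closed_exuv[OF wW(1,3)] by (simp add: c0 xw bw cqs)
  then have "\<rho> * \<phi> x w1 w2 + \<rho> * \<phi> x w1 w2 = 0" by (simp add: D \<phi>s f)
  then show "\<phi> w1 x w2 = 0" using \<rho> \<phi>_anti(1)[of w1 x w2] by simp
  have "\<phi> (br e w1) w1' w2 - \<phi> (br e w1') w1 w2 + \<phi> (br e w2) w1 w1' = 0"
    using closed4[of e w1 w1' w2] by (simp add: bw)
  then show "\<phi> w1 w1' w2 = 0" using \<rho> \<phi>_anti(1)[of w1' w1 w2] \<phi>_cyc[of w2 w1 w1'] \<phi>_cyc[of w1 w1' w2] \<phi>_cyc[of K w1 w1'] f(3)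
    by (simp add: D \<phi>s)
qed

end

context g2_A
begin

text \<open>Closedness expresses the central structure constants \<open>\<alpha>\<close>,
  \<open>\<beta>\<close> by the remaining data, leading to the relation
  \<open>c P (m^2 + 3 r E^2) = 0\<close>. A positive \<open>r\<close> is impossible. For
  \<open>c = 0\<close> the algebra is \<open>s1\<close>; otherwise \<open>m^2 = - 3 r E^2\<close>,
  whose two roots give \<open>s10\<close> and \<open>s11\<close>.\<close>

lemma P_case:
  assumes ex: "\<exists>u\<in>W. \<exists>v\<in>W. cp (br u v) \<noteq> 0"
  shows "lie_isomorphic br s1 \<or> lie_isomorphic br s10 \<or> lie_isomorphic br s11"
proof -
  obtain v1 v2 k1 k2 r m l y P where vW: "v1 \<in> W" "v2 \<in> W" "k1 \<in> W" "k2 \<in> W" and fr: "frame [v1, v2, k1, k2]"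
    and D: "br e v1 = v2" "br e v2 = r *\<^sub>R v1 + m *\<^sub>R k1 + l *\<^sub>R k2" "br e k1 = k2" "br e k2 = r *\<^sub>R k1"
    and X: "br x v1 = y *\<^sub>R k2" "br x v2 = (y * r) *\<^sub>R k1" "br x k1 = 0" "br x k2 = 0"
    and r: "r \<noteq> 0" and P: "P \<noteq> 0" and p12: "cp (br v1 v2) = P"
    and pk0: "\<forall>w\<in>W. cp (br k1 w) = 0" "\<forall>w\<in>W. cp (br k2 w) = 0"
    and om: "\<omega> k1 v2 = P" "\<omega> v1 k2 = P" "\<omega> v1 k1 = 0" "\<omega> v2 k2 = 0" "\<omega> k1 k2 = 0"
    and l: "l = - E" and fl: "\<forall>u\<in>W. \<forall>v\<in>W. pr (br u v) = 0"
    by (rule P_normal[OF ex])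
  note pk = pk0[rule_format]
  interpret fl: g2_flat br \<phi> z e \<omega> x c by unfold_locales (use ca0 fl in auto)
  have fr7: "frame [x, e, z, v1, v2, k1, k2]" by (rule frame7_W[OF fr vW])
  define q where "q u v = cq (br u v)" for u v
  have qs: "q (u + u') v = q u v + q u' v" "q u (v + v') = q u v + q u v'" "q (s *\<^sub>R u) v = s * q u v"
    "q u (s *\<^sub>R v) = s * q u v" "q u u = 0" "q (u - u') v = q u v - q u' v" "q u (v - v') = q u v - q u v'" for u u' v v' s by (simp_all add: q_def brs cqs)
  have qanti: "q u v = - q v u" for u v using anti[of u v] by (simp add: q_def cqs)
  have pk': "cp (br w k1) = 0" "cp (br w k2) = 0" if "w \<in> W" for w
    using pk[OF that] anti[of w k1] anti[of w k2] by (simp_all add: cps)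
  have q_e': "q (br e u) v + q u (br e v) = - c * cp (br u v)" for u v using q_e by (simp add: q_def)
  define \<alpha> where "\<alpha> = q v1 k2"
  define \<beta> where "\<beta> = q v1 k1"
  have q21: "q v2 k1 = - \<alpha>" using q_e'[of v1 k1] pk'[OF vW(1)] by (simp add: D \<alpha>_def)
  have q22: "q v2 k2 = - r * \<beta>" using q_e'[of v1 k2] pk'[OF vW(1)] by (simp add: D \<beta>_def qs)
  have qkk: "q k1 k2 = 0"
    using q_e'[of v2 k1] pk'[OF vW(2)] q22 E_nz l qanti[of k2 k1] by (simp add: D qs \<beta>_def)
  have ma: "m * \<beta> - E * \<alpha> = - c * P"
    using q_e'[of v1 v2] p12 by (simp add: D qs l \<alpha>_def[symmetric] \<beta>_def[symmetric])
  have y\<beta>: "y * \<beta> = 0"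
    using q_x[of v1 v2] ca0[OF vW(1,2)] qanti[of k2 v2] q22 r
    by (auto simp: X q_def[symmetric] qs \<beta>_def[symmetric])
  have rev: "\<omega> v2 k1 = - P" using \<omega>_anti[of v2 k1] om by simp
  have fkk: "\<phi> x k1 k2 = 2 * \<alpha>"
    using fl.closed_W4[OF vW] P p12 pk[OF vW(4)] pk'[OF vW(1)] pk'[OF vW(2)] q21 om rev
    by (simp add: q_def[symmetric] qkk \<alpha>_def[symmetric] \<beta>_def[symmetric] algebra_simps)
  note cl = fl.closed_exuv[folded q_def]
  have \<alpha>: "\<alpha> = - c * P / (2 * E)"
  proof -
    have "c * P - (\<phi> x v2 k2 + r * \<phi> x v1 k1) + E * \<alpha> = 0"
      using cl[OF vW(1,4)] om by (simp add: D X \<phi>s \<alpha>_def)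
    moreover have "- c * P - (r * \<phi> x v1 k1 + l * \<phi> x k2 k1 + \<phi> x v2 k2) - E * \<alpha> = 0"
      using cl[OF vW(2,3)] rev q21 by (simp add: D X \<phi>s)
    ultimately have "2 * E * \<alpha> = - c * P"
      using fkk \<phi>_anti(2)[of x k2 k1] l by (simp add: algebra_simps)
    then show ?thesis using E_nz by (simp add: field_simps)
  qed
  have m\<beta>: "m * \<beta> = - 3 / 2 * c * P" using ma \<alpha> E_nz by (simp add: field_simps)
  have mf: "m * (2 * \<alpha>) + 2 * r * E * \<beta> = - 2 * r * y * \<phi> e k2 k1"
  proof -
    have "- (\<phi> x v2 k1 + \<phi> x v1 k2) + y * \<phi> e k2 k1 + E * \<beta> = 0"
      using cl[OF vW(1,3)] om by (simp add: D X \<phi>s \<beta>_def)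
    then have "r * (- (\<phi> x v2 k1 + \<phi> x v1 k2) + y * \<phi> e k2 k1 + E * \<beta>) = 0" by simp
    moreover have "- (r * \<phi> x v1 k2 + m * (2 * \<alpha>) + r * \<phi> x v2 k1) - y * r * \<phi> e k2 k1 - E * r * \<beta> = 0"
      using cl[OF vW(2,4)] om q22 \<phi>_anti(2)[of e k1 k2] by (simp add: D X \<phi>s fkk)
    ultimately show ?thesis by (simp add: algebra_simps)
  qed
  have brWW: "br u v = cp (br u v) *\<^sub>R x + q u v *\<^sub>R z" if "u \<in> W" "v \<in> W" for u v
    using fl.br_W[OF that] by (simp add: q_def)
  have bvk: "br v1 k1 = \<beta> *\<^sub>R z" "br v1 k2 = \<alpha> *\<^sub>R z" "br v2 k1 = (- \<alpha>) *\<^sub>R z" "br v2 k2 = (- r * \<beta>) *\<^sub>R z" "br k1 k2 = 0"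
    "br v1 v2 = P *\<^sub>R x + q v1 v2 *\<^sub>R z"
    using brWW[OF vW(1,3)] brWW[OF vW(1,4)] brWW[OF vW(2,3)] brWW[OF vW(2,4)] brWW[OF vW(3,4)] brWW[OF vW(1,2)] vW
    by (simp_all add: pk pk' p12 q21 q22 qkk \<alpha>_def[symmetric] \<beta>_def[symmetric])
  have "frame [k2, k1]" by (rule frame_subset[OF fr7]) (use fr7 in \<open>auto simp: frame_def\<close>)
  then have nz: "k1 \<noteq> 0" "k2 \<notin> span {k1}" by (auto simp: frame_Cons)
  \<comment> \<open>Otherwise closedness would make \<open>\<phi> k1 k2\<close> vanish on a basis,
    and \<open>k2\<close> would lie in the kernel line of \<open>\<phi> k1\<close>.\<close>
  have y: "y = 0"
  proof (rule ccontr)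
    assume y: "y \<noteq> 0"
    then have b: "\<beta> = 0" using y\<beta> by simp
    then have c0: "c = 0" using m\<beta> P by simp
    then have a0: "\<alpha> = 0" using \<alpha> by simp
    have "\<phi> e k2 k1 = 0" using mf y r a0 b by simp
    then have e0: "\<phi> k1 k2 e = 0" using \<phi>_anti(2)[of e k2 k1] \<phi>_cyc[of e k1 k2] by simp
    have x0: "\<phi> k1 k2 x = 0" using fkk a0 \<phi>_cyc[of x k1 k2] by simp
    have z0': "\<phi> k1 k2 z = 0" using om(5) fl.\<omega>_\<phi>_W[OF vW(3,4)] \<phi>_cyc[of z k1 k2] by simp
    have b0: "br v2 k2 = 0" "br k2 v1 = 0" "br v1 k1 = 0" "br k1 v2 = 0"
      using bvk a0 b anti[of k2 v1] anti[of k1 v2] by simp_all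
    have b21: "br v2 v1 = (- P) *\<^sub>R x + (- q v1 v2) *\<^sub>R z" using bvk(6) anti[of v2 v1] by simp
    have zx: "\<phi> z x k1 = 0" "\<phi> z x k2 = 0"
      using \<omega>_\<phi>[of x k1] \<omega>_\<phi>[of x k2] \<omega>_Null_Range[OF xN] vW X sN by (auto simp: subspace_0)
    have "(y * r) * \<phi> k1 k2 v1 = 0"
      using closed4[of x v2 k2 v1] by (simp add: X b0 b21 \<phi>s zx)
    then have 1: "\<phi> k1 k2 v1 = 0" using y r by simp
    have "y * \<phi> k2 k1 v2 = 0"
      using closed4[of x v1 k1 v2] by (simp add: X b0 bvk(6) \<phi>s zx)
    then have 2: "\<phi> k1 k2 v2 = 0" using y \<phi>_anti(1)[of k2 k1 v2] by simp
    have "\<phi> k1 k2 w = 0" for w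
    proof -
      have "w \<in> span (set [x, e, z, v1, v2, k1, k2])" using frame_UNIV[OF fr7] by simp
      also have "\<dots> \<subseteq> {w. \<phi> k1 k2 w = 0}"
        by (rule span_minimal) (use e0 x0 z0' 1 2 in \<open>auto simp: subspace_def \<phi>s\<close>)
      finally show ?thesis by simp
    qed
    then have "k2 \<in> span {k1}" using kernel[OF nz(1)] by simp
    then show False using nz by simp
  qed
  have x0: "br x v1 = 0" "br x v2 = 0" using X y by auto
  have r_neg: "r < 0"
  proof (rule ccontr)
    assume "\<not> r < 0"
    then have rp: "r > 0" using r by simp
    define \<rho> where "\<rho> = sqrt r"
    have \<rho>: "\<rho> > 0" "r = \<rho> * \<rho>" using rp by (auto simp: \<rho>_def)
    have "m * (m * (2 * \<alpha>) + 2 * r * E * \<beta>) = 0" using mf y by simp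
    then have "2 * (m * m * \<alpha>) + 2 * (r * E * (m * \<beta>)) = 0" by (simp add: algebra_simps)
    then have "c * P * (m * m + 3 * (r * E * E)) = 0"
      unfolding m\<beta> \<alpha> using E_nz by (simp add: field_simps)
    moreover have "m * m + 3 * (r * E * E) > 0"
      using rp E_nz by (metis add_nonneg_pos mult.assoc mult_pos_pos not_square_less_zero linorder_neqE_linordered_idom zero_less_mult_iff zero_less_numeral not_le_imp_less)
    ultimately have c0: "c = 0" using P by simp
    then have a0: "\<alpha> = 0" using \<alpha> by simp
    have b0: "\<beta> = 0" using mf y a0 r E_nz by simp
    define w1 where "w1 = k2 + \<rho> *\<^sub>R k1"
    define w1' where "w1' = k2 - \<rho> *\<^sub>R k1"
    define w2 where "w2 = v2 + \<rho> *\<^sub>R v1"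
    define K where "K = m *\<^sub>R k1 + l *\<^sub>R k2"
    have wW: "w1 \<in> W" "w1' \<in> W" "w2 \<in> W" "K \<in> W" unfolding w1_def w1'_def w2_def K_def
      using vW sW by (auto intro!: subspace_add subspace_diff subspace_scale)
    have Dw: "br e w1 = \<rho> *\<^sub>R w1" "br e w1' = - \<rho> *\<^sub>R w1'" "br e w2 = \<rho> *\<^sub>R w2 + K"
      by (simp_all add: w1_def w1'_def w2_def K_def brs D \<rho>(2) algebra_simps)
    have bk: "br u v = 0" if "u = k1 \<or> u = k2" "v = k1 \<or> v = k2 \<or> v = v1 \<or> v = v2" for u v
      using that bvk a0 b0 anti[of k1 v1] anti[of k2 v1] anti[of k1 v2] anti[of k2 v2] anti[of k2 k1] by auto
    have bw: "br w1 w1' = 0" "br w1 w2 = 0" "br w1' w2 = 0" "br w1 K = 0"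
      by (simp_all add: w1_def w1'_def w2_def K_def brs bk)
    have xw: "br x w1 = 0" "br x w2 = 0" by (simp_all add: w1_def w2_def brs X(3,4) x0)
    have f0: "\<phi> x k1 k2 = 0" "\<phi> x k2 k1 = 0" using fkk a0 \<phi>_anti(2)[of x k2 k1] by auto
    have fr5: "frame [w1, z, x, w1', w2]"
    proof -
      have *: "frame [w1, z, x, w1', w2, e, v1]"
      proof (rule frame_change[OF fr7])
        let ?S = "span (set [w1, z, x, w1', w2, e, v1])"
        have mem: "w1 \<in> ?S" "w1' \<in> ?S" "w2 \<in> ?S" "v1 \<in> ?S" "x \<in> ?S" "e \<in> ?S" "z \<in> ?S" by (auto intro: span_base)
        have "k2 = (1/2) *\<^sub>R (w1 + w1')" "k1 = (1 / (2 * \<rho>)) *\<^sub>R (w1 - w1')" "v2 = w2 - \<rho> *\<^sub>R v1"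
          using \<rho> by (simp_all add: w1_def w1'_def w2_def scaleR_2[symmetric] algebra_simps)
        then have "k2 \<in> ?S" "k1 \<in> ?S" "v2 \<in> ?S" using mem by (metis span_scale span_add span_diff)+
        then show "set [x, e, z, v1, v2, k1, k2] \<subseteq> ?S" using mem by auto
      qed simp
      show ?thesis by (rule frame_subset[OF *]) (use * in \<open>auto simp: frame_def\<close>)
    qed
    show False
    proof (rule fl.resonant_False[OF fr5 wW(1-3) Dw _ c0 bw(1-3) xw])
      show "\<omega> w1 w1' = 0" using om(5) \<omega>_anti[of k2 k1] by (simp add: w1_def w1'_def \<omega>s)
      show "\<omega> w1 w2 = 0" using om \<omega>_anti[of k1 v1] \<omega>_anti[of k2 v1] \<omega>_anti[of k2 v2] by (simp add: w1_def w2_def \<omega>s)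
      show "\<phi> w1 w1' K = 0" using \<phi>_anti(1)[of k1 k2] \<phi>_cyc[of k1 k2] by (simp add: w1_def w1'_def K_def \<phi>s)
    qed (use \<rho> f0 in \<open>auto simp: w1_def w1'_def K_def \<phi>s\<close>)
  qed
  define \<rho> where "\<rho> = sqrt (- r)"
  have \<rho>: "\<rho> > 0" "r = - (\<rho> * \<rho>)" using r_neg by (auto simp: \<rho>_def)
  \<comment> \<open>\<open>n k1 + m' k2\<close> is the nilpotent Jordan part of \<open>ad e\<close>
    applied to \<open>v1\<close>, namely \<open>D (D^2 - r) v1 / (2 r)\<close>. With
    \<open>f6 = e / \<rho>\<close>, \<open>f3\<close> and \<open>f4\<close> are the semisimple and
    nilpotent parts of \<open>[f6, v1]\<close>.\<close>
  define n where "n = - E / 2"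
  define m' where "m' = - m / (2 * (\<rho> * \<rho>))"
  define T where "T = n * \<beta> + m' * \<alpha>"
  define f4 where "f4 = (n / \<rho>) *\<^sub>R k1 + (m' / \<rho>) *\<^sub>R k2"
  define f3 where "f3 = (1 / \<rho>) *\<^sub>R v2 - f4"
  define f5 where "f5 = (n / (\<rho> * \<rho>)) *\<^sub>R k2 - m' *\<^sub>R k1"
  define f6 where "f6 = (1 / \<rho>) *\<^sub>R e"
  define f1 where "f1 = - br v1 f3"
  have A1: "n * \<alpha> - m' * (\<rho> * \<rho>) * \<beta> = - c * P / 2"
  proof -
    have "n * \<alpha> = c * P / 4" using E_nz by (simp add: n_def \<alpha>)
    moreover have "m' * (\<rho> * \<rho>) * \<beta> = - (m * \<beta>) / 2" using \<rho>(1) by (simp add: m'_def)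
    ultimately show ?thesis by (simp add: m\<beta>)
  qed
  have f1: "f1 = (- P / \<rho>) *\<^sub>R x + (T / \<rho> - q v1 v2 / \<rho>) *\<^sub>R z"
    by (simp add: f1_def f3_def f4_def brs bvk T_def) (simp add: vec_eq_iff algebra_simps add_divide_distrib)
  have "br x k1 = 0" "br x k2 = 0" using X by auto
  note xs = this x0
  have Df: "br f6 v1 = f3 + f4" "br f6 f3 = - v1 + f5" "br f6 f4 = f5" "br f6 f5 = - f4"
    using \<rho> by (simp_all add: f3_def f4_def f5_def f6_def brs D l n_def m'_def) 
     (simp_all add: vec_eq_iff field_simps)
  have b1: "br v1 f3 = - f1" by (simp add: f1_def)
  have kr: "br k2 k1 = 0" "br k1 v1 = - (\<beta> *\<^sub>R z)" "br k2 v1 = - (\<alpha> *\<^sub>R z)" "br k1 v2 = \<alpha> *\<^sub>R z" "br k2 v2 = (r * \<beta>) *\<^sub>R z"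
    using bvk anti[of k2 k1] anti[of k1 v1] anti[of k2 v1] anti[of k1 v2] anti[of k2 v2] by simp_all
  have B0: "br v1 f5 = ((n * \<alpha> - m' * (\<rho> * \<rho>) * \<beta>) / (\<rho> * \<rho>)) *\<^sub>R z"
      "br f3 f4 = (- (n * \<alpha> - m' * (\<rho> * \<rho>) * \<beta>) / (\<rho> * \<rho>)) *\<^sub>R z"
    using \<rho>(1) by (simp_all add: f3_def f4_def f5_def brs bvk kr \<rho>(2)) (simp_all add: vec_eq_iff field_simps)
  have B: "br v1 f4 = (T / \<rho>) *\<^sub>R z" "br v1 f5 = (- c * P / (2 * (\<rho> * \<rho>))) *\<^sub>R z" "br f3 f4 = (c * P / (2 * (\<rho> * \<rho>))) *\<^sub>R z"
    "br f3 f5 = (T / \<rho>) *\<^sub>R z" "br f4 f5 = 0"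
    using B0 unfolding A1 using \<rho>(1) by (simp_all add: f3_def f4_def f5_def brs bvk kr T_def \<rho>(2)) (simp_all add: vec_eq_iff field_simps)
  have F1: "br f1 v1 = 0" "br f1 f3 = 0" "br f1 f4 = 0" "br f1 f5 = 0" "br f1 f6 = (- (c * P / (\<rho> * \<rho>))) *\<^sub>R z"
    by (simp_all add: f1 f3_def f4_def f5_def f6_def brs xs xe)
  have rev6: "br v1 f6 = - f3 + - f4" "br f3 f6 = v1 + - f5" "br f4 f6 = - f5" "br f5 f6 = f4"
    using Df anti[of v1 f6] anti[of f3 f6] anti[of f4 f6] anti[of f5 f6] by simp_all
  have fr': "frame [f1, v1, f3, f4, f5, f6, k *\<^sub>R z]" if "k \<noteq> 0" for k
  proof (rule frame_change[OF fr7])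
    let ?S = "span (set [f1, v1, f3, f4, f5, f6, k *\<^sub>R z])"
    have mem: "f1 \<in> ?S" "v1 \<in> ?S" "f3 \<in> ?S" "f4 \<in> ?S" "f5 \<in> ?S" "f6 \<in> ?S" "k *\<^sub>R z \<in> ?S" by (auto intro: span_base)
    have "z = (1 / k) *\<^sub>R (k *\<^sub>R z)" using that by simp
    then have z: "z \<in> ?S" using mem by (metis span_scale)
    have "x = (- \<rho> / P) *\<^sub>R (f1 - (T / \<rho> - q v1 v2 / \<rho>) *\<^sub>R z)" using P \<rho>(1) by (simp add: f1)
    then have x: "x \<in> ?S" using mem z by (metis span_scale span_diff)
    have "e = \<rho> *\<^sub>R f6" using \<rho> by (simp add: f6_def)
    then have e: "e \<in> ?S" using mem by (metis span_scale)
    have "v2 = \<rho> *\<^sub>R (f3 + f4)" using \<rho> by (simp add: f3_def)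
    then have v2: "v2 \<in> ?S" using mem by (metis span_scale span_add)
    \<comment> \<open>Up to a power of \<open>\<rho>\<close>, the determinant of the passage from
      \<open>k1, k2\<close> to \<open>f4, f5\<close>.\<close>
    define N where "N = n * n + m' * m' * (\<rho> * \<rho>)"
    have "n * n > 0" "m' * m' * (\<rho> * \<rho>) \<ge> 0" using E_nz by (auto simp: n_def zero_less_mult_iff zero_le_mult_iff)
    then have N: "N > 0" unfolding N_def by (rule add_pos_nonneg)
    have "N *\<^sub>R k1 = (n * \<rho>) *\<^sub>R f4 - (m' * (\<rho> * \<rho>)) *\<^sub>R f5" "N *\<^sub>R k2 = (m' * \<rho> * (\<rho> * \<rho>)) *\<^sub>R f4 + (n * (\<rho> * \<rho>)) *\<^sub>R f5"
      using \<rho>(1) by (simp_all add: f4_def f5_def N_def vec_eq_iff field_simps)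
    then have "N *\<^sub>R k1 \<in> ?S" "N *\<^sub>R k2 \<in> ?S" using mem by (metis span_scale span_add span_diff)+
    from span_scale[OF this(1), of "1 / N"] span_scale[OF this(2), of "1 / N"] have "k1 \<in> ?S" "k2 \<in> ?S" using N by auto
    then show "set [x, e, z, v1, v2, k1, k2] \<subseteq> ?S" using mem x e z v2 by simp
  qed simp
  show ?thesis
  proof (cases "c = 0")
    case True
    then have "\<alpha> = 0" using \<alpha> by simp
    moreover have "\<beta> = 0" using mf y \<open>\<alpha> = 0\<close> r E_nz by simp
    ultimately have T: "T = 0" by (simp add: T_def)
    have "lie_isomorphic br s1"
      by (rule s1_I[OF fr'[of 1]]) (simp_all add: F1 B T True b1 rev6 brs)
    then show ?thesis by simp
  next
    case False
    \<comment> \<open>The ratio whose square closedness forces to be 3.\<close>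
    define t where "t = - m / (\<rho> * E)"
    have m: "m = - t * (\<rho> * E)" using \<rho>(1) E_nz by (simp add: t_def)
    have "m * (m * (2 * \<alpha>) + 2 * r * E * \<beta>) = 0" using mf y by simp
    then have "2 * (m * m * \<alpha>) + 2 * (r * E * (m * \<beta>)) = 0" by (simp add: algebra_simps)
    then have "c * P * (m * m + 3 * (r * E * E)) = 0"
      unfolding m\<beta> \<alpha> using E_nz by (simp add: field_simps)
    then have "m * m + 3 * (r * E * E) = 0" using P False by simp
    then have "(\<rho> * E) * (\<rho> * E) * (t * t - 3) = 0" by (simp add: m \<rho>(2) algebra_simps)
    then have t3: "t * t = 3" using \<rho>(1) E_nz by simp
    then have t0: "t \<noteq> 0" by auto
    have "t * (\<beta> * (2 * (\<rho> * E))) = t * (t * (c * P))" using m\<beta> t3 by (simp add: m algebra_simps)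
    then have "\<beta> * (2 * (\<rho> * E)) = t * (c * P)" using t0 by simp
    then have \<beta>': "\<beta> = t * c * P / (2 * (\<rho> * E))" using \<rho>(1) E_nz by (simp add: field_simps)
    have "m' = t * E / (2 * \<rho>)" using \<rho>(1) by (simp add: m'_def m)
    then have T: "T = - t * (c * P / (2 * \<rho>))"
      using \<rho>(1) E_nz by (simp add: T_def \<beta>' \<alpha> n_def field_simps)
    define k where "k = c * P / (2 * (\<rho> * \<rho>))"
    have k: "k \<noteq> 0" using False P \<rho> by (simp add: k_def)
    have ks: "T / \<rho> = - t * k" "- c * P / (2 * (\<rho> * \<rho>)) = - k" "c * P / (2 * (\<rho> * \<rho>)) = k" "- (c * P / (\<rho> * \<rho>)) = - 2 * k"
      using \<rho>(1) by (simp_all add: T k_def)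
    have "(t - sqrt 3) * (t + sqrt 3) = 0" using t3 by (simp add: algebra_simps)
    then consider "t = sqrt 3" | "t = - sqrt 3" by (auto simp: eq_neg_iff_add_eq_0)
    then show ?thesis
    proof cases
      case 1
      have "lie_isomorphic br s10" by (rule s10_I[OF fr'[OF k]]) (simp_all add: F1 B b1 rev6 brs ks 1)
      then show ?thesis by simp
    next
      case 2
      have "lie_isomorphic br s11" by (rule s11_I[OF fr'[OF k]]) (simp_all add: F1 B b1 rev6 brs ks 2)
      then show ?thesis by simp
    qed
  qed
qed

end

section \<open>Brackets of W on the central line\<close>

locale g2_abelian = g2_torus +
  assumes flat: "\<And>u v. u \<in> W \<Longrightarrow> v \<in> W \<Longrightarrow> pr (br u v) = 0"
begin

sublocale g2_flat by unfold_locales (use ca0 flat in auto)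

definition q :: "real^7 \<Rightarrow> real^7 \<Rightarrow> real" where "q u v = cq (br u v)"

lemma qs: "q (u + u') v = q u v + q u' v" "q u (v + v') = q u v + q u v'" "q (s *\<^sub>R u) v = s * q u v"
    "q u (s *\<^sub>R v) = s * q u v" "q (u - u') v = q u v - q u' v" "q u (v - v') = q u v - q u v'" "q u u = 0"
  by (simp_all add: q_def brs cqs)

lemma q_anti: "q u v = - q v u"
  using anti[of u v] by (simp add: q_def cqs)

lemma br_q: "u \<in> W \<Longrightarrow> v \<in> W \<Longrightarrow> br u v = q u v *\<^sub>R z"
  using br_W cp0 by (simp add: q_def)

lemma q_D: "u \<in> W \<Longrightarrow> v \<in> W \<Longrightarrow> q (br e u) v + q u (br e v) = 0"
  using q_e[of u v] cp0 by (simp add: q_def)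

lemma q_X: "u \<in> W \<Longrightarrow> v \<in> W \<Longrightarrow> q (br x u) v + q u (br x v) = 0"
  using q_x[of u v] ca0 by (simp add: q_def)

lemma closed_q: "u \<in> W \<Longrightarrow> v \<in> W \<Longrightarrow>
  c * \<omega> u v - (\<phi> x (br e u) v + \<phi> x u (br e v)) + (\<phi> e (br x u) v + \<phi> e u (br x v)) + E * q u v = 0"
  using closed_exuv by (simp add: q_def)

lemma wedge_q: "a \<in> W \<Longrightarrow> b \<in> W \<Longrightarrow> u \<in> W \<Longrightarrow> v \<in> W \<Longrightarrow>
    q a b * \<omega> u v - q a u * \<omega> b v + q a v * \<omega> b u + q b u * \<omega> a v - q b v * \<omega> a u + q u v * \<omega> a b = 0"
  using closed_W4[of a b u v] cp0 by (simp add: q_def)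

end

locale g2_double0 = g2_double + g2_torus
begin

lemma NN_skew: "u \<in> W \<Longrightarrow> v \<in> W \<Longrightarrow> \<omega> (NN u) v = - \<omega> u (NN v)"
  using D_skew[of "br e (br e u)" v] D_skew[of "br e u" "br e v"] D_skew[of u "br e (br e v)"] D_skew[of u v] eW
  by (simp add: NN_def brs \<omega>s algebra_simps)

lemma SS_skew: "u \<in> W \<Longrightarrow> v \<in> W \<Longrightarrow> \<omega> (SS u) v = - \<omega> u (SS v)"
  using D_skew NN_skew by (simp add: SS_def \<omega>s)

text \<open>Since \<open>Y\<close> and \<open>SS\<close> are skew and commute on \<open>W\<close>,
  \<open>\<omega> (Y u) v\<close> is a symmetric form on \<open>W\<close> for which
  \<open>SS\<close> is skew. This explains the zero pairings and the factor \<open>- r\<close>; a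
  vector on which the form is non-zero generates \<open>W\<close> under \<open>SS\<close> and
  \<open>Y\<close>.\<close>

lemma frame_skew_square:
  assumes Y: "linear Y" "\<And>w. w \<in> W \<Longrightarrow> Y w \<in> W" "\<And>w. w \<in> W \<Longrightarrow> SS (Y w) = Y (SS w)"
    and sk: "\<And>u v. u \<in> W \<Longrightarrow> v \<in> W \<Longrightarrow> \<omega> (Y u) v = - \<omega> u (Y v)"
    and sq: "\<And>w. w \<in> W \<Longrightarrow> Y (Y w) = 0" and nz: "\<exists>w\<in>W. Y w \<noteq> 0"
  obtains v b where "v \<in> W" "b \<noteq> 0" "frame [v, SS v, Y v, Y (SS v)]"
    "\<omega> (Y v) v = b" "\<omega> (Y (SS v)) (SS v) = - r * b" "\<omega> (Y v) (SS v) = 0" "\<omega> (Y (SS v)) v = 0" "\<omega> (Y v) (Y (SS v)) = 0"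
proof -
  obtain v where v: "v \<in> W" "\<omega> v (Y v) \<noteq> 0"
    using skew_vector[OF sW Y(1,2) nz sk \<omega>_nd_Range] by blast
  then have v: "v \<in> W" "\<omega> (Y v) v \<noteq> 0" using \<omega>_anti[of v "Y v"] by auto
  note S = SS_skew
  have sv: "SS v \<in> W" using SS_W v by blast
  have 1: "\<omega> (Y (SS v)) (SS v) = - r * \<omega> (Y v) v"
    using S[OF Y(2)[OF v(1)] sv] Y(3)[OF v(1)] SS_SS[OF v(1)] by (simp add: \<omega>s)
  have 2: "\<omega> (Y v) (SS v) = 0"
    using S[OF Y(2)[OF v(1)] v(1)] Y(3)[OF v(1)] sk[OF sv v(1)] \<omega>_anti[of "SS v" "Y v"] by simp
  have 3: "\<omega> (Y (SS v)) v = 0" using S[OF Y(2)[OF v(1)] v(1)] Y(3)[OF v(1)] 2 by simp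
  have 4: "\<omega> (Y v) (Y (SS v)) = 0" using sk[OF v(1) Y(2)[OF sv]] sq[OF sv] by (simp add: \<omega>s)
  have "frame [v, SS v, Y (SS v), Y v]"
    unfolding frame_explicit
  proof (intro allI impI)
    fix a1 a2 a3 a4 assume h: "a1 *\<^sub>R v + a2 *\<^sub>R SS v + a3 *\<^sub>R Y (SS v) + a4 *\<^sub>R Y v = 0"
    let ?w = "a1 *\<^sub>R v + a2 *\<^sub>R SS v + a3 *\<^sub>R Y (SS v) + a4 *\<^sub>R Y v"
    have "\<omega> (Y v) ?w = a1 * \<omega> (Y v) v" "\<omega> (Y (SS v)) ?w = a2 * (- r * \<omega> (Y v) v)"
      using 1 2 3 4 \<omega>_anti[of "Y (SS v)" "Y v"] by (simp_all add: \<omega>s)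
    then have a: "a1 = 0" "a2 = 0" unfolding h using v r0 by (auto simp: \<omega>s)
    have "\<omega> ?w v = a4 * \<omega> (Y v) v" "\<omega> ?w (SS v) = a3 * (- r * \<omega> (Y v) v)"
      using 1 2 3 by (simp_all add: \<omega>s a)
    then show "a1 = 0 \<and> a2 = 0 \<and> a3 = 0 \<and> a4 = 0" unfolding h using v r0 a by (auto simp: \<omega>s)
  qed
  then have "frame [v, SS v, Y v, Y (SS v)]" by (rule frame_permute) auto
  then show thesis using that[of v "\<omega> (Y v) v"] v 1 2 3 4 by simp
qed

lemma frame_independent:
  assumes "frame [v, v', u, u']" "a *\<^sub>R u + b *\<^sub>R u' = 0" shows "a = 0 \<and> b = 0"
proof -
  have "0 *\<^sub>R v + 0 *\<^sub>R v' + a *\<^sub>R u + b *\<^sub>R u' = 0" using assms by simp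
  then show ?thesis using assms(1) unfolding frame_explicit by blast
qed

end

locale g2_AD = g2_A + g2_double0
begin

sublocale g2_abelian by unfold_locales (use ca0 cp0 pr_zero in auto)

text \<open>The square \<open>A'\<close> of \<open>ad x\<close> is self-adjoint with
  \<open>A'^2 = 0\<close>. If \<open>A' v\<close> paired with \<open>SS v\<close>, then modulo the
  image of \<open>A'\<close> the operator \<open>ad x\<close> would be a number
  \<open>a + b SS\<close>; nilpotency would give \<open>a = b = 0\<close> and
  \<open>A' v = 0\<close>. So that pairing is identically 0, and polarization gives
  \<open>A' = 0\<close>.\<close>

lemma x_square_zero: assumes "w \<in> W" shows "br x (br x w) = 0"
proof -
  have sk: "\<omega> (br x u) v = - \<omega> u (br x v)" if "u \<in> W" "v \<in> W" for u v using \<omega>_x_skew[OF that] by simp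
  have l2: "linear (\<lambda>w. br x (br x w))" using linear_compose[OF lin2 lin2] by (simp add: o_def)
  obtain \<tau> \<delta> where A: "\<And>w. w \<in> W \<Longrightarrow> br x (br x (br x (br x w))) = \<tau> *\<^sub>R br x (br x w) - \<delta> *\<^sub>R w"
    by (rule self_adjoint_quadratic[OF sW dim4 \<omega>_bil \<omega>_self \<omega>_nd_Range l2]) (use xW sk in auto)
  have \<delta>: "\<delta> = 0"
  proof -
    obtain w where "w \<in> W" "w \<noteq> 0" "\<And>C. C \<in> {br x} \<Longrightarrow> C w = 0"
      by (rule commuting_nilpotent_kernel[of "{br x}" W]) (use lin2 sW xW Range_nz xnil in auto)
    then show ?thesis using A[of w] by (simp add: brs)
  qed
  have A0: "br x (br x (br x (br x w))) = 0" if w: "w \<in> W" for w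
  proof (rule ccontr)
    assume nz: "br x (br x (br x (br x w))) \<noteq> 0"
    define u where "u = br x (br x w)"
    have u: "u \<in> W" "u \<noteq> 0" "br x (br x u) = \<tau> *\<^sub>R u" using A[OF w] \<delta> xW w nz by (auto simp: u_def brs)
    obtain n where "(br x ^^ n) u = 0" using xnil u by blast
    then have "\<tau> = 0" using nilpotent_square_eigenvalue[OF lin2 _ u(2,3)] by blast
    then show False using nz u by (simp add: u_def)
  qed
  define A' where "A' w = br x (br x w)" for w
  have A'lin: "A' (u + v) = A' u + A' v" "A' (s *\<^sub>R u) = s *\<^sub>R A' u" "A' 0 = 0" for u v s by (simp_all add: A'_def brs)
  have A'W: "A' w \<in> W" if "w \<in> W" for w using that xW by (simp add: A'_def)
  have A'S: "A' (SS w) = SS (A' w)" for w by (simp add: A'_def SS_x)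
  have A'A': "A' (A' w) = 0" if "w \<in> W" for w using A0[OF that] by (simp add: A'_def)
  have sa: "\<omega> (A' u) v = \<omega> u (A' v)" if "u \<in> W" "v \<in> W" for u v
    using sk[OF xW[OF that(1)] that(2)] sk[OF that(1) xW[OF that(2)]] by (simp add: A'_def)
  note S = SS_skew
  have d: "\<omega> (A' v) (SS v) = 0" if v: "v \<in> W" for v
  proof (rule ccontr)
    assume k: "\<omega> (A' v) (SS v) \<noteq> 0"
    have sv: "SS v \<in> W" using SS_W v by blast
    have "frame [v, SS v, A' v, A' (SS v)]"
    proof (rule frame_by_pairing[of _ _ "\<omega> (A' v) (SS v)"])
      show "\<omega> v (A' (SS v)) = \<omega> (A' v) (SS v)" using sa[OF v sv] by simp
      show "\<omega> (A' v) v = 0" using sa[OF v v] \<omega>_anti[of v "A' v"] by simp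
      show "\<omega> (A' (SS v)) (SS v) = 0" using sa[OF sv sv] \<omega>_anti[of "SS v" "A' (SS v)"] by simp
      show "\<omega> (A' v) (A' (SS v)) = 0" using sa[OF v A'W[OF sv]] A'A'[OF sv] by (simp add: \<omega>s)
    qed (use k in auto)
    note fr = this
    obtain a b s t where xv: "br x v = a *\<^sub>R v + b *\<^sub>R SS v + s *\<^sub>R A' v + t *\<^sub>R A' (SS v)"
      by (rule W_coords[OF fr v sv A'W[OF v] A'W[OF sv] xW[OF v]])
    have xA: "br x (A' w) = A' (br x w)" for w by (simp add: A'_def)
    have 1: "A' (br x v) = a *\<^sub>R A' v + b *\<^sub>R A' (SS v)"
      using A'A'[OF v] A'A'[OF sv] by (simp add: xv A'lin)
    have 2: "A' (br x (SS v)) = a *\<^sub>R A' (SS v) + (r * b) *\<^sub>R A' v"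
      using arg_cong[OF 1, of SS] SS_SS[OF A'W[OF v]] by (simp add: SNs A'S SS_x[symmetric])
    have "0 = A' (br x (br x v))" using A'A'[OF v] by (simp add: A'_def)
    also have "\<dots> = a *\<^sub>R A' (br x v) + b *\<^sub>R A' (br x (SS v))"
      using A'A'[OF xW[OF v]] A'A'[OF xW[OF sv]] by (simp add: xv brs A'lin xA)
    finally have "(a * a + r * b * b) *\<^sub>R A' v + (2 * a * b) *\<^sub>R A' (SS v) = 0"
      unfolding 1 2 by (simp add: vec_eq_iff algebra_simps)
    from frame_independent[OF fr this] have "a = 0" "b = 0" using r0 by auto
    then have "A' v = s *\<^sub>R A' (br x v) + t *\<^sub>R A' (br x (SS v))"
      using arg_cong[OF xv, of "br x"] \<open>a = 0\<close> \<open>b = 0\<close> by (simp add: A'_def brs)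
    then have "A' v = 0" unfolding 1 2 using \<open>a = 0\<close> \<open>b = 0\<close> by simp
    then show False using k by (simp add: \<omega>s)
  qed
  have "\<omega> (A' w) v = 0" if v: "v \<in> W" for v
  proof -
    obtain u where u: "u \<in> W" "SS u = v" using SS_W[OF v] SS_SS[OF v] r0 sW
      by (intro that[of "(1 / r) *\<^sub>R SS v"]) (auto simp: SNs subspace_scale)
    have "\<omega> (A' (w + u)) (SS (w + u)) = 0" using d assms u sW by (simp add: subspace_add)
    then have "\<omega> (A' w) v + \<omega> (A' u) (SS w) = 0" using d[OF assms] d[OF u(1)] u(2) by (simp add: A'lin SNs \<omega>s)
    moreover have "\<omega> (A' u) (SS w) = \<omega> (A' w) v"
      using S[OF A'W[OF u(1)] assms] sa[OF SS_W[OF u(1)] assms] \<omega>_anti[of "A' w" "SS u"] u(2) A'S[of u] by simp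
    ultimately show ?thesis by simp
  qed
  then show ?thesis using \<omega>_nd_Range[OF A'W[OF assms]] by (simp add: A'_def)
qed

text \<open>The form \<open>h\<close> is invariant under \<open>ad e\<close> and at the same time
  the \<open>ad e\<close>-derivative of \<open>\<phi> x\<close>; as \<open>ad e\<close> has square
  \<open>r\<close>, this forces \<open>h = 0\<close>, that is, \<open>q\<close> is a multiple of
  \<open>\<omega>\<close>. From \<open>q \<and> \<omega> = 0\<close> it follows that
  \<open>c = 0\<close> and that \<open>W\<close> is abelian; the sign of \<open>r\<close> separates
  \<open>s5\<close> from \<open>s7\<close>.\<close>

lemma semisimple_case:
  assumes X: "\<And>w. w \<in> W \<Longrightarrow> br x w = 0" and N: "\<And>w. w \<in> W \<Longrightarrow> NN w = 0"
  shows "lie_isomorphic br s5 \<or> lie_isomorphic br s7"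
proof -
  have D2: "br e (br e w) = r *\<^sub>R w" if "w \<in> W" for w using D_NN[OF that] N[OF that] by simp
  define h where "h u v = c * \<omega> u v + E * q u v" for u v
  have h: "h u v = \<phi> x (br e u) v + \<phi> x u (br e v)" if "u \<in> W" "v \<in> W" for u v
    using closed_q[OF that] X that by (simp add: h_def)
  have hs: "h (br e u) v + h u (br e v) = 0" if "u \<in> W" "v \<in> W" for u v
    using D_skew[OF that] q_D[OF that] by (simp add: h_def algebra_simps) (metis mult_zero_right ring_distribs(1))
  have h0: "h u v = 0" if uv: "u \<in> W" "v \<in> W" for u v
  proof -
    have 1: "h (br e u) v = 0" if "u \<in> W" for u
      using hs[OF that uv(2)] h[OF eW[OF that] uv(2)] h[OF that eW[OF uv(2)]] D2[OF that] D2[OF uv(2)] by (simp add: \<phi>s)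
    have "h (br e (br e u)) v = 0" using 1 eW uv by blast
    then show ?thesis using D2[OF uv(1)] r0 by (simp add: h_def \<omega>s qs) (metis mult.left_commute mult_cancel_left ring_distribs(1) mult_zero_right)
  qed
  obtain a b s t where sb: "frame [a, b, s, t]" "span {a, b, s, t} = W"
    "\<omega> a b = 1" "\<omega> s t = 1" "\<omega> a s = 0" "\<omega> a t = 0" "\<omega> b s = 0" "\<omega> b t = 0"
    by (rule symplectic_basis4[OF sW dim4 \<omega>_bil \<omega>_self \<omega>_nd_Range])
  have mem: "a \<in> W" "b \<in> W" "s \<in> W" "t \<in> W" unfolding sb(2)[symmetric] by (rule span_base, simp)+
  have "q a b + q s t = 0" using wedge_q[OF mem] sb by simp
  moreover have "c + E * q a b = 0" "c + E * q s t = 0" using h0[OF mem(1,2)] h0[OF mem(3,4)] sb by (simp_all add: h_def)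
  ultimately have "2 * c + E * 0 = 0" by (metis add.assoc add.left_commute mult_2 add.right_neutral ring_distribs(1))
  then have c0: "c = 0" by simp
  have bW: "br u v = 0" if "u \<in> W" "v \<in> W" for u v
    using h0[OF that] E_nz br_q[OF that] by (simp add: h_def c0)
  have "\<exists>w\<in>W. br e w \<noteq> 0" using inj_e W_nz by blast
  then obtain v where v: "v \<in> W" "\<omega> v (br e v) \<noteq> 0"
    using skew_vector[OF sW lin2 eW _ D_skew \<omega>_nd_Range] by blast
  \<comment> \<open>The symplectic complement of the plane of \<open>v\<close> and
    \<open>[e, v]\<close>, from which the second plane is taken.\<close>
  define C where "C = {w \<in> W. \<omega> w v = 0 \<and> \<omega> w (br e v) = 0}"
  have ev: "br e v \<in> W" using eW v by blast
  have split: "w - (\<omega> w (br e v) / \<omega> v (br e v)) *\<^sub>R v + (\<omega> w v / \<omega> v (br e v)) *\<^sub>R br e v \<in> C" if "w \<in> W" for w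
    using that v ev sW \<omega>_anti[of "br e v" v] by (auto simp: C_def \<omega>s intro!: subspace_add subspace_diff subspace_scale)
  have "\<exists>w\<in>C. \<omega> w (br e w) \<noteq> 0"
  proof (rule skew_vector)
    show "subspace C" using sW by (auto simp: C_def subspace_def \<omega>s)
    have "C \<noteq> {0}"
    proof
      assume C0: "C = {0}"
      have "W \<subseteq> span {v, br e v}"
      proof
        fix w assume "w \<in> W"
        from split[OF this] have "w - (\<omega> w (br e v) / \<omega> v (br e v)) *\<^sub>R v + (\<omega> w v / \<omega> v (br e v)) *\<^sub>R br e v = 0" unfolding C0 by simp
        then have "w = (\<omega> w (br e v) / \<omega> v (br e v)) *\<^sub>R v - (\<omega> w v / \<omega> v (br e v)) *\<^sub>R br e v" by (simp add: algebra_simps)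
        then show "w \<in> span {v, br e v}" by (metis insertI1 insertI2 span_base span_diff span_scale)
      qed
      then have "dim W \<le> card {v, br e v}" by (rule dim_le_card) simp
      also have "\<dots> \<le> 2" by (simp add: card_insert_if)
      finally show False using dim4 by simp
    qed
    then show "\<exists>w\<in>C. br e w \<noteq> 0" using inj_e \<open>subspace C\<close> subspace_0 by (fastforce simp: C_def)
    show "br e w \<in> C" if "w \<in> C" for w
      using that D_skew[of w v] D_skew[of w "br e v"] D2[OF v(1)] v ev eW by (auto simp: C_def \<omega>s)
    fix w assume w: "w \<in> C" "\<And>u. u \<in> C \<Longrightarrow> \<omega> w u = 0"
    have "\<omega> w u = 0" if "u \<in> W" for u
      using w(2)[OF split[OF that]] w(1) by (simp add: C_def \<omega>s)
    then show "w = 0" using \<omega>_nd_Range w(1) by (auto simp: C_def)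
  qed (use lin2 D_skew in \<open>auto simp: C_def\<close>)
  then obtain w where w: "w \<in> W" "\<omega> w v = 0" "\<omega> w (br e v) = 0" "\<omega> w (br e w) \<noteq> 0" by (auto simp: C_def)
  have ew: "br e w \<in> W" using eW w by blast
  have orth: "\<omega> (br e w) v = 0" "\<omega> (br e w) (br e v) = 0"
    using D_skew[OF w(1) v(1)] D_skew[OF w(1) ev] w D2[OF v(1)] by (simp_all add: \<omega>s)
  have fr: "frame [v, br e v, w, br e w]"
    by (rule frame_orthogonal_planes)
      (use v w orth \<omega>_anti[of v w] \<omega>_anti[of v "br e w"] \<omega>_anti[of "br e v"] in auto)
  have fr7: "frame [x, e, z, v, br e v, w, br e w]" by (rule frame7_W[OF fr v(1) ev w(1) ew])
  have xe0: "br x e = 0" "br e x = 0" using xe ex by (simp_all add: c0)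
  have xW0: "br x u = 0" "br u x = 0" if "u \<in> W" for u using X[OF that] anti[of u x] by simp_all
  show ?thesis
  proof (cases "r > 0")
    case True
    define \<rho> where "\<rho> = sqrt r"
    have \<rho>: "\<rho> > 0" "r = \<rho> * \<rho>" using True by (auto simp: \<rho>_def)
    define p where "p s u = br e u + (s * \<rho>) *\<^sub>R u" for s u
    have pW: "p s u \<in> W" if "u \<in> W" for s u using that eW sW by (auto simp: p_def intro!: subspace_add subspace_scale)
    have pe: "br (p 1 u) ((1 / \<rho>) *\<^sub>R e) = - p 1 u" "br (p (- 1) u) ((1 / \<rho>) *\<^sub>R e) = p (- 1) u" if "u \<in> W" for u
      using \<rho>(1) D2[OF that] anti[of u e] anti[of "br e u" e]
      by (simp_all add: p_def brs \<rho>(2)) (simp_all add: vec_eq_iff field_simps)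
    have "frame [p 1 v, p (- 1) v, p (- 1) w, p 1 w, (1 / \<rho>) *\<^sub>R e, x, z]"
    proof (rule frame_change[OF fr7])
      let ?S = "span (set [p 1 v, p (- 1) v, p (- 1) w, p 1 w, (1 / \<rho>) *\<^sub>R e, x, z])"
      have mem: "p 1 v \<in> ?S" "p (- 1) v \<in> ?S" "p (- 1) w \<in> ?S" "p 1 w \<in> ?S" "(1 / \<rho>) *\<^sub>R e \<in> ?S" "x \<in> ?S" "z \<in> ?S"
        by (auto intro: span_base)
      have "br e u = (1 / 2) *\<^sub>R (p 1 u + p (- 1) u)" "u = (1 / (2 * \<rho>)) *\<^sub>R (p 1 u - p (- 1) u)" for u
        using \<rho>(1) by (simp_all add: p_def vec_eq_iff)
      then have "br e v \<in> ?S" "v \<in> ?S" "br e w \<in> ?S" "w \<in> ?S" using mem by (metis span_scale span_add span_diff)+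
      moreover have "e = \<rho> *\<^sub>R ((1 / \<rho>) *\<^sub>R e)" using \<rho>(1) by simp
      then have "e \<in> ?S" using mem by (metis span_scale)
      ultimately show "set [x, e, z, v, br e v, w, br e w] \<subseteq> ?S" using mem by simp
    qed simp
    then have "lie_isomorphic br s5"
      by (rule s5_I) (simp_all add: bW pW v w pe[unfolded brs(4)] xW0 brs xe0)
    then show ?thesis by simp
  next
    case False
    define \<rho> where "\<rho> = sqrt (- r)"
    have \<rho>: "\<rho> > 0" "r = - (\<rho> * \<rho>)" using False r0 by (auto simp: \<rho>_def)
    define p where "p u = (1 / \<rho>) *\<^sub>R br e u" for u
    have pW: "p u \<in> W" if "u \<in> W" for u using that eW sW by (auto simp: p_def intro!: subspace_scale)
    have pe: "br (p u) ((1 / \<rho>) *\<^sub>R e) = u" "br u ((1 / \<rho>) *\<^sub>R e) = - p u" if "u \<in> W" for u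
      using \<rho>(1) D2[OF that] anti[of u e] anti[of "br e u" e]
      by (simp_all add: p_def brs \<rho>(2))
    have pp: "p (p u) = - u" if "u \<in> W" for u using \<rho>(1) D2[OF that] by (simp add: p_def brs \<rho>(2))
    have "frame [br e v, v, br e w, w, e, x, z]" by (rule frame_permute[OF fr7]) auto
    from frame_scale[OF this, of "[1 / \<rho>, 1, 1 / \<rho>, 1, 1 / \<rho>, 1, 1]"]
    have "frame [p v, v, p w, w, (1 / \<rho>) *\<^sub>R e, x, z]" using \<rho>(1) by (simp add: p_def)
    then have "lie_isomorphic br s7"
      by (rule s7_I) (simp_all add: bW pW v w pe[unfolded brs(4)] pp xW0 brs xe0)
    then show ?thesis by simp
  qed
qed

text \<open>Closedness gives \<open>c = 0\<close>, so that \<open>x\<close> is central as well: in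
  the table of \<open>s1\<close> it becomes the last vector, and a multiple of \<open>z\<close> the
  first. A positive \<open>r\<close> contradicts \<open>resonant_False\<close>, and
  \<open>[v, v'] = 0\<close> would produce an isotropic 4-plane for
  \<open>x - \<gamma> z\<close>.\<close>

lemma nilpotent_case:
  assumes X: "\<And>w. w \<in> W \<Longrightarrow> br x w = 0" and N: "\<exists>w\<in>W. NN w \<noteq> 0"
  shows "lie_isomorphic br s1"
proof -
  obtain v b where v: "v \<in> W" "b \<noteq> 0" and fr: "frame [v, SS v, NN v, NN (SS v)]"
    and om: "\<omega> (NN v) v = b" "\<omega> (NN (SS v)) (SS v) = - r * b" "\<omega> (NN v) (SS v) = 0" "\<omega> (NN (SS v)) v = 0"
      "\<omega> (NN v) (NN (SS v)) = 0"
    by (rule frame_skew_square[OF NN_linear NN_W SN_comm NN_skew NN_NN N])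
  define v' where "v' = SS v"
  define k where "k = NN v"
  define k' where "k' = NN v'"
  note om = om[folded v'_def, folded k_def k'_def] and fr = fr[folded v'_def, folded k_def k'_def]
  have mem: "v \<in> W" "v' \<in> W" "k \<in> W" "k' \<in> W" using v SS_W NN_W by (auto simp: v'_def k_def k'_def)
  have D: "br e v = v' + k" "br e v' = r *\<^sub>R v + k'" "br e k = k'" "br e k' = r *\<^sub>R k"
    using SS_SS[OF v(1)] NN_NN[OF v(1)] NN_NN[OF SS_W[OF v(1)]]
    by (simp_all add: D_SN v'_def k_def k'_def SN_comm) (simp_all add: SN_comm[symmetric] SNs)
  have fr7: "frame [x, e, z, v, v', k, k']" by (rule frame7_W[OF fr mem])
  have rev: "\<omega> v k = - b" "\<omega> v' k' = r * b" "\<omega> v' k = 0" "\<omega> v k' = 0" "\<omega> k' k = 0"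
    using om \<omega>_anti[of v k] \<omega>_anti[of v' k'] \<omega>_anti[of v' k] \<omega>_anti[of v k'] \<omega>_anti[of k' k] by auto
  have "q k v' + q v k' = 0" using q_D[OF mem(1,2)] by (simp add: D qs)
  moreover have "q v' k + q v k' = 0" using q_D[OF mem(1,3)] by (simp add: D qs)
  ultimately have q1: "q v' k = 0" "q v k' = 0" using q_anti[of k v'] by auto
  have "q v' k' + q k k' + r * q v k = 0" using q_D[OF mem(1,4)] by (simp add: D qs)
  moreover have "r * q v k - q k k' + q v' k' = 0" using q_D[OF mem(2,3)] q_anti[of k' k] by (simp add: D qs)
  ultimately have q2: "q k k' = 0" "q v' k' = - r * q v k" by auto
  have "2 * (r * b * q v k) = 0" using wedge_q[OF mem] by (auto simp: q1 q2 rev om)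
  then have q3: "q v k = 0" using v r0 by simp
  then have q4: "q v' k' = 0" using q2 by simp
  have f1: "- (c * b) - (\<phi> x v' k + \<phi> x v k') = 0" using closed_q[OF mem(1,3)] X mem by (simp add: D \<phi>s rev q3)
  have "c * (r * b) - (r * \<phi> x v k' + r * \<phi> x v' k) = 0" using closed_q[OF mem(2,4)] X mem by (simp add: D \<phi>s rev q4)
  then have "r * (c * b - (\<phi> x v' k + \<phi> x v k')) = 0" by (simp add: algebra_simps)
  then have "c * b - (\<phi> x v' k + \<phi> x v k') = 0" using r0 by (metis mult_eq_0_iff)
  then have "c * b = 0" using f1 by linarith
  then have c0: "c = 0" using v by simp
  have "\<phi> x v' k' + \<phi> x k k' + r * \<phi> x v k = 0" using closed_q[OF mem(1,4)] X mem by (simp add: D \<phi>s rev q1 c0)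
  moreover have "r * \<phi> x v k - \<phi> x k k' + \<phi> x v' k' = 0"
    using closed_q[OF mem(2,3)] X mem \<phi>_anti(2)[of x k' k] by (simp add: D \<phi>s rev q1 c0)
  ultimately have fkk: "\<phi> x k k' = 0" "\<phi> x k' k = 0" using \<phi>_anti(2)[of x k' k] by auto
  have fs: "\<phi> x k v' + \<phi> x v k' = E * q v v'" using closed_q[OF mem(1,2)] X mem by (simp add: D \<phi>s c0)
  have b0: "br v k = 0" "br v k' = 0" "br v' k = 0" "br v' k' = 0" "br k k' = 0" "br v v' = q v v' *\<^sub>R z"
    using br_q[OF mem(1,3)] br_q[OF mem(1,4)] br_q[OF mem(2,3)] br_q[OF mem(2,4)] br_q[OF mem(3,4)] br_q[OF mem(1,2)]
    by (simp_all add: q1 q2 q3 q4)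
  have b0r: "br k v = 0" "br k' v = 0" "br k v' = 0" "br k' v' = 0" "br k' k = 0"
    using b0 anti[of k v] anti[of k' v] anti[of k v'] anti[of k' v'] anti[of k' k] by auto
  have r_neg: "r < 0"
  proof (rule ccontr)
    assume "\<not> r < 0"
    define \<rho> where "\<rho> = sqrt r"
    have \<rho>: "\<rho> > 0" "r = \<rho> * \<rho>" using r0 \<open>\<not> r < 0\<close> by (auto simp: \<rho>_def)
    define w1 where "w1 = k' + \<rho> *\<^sub>R k"
    define w1' where "w1' = k' - \<rho> *\<^sub>R k"
    define w2 where "w2 = v' + \<rho> *\<^sub>R v"
    have wW: "w1 \<in> W" "w1' \<in> W" "w2 \<in> W" unfolding w1_def w1'_def w2_def
      using mem sW by (auto intro!: subspace_add subspace_diff subspace_scale)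
    have *: "frame [w1, z, x, w1', w2, e, v]"
    proof (rule frame_change[OF fr7])
      let ?S = "span (set [w1, z, x, w1', w2, e, v])"
      have mem: "w1 \<in> ?S" "w1' \<in> ?S" "w2 \<in> ?S" "v \<in> ?S" "x \<in> ?S" "e \<in> ?S" "z \<in> ?S" by (auto intro: span_base)
      have "k' = (1/2) *\<^sub>R (w1 + w1')" "k = (1 / (2 * \<rho>)) *\<^sub>R (w1 - w1')" "v' = w2 - \<rho> *\<^sub>R v"
        using \<rho> by (simp_all add: w1_def w1'_def w2_def scaleR_2[symmetric] algebra_simps)
      then have "k' \<in> ?S" "k \<in> ?S" "v' \<in> ?S" using mem by (metis span_scale span_add span_diff)+
      then show "set [x, e, z, v, v', k, k'] \<subseteq> ?S" using mem by auto
    qed simp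
    have fr5: "frame [w1, z, x, w1', w2]" by (rule frame_subset[OF *]) (use * in \<open>auto simp: frame_def\<close>)
    show False
    proof (rule resonant_False[OF fr5 wW])
      show "br e w2 = \<rho> *\<^sub>R w2 + w1" by (simp add: w1_def w2_def brs D \<rho>(2) algebra_simps)
      show "\<omega> w1 w2 = 0" using om rev by (simp add: w1_def w2_def \<omega>s \<rho>(2))
    qed (use \<rho> fkk om rev b0 b0r X mem in \<open>auto simp: w1_def w1'_def w2_def \<phi>s \<omega>s brs D c0 algebra_simps\<close>)
  qed
  have s0: "q v v' \<noteq> 0"
  proof
    assume s: "q v v' = 0"
    \<comment> \<open>Since \<open>\<phi> z k v = b\<close>, this makes
      \<open>\<phi> (x - \<gamma> z) k v\<close> vanish.\<close>
    define \<gamma> where "\<gamma> = \<phi> x k v / b"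
    have fvk: "\<phi> x v k' = 0" using fs f1 s \<phi>_anti(2)[of x k v'] by (simp add: c0)
    have zw: "\<phi> z u w = \<omega> u w" if "u \<in> W" "w \<in> W" for u w using \<omega>_\<phi>_W[OF that] by simp
    have zx: "\<phi> z x u = 0" if "u \<in> W" for u
      using \<omega>_\<phi>[of x u] \<omega>_Null_Range[OF xN that] X[OF that] sN by (simp add: subspace_0)
    show False
    proof (rule isotropic)
      have "frame [x, z, k, k', v]" by (rule frame_subset[OF fr7]) (use fr7 in \<open>auto simp: frame_def\<close>)
      from frame_add_span[OF this, of "- (\<gamma> *\<^sub>R z)"]
      show "frame [x - \<gamma> *\<^sub>R z, z, k, k', v]" by (simp add: span_neg span_scale span_base)
    qed (use v mem fkk fvk zx zw om rev \<phi>_anti(1)[of x z] \<phi>_anti(2)[of x k' v] in \<open>auto simp: \<phi>s \<gamma>_def\<close>)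
  qed
  define \<rho> where "\<rho> = sqrt (- r)"
  have \<rho>: "\<rho> > 0" "r = - (\<rho> * \<rho>)" using r_neg by (auto simp: \<rho>_def)
  have "frame [z, v, v', k, k', e, x]" by (rule frame_permute[OF fr7]) auto
  from frame_scale[OF this, of "[- (q v v' / \<rho>), 1, 1 / \<rho>, 1 / \<rho>, 1 / (\<rho> * \<rho>), 1 / \<rho>, 1]"]
  have "frame [- ((q v v' / \<rho>) *\<^sub>R z), v, (1 / \<rho>) *\<^sub>R v', (1 / \<rho>) *\<^sub>R k, (1 / (\<rho> * \<rho>)) *\<^sub>R k', (1 / \<rho>) *\<^sub>R e, x]"
    using s0 \<rho>(1) by simp
  note fr_s1 = this
  have xc: "br y x = 0" for y
  proof -
    have "br x y = 0" by (subst coords[of y]) (simp add: brs xe c0 X pr)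
    then show ?thesis using anti[of y x] by simp
  qed
  show ?thesis
    by (rule s1_I[OF fr_s1])
      (use \<rho> D mem anti[of v e] anti[of v' e] anti[of k e] anti[of k' e]
        in \<open>simp_all add: brs b0 xc\<close>, simp_all add: vec_eq_iff field_simps)
qed

end

context g2_AD
begin

text \<open>\<open>NN\<close> commutes with \<open>ad x\<close> and \<open>SS\<close>, and turns out
  to be \<open>a\<close> times \<open>ad x\<close> on \<open>W\<close>; hence
  \<open>e' = e - a x\<close> acts as \<open>SS\<close>. What remains is the sign of
  \<open>r\<close> and the central coefficient \<open>s\<close> of \<open>[v, v']\<close>: positive
  \<open>r\<close> gives \<open>s2\<close> or \<open>s8\<close>, and negative \<open>r\<close> gives
  \<open>s9\<close>, since the Pfaffian excludes \<open>s = 0\<close>.\<close>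

lemma unipotent_case:
  assumes X: "\<exists>w\<in>W. br x w \<noteq> 0"
  shows "lie_isomorphic br s2 \<or> lie_isomorphic br s8 \<or> lie_isomorphic br s9"
proof -
  have x_skew: "\<omega> (br x u) v = - \<omega> u (br x v)" if "u \<in> W" "v \<in> W" for u v using \<omega>_x_skew[OF that] by simp
  obtain v b where v: "v \<in> W" "b \<noteq> 0" and fr: "frame [v, SS v, br x v, br x (SS v)]"
    and om: "\<omega> (br x v) v = b" "\<omega> (br x (SS v)) (SS v) = - r * b" "\<omega> (br x v) (SS v) = 0" "\<omega> (br x (SS v)) v = 0"
      "\<omega> (br x v) (br x (SS v)) = 0"
    by (rule frame_skew_square[OF lin2 xW SS_x x_skew x_square_zero X])
  define v' where "v' = SS v"
  define u where "u = br x v"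
  define u' where "u' = br x v'"
  note om = om[folded v'_def, folded u_def u'_def] and fr = fr[folded v'_def, folded u_def u'_def]
  have mem: "v \<in> W" "v' \<in> W" "u \<in> W" "u' \<in> W" using v SS_W xW by (auto simp: v'_def u_def u'_def)
  have X: "br x v = u" "br x v' = u'" "br x u = 0" "br x u' = 0"
    using x_square_zero mem by (auto simp: u_def u'_def)
  have S: "SS v = v'" "SS v' = r *\<^sub>R v" "SS u = u'" "SS u' = r *\<^sub>R u"
    using SS_SS[OF v(1)] by (simp_all add: v'_def u_def u'_def SS_x brs)
  have fr7: "frame [x, e, z, v, v', u, u']" by (rule frame7_W[OF fr mem])
  have rev: "\<omega> v u = - b" "\<omega> v' u' = r * b" "\<omega> v' u = 0" "\<omega> v u' = 0" "\<omega> u' u = 0"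
    using om \<omega>_anti[of v u] \<omega>_anti[of v' u'] \<omega>_anti[of v' u] \<omega>_anti[of v u'] \<omega>_anti[of u' u] by auto
  obtain a1 a2 a c2 where Nv: "NN v = a1 *\<^sub>R v + a2 *\<^sub>R v' + a *\<^sub>R u + c2 *\<^sub>R u'"
    by (rule W_coords[OF fr mem NN_W[OF v(1)]])
  have Nu: "NN u = a1 *\<^sub>R u + a2 *\<^sub>R u'" 
  proof -
    have "NN u = br x (NN v)" by (simp add: NN_x[symmetric] X)
    then show ?thesis by (simp add: Nv brs X)
  qed
  have Nv': "NN v' = a1 *\<^sub>R v' + (a2 * r) *\<^sub>R v + a *\<^sub>R u' + (c2 * r) *\<^sub>R u"
  proof -
    have "NN v' = SS (NN v)" by (simp add: SN_comm S)
    then show ?thesis by (simp add: Nv SNs S)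
  qed
  have Nu': "NN u' = a1 *\<^sub>R u' + (a2 * r) *\<^sub>R u" 
  proof -
    have "NN u' = br x (NN v')" by (simp add: NN_x[symmetric] X)
    then show ?thesis by (simp add: Nv' brs X)
  qed
  have "NN (NN u) = 0" using NN_NN mem by blast
  then have "(a1 * a1 + a2 * a2 * r) *\<^sub>R u + (2 * a1 * a2) *\<^sub>R u' = 0"
    by (simp add: Nu SNs Nu') (simp add: vec_eq_iff algebra_simps)
  from frame_independent[OF fr this] have a12: "a1 = 0" "a2 = 0" using r0 by auto
  have "\<omega> (NN v) v' = - \<omega> v (NN v')" using NN_skew[OF mem(1,2)] .
  then have "r * b * c2 = 0" by (auto simp: Nv Nv' a12 \<omega>s om rev)
  then have c2: "c2 = 0" using v r0 by simp
  define e' where "e' = e - a *\<^sub>R x"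
  have D: "br e' v = v'" "br e' v' = r *\<^sub>R v" "br e' u = u'" "br e' u' = r *\<^sub>R u"
    using Nv Nv' Nu Nu' S X by (simp_all add: e'_def brs D_SN a12 c2)
  have e'_S: "br e' w = SS w" if w: "w \<in> W" for w
  proof -
    obtain c1 c2 c3 c4 where w: "w = c1 *\<^sub>R v + c2 *\<^sub>R v' + c3 *\<^sub>R u + c4 *\<^sub>R u'" by (rule W_coords[OF fr mem w])
    show ?thesis by (simp add: w brs SNs D S)
  qed
  have qS: "q (SS s) t + q s (SS t) = 0" if "s \<in> W" "t \<in> W" for s t
  proof -
    have "(q (br e s) t + q s (br e t)) - a * (q (br x s) t + q s (br x t)) = 0" using q_D[OF that] q_X[OF that] by simp
    then show ?thesis using e'_S[OF that(1)] e'_S[OF that(2)] by (simp add: e'_def brs qs[symmetric]) (simp add: qs algebra_simps)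
  qed
  have q1: "q v' u = 0" "q v u' = 0"
    using q_X[OF mem(1,2)] qS[OF mem(1,3)] q_anti[of u v'] by (simp_all add: X S)
  have q2: "q u u' = 0" using q_X[OF mem(1,4)] by (simp add: X qs) (simp add: q_def cqs)
  have q3: "q v' u' = - r * q v u" using qS[OF mem(1,4)] by (simp add: S qs)
  have "2 * (r * b * q v u) = 0" using wedge_q[OF mem] by (auto simp: q1 q2 q3 rev om)
  then have q4: "q v u = 0" using v r0 by simp
  then have q5: "q v' u' = 0" using q3 by simp
  have closed_S: "c * \<omega> s t - (\<phi> x (SS s) t + \<phi> x s (SS t)) + (\<phi> e' (br x s) t + \<phi> e' s (br x t)) + E * q s t = 0"
    if "s \<in> W" "t \<in> W" for s t
  proof -
    have 1: "SS w = br e w - a *\<^sub>R br x w" if "w \<in> W" for w using e'_S[OF that] by (simp add: e'_def brs)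
    show ?thesis using closed_q[OF that] by (simp add: 1 that e'_def \<phi>s algebra_simps)
  qed
  have "- (c * b) - (\<phi> x v' u + \<phi> x v u') = 0" using closed_S[OF mem(1,3)] by (simp add: S X \<phi>s rev q4)
  moreover have "c * (r * b) - (r * \<phi> x v u' + r * \<phi> x v' u) = 0" using closed_S[OF mem(2,4)] by (simp add: S X \<phi>s rev q5)
  then have "r * (c * b - (\<phi> x v' u + \<phi> x v u')) = 0" by (simp add: algebra_simps)
  then have "c * b - (\<phi> x v' u + \<phi> x v u') = 0" using r0 by (metis mult_eq_0_iff)
  ultimately have "c * b = 0" by linarith
  then have c0: "c = 0" using v by simp
  define s where "s = q v v'"
  have b0: "br v u = 0" "br v u' = 0" "br v' u = 0" "br v' u' = 0" "br u u' = 0" "br v v' = s *\<^sub>R z"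
    using br_q[OF mem(1,3)] br_q[OF mem(1,4)] br_q[OF mem(2,3)] br_q[OF mem(2,4)] br_q[OF mem(3,4)] br_q[OF mem(1,2)]
    by (simp_all add: q1 q2 q4 q5 s_def)
  have b0r: "br u v = 0" "br u' v = 0" "br u v' = 0" "br u' v' = 0" "br u' u = 0" "br v' v = - (s *\<^sub>R z)"
    using b0 anti[of u v] anti[of u' v] anti[of u v'] anti[of u' v'] anti[of u' u] anti[of v' v] by auto
  have xe0: "br x e' = 0" "br e' x = 0" by (simp_all add: e'_def brs xe ex c0)
  have Dr: "br v e' = - v'" "br v' e' = - r *\<^sub>R v" "br u e' = - u'" "br u' e' = - r *\<^sub>R u"
    "br v x = - u" "br v' x = - u'" "br u x = 0" "br u' x = 0"
    using D X anti[of v e'] anti[of v' e'] anti[of u e'] anti[of u' e'] anti[of v x] anti[of v' x] anti[of u x] anti[of u' x] by simp_all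
  have fr7': "frame [x, e', z, v, v', u, u']"
  proof (rule frame_change[OF fr7])
    let ?S = "span (set [x, e', z, v, v', u, u'])"
    have mem: "x \<in> ?S" "e' \<in> ?S" by (auto intro: span_base)
    have "e = e' + a *\<^sub>R x" by (simp add: e'_def)
    then have "e \<in> ?S" using mem by (metis span_scale span_add)
    then show "set [x, e, z, v, v', u, u'] \<subseteq> ?S" by (auto intro: span_base)
  qed simp
  show ?thesis
  proof (cases "r > 0")
    case True
    define \<rho> where "\<rho> = sqrt r"
    have \<rho>: "\<rho> > 0" "r = \<rho> * \<rho>" using True by (auto simp: \<rho>_def)
    define p where "p t w w' = w' + (t * \<rho>) *\<^sub>R w" for t and w w' :: "real^7"
    have fr_k: "frame [p 1 u u', p (- 1) u u', p 1 v v', p (- 1) v v', x, (1 / \<rho>) *\<^sub>R e', k *\<^sub>R z]" (is "frame ?fs") if "k \<noteq> 0" for k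
    proof (rule frame_change[OF fr7'])
      have mem: "\<forall>f\<in>set ?fs. f \<in> span (set ?fs)" by (auto intro: span_base)
      have "e' = \<rho> *\<^sub>R ((1 / \<rho>) *\<^sub>R e')" "z = (1 / k) *\<^sub>R (k *\<^sub>R z)" using \<rho>(1) that by simp_all
      then have 1: "e' \<in> span (set ?fs)" "z \<in> span (set ?fs)"
        using mem by (metis (no_types, lifting) span_scale list.set_intros)+
      have "w' = (1 / 2) *\<^sub>R (p 1 w w' + p (- 1) w w')" "w = (1 / (2 * \<rho>)) *\<^sub>R (p 1 w w' - p (- 1) w w')" for w w'
        using \<rho>(1) by (simp_all add: p_def vec_eq_iff)
      then have 2: "w' \<in> span (set ?fs) \<and> w \<in> span (set ?fs)" if "p 1 w w' \<in> set ?fs" "p (- 1) w w' \<in> set ?fs" for w w'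
        using mem that by (metis span_scale span_add span_diff)
      have "v' \<in> span (set ?fs) \<and> v \<in> span (set ?fs)" by (rule 2) auto
      moreover have "u' \<in> span (set ?fs) \<and> u \<in> span (set ?fs)" by (rule 2) auto
      ultimately show "set [x, e', z, v, v', u, u'] \<subseteq> span (set ?fs)" using mem 1 by simp
    qed simp
    have pe: "(1 / \<rho>) *\<^sub>R br (p 1 v v') e' = - p 1 v v'" "(1 / \<rho>) *\<^sub>R br (p (- 1) v v') e' = p (- 1) v v'"
      "(1 / \<rho>) *\<^sub>R br (p 1 u u') e' = - p 1 u u'" "(1 / \<rho>) *\<^sub>R br (p (- 1) u u') e' = p (- 1) u u'"
      using \<rho>(1) by (simp_all add: p_def brs \<rho>(2) Dr) (simp_all add: vec_eq_iff field_simps)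
    have px: "br (p t v v') x = - p t u u'" "br (p t u u') x = 0" for t by (simp_all add: p_def brs Dr)
    have pp: "br (p t u u') (p t' v v') = 0" "br (p t u u') (p t' u u') = 0" for t t'
      by (simp_all add: p_def brs b0 b0r)
    have pv: "br (p 1 v v') (p (- 1) v v') = (2 * \<rho> * s) *\<^sub>R z"
      by (simp add: p_def brs b0 b0r) (simp add: vec_eq_iff algebra_simps)
    show ?thesis
    proof (cases "s = 0")
      case True
      have "lie_isomorphic br s2" by (rule s2_I[OF fr_k[of 1]]) (simp_all add: pe px pp pv True brs xe0)
      then show ?thesis by simp
    next
      case False
      then have k: "- 2 * \<rho> * s \<noteq> 0" using \<rho> by simp
      have "lie_isomorphic br s8" by (rule s8_I[OF fr_k[OF k]]) (simp_all add: pe px pp pv brs xe0)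
      then show ?thesis by simp
    qed
  next
    case False
    define \<rho> where "\<rho> = sqrt (- r)"
    have r: "r < 0" using False r0 by simp
    have \<rho>: "\<rho> > 0" "r = - (\<rho> * \<rho>)" using r by (auto simp: \<rho>_def)
    have s0: "s \<noteq> 0"
    proof
      assume s: "s = 0"
      have co: "\<phi> v v' u = 0" "\<phi> v v' u' = 0" "\<phi> v u u' = 0" "\<phi> v' u u' = 0"
        using closed4[of e' v v' u] closed4[of e' v v' u'] closed4[of e' v u u'] closed4[of e' v' u u'] r
          \<phi>_anti(1)[of u' v v'] \<phi>_anti(1)[of u v v'] \<phi>_cyc[of u' v v'] \<phi>_cyc[of u v v'] \<phi>_anti(1)[of u' v u] \<phi>_anti(1)[of u' v' u]
        by (simp_all add: D b0 s \<phi>s)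
      have "2 * \<phi> e' u u' = 0"
        using closed_S[OF mem(1,4)] closed_S[OF mem(2,3)] \<phi>_anti(2)[of e' u' u]
        by (simp add: S X \<phi>s rev q1 c0)
      then have g1: "\<phi> e' u u' = 0" by simp
      have g2: "\<phi> e' v u' = \<phi> e' v' u"
        using closed_S[OF mem(1,2)] \<phi>_anti(2)[of e' u v'] s by (simp add: S X \<phi>s c0 s_def[symmetric])
      have zw: "\<phi> z s t = \<omega> s t" if "s \<in> W" "t \<in> W" for s t using \<omega>_\<phi>_W[OF that] by simp
      \<comment> \<open>With this \<open>t\<close> the entry at \<open>v, u\<close> of
        \<open>\<phi> (e' + t z)\<close> is 0, and the Pfaffian is a square. That of
        \<open>z\<close> is \<open>r b^2\<close>, which is negative, against the constant
        sign.\<close>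
      define t where "t = \<phi> e' v u / b"
      have "frame [e', z, v, v', u, u']" by (rule frame_subset[OF fr7']) (use fr7' in \<open>auto simp: frame_def\<close>)
      from frame_add_span[OF this, of "t *\<^sub>R z"]
      have fr': "frame [e' + t *\<^sub>R z, z, v, v', u, u']" by (simp add: span_scale span_base)
      have "pf v v' u u' (e' + t *\<^sub>R z) * pf v v' u u' z > 0" by (rule pf_sign[OF fr' co])
      moreover have "pf v v' u u' z = r * (b * b)" by (simp add: pf_def zw mem rev om)
      moreover have "pf v v' u u' (e' + t *\<^sub>R z) = \<phi> e' v' u * \<phi> e' v' u"
        using v(2) by (simp add: pf_def \<phi>s zw mem rev om g1 g2 t_def)
      moreover have "r * (b * b) \<le> 0" using r by (simp add: mult_nonpos_nonneg)
      ultimately show False by (simp add: mult_nonneg_nonpos not_less flip: not_le)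
    qed
    have "frame [u, u', v, v', x, e', z]" by (rule frame_permute[OF fr7']) auto
    from frame_scale[OF this, of "[1, 1 / \<rho>, 1, 1 / \<rho>, 1, 1 / \<rho>, - s / \<rho>]"]
    have "frame [u, (1 / \<rho>) *\<^sub>R u', v, (1 / \<rho>) *\<^sub>R v', x, (1 / \<rho>) *\<^sub>R e', (- s / \<rho>) *\<^sub>R z]"
      using s0 \<rho>(1) by simp
    then have "lie_isomorphic br s9"
      by (rule s9_I) (use \<rho>(1) in \<open>simp_all add: brs b0 b0r Dr xe0 \<rho>(2)\<close>)
    then show ?thesis by simp
  qed
qed

end

context g2_A
begin

lemma double_case:
  assumes "r \<noteq> 0" "\<And>w. w \<in> W \<Longrightarrow> br e (br e (br e (br e w) - r *\<^sub>R w)) = r *\<^sub>R (br e (br e w) - r *\<^sub>R w)"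
    and "\<And>u v. u \<in> W \<Longrightarrow> v \<in> W \<Longrightarrow> cp (br u v) = 0"
  shows "lie_isomorphic br s1 \<or> lie_isomorphic br s2 \<or> lie_isomorphic br s5 \<or> lie_isomorphic br s7 \<or>
    lie_isomorphic br s8 \<or> lie_isomorphic br s9"
proof -
  interpret g2_AD br \<phi> z e \<omega> x c r by unfold_locales (use assms ca0 in auto)
  show ?thesis using unipotent_case nilpotent_case semisimple_case by blast
qed

end

section \<open>Two orthogonal invariant planes\<close>

context g2_torus
begin

text \<open>Combinations \<open>f1\<close>, \<open>f2\<close> of \<open>e\<close> and
  \<open>x\<close> act as \<open>ad e\<close> on one plane and as 0 on the other. Their eigenvalues
  make \<open>W\<close> abelian up to the center, closedness removes the central part and
  \<open>c\<close>, and the constant sign of the Pfaffian shows that \<open>r1\<close> and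
  \<open>r2\<close> are positive.\<close>

lemma orthogonal_planes:
  assumes C1: "C1 \<subseteq> W" "subspace C1" "C1 \<noteq> {0}" "\<And>w. w \<in> C1 \<Longrightarrow> br e w \<in> C1" "\<And>w. w \<in> C1 \<Longrightarrow> br x w \<in> C1"
      "\<And>w. w \<in> C1 \<Longrightarrow> br e (br e w) = r1 *\<^sub>R w"
    and C2: "C2 \<subseteq> W" "subspace C2" "C2 \<noteq> {0}" "\<And>w. w \<in> C2 \<Longrightarrow> br e w \<in> C2" "\<And>w. w \<in> C2 \<Longrightarrow> br x w \<in> C2"
      "\<And>w. w \<in> C2 \<Longrightarrow> br e (br e w) = r2 *\<^sub>R w"
    and sum: "\<And>w. w \<in> W \<Longrightarrow> \<exists>a\<in>C1. \<exists>b\<in>C2. w = a + b"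
    and orth: "\<And>a b. a \<in> C1 \<Longrightarrow> b \<in> C2 \<Longrightarrow> \<omega> a b = 0"
    and nprop: "\<And>s. \<exists>w\<in>W. br x w \<noteq> s *\<^sub>R br e w"
  shows "lie_isomorphic br s4"
proof -
  obtain u v x1 x2 where uv: "u \<in> C1" "v \<in> C2" "\<omega> u (br e u) \<noteq> 0" "\<omega> v (br e v) \<noteq> 0" "frame [u, br e u, v, br e v]"
    "br x u = x1 *\<^sub>R br e u" "br x v = x2 *\<^sub>R br e v" by (rule orthogonal_plane_basis[OF C1 C2 sum orth])
  define u' where "u' = br e u"
  define v' where "v' = br e v"
  define g1 where "g1 = \<omega> u u'"
  define g2 where "g2 = \<omega> v v'"
  have mC: "u \<in> C1" "u' \<in> C1" "v \<in> C2" "v' \<in> C2" using uv C1(4) C2(4) by (auto simp: u'_def v'_def)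
  then have mem: "u \<in> W" "u' \<in> W" "v \<in> W" "v' \<in> W" using C1(1) C2(1) by auto
  have g: "g1 \<noteq> 0" "g2 \<noteq> 0" using uv by (auto simp: g1_def g2_def u'_def v'_def)
  have om: "\<omega> u v = 0" "\<omega> u v' = 0" "\<omega> u' v = 0" "\<omega> u' v' = 0" "\<omega> u u' = g1" "\<omega> v v' = g2"
    using orth mC by (auto simp: g1_def g2_def)
  have fr: "frame [u, u', v, v']" using uv(5) by (simp add: u'_def v'_def)
  have fr7: "frame [x, e, z, u, u', v, v']" by (rule frame7_W[OF fr mem])
  have D: "br e u = u'" "br e u' = r1 *\<^sub>R u" "br e v = v'" "br e v' = r2 *\<^sub>R v"
    using C1(6)[OF mC(1)] C2(6)[OF mC(3)] by (simp_all add: u'_def v'_def)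
  have "u' \<noteq> 0" "v' \<noteq> 0" using g om by (auto simp: \<omega>s)
  then have r0: "r1 \<noteq> 0" "r2 \<noteq> 0" using D(2,4) inj_e mem by auto
  have X: "br x u = x1 *\<^sub>R u'" "br x u' = (x1 * r1) *\<^sub>R u" "br x v = x2 *\<^sub>R v'" "br x v' = (x2 * r2) *\<^sub>R v"
    using uv(6,7) comm_xe[of u] comm_xe[of v] by (simp_all add: u'_def[symmetric] v'_def[symmetric] D brs)
  have ne: "x1 \<noteq> x2"
  proof
    assume "x1 = x2"
    then have "br x w = x1 *\<^sub>R br e w" if w: "w \<in> W" for w
    proof -
      obtain c1 c2 c3 c4 where w: "w = c1 *\<^sub>R u + c2 *\<^sub>R u' + c3 *\<^sub>R v + c4 *\<^sub>R v'" by (rule W_coords[OF fr mem w])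
      show ?thesis using \<open>x1 = x2\<close> by (simp add: w brs X D algebra_simps)
    qed
    then show False using nprop by blast
  qed
  define d where "d = x1 - x2"
  have d: "d \<noteq> 0" using ne by (simp add: d_def)
  define f1 where "f1 = (1 / d) *\<^sub>R (x - x2 *\<^sub>R e)"
  define f2 where "f2 = (1 / d) *\<^sub>R (x1 *\<^sub>R e - x)"
  have e_f: "e = f1 + f2" and x_f: "x = x1 *\<^sub>R f1 + x2 *\<^sub>R f2"
  proof -
    have 1: "d *\<^sub>R f1 = x - x2 *\<^sub>R e" "d *\<^sub>R f2 = x1 *\<^sub>R e - x" using d by (simp_all add: f1_def f2_def)
    have "d *\<^sub>R (f1 + f2) = d *\<^sub>R e" unfolding scaleR_add_right 1 by (simp add: d_def algebra_simps)
    then show "e = f1 + f2" using d by simp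
    have "d *\<^sub>R (x1 *\<^sub>R f1 + x2 *\<^sub>R f2) = x1 *\<^sub>R (d *\<^sub>R f1) + x2 *\<^sub>R (d *\<^sub>R f2)" by (simp add: algebra_simps)
    also have "\<dots> = d *\<^sub>R x" unfolding 1 by (simp add: d_def algebra_simps)
    finally show "x = x1 *\<^sub>R f1 + x2 *\<^sub>R f2" using d by simp
  qed
  have F: "br f1 u = u'" "br f1 u' = r1 *\<^sub>R u" "br f1 v = 0" "br f1 v' = 0"
    "br f2 u = 0" "br f2 u' = 0" "br f2 v = v'" "br f2 v' = r2 *\<^sub>R v"
  proof -
    have k: "(1 / d) *\<^sub>R (x1 *\<^sub>R w - x2 *\<^sub>R w) = w" for w :: "real^7"
      using d by (simp add: scaleR_left_diff_distrib[symmetric] d_def[symmetric])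
    show "br f1 u = u'" "br f1 u' = r1 *\<^sub>R u" "br f2 v = v'" "br f2 v' = r2 *\<^sub>R v"
      using k[of u'] k[of "r1 *\<^sub>R u"] k[of v'] k[of "r2 *\<^sub>R v"] by (simp_all add: f1_def f2_def brs X D)
  qed (simp_all add: f1_def f2_def brs X D)
  have pr_f: "pr (br f1 w) = br f1 (pr w)" "pr (br f2 w) = br f2 (pr w)" for w
    using pr_e[of w] pr_x[of w] by (simp_all add: f1_def f2_def brs prs)
  have T: "br f (pr (br s t)) = pr (br (br f s) t) + pr (br s (br f t))" if "f = f1 \<or> f = f2" for f s t
  proof -
    have "br f (pr (br s t)) = pr (br f (br s t))" using that pr_f by metis
    then show ?thesis by (simp only: jacobi[of f s t] prs)
  qed
  have fW1: "br f1 w \<in> W" "br f2 w \<in> W" if "w \<in> W" for w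
    unfolding f1_def f2_def brs by (intro subspace_scale[OF sW] subspace_diff[OF sW] eW xW that)+
  have fW: "br f w \<in> W" if "f = f1 \<or> f = f2" "w \<in> W" for f w using fW1[OF that(2)] that(1) by metis
  have f12: "br f1 (br f2 w) = 0" "br f2 (br f1 w) = 0" if w: "w \<in> W" for w
  proof -
    obtain c1 c2 c3 c4 where w: "w = c1 *\<^sub>R u + c2 *\<^sub>R u' + c3 *\<^sub>R v + c4 *\<^sub>R v'" by (rule W_coords[OF fr mem w])
    show "br f1 (br f2 w) = 0" "br f2 (br f1 w) = 0" unfolding w by (simp_all add: brs F)
  qed
  have ker: "w = 0" if "w \<in> W" "br f1 w = 0" "br f2 w = 0" for w
  proof -
    have "br (f1 + f2) w = 0" using that(2,3) by (simp add: brs)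
    then show ?thesis using inj_e[OF that(1)] e_f by simp
  qed
  define t where "t = pbr"
  note tW = pbr_W[folded t_def] and tl = pbrs[folded t_def] pbr_self[folded t_def]
  have Tf: "br f1 (t s s') = t (br f1 s) s' + t s (br f1 s')" "br f2 (t s s') = t (br f2 s) s' + t s (br f2 s')" for s s'
    unfolding t_def pbr_def by (rule T, simp)+
  have t1: "t u u' = 0" by (rule ker[OF tW]) (simp_all add: Tf F tl)
  have t2: "t v v' = 0" by (rule ker[OF tW]) (simp_all add: Tf F tl)
  \<comment> \<open>On a mixed product \<open>f1\<close> and \<open>f2\<close> have the non-zero
    squares \<open>r1\<close> and \<open>r2\<close>, although their composition is 0 on
    \<open>W\<close>.\<close>
  have t3: "t s s' = 0" if "s = u \<or> s = u'" "s' = v \<or> s' = v'" for s s'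
  proof -
    have 1: "br f1 (br f1 (t s s')) = r1 *\<^sub>R t s s'" using that by (auto simp: Tf F tl brs)
    have "br f2 (r1 *\<^sub>R t s s') = 0" unfolding 1[symmetric] by (rule f12(2)[OF fW[OF _ tW]]) simp
    then have "br f2 (t s s') = 0" using r0 by (simp add: brs)
    moreover have "br f2 (br f2 (t s s')) = r2 *\<^sub>R t s s'" using that by (auto simp: Tf F tl brs)
    ultimately show ?thesis using r0 by simp
  qed
  have flat: "pr (br s s') = 0" if "s \<in> W" "s' \<in> W" for s s'
    by (rule flat_on_basis[OF fr mem _ _ _ _ _ _ that, folded t_def]) (simp_all add: t1 t2 t3)
  interpret ab: g2_abelian br \<phi> z e \<omega> x c by unfold_locales (rule flat)
  note qs = ab.qs
  have qf: "ab.q (br f s) s' + ab.q s (br f s') = 0" if "f = f1 \<or> f = f2" "s \<in> W" "s' \<in> W" for f s s'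
  proof -
    have 1: "ab.q (br e s) s' + ab.q s (br e s') = 0" "ab.q (br x s) s' + ab.q s (br x s') = 0"
      using ab.q_D[OF that(2,3)] ab.q_X[OF that(2,3)] by auto
    have "ab.q (br f1 s) s' + ab.q s (br f1 s') = (1 / d) * ((ab.q (br x s) s' + ab.q s (br x s')) - x2 * (ab.q (br e s) s' + ab.q s (br e s')))"
      "ab.q (br f2 s) s' + ab.q s (br f2 s') = (1 / d) * (x1 * (ab.q (br e s) s' + ab.q s (br e s')) - (ab.q (br x s) s' + ab.q s (br x s')))"
      by (simp_all add: f1_def f2_def brs qs algebra_simps)
    then show ?thesis using that(1) 1 by auto
  qed
  have q0: "ab.q 0 s = 0" "ab.q s 0 = 0" for s using qs(3)[of 0 0 s] qs(4)[of s 0 0] by auto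
  have q1: "ab.q s s' = 0" if "s = u \<or> s = u'" "s' = v \<or> s' = v'" for s s'
  proof -
    have "s \<in> W" "s' \<in> W" using that mem by auto
    then have "ab.q (br f1 (br f1 s)) s' + ab.q (br f1 s) (br f1 s') = 0" by (intro qf fW) auto
    then show ?thesis using that F r0 by (auto simp: qs q0 brs)
  qed
  have m: "c * g1 + E * ab.q u u' = 0" "c * g2 + E * ab.q v v' = 0"
    using ab.closed_q[OF mem(1,2)] ab.closed_q[OF mem(3,4)] by (simp_all add: D X \<phi>s om)
  have "ab.q u u' * g2 + ab.q v v' * g1 = 0" using ab.wedge_q[OF mem] by (simp add: om)
  moreover have "(c * g1 + E * ab.q u u') * g2 + (c * g2 + E * ab.q v v') * g1 =
      2 * (c * g1 * g2) + E * (ab.q u u' * g2 + ab.q v v' * g1)" by (simp add: algebra_simps)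
  ultimately have "2 * (c * g1 * g2) = 0" unfolding m by simp
  then have c0: "c = 0" using g by simp
  then have q2: "ab.q u u' = 0" "ab.q v v' = 0" using m E_nz by auto
  have b0: "br u u' = 0" "br u v = 0" "br u v' = 0" "br u' v = 0" "br u' v' = 0" "br v v' = 0"
    using ab.br_q[OF mem(1,2)] ab.br_q[OF mem(1,3)] ab.br_q[OF mem(1,4)] ab.br_q[OF mem(2,3)] ab.br_q[OF mem(2,4)]
      ab.br_q[OF mem(3,4)] q1 q2 by simp_all
  then have b0r: "br u' u = 0" "br v u = 0" "br v' u = 0" "br v u' = 0" "br v' u' = 0" "br v' v = 0"
    using anti[of u' u] anti[of v u] anti[of v' u] anti[of v u'] anti[of v' u'] anti[of v' v] by auto
  have ff: "br f1 f2 = 0" by (simp add: f1_def f2_def brs xe ex c0)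
  have fr7': "frame [f1, f2, z, u, u', v, v']"
  proof (rule frame_change[OF fr7])
    let ?S = "span (set [f1, f2, z, u, u', v, v'])"
    have mem: "f1 \<in> ?S" "f2 \<in> ?S" by (auto intro: span_base)
    then have "e \<in> ?S" "x \<in> ?S" by (metis e_f span_add, metis x_f span_add span_scale mem)
    then show "set [x, e, z, u, u', v, v'] \<subseteq> ?S" by (auto intro: span_base)
  qed simp
  have co: "\<phi> u u' v = 0" "\<phi> u u' v' = 0" "\<phi> u v v' = 0" "\<phi> u' v v' = 0"
    using closed4[of f1 u v v'] closed4[of f1 u' v v'] closed4[of f2 u u' v] closed4[of f2 u u' v'] r0
      \<phi>_cyc[of v' u u'] \<phi>_cyc[of v u u'] by (simp_all add: F b0 \<phi>s)
  \<comment> \<open>Closedness on \<open>f1, f2\<close> and one vector of each plane expresses the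
    mixed values of \<open>\<phi> f2\<close> by these four values of
    \<open>\<phi> f1\<close>.\<close>
  define A where "A = \<phi> f1 u v"
  define B where "B = \<phi> f1 u v'"
  define C where "C = \<phi> f1 u' v"
  define G where "G = \<phi> f1 u' v'"
  have r: "\<phi> f2 u' v = B" "r1 * \<phi> f2 u v = G" "\<phi> f2 u' v' = r2 * A" "r1 * \<phi> f2 u v' = r2 * C"
    using closed4[of f1 f2 u v] closed4[of f1 f2 u' v] closed4[of f1 f2 u v'] closed4[of f1 f2 u' v']
      \<phi>_anti(1)[of u' f2] \<phi>_anti(1)[of u f2] \<phi>_cyc[of v' f1 u] \<phi>_cyc[of v' f1 u'] \<phi>_cyc[of v f1 u] \<phi>_cyc[of v f1 u']
    by (simp_all add: F b0 ff \<phi>s A_def B_def C_def G_def)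
  have f2': "\<phi> f2 u' v = B" "\<phi> f2 u v = G / r1" "\<phi> f2 u' v' = r2 * A" "\<phi> f2 u v' = r2 * C / r1"
    using r r0 by (auto simp: field_simps)
  have zw: "\<phi> z s t = \<omega> s t" if "s \<in> W" "t \<in> W" for s t using ab.\<omega>_\<phi>_W[OF that] by simp
  text \<open>Subtracting a multiple of \<open>z\<close> annihilates the first term of the Pfaffian without affecting the other two.\<close>
  define y where "y s t = s *\<^sub>R f1 + t *\<^sub>R f2 - (\<phi> (s *\<^sub>R f1 + t *\<^sub>R f2) u u' / g1) *\<^sub>R z" for s t
  have pf_y: "pf u u' v v' (y s t) = - ((s * A + t * G / r1) * (s * G + t * (r2 * A))) + (s * B + t * (r2 * C / r1)) * (s * C + t * B)" for s t
    using g by (simp add: pf_def y_def \<phi>s zw mem om f2' A_def[symmetric] B_def[symmetric] C_def[symmetric] G_def[symmetric])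
  have pos: "pf u u' v v' (y s t) * pf u u' v v' (y s' t') > 0" if st: "s * t' \<noteq> t * s'" for s t s' t'
  proof (rule pf_sign[OF _ co])
    have "frame [y s t, y s' t', z, u, u', v, v']"
    proof (rule frame_change[OF fr7'])
      let ?S = "span (set [y s t, y s' t', z, u, u', v, v'])"
      have mem: "y s t \<in> ?S" "y s' t' \<in> ?S" "z \<in> ?S" by (auto intro: span_base)
      define k where "k s t = \<phi> (s *\<^sub>R f1 + t *\<^sub>R f2) u u' / g1" for s t
      have yk: "y s t = s *\<^sub>R f1 + t *\<^sub>R f2 - k s t *\<^sub>R z" for s t by (simp add: y_def k_def)
      have "(s * t' - t * s') *\<^sub>R f1 = t' *\<^sub>R y s t - t *\<^sub>R y s' t' + (t' * k s t - t * k s' t') *\<^sub>R z"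
        "(s * t' - t * s') *\<^sub>R f2 = s *\<^sub>R y s' t' - s' *\<^sub>R y s t + (s * k s' t' - s' * k s t) *\<^sub>R z"
        by (simp_all add: yk vec_eq_iff algebra_simps)
      then have "(s * t' - t * s') *\<^sub>R f1 \<in> ?S" "(s * t' - t * s') *\<^sub>R f2 \<in> ?S"
        using mem by (metis span_add span_diff span_scale)+
      from span_scale[OF this(1), of "1 / (s * t' - t * s')"] span_scale[OF this(2), of "1 / (s * t' - t * s')"]
      have "f1 \<in> ?S" "f2 \<in> ?S" using st by auto
      then show "set [f1, f2, z, u, u', v, v'] \<subseteq> ?S" by (auto intro: span_base)
    qed simp
    note * = this
    show "frame [y s t, y s' t', u, u', v, v']" by (rule frame_subset[OF *]) (use * in \<open>auto simp: frame_def\<close>)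
  qed
  \<comment> \<open>The Pfaffians at \<open>f1\<close> and \<open>f2\<close>, corrected by
    \<open>z\<close>, have as product \<open>r2 / r1\<close> times a square.\<close>
  have sgn: "r1 * r2 > 0"
  proof (rule ccontr)
    assume "\<not> r1 * r2 > 0"
    then have "r2 / r1 \<le> 0" by (simp add: divide_le_0_iff zero_less_mult_iff not_less) linarith
    moreover have "pf u u' v v' (y 1 0) * pf u u' v v' (y 0 1) = (r2 / r1) * ((A * G - B * C) * (A * G - B * C))"
      using r0 by (simp add: pf_y field_simps)
    moreover have "(A * G - B * C) * (A * G - B * C) \<ge> 0" by simp
    ultimately have "pf u u' v v' (y 1 0) * pf u u' v v' (y 0 1) \<le> 0" by (metis mult_nonpos_nonneg)
    then show False using pos[of 1 1 0 0] by simp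
  qed
  have rp: "r1 > 0 \<and> r2 > 0"
  proof (rule ccontr)
    assume "\<not> (r1 > 0 \<and> r2 > 0)"
    then have rn: "r1 < 0" "r2 < 0" using sgn by (auto simp: zero_less_mult_iff)
    define \<rho>1 where "\<rho>1 = sqrt (- r1)"
    define \<rho>2 where "\<rho>2 = sqrt (- r2)"
    have \<rho>: "\<rho>1 > 0" "\<rho>2 > 0" "r1 = - (\<rho>1 * \<rho>1)" "r2 = - (\<rho>2 * \<rho>2)" using rn by (auto simp: \<rho>1_def \<rho>2_def)
    \<comment> \<open>For negative \<open>r1\<close> and \<open>r2\<close> these two vectors give
      sums of two squares with opposite signs.\<close>
    have "pf u u' v v' (y \<rho>2 \<rho>1) = \<rho>2 / \<rho>1 * ((\<rho>1 * \<rho>2 * A - G) * (\<rho>1 * \<rho>2 * A - G)  + (\<rho>1 * B + \<rho>2 * C) * (\<rho>1 * B + \<rho>2 * C))"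
      "pf u u' v v' (y \<rho>2 (- \<rho>1)) = - (\<rho>2 / \<rho>1 * ((\<rho>1 * \<rho>2 * A + G) * (\<rho>1 * \<rho>2 * A + G)  + (\<rho>1 * B - \<rho>2 * C) * (\<rho>1 * B - \<rho>2 * C)))"
      using \<rho>(1,2) by (simp_all add: pf_y \<rho>(3,4) field_simps)
    then have "pf u u' v v' (y \<rho>2 \<rho>1) \<ge> 0" "pf u u' v v' (y \<rho>2 (- \<rho>1)) \<le> 0" using \<rho>(1,2) by simp_all
    then have "pf u u' v v' (y \<rho>2 \<rho>1) * pf u u' v v' (y \<rho>2 (- \<rho>1)) \<le> 0" by (rule mult_nonneg_nonpos)
    then show False using pos[of \<rho>2 "- \<rho>1" \<rho>1 \<rho>2] \<rho>(1,2) by simp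
  qed
  define \<rho>1 where "\<rho>1 = sqrt r1"
  define \<rho>2 where "\<rho>2 = sqrt r2"
  have \<rho>: "\<rho>1 > 0" "\<rho>2 > 0" "r1 = \<rho>1 * \<rho>1" "r2 = \<rho>2 * \<rho>2" using rp by (auto simp: \<rho>1_def \<rho>2_def)
  have "frame [f1, u, u', f2, v, v', z]" by (rule frame_permute[OF fr7']) auto
  from frame_scale[OF this, of "[1 / \<rho>1, 1, 1 / \<rho>1, 1 / \<rho>2, 1, 1 / \<rho>2, 1]"]
  have "frame [(1 / \<rho>1) *\<^sub>R f1, u, (1 / \<rho>1) *\<^sub>R u', (1 / \<rho>2) *\<^sub>R f2, v, (1 / \<rho>2) *\<^sub>R v', z]"
    using \<rho>(1,2) by simp
  then show ?thesis
    by (rule s4_I) (use \<rho>(1,2) F anti[of u f2] anti[of u' f2] in \<open>simp_all add: brs b0 b0r ff \<rho>(3,4)\<close>)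
qed

end

section \<open>Complex structures on W\<close>

context g2_torus
begin

text \<open>\<open>R = \<alpha> + \<beta> I\<close> is a square root of \<open>D^2\<close>, for
  \<open>D = ad e\<close>, that commutes with \<open>D\<close>, so \<open>D - R\<close> and
  \<open>D + R\<close> multiply to 0. As \<open>D\<close> is skew and \<open>R\<close> self-adjoint,
  neither factor is 0 on \<open>W\<close>; hence there are vectors with \<open>D a = R a\<close> and
  \<open>D b = - R b\<close>.\<close>

lemma complex_structure_basis:
  assumes I: "linear I" "\<And>w. w \<in> W \<Longrightarrow> I w \<in> W" "\<And>w. w \<in> W \<Longrightarrow> I (I w) = - w"
      "\<And>u v. u \<in> W \<Longrightarrow> v \<in> W \<Longrightarrow> \<omega> (I u) v = \<omega> u (I v)"
      "\<And>w. w \<in> W \<Longrightarrow> I (br e w) = br e (I w)" "\<And>w. w \<in> W \<Longrightarrow> I (br x w) = br x (I w)"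
    and D2: "\<And>w. w \<in> W \<Longrightarrow> br e (br e w) = (\<alpha> * \<alpha> - \<beta> * \<beta>) *\<^sub>R w + (2 * \<alpha> * \<beta>) *\<^sub>R I w"
  obtains a a' b b' x1 x2 where "frame [a, a', b, b']" "a \<in> W" "a' \<in> W" "b \<in> W" "b' \<in> W"
    "br e a = \<alpha> *\<^sub>R a + \<beta> *\<^sub>R a'" "br e a' = \<alpha> *\<^sub>R a' - \<beta> *\<^sub>R a"
    "br e b = - \<alpha> *\<^sub>R b - \<beta> *\<^sub>R b'" "br e b' = - \<alpha> *\<^sub>R b' + \<beta> *\<^sub>R b"
    "br x a = x1 *\<^sub>R a + x2 *\<^sub>R a'" "br x a' = x1 *\<^sub>R a' - x2 *\<^sub>R a"
    "br x b = - x1 *\<^sub>R b - x2 *\<^sub>R b'" "br x b' = - x1 *\<^sub>R b' + x2 *\<^sub>R b"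
    "\<omega> a a' = 0" "\<omega> b b' = 0" "\<omega> a' b = \<omega> a b'" "\<omega> a' b' = - \<omega> a b" "\<omega> a b \<noteq> 0 \<or> \<omega> a b' \<noteq> 0"
proof -
  note Is = linear_rules[OF I(1)]
  define R where "R w = \<alpha> *\<^sub>R w + \<beta> *\<^sub>R I w" for w
  have Rs: "R (u + v) = R u + R v" "R (s *\<^sub>R u) = s *\<^sub>R R u" "R (- u) = - R u" "R (u - v) = R u - R v" for u v s
    by (simp_all add: R_def Is algebra_simps)
  have RW: "R w \<in> W" if "w \<in> W" for w using that I(2) sW by (auto simp: R_def intro!: subspace_add subspace_scale)
  have RR: "R (R w) = br e (br e w)" if "w \<in> W" for w
    using D2[OF that] I(3)[OF that] by (simp add: R_def Is) (simp add: vec_eq_iff algebra_simps)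
  have Re: "R (br e w) = br e (R w)" "R (br x w) = br x (R w)" if "w \<in> W" for w
    using I(5,6)[OF that] by (simp_all add: R_def brs)
  have R0: "w = 0" if "w \<in> W" "R w = 0" for w
  proof -
    have "R 0 = 0" by (simp add: R_def Is)
    then have "br e (br e w) = 0" using RR[OF that(1)] that(2) by simp
    then show ?thesis using inj_e eW that(1) by blast
  qed
  have Rsa: "\<omega> (R u) v = \<omega> u (R v)" if "u \<in> W" "v \<in> W" for u v using I(4)[OF that] by (simp add: R_def \<omega>s)
  have ex: "\<exists>w\<in>W. br e w + s *\<^sub>R R w \<noteq> 0" for s
  proof (rule ccontr)
    assume "\<not> ?thesis"
    then have h: "br e w = - s *\<^sub>R R w" if "w \<in> W" for w using that by (simp add: eq_neg_iff_add_eq_0)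
    obtain w where w: "w \<in> W" "w \<noteq> 0" using W_nz by blast
    have "\<omega> (br e w) v = 0" if v: "v \<in> W" for v
      using D_skew[OF w(1) v] h[OF w(1)] h[OF v] Rsa[OF w(1) v] by (simp add: \<omega>s)
    then have "br e w = 0" using \<omega>_nd_Range eW w by blast
    then show False using inj_e w by blast
  qed
  obtain w0 where w0: "w0 \<in> W" "br e w0 + 1 *\<^sub>R R w0 \<noteq> 0" using ex by blast
  obtain w1 where w1: "w1 \<in> W" "br e w1 + (- 1) *\<^sub>R R w1 \<noteq> 0" using ex by blast
  define a where "a = br e w0 + R w0"
  define b where "b = br e w1 - R w1"
  have ab: "a \<in> W" "b \<in> W" "a \<noteq> 0" "b \<noteq> 0"
    using w0 w1 eW RW sW by (auto simp: a_def b_def intro!: subspace_add subspace_diff)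
  have Da: "br e a = R a" and Db: "br e b = - R b"
    using RR[OF w0(1)] RR[OF w1(1)] Re(1)[OF w0(1)] Re(1)[OF w1(1)] by (simp_all add: a_def b_def Rs brs)
  define a' where "a' = I a"
  define b' where "b' = I b"
  have mem: "a \<in> W" "a' \<in> W" "b \<in> W" "b' \<in> W" using ab I(2) by (auto simp: a'_def b'_def)
  have Ia: "I a = a'" "I a' = - a" "I b = b'" "I b' = - b" using I(3) ab by (auto simp: a'_def b'_def)
  have Da': "br e a' = R a'" and Db': "br e b' = - R b'"
    using I(5)[OF ab(1)] I(5)[OF ab(2)] Da Db by (simp_all add: a'_def b'_def R_def Is)
  have cplx: "s = 0 \<and> t = 0" if "w \<in> W" "w \<noteq> 0" "s *\<^sub>R w + t *\<^sub>R I w = 0" for s t w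
  proof -
    have "I (s *\<^sub>R w + t *\<^sub>R I w) = 0" using that Is by simp
    then have "s *\<^sub>R I w - t *\<^sub>R w = 0" using I(3)[OF that(1)] by (simp add: Is)
    then have "s *\<^sub>R (s *\<^sub>R w + t *\<^sub>R I w) - t *\<^sub>R (s *\<^sub>R I w - t *\<^sub>R w) = 0" using that by simp
    then have "(s * s + t * t) *\<^sub>R w = 0" by (simp add: algebra_simps)
    then show ?thesis using that by (simp add: sum_squares_eq_zero_iff)
  qed
  have sep: "p = 0" if "p \<in> W" "br e p = R p" "br e p = - R p" for p
  proof -
    have "2 *\<^sub>R R p = 0" using that by (simp add: scaleR_2 eq_neg_iff_add_eq_0)
    then show ?thesis using R0 that by simp
  qed
  have fr: "frame [a, a', b, b']"
    unfolding frame_explicit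
  proof (intro allI impI)
    fix c1 c2 c3 c4 assume h: "c1 *\<^sub>R a + c2 *\<^sub>R a' + c3 *\<^sub>R b + c4 *\<^sub>R b' = 0"
    let ?p = "c1 *\<^sub>R a + c2 *\<^sub>R a'" and ?q = "c3 *\<^sub>R b + c4 *\<^sub>R b'"
    have pq: "?p = - ?q" using h by (simp only: eq_neg_iff_add_eq_0 add.assoc)
    have "br e ?p = R ?p" by (simp add: brs Da Da' Rs)
    moreover have "br e ?q = - R ?q" by (simp add: brs Db Db' Rs)
    then have "br e ?p = - R ?p" unfolding pq by (simp only: brs Rs)
    moreover have "?p \<in> W" using mem sW by (intro subspace_add subspace_scale)
    ultimately have p: "?p = 0" by (intro sep)
    then have "?q = 0" using pq by (metis neg_equal_0_iff_equal)
    then show "c1 = 0 \<and> c2 = 0 \<and> c3 = 0 \<and> c4 = 0"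
      using p cplx[OF ab(1,3), of c1 c2] cplx[OF ab(2,4), of c3 c4] by (simp add: Ia)
  qed
  have aa: "\<omega> a a' = 0" "\<omega> b b' = 0"
    using I(4)[OF ab(1,1)] I(4)[OF ab(2,2)] \<omega>_anti[of a' a] \<omega>_anti[of b' b] by (simp_all add: Ia)
  have ab': "\<omega> a' b = \<omega> a b'" "\<omega> a' b' = - \<omega> a b"
    using I(4)[OF mem(1,3)] I(4)[OF mem(1,4)] by (simp_all add: Ia \<omega>s)
  have nz: "\<omega> a b \<noteq> 0 \<or> \<omega> a b' \<noteq> 0"
  proof (rule ccontr)
    assume h: "\<not> ?thesis"
    have "a = 0"
    proof (rule \<omega>_nd_Range[OF ab(1)])
      fix w assume "w \<in> W"
      then obtain c1 c2 c3 c4 where w: "w = c1 *\<^sub>R a + c2 *\<^sub>R a' + c3 *\<^sub>R b + c4 *\<^sub>R b'" by (rule W_coords[OF fr mem])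
      show "\<omega> a w = 0" using h aa by (simp add: w \<omega>s)
    qed
    then show False using ab by simp
  qed
  obtain x1 x2 a3 a4 where Xa: "br x a = x1 *\<^sub>R a + x2 *\<^sub>R a' + a3 *\<^sub>R b + a4 *\<^sub>R b'"
    by (rule W_coords[OF fr mem xW[OF ab(1)]])
  let ?q = "a3 *\<^sub>R b + a4 *\<^sub>R b'"
  have "br e ?q = R ?q"
  proof -
    have q: "?q = br x a - (x1 *\<^sub>R a + x2 *\<^sub>R a')" using Xa by simp
    have "br e (br x a) = R (br x a)" using comm_xe[of a] Re(2)[OF ab(1)] Da by simp
    then show ?thesis unfolding q by (simp add: brs Rs Da Da')
  qed
  moreover have "br e ?q = - R ?q" by (simp add: brs Db Db' Rs)
  moreover have "?q \<in> W" using mem sW by (intro subspace_add subspace_scale)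
  ultimately have "?q = 0" by (intro sep)
  then have Xa: "br x a = x1 *\<^sub>R a + x2 *\<^sub>R a'" using Xa by (simp add: add.assoc)
  obtain b1 b2 y1 y2 where Xb: "br x b = b1 *\<^sub>R a + b2 *\<^sub>R a' + y1 *\<^sub>R b + y2 *\<^sub>R b'"
    by (rule W_coords[OF fr mem xW[OF ab(2)]])
  let ?p = "b1 *\<^sub>R a + b2 *\<^sub>R a'"
  have "br e ?p = - R ?p"
  proof -
    have p: "?p = br x b - (y1 *\<^sub>R b + y2 *\<^sub>R b')" using Xb by simp
    have "br e (br x b) = - R (br x b)" using comm_xe[of b] Re(2)[OF ab(2)] Db by (simp add: brs)
    then show ?thesis unfolding p by (simp add: brs Rs Db Db')
  qed
  moreover have "br e ?p = R ?p" by (simp add: brs Da Da' Rs)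
  moreover have "?p \<in> W" using mem sW by (intro subspace_add subspace_scale)
  ultimately have "?p = 0" by (intro sep)
  then have Xb: "br x b = y1 *\<^sub>R b + y2 *\<^sub>R b'" using Xb by simp
  have Xa': "br x a' = x1 *\<^sub>R a' - x2 *\<^sub>R a" "br x b' = y1 *\<^sub>R b' - y2 *\<^sub>R b"
    using I(6)[OF ab(1)] I(6)[OF ab(2)] Xa Xb by (simp_all add: Ia Is)
  have "(x1 + y1) * \<omega> a b + (x2 + y2) * \<omega> a b' = 0"
    using X_skew[OF mem(1,3)] by (simp add: Xa Xb \<omega>s ab' algebra_simps)
  moreover have "(x1 + y1) * \<omega> a b' - (x2 + y2) * \<omega> a b = 0"
    using X_skew[OF mem(1,4)] by (simp add: Xa Xa' \<omega>s ab' algebra_simps)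
  ultimately have "\<omega> a b * ((x1 + y1) * \<omega> a b + (x2 + y2) * \<omega> a b') + \<omega> a b' * ((x1 + y1) * \<omega> a b' - (x2 + y2) * \<omega> a b) = 0"
    "\<omega> a b' * ((x1 + y1) * \<omega> a b + (x2 + y2) * \<omega> a b') - \<omega> a b * ((x1 + y1) * \<omega> a b' - (x2 + y2) * \<omega> a b) = 0" by simp_all
  then have "(x1 + y1) * (\<omega> a b * \<omega> a b + \<omega> a b' * \<omega> a b') = 0" "(x2 + y2) * (\<omega> a b * \<omega> a b + \<omega> a b' * \<omega> a b') = 0"
    by (simp_all add: algebra_simps)
  moreover have "\<omega> a b * \<omega> a b + \<omega> a b' * \<omega> a b' \<noteq> 0" using nz by (simp add: sum_squares_eq_zero_iff)
  ultimately have "x1 + y1 = 0" "x2 + y2 = 0" by (metis mult_eq_0_iff)+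
  then have y: "y1 = - x1" "y2 = - x2" by simp_all
  show thesis
    by (rule that[OF fr mem _ _ _ _ Xa Xa'(1) _ _ aa ab' nz])
      (simp_all add: Da Da' Db Db' R_def Ia Xb Xa' y)
qed

text \<open>On the complex line of \<open>a\<close> the operators \<open>ad e\<close> and
  \<open>ad x\<close> are the numbers \<open>\<alpha> + i \<beta>\<close> and
  \<open>x1 + i x2\<close>, on that of \<open>b\<close> their negatives. If the two are linearly
  dependent over the reals, the algebra is \<open>s6\<close>; otherwise suitable combinations act,
  up to sign, as 1 and \<open>i\<close>, which is \<open>s3\<close>.\<close>

lemma complex_case:
  assumes I: "linear I" "\<And>w. w \<in> W \<Longrightarrow> I w \<in> W" "\<And>w. w \<in> W \<Longrightarrow> I (I w) = - w"
      "\<And>u v. u \<in> W \<Longrightarrow> v \<in> W \<Longrightarrow> \<omega> (I u) v = \<omega> u (I v)"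
      "\<And>w. w \<in> W \<Longrightarrow> I (br e w) = br e (I w)" "\<And>w. w \<in> W \<Longrightarrow> I (br x w) = br x (I w)"
    and D2: "\<And>w. w \<in> W \<Longrightarrow> br e (br e w) = (\<alpha> * \<alpha> - \<beta> * \<beta>) *\<^sub>R w + (2 * \<alpha> * \<beta>) *\<^sub>R I w"
    and nd: "\<alpha> > 0 \<and> \<beta> > 0 \<or> \<not> (\<exists>s. \<forall>w\<in>W. br x w = s *\<^sub>R br e w)"
  shows "lie_isomorphic br s3 \<or> (\<exists>\<gamma>>0. lie_isomorphic br (s6 \<gamma>))"
proof -
  obtain a a' b b' x1 x2 where fr: "frame [a, a', b, b']" and mem: "a \<in> W" "a' \<in> W" "b \<in> W" "b' \<in> W"
    and D: "br e a = \<alpha> *\<^sub>R a + \<beta> *\<^sub>R a'" "br e a' = \<alpha> *\<^sub>R a' - \<beta> *\<^sub>R a"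
    "br e b = - \<alpha> *\<^sub>R b - \<beta> *\<^sub>R b'" "br e b' = - \<alpha> *\<^sub>R b' + \<beta> *\<^sub>R b"
    and X: "br x a = x1 *\<^sub>R a + x2 *\<^sub>R a'" "br x a' = x1 *\<^sub>R a' - x2 *\<^sub>R a"
    "br x b = - x1 *\<^sub>R b - x2 *\<^sub>R b'" "br x b' = - x1 *\<^sub>R b' + x2 *\<^sub>R b"
    and om: "\<omega> a a' = 0" "\<omega> b b' = 0" "\<omega> a' b = \<omega> a b'" "\<omega> a' b' = - \<omega> a b" and nz: "\<omega> a b \<noteq> 0 \<or> \<omega> a b' \<noteq> 0"
    by (rule complex_structure_basis[OF I D2])
  have fr7: "frame [x, e, z, a, a', b, b']" by (rule frame7_W[OF fr mem])
  define d where "d = \<alpha> * x2 - \<beta> * x1"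
  have dep: "\<exists>s. x1 = s * \<alpha> \<and> x2 = s * \<beta>" if "d = 0"
  proof (cases "\<alpha> = 0")
    case True
    have "br e a \<noteq> 0" using inj_e[OF mem(1)] fr by (auto simp: frame_Cons span_zero)
    then have "\<beta> \<noteq> 0" using D(1) True by auto
    then show ?thesis using that True by (intro exI[of _ "x2 / \<beta>"]) (auto simp: d_def)
  next
    case False
    then show ?thesis using that by (intro exI[of _ "x1 / \<alpha>"]) (auto simp: d_def field_simps)
  qed
  have pr_op: "\<forall>w\<in>W. br x w = s *\<^sub>R br e w" if s: "x1 = s * \<alpha>" "x2 = s * \<beta>" for s
  proof
    fix w assume "w \<in> W"
    then obtain c1 c2 c3 c4 where w: "w = c1 *\<^sub>R a + c2 *\<^sub>R a' + c3 *\<^sub>R b + c4 *\<^sub>R b'" by (rule W_coords[OF fr mem])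
    show "br x w = s *\<^sub>R br e w" by (simp add: w brs X D s algebra_simps)
  qed
  \<comment> \<open>The combination \<open>Y\<close> acts by a number with non-zero real and
    imaginary parts, so \<open>Y^2\<close> has no real eigenvalue on \<open>W\<close>. This is what
    kills the \<open>W\<close>-components of brackets.\<close>
  have "\<exists>\<sigma> \<tau>. \<sigma> * \<alpha> + \<tau> * x1 \<noteq> 0 \<and> \<sigma> * \<beta> + \<tau> * x2 \<noteq> 0"
  proof (cases "d = 0")
    case True
    then have "\<alpha> > 0 \<and> \<beta> > 0" using nd dep pr_op by blast
    then show ?thesis by (intro exI[of _ 1] exI[of _ 0]) simp
  next
    case False
    have "(x2 - x1) / d * \<alpha> + (\<alpha> - \<beta>) / d * x1 = 1" "(x2 - x1) / d * \<beta> + (\<alpha> - \<beta>) / d * x2 = 1"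
      using False by (simp_all add: field_simps) (simp_all add: d_def algebra_simps)
    then show ?thesis by (metis zero_neq_one)
  qed
  then obtain \<sigma> \<tau> where st: "\<sigma> * \<alpha> + \<tau> * x1 \<noteq> 0" "\<sigma> * \<beta> + \<tau> * x2 \<noteq> 0" by blast
  define Y where "Y w = \<sigma> *\<^sub>R br e w + \<tau> *\<^sub>R br x w" for w
  define A where "A = \<sigma> * \<alpha> + \<tau> * x1"
  define B where "B = \<sigma> * \<beta> + \<tau> * x2"
  have AB: "A \<noteq> 0" "B \<noteq> 0" using st by (auto simp: A_def B_def)
  have Ys: "Y (u + v) = Y u + Y v" "Y (s *\<^sub>R u) = s *\<^sub>R Y u" "Y (u - v) = Y u - Y v" "Y (- u) = - Y u" for u v s
    by (simp_all add: Y_def brs algebra_simps)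
  have Y: "Y a = A *\<^sub>R a + B *\<^sub>R a'" "Y a' = A *\<^sub>R a' - B *\<^sub>R a" "Y b = - A *\<^sub>R b - B *\<^sub>R b'" "Y b' = - A *\<^sub>R b' + B *\<^sub>R b"
    by (simp_all add: Y_def X D A_def B_def algebra_simps)
  have noeig: "w = 0" if w: "w \<in> W" and Yw: "Y (Y w) = \<mu> *\<^sub>R w" for w \<mu>
  proof -
    obtain c1 c2 c3 c4 where c: "w = c1 *\<^sub>R a + c2 *\<^sub>R a' + c3 *\<^sub>R b + c4 *\<^sub>R b'" by (rule W_coords[OF fr mem w])
    define k where "k = A * A - B * B - \<mu>"
    define l where "l = 2 * A * B"
    have "(c1 * k - c2 * l) *\<^sub>R a + (c1 * l + c2 * k) *\<^sub>R a' + (c3 * k - c4 * l) *\<^sub>R b + (c3 * l + c4 * k) *\<^sub>R b' = Y (Y w) - \<mu> *\<^sub>R w"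
      by (simp add: c Ys Y k_def l_def) (simp add: vec_eq_iff algebra_simps)
    also have "\<dots> = 0" using Yw by simp
    finally have eqs: "c1 * k - c2 * l = 0 \<and> c1 * l + c2 * k = 0 \<and> c3 * k - c4 * l = 0 \<and> c3 * l + c4 * k = 0"
      using fr unfolding frame_explicit by blast
    have "s = 0 \<and> t = 0" if "s * k - t * l = 0" "s * l + t * k = 0" for s t
    proof -
      have "s * (s * l + t * k) - t * (s * k - t * l) = 0" using that by simp
      then have "l * (s * s + t * t) = 0" by (simp add: algebra_simps)
      then show ?thesis using AB by (simp add: l_def sum_squares_eq_zero_iff)
    qed
    then have "c1 = 0 \<and> c2 = 0" "c3 = 0 \<and> c4 = 0" using eqs by blast+
    then show ?thesis using c by simp
  qed
  define t where "t = pbr"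
  note tW = pbr_W[folded t_def] and tl = pbrs[folded t_def] pbr_self[folded t_def]
  have tY: "Y (t s s') = t (Y s) s' + t s (Y s')" for s s'
    using t_e[of s s'] t_x[of s s'] by (simp add: Y_def pbr_def[symmetric] t_def[symmetric] tl algebra_simps)
  have "Y (t a a') = (2 * A) *\<^sub>R t a a'" "Y (t b b') = (- 2 * A) *\<^sub>R t b b'"
    by (simp_all add: tY Y tl) (simp_all add: vec_eq_iff)
  then have t1: "t a a' = 0" "t b b' = 0"
    by (intro noeig[OF tW, of _ _ "(2 * A) * (2 * A)"], simp add: Ys)+
  have Y1: "Y (t a b) = B *\<^sub>R (t a' b - t a b')" "Y (t a' b') = B *\<^sub>R (t a' b - t a b')"
    and Y2: "Y (t a' b) = - B *\<^sub>R (t a b + t a' b')" "Y (t a b') = B *\<^sub>R (t a b + t a' b')"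
    by (simp_all add: tY Y tl algebra_simps)
  have "t a b - t a' b' = 0" by (rule noeig[of _ 0]) (use tW sW in \<open>auto simp: Ys Y1 intro!: subspace_diff\<close>, simp add: Y_def brs)
  then have eq1: "t a' b' = t a b" by simp
  have "t a' b + t a b' = 0" by (rule noeig[of _ 0]) (use tW sW in \<open>auto simp: Ys Y2 intro!: subspace_add\<close>, simp add: Y_def brs)
  then have eq2: "t a b' = - t a' b" by (simp add: eq_neg_iff_add_eq_0 add.commute)
  have "Y (t a b) = (2 * B) *\<^sub>R t a' b" "Y (t a' b) = (- 2 * B) *\<^sub>R t a b"
    using Y1(1) Y2(1) by (simp_all add: eq1 eq2) (simp_all add: vec_eq_iff)
  then have "Y (Y (t a b)) = (- 4 * B * B) *\<^sub>R t a b" "Y (Y (t a' b)) = (- 4 * B * B) *\<^sub>R t a' b" by (simp_all add: Ys)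
  then have t2: "t a b = 0" "t a' b = 0" using noeig[OF tW] by blast+
  have flat: "pr (br s s') = 0" if "s \<in> W" "s' \<in> W" for s s'
    by (rule flat_on_basis[OF fr mem _ _ _ _ _ _ that, folded t_def]) (simp_all add: t1 t2 eq1 eq2)
  interpret ab: g2_abelian br \<phi> z e \<omega> x c by unfold_locales (rule flat)
  define q where "q = ab.q"
  note qs = ab.qs[folded q_def]
  have qY: "q (Y s) s' + q s (Y s') = 0" if "s \<in> W" "s' \<in> W" for s s'
  proof -
    have "q (Y s) s' + q s (Y s') = \<sigma> * (q (br e s) s' + q s (br e s')) + \<tau> * (q (br x s) s' + q s (br x s'))"
      by (simp add: Y_def qs algebra_simps)
    then show ?thesis using ab.q_D[OF that] ab.q_X[OF that] by (simp add: q_def)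
  qed
  have qneg: "q (- s) s' = - q s s'" "q s (- s') = - q s s'" for s s' using qs(3)[of "-1"] qs(4)[of _ "-1"] by auto
  have q1: "q a a' = 0" "q b b' = 0"
    using qY[OF mem(1,2)] qY[OF mem(3,4)] AB by (simp_all add: Y qs qneg)
  have "B * (q a' b - q a b') = 0" using qY[OF mem(1,3)] by (simp add: Y qs qneg algebra_simps)
  then have q2: "q a' b = q a b'" using AB by simp
  have "B * (q a b + q a' b') = 0" using qY[OF mem(1,4)] by (simp add: Y qs qneg algebra_simps)
  then have q3: "q a' b' = - q a b" using AB by (simp add: eq_neg_iff_add_eq_0 add.commute)
  note cl = ab.closed_q[folded q_def]
  have "2 * (c * \<omega> a b + E * q a b) = 0"
    using cl[OF mem(1,3)] cl[OF mem(2,4)] by (simp add: D X \<phi>s om q3 algebra_simps)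
  then have m1: "c * \<omega> a b + E * q a b = 0" by simp
  have "2 * (c * \<omega> a b' + E * q a b') = 0"
    using cl[OF mem(1,4)] cl[OF mem(2,3)] by (simp add: D X \<phi>s om q2 algebra_simps)
  then have m2: "c * \<omega> a b' + E * q a b' = 0" by simp
  have "2 * (q a b * \<omega> a b + q a b' * \<omega> a b') = 0"
    using ab.wedge_q[folded q_def, OF mem] by (simp add: om q1 q2 q3 algebra_simps)
  then have w: "q a b * \<omega> a b + q a b' * \<omega> a b' = 0" by simp
  have "c * (\<omega> a b * \<omega> a b + \<omega> a b' * \<omega> a b') = (c * \<omega> a b + E * q a b) * \<omega> a b + (c * \<omega> a b' + E * q a b') * \<omega> a b'
      - E * (q a b * \<omega> a b + q a b' * \<omega> a b')" by (simp add: algebra_simps)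
  then have "c * (\<omega> a b * \<omega> a b + \<omega> a b' * \<omega> a b') = 0" unfolding m1 m2 w by simp
  then have c0: "c = 0" using nz by (auto simp: sum_squares_eq_zero_iff)
  then have q0: "q a b = 0" "q a b' = 0" using m1 m2 E_nz by auto
  have b0: "br a a' = 0" "br a b = 0" "br a b' = 0" "br a' b = 0" "br a' b' = 0" "br b b' = 0"
    using ab.br_q[folded q_def, OF mem(1,2)] ab.br_q[folded q_def, OF mem(1,3)] ab.br_q[folded q_def, OF mem(1,4)]
      ab.br_q[folded q_def, OF mem(2,3)] ab.br_q[folded q_def, OF mem(2,4)] ab.br_q[folded q_def, OF mem(3,4)] q0 q1 q2 q3 by simp_all
  then have b0r: "br a' a = 0" "br b a = 0" "br b' a = 0" "br b a' = 0" "br b' a' = 0" "br b' b = 0"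
    using anti[of a' a] anti[of b a] anti[of b' a] anti[of b a'] anti[of b' a'] anti[of b' b] by auto
  have xe0: "br x e = 0" "br e x = 0" by (simp_all add: xe ex c0)
  have rD: "br a e = - \<alpha> *\<^sub>R a - \<beta> *\<^sub>R a'" "br a' e = - \<alpha> *\<^sub>R a' + \<beta> *\<^sub>R a"
    "br b e = \<alpha> *\<^sub>R b + \<beta> *\<^sub>R b'" "br b' e = \<alpha> *\<^sub>R b' - \<beta> *\<^sub>R b"
    "br a x = - x1 *\<^sub>R a - x2 *\<^sub>R a'" "br a' x = - x1 *\<^sub>R a' + x2 *\<^sub>R a"
    "br b x = x1 *\<^sub>R b + x2 *\<^sub>R b'" "br b' x = x1 *\<^sub>R b' - x2 *\<^sub>R b"
    using D X anti[of a e] anti[of a' e] anti[of b e] anti[of b' e] anti[of a x] anti[of a' x] anti[of b x] anti[of b' x] by simp_all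
  show ?thesis
  proof (cases "d = 0")
    case True
    then obtain s where s: "x1 = s * \<alpha>" "x2 = s * \<beta>" using dep by blast
    then have pos: "\<alpha> > 0" "\<beta> > 0" using nd pr_op by blast+
    have "frame [a, - a', b, b', (1 / \<beta>) *\<^sub>R e, x - s *\<^sub>R e, z]" (is "frame ?fs")
    proof (rule frame_change[OF fr7])
      have mem: "\<forall>f\<in>set ?fs. f \<in> span (set ?fs)" by (auto intro: span_base)
      have "e = \<beta> *\<^sub>R ((1 / \<beta>) *\<^sub>R e)" using pos by simp
      then have e: "e \<in> span (set ?fs)" using mem by (metis (no_types, lifting) span_scale list.set_intros)
      have "x = (x - s *\<^sub>R e) + s *\<^sub>R e" by simp
      then have x: "x \<in> span (set ?fs)" using mem e by (metis (no_types, lifting) span_add span_scale list.set_intros)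
      have "a' = - (- a')" by simp
      then have "a' \<in> span (set ?fs)" using mem by (metis (no_types, lifting) span_neg list.set_intros)
      then show "set [x, e, z, a, a', b, b'] \<subseteq> span (set ?fs)" using mem x e by simp
    qed simp
    then have "lie_isomorphic br (s6 (\<alpha> / \<beta>))"
      by (rule s6_I) (use pos in \<open>simp_all add: brs b0 b0r xe0 rD s\<close>, simp_all add: vec_eq_iff field_simps)
    moreover have "\<alpha> / \<beta> > 0" using pos by simp
    ultimately show ?thesis by blast
  next
    case False
    \<comment> \<open>\<open>j\<close> and \<open>i\<close> come from inverting the 2 x 2 matrix of
      the two complex numbers, of determinant \<open>d\<close>.\<close>
    define j where "j = (\<alpha> / d) *\<^sub>R x - (x1 / d) *\<^sub>R e"
    define i where "i = (\<beta> / d) *\<^sub>R x - (x2 / d) *\<^sub>R e"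
    have dd: "\<alpha> / d * x2 = 1 + x1 / d * \<beta>" "\<beta> / d * x1 = x2 / d * \<alpha> - 1"
      using False by (simp_all add: field_simps) (simp_all add: d_def algebra_simps)
    have J: "br a j = - a'" "br a' j = a" "br b j = b'" "br b' j = - b"
      and Ii: "br a i = a" "br a' i = a'" "br b i = - b" "br b' i = - b'"
      using False by (simp_all add: j_def i_def brs rD vec_eq_iff field_simps) (simp_all add: d_def algebra_simps)
    have "frame [a, - a', b, - b', j, i, z]" (is "frame ?fs")
    proof (rule frame_change[OF fr7])
      have mem: "\<forall>f\<in>set ?fs. f \<in> span (set ?fs)" by (auto intro: span_base)
      have "a' = - (- a')" "b' = - (- b')" by simp_all
      then have "a' \<in> span (set ?fs)" "b' \<in> span (set ?fs)" using mem by (metis (no_types, lifting) span_neg list.set_intros)+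
      moreover have "e = \<beta> *\<^sub>R j - \<alpha> *\<^sub>R i" "x = x2 *\<^sub>R j - x1 *\<^sub>R i"
        using False by (simp_all add: j_def i_def vec_eq_iff field_simps) (simp_all add: d_def algebra_simps)
      then have "e \<in> span (set ?fs)" "x \<in> span (set ?fs)" using mem by (metis (no_types, lifting) span_diff span_scale list.set_intros)+
      ultimately show "set [x, e, z, a, a', b, b'] \<subseteq> span (set ?fs)" using mem by simp
    qed simp
    note fr' = this
    have "br j i = 0" by (simp add: j_def i_def brs xe0)
    then have "lie_isomorphic br s3"
      by (intro s3_I[OF fr']) (simp_all add: brs b0 b0r J Ii)
    then show ?thesis by blast
  qed
qed

end

context g2_torus
begin

text \<open>The eigenvalues of \<open>Q\<close> are \<open>\<tau> / 2\<close> plus and minus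
  \<open>i \<kappa>\<close>, so \<open>(Q - \<tau> / 2) / \<kappa>\<close> is a complex
  structure.\<close>

lemma quadratic_complex_case:
  assumes Qlin: "linear Q" and QW: "\<And>w. w \<in> W \<Longrightarrow> Q w \<in> W"
    and Qsa: "\<And>u v. u \<in> W \<Longrightarrow> v \<in> W \<Longrightarrow> \<omega> (Q u) v = \<omega> u (Q v)"
    and Qc: "\<And>w. Q (br e w) = br e (Q w)" "\<And>w. Q (br x w) = br x (Q w)"
    and Q2: "\<And>w. w \<in> W \<Longrightarrow> Q (Q w) = \<tau> *\<^sub>R Q w - \<delta> *\<^sub>R w" and \<kappa>: "\<kappa> > 0" "\<kappa> * \<kappa> = \<delta> - \<tau> * \<tau> / 4"
    and D2: "\<And>w. w \<in> W \<Longrightarrow> br e (br e w) = (\<alpha> * \<alpha> - \<beta> * \<beta>) *\<^sub>R w + (2 * \<alpha> * \<beta> / \<kappa>) *\<^sub>R (Q w - (\<tau> / 2) *\<^sub>R w)"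
    and nd: "\<alpha> > 0 \<and> \<beta> > 0 \<or> \<not> (\<exists>s. \<forall>w\<in>W. br x w = s *\<^sub>R br e w)"
  shows "lie_isomorphic br s3 \<or> (\<exists>\<gamma>>0. lie_isomorphic br (s6 \<gamma>))"
proof -
  note Qs = linear_rules[OF Qlin]
  define k where "k = 1 / \<kappa>"
  define h where "h = \<tau> / 2"
  have k: "k * \<kappa> = 1" and th: "\<tau> = 2 * h" using \<kappa> by (simp_all add: k_def h_def)
  define I where "I w = k *\<^sub>R (Q w - h *\<^sub>R w)" for w
  show ?thesis
  proof (rule complex_case[of I \<alpha> \<beta>])
    show "linear I" unfolding I_def[abs_def] by (rule linearI) (simp_all add: Qs algebra_simps)
    fix w assume w: "w \<in> W"
    show "I w \<in> W" using w QW sW by (auto simp: I_def intro!: subspace_scale subspace_diff)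
    have "I (I w) = (k * k) *\<^sub>R (Q (Q w) - (2 * h) *\<^sub>R Q w + (h * h) *\<^sub>R w)"
      by (simp add: I_def Qs) (simp add: vec_eq_iff algebra_simps)
    also have "Q (Q w) - (2 * h) *\<^sub>R Q w + (h * h) *\<^sub>R w = - ((\<kappa> * \<kappa>) *\<^sub>R w)"
      unfolding Q2[OF w] \<kappa>(2) th by (simp add: algebra_simps)
    also have "(k * k) *\<^sub>R - ((\<kappa> * \<kappa>) *\<^sub>R w) = - ((k * \<kappa>) * (k * \<kappa>)) *\<^sub>R w" by (simp add: algebra_simps)
    finally show "I (I w) = - w" unfolding k by simp
    show "I (br e w) = br e (I w)" "I (br x w) = br x (I w)" by (simp_all add: I_def brs Qc)
    show "br e (br e w) = (\<alpha> * \<alpha> - \<beta> * \<beta>) *\<^sub>R w + (2 * \<alpha> * \<beta>) *\<^sub>R I w"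
      unfolding D2[OF w] by (simp add: I_def k_def h_def)
    show "\<omega> (I w) v = \<omega> w (I v)" if "v \<in> W" for v using Qsa[OF w that] by (simp add: I_def \<omega>s)
  qed (rule nd)
qed

lemma complex_poly_case:
  assumes td: "\<tau>\<^sup>2 < 4 * \<delta>" and A: "\<And>w. w \<in> W \<Longrightarrow> br e (br e (br e (br e w))) = \<tau> *\<^sub>R br e (br e w) - \<delta> *\<^sub>R w"
  shows "lie_isomorphic br s3 \<or> (\<exists>\<gamma>>0. lie_isomorphic br (s6 \<gamma>))"
proof -
  define \<kappa> where "\<kappa> = sqrt (\<delta> - \<tau> * \<tau> / 4)"
  have \<kappa>: "\<kappa> > 0" "\<kappa> * \<kappa> = \<delta> - \<tau> * \<tau> / 4" using td by (auto simp: \<kappa>_def power2_eq_square)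
  have "sqrt \<delta> > \<bar>\<tau>\<bar> / 2"
  proof -
    have "(\<bar>\<tau>\<bar> / 2)\<^sup>2 < \<delta>" using td by (simp add: power2_eq_square)
    then show ?thesis by (rule real_less_rsqrt)
  qed
  then have "sqrt \<delta> + \<tau> / 2 > 0" using abs_ge_minus_self[of \<tau>] by simp
  then have pos: "(sqrt \<delta> + \<tau> / 2) / 2 > 0" by simp
  have \<delta>0: "\<delta> \<ge> 0" using td zero_le_power2[of \<tau>] by linarith
  \<comment> \<open>\<open>\<alpha> + i \<beta>\<close> is the square root of the eigenvalue
    \<open>\<tau> / 2 + i \<kappa>\<close> of the square of \<open>ad e\<close>; the modulus of this
    eigenvalue is \<open>sqrt \<delta>\<close>.\<close>
  define \<alpha> where "\<alpha> = sqrt ((sqrt \<delta> + \<tau> / 2) / 2)"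
  have \<alpha>: "\<alpha> > 0" "\<alpha> * \<alpha> = (sqrt \<delta> + \<tau> / 2) / 2" using pos by (auto simp: \<alpha>_def)
  define \<beta> where "\<beta> = \<kappa> / (2 * \<alpha>)"
  have \<beta>: "\<beta> > 0" "2 * \<alpha> * \<beta> = \<kappa>" using \<alpha> \<kappa> by (auto simp: \<beta>_def)
  have ab: "\<alpha> * \<alpha> - \<beta> * \<beta> = \<tau> / 2"
  proof -
    have "(4 * (\<alpha> * \<alpha>)) * (\<beta> * \<beta>) = \<kappa> * \<kappa>" unfolding \<beta>(2)[symmetric] by simp
    also have "\<dots> = (4 * (\<alpha> * \<alpha>)) * ((sqrt \<delta> - \<tau> / 2) / 2)"
      using \<delta>0 by (simp add: \<kappa>(2) \<alpha>(2) field_simps)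
    finally have "\<beta> * \<beta> = (sqrt \<delta> - \<tau> / 2) / 2" using \<alpha>(1) by simp
    then show ?thesis by (simp add: \<alpha>(2) field_simps)
  qed
  show ?thesis
  proof (rule quadratic_complex_case[of "\<lambda>w. br e (br e w)" \<tau> \<delta> \<kappa> \<alpha> \<beta>])
    show "\<omega> (br e (br e u)) v = \<omega> u (br e (br e v))" if "u \<in> W" "v \<in> W" for u v
      using D_skew[OF eW[OF that(1)] that(2)] D_skew[OF that(1) eW[OF that(2)]] by simp
    show "br e (br e w) = (\<alpha> * \<alpha> - \<beta> * \<beta>) *\<^sub>R w + (2 * \<alpha> * \<beta> / \<kappa>) *\<^sub>R (br e (br e w) - (\<tau> / 2) *\<^sub>R w)" for w
      unfolding ab \<beta>(2) using \<kappa>(1) by simp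
  qed (use \<alpha> \<beta> \<kappa> A eW linear_compose[OF lin2[of e] lin2[of e]] in \<open>auto simp: comm_xe o_def\<close>)
qed

end

section \<open>The nilradical of codimension two\<close>

context g2_B
begin

lemma not_square_zero:
  assumes "\<And>w. w \<in> W \<Longrightarrow> br (x - s *\<^sub>R e) (br (x - s *\<^sub>R e) w) = 0"
  shows False
proof -
  have "x - s *\<^sub>R e = - s *\<^sub>R e + 1 *\<^sub>R x" by simp
  then have "(br (- s *\<^sub>R e + 1 *\<^sub>R x) ^^ 2) w = 0" if "w \<in> W" for w
    using assms[OF that] by (simp only: numeral_2_eq_2 funpow.simps o_apply id_apply)
  then have "(1 :: real) = 0" using nonil[of "- s" 1] by blast
  then show False by simp
qed

lemma not_proportional: "\<not> (\<forall>w\<in>W. br x w = s *\<^sub>R br e w)"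
proof
  assume "\<forall>w\<in>W. br x w = s *\<^sub>R br e w"
  then have "br (x - s *\<^sub>R e) w = 0" if "w \<in> W" for w using that by (simp add: brs)
  then show False using not_square_zero[of s] by simp
qed

text \<open>A nilpotent part of \<open>ad e\<close> would make some \<open>x - p' e\<close> square
  to 0 on \<open>W\<close>, so \<open>ad e\<close> is semisimple there. The self-adjoint operator
  \<open>Q\<close>, the composition of \<open>ad e\<close> and \<open>ad x\<close>, determines
  \<open>ad x\<close>. Non-real roots of its quadratic give a complex structure, a double root a
  combination of square 0, and distinct real roots two orthogonal planes.\<close>

lemma double_case_B:
  assumes r0: "r \<noteq> 0" and dbl: "\<And>w. w \<in> W \<Longrightarrow> br e (br e (br e (br e w) - r *\<^sub>R w)) = r *\<^sub>R (br e (br e w) - r *\<^sub>R w)"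
  shows "lie_isomorphic br s3 \<or> lie_isomorphic br s4 \<or> (\<exists>\<gamma>>0. lie_isomorphic br (s6 \<gamma>))"
proof -
  interpret d: g2_double0 br \<phi> z e \<omega> x c r by unfold_locales (use r0 dbl cp0 in auto)
  have N0: "d.NN w = 0" if "w \<in> W" for w
  proof (rule ccontr)
    assume "d.NN w \<noteq> 0"
    then have ex: "\<exists>w\<in>W. d.NN w \<noteq> 0" using that by blast
    obtain v b where v: "v \<in> W" "b \<noteq> 0" and fr: "frame [v, d.SS v, d.NN v, d.NN (d.SS v)]"
      and om: "\<omega> (d.NN v) v = b" "\<omega> (d.NN (d.SS v)) (d.SS v) = - r * b" "\<omega> (d.NN v) (d.SS v) = 0" "\<omega> (d.NN (d.SS v)) v = 0"
        "\<omega> (d.NN v) (d.NN (d.SS v)) = 0"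
      by (rule d.frame_skew_square[OF d.NN_linear d.NN_W d.SN_comm d.NN_skew d.NN_NN ex])
    define v' where "v' = d.SS v"
    define k where "k = d.NN v"
    define k' where "k' = d.NN v'"
    note om = om[folded v'_def, folded k_def k'_def] and fr = fr[folded v'_def, folded k_def k'_def]
    have mem: "v \<in> W" "v' \<in> W" "k \<in> W" "k' \<in> W" using v d.SS_W d.NN_W by (auto simp: v'_def k_def k'_def)
    have SN: "d.SS v' = r *\<^sub>R v" "d.NN k = 0" "d.NN k' = 0" "d.SS k = k'" "d.SS k' = r *\<^sub>R k"
      using d.SS_SS[OF v(1)] d.NN_NN mem(1,2) by (simp_all add: v'_def k_def k'_def d.SN_comm d.SNs)
    have D: "br e v = v' + k" "br e v' = r *\<^sub>R v + k'" "br e k = k'" "br e k' = r *\<^sub>R k"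
      by (simp_all add: d.D_SN SN) (simp_all add: v'_def k_def k'_def)
    obtain p p' s t where Xv: "br x v = p *\<^sub>R v + p' *\<^sub>R v' + s *\<^sub>R k + t *\<^sub>R k'"
      by (rule W_coords[OF fr mem xW[OF mem(1)]])
    have "br x v' = d.SS (br x v)" by (simp add: d.SS_x v'_def)
    then have Xv': "br x v' = p *\<^sub>R v' + (p' * r) *\<^sub>R v + s *\<^sub>R k' + (t * r) *\<^sub>R k"
      by (simp add: Xv d.SNs SN v'_def[symmetric])
    have "br x k = d.NN (br x v)" by (simp add: d.NN_x k_def)
    then have Xk: "br x k = p *\<^sub>R k + p' *\<^sub>R k'" by (simp add: Xv d.SNs SN k_def[symmetric] k'_def[symmetric])
    have "br x k' = d.NN (br x v')" by (simp add: d.NN_x k'_def)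
    then have Xk': "br x k' = p *\<^sub>R k' + (p' * r) *\<^sub>R k" by (simp add: Xv' d.SNs SN k_def[symmetric] k'_def[symmetric])
    have "\<omega> (br x v) k = - \<omega> v (br x k)" by (rule X_skew[OF mem(1,3)])
    then have "2 * (p * b) = 0" using om \<omega>_anti[of v k] \<omega>_anti[of v' k] \<omega>_anti[of v k'] \<omega>_anti[of k' k]
      by (simp add: Xv Xk \<omega>s)
    then have p: "p = 0" using v by simp
    show False
    proof (rule not_square_zero[of p'])
      fix w assume w: "w \<in> W"
      define Z where "Z u = br (x - p' *\<^sub>R e) u" for u
      have Zs: "Z (a + b) = Z a + Z b" "Z (q *\<^sub>R a) = q *\<^sub>R Z a" for a b q by (simp_all add: Z_def brs algebra_simps)
      have Z: "Z v = (s - p') *\<^sub>R k + t *\<^sub>R k'" "Z v' = (s - p') *\<^sub>R k' + (t * r) *\<^sub>R k" "Z k = 0" "Z k' = 0"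
        by (simp_all add: Z_def brs Xv Xv' Xk Xk' D p algebra_simps)
      obtain c1 c2 c3 c4 where c: "w = c1 *\<^sub>R v + c2 *\<^sub>R v' + c3 *\<^sub>R k + c4 *\<^sub>R k'" by (rule W_coords[OF fr mem w])
      have "Z (Z w) = 0" unfolding c by (simp add: Zs Z)
      then show "br (x - p' *\<^sub>R e) (br (x - p' *\<^sub>R e) w) = 0" by (simp add: Z_def)
    qed
  qed
  have D2: "br e (br e w) = r *\<^sub>R w" if "w \<in> W" for w using d.D_NN[OF that] N0[OF that] by simp
  define Q where "Q w = br e (br x w)" for w
  have Qlin: "linear Q" unfolding Q_def[abs_def] by (rule linearI) (simp_all add: brs)
  note Qs = linear_rules[OF Qlin]
  have QW: "Q w \<in> W" if "w \<in> W" for w using that eW xW by (simp add: Q_def)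
  have Qsa: "\<omega> (Q u) v = \<omega> u (Q v)" if "u \<in> W" "v \<in> W" for u v
    using D_skew[OF xW[OF that(1)] that(2)] X_skew[OF that(1) eW[OF that(2)]] by (simp add: Q_def comm_xe)
  have Qc: "Q (br e w) = br e (Q w)" "Q (br x w) = br x (Q w)" for w by (simp_all add: Q_def comm_xe)
  have XQ: "br x w = (1 / r) *\<^sub>R br e (Q w)" if "w \<in> W" for w using D2[OF xW[OF that]] r0 by (simp add: Q_def)
  obtain \<tau> \<delta> where Q2: "\<And>w. w \<in> W \<Longrightarrow> Q (Q w) = \<tau> *\<^sub>R Q w - \<delta> *\<^sub>R w"
    by (rule self_adjoint_quadratic[OF sW dim4 \<omega>_bil \<omega>_self \<omega>_nd_Range Qlin]) (use QW Qsa in auto)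
  consider "\<tau>\<^sup>2 < 4 * \<delta>" | "\<tau>\<^sup>2 = 4 * \<delta>" | "\<tau>\<^sup>2 > 4 * \<delta>" by linarith
  then show ?thesis
  proof cases
    case 1
    define \<kappa> where "\<kappa> = sqrt (\<delta> - \<tau> * \<tau> / 4)"
    have \<kappa>: "\<kappa> > 0" "\<kappa> * \<kappa> = \<delta> - \<tau> * \<tau> / 4" using 1 by (auto simp: \<kappa>_def power2_eq_square)
    \<comment> \<open>The square of \<open>ad e\<close> is the real number \<open>r\<close>, so its
      root \<open>\<alpha> + i \<beta>\<close> is real or purely imaginary.\<close>
    have "\<exists>\<alpha> \<beta>. \<alpha> * \<alpha> - \<beta> * \<beta> = r \<and> \<alpha> * \<beta> = 0"
    proof (cases "r > 0")
      case True
      then show ?thesis by (intro exI[of _ "sqrt r"] exI[of _ 0]) simp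
    next
      case False
      then show ?thesis by (intro exI[of _ 0] exI[of _ "sqrt (- r)"]) simp
    qed
    then obtain \<alpha> \<beta> where ab: "\<alpha> * \<alpha> - \<beta> * \<beta> = r" "\<alpha> * \<beta> = 0" by blast
    have "lie_isomorphic br s3 \<or> (\<exists>\<gamma>>0. lie_isomorphic br (s6 \<gamma>))"
      by (rule quadratic_complex_case[OF Qlin QW Qsa Qc Q2 \<kappa>, of \<alpha> \<beta>])
        (use D2 ab not_proportional in auto)
    then show ?thesis by blast
  next
    case 2
    define \<mu> where "\<mu> = \<tau> / 2"
    have m: "\<tau> = 2 * \<mu>" "\<delta> = \<mu> * \<mu>" using 2 by (simp_all add: \<mu>_def power2_eq_square)
    have False
    proof (rule not_square_zero[of "\<mu> / r"])
      fix w assume w: "w \<in> W"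
      define Z where "Z u = br (x - (\<mu> / r) *\<^sub>R e) u" for u
      have Z: "Z u = (1 / r) *\<^sub>R br e (Q u - \<mu> *\<^sub>R u)" if "u \<in> W" for u
        using XQ[OF that] by (simp add: Z_def brs algebra_simps)
      have mem: "Q w - \<mu> *\<^sub>R w \<in> W" using QW[OF w] w sW by (intro subspace_diff subspace_scale)
      have "Z (Z w) = (1 / r * (1 / r)) *\<^sub>R br e (br e (Q (Q w - \<mu> *\<^sub>R w) - \<mu> *\<^sub>R (Q w - \<mu> *\<^sub>R w)))"
        using r0 eW[OF mem] sW by (simp add: Z[OF w] Z subspace_scale Qs Qc brs) (simp add: vec_eq_iff field_simps)
      also have "Q (Q w - \<mu> *\<^sub>R w) - \<mu> *\<^sub>R (Q w - \<mu> *\<^sub>R w) = 0"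
        unfolding Qs Q2[OF w] m by (simp add: vec_eq_iff algebra_simps)
      finally have "Z (Z w) = 0" by simp
      then show "br (x - (\<mu> / r) *\<^sub>R e) (br (x - (\<mu> / r) *\<^sub>R e) w) = 0" by (simp add: Z_def)
    qed
    then show ?thesis ..
  next
    case 3
    define s where "s = sqrt (\<tau>\<^sup>2 - 4 * \<delta>)"
    have s: "s > 0" "s * s = \<tau> * \<tau> - 4 * \<delta>" using 3 by (auto simp: s_def power2_eq_square)
    define \<mu>1 where "\<mu>1 = (\<tau> + s) / 2"
    define \<mu>2 where "\<mu>2 = (\<tau> - s) / 2"
    have ms: "\<mu>1 + \<mu>2 = \<tau>" "\<mu>1 * \<mu>2 = \<delta>" "\<mu>1 - \<mu>2 = s" using s by (auto simp: \<mu>1_def \<mu>2_def field_simps)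
    define C where "C \<mu> = {w \<in> W. Q w = \<mu> *\<^sub>R w}" for \<mu>
    have sub: "subspace (C \<mu>)" for \<mu> using sW by (auto simp: C_def subspace_def Qs linear_0[OF Qlin] algebra_simps)
    have CW: "w \<in> W" if "w \<in> C \<mu>" for w \<mu> using that by (simp add: C_def)
    have sum: "\<exists>a\<in>C \<mu>1. \<exists>b\<in>C \<mu>2. w = a + b" if w: "w \<in> W" for w
    proof (intro bexI)
      let ?a = "(1 / s) *\<^sub>R (Q w - \<mu>2 *\<^sub>R w)" and ?b = "(- (1 / s)) *\<^sub>R (Q w - \<mu>1 *\<^sub>R w)"
      have mem: "Q w - \<mu> *\<^sub>R w \<in> W" for \<mu> using QW[OF w] w sW by (intro subspace_diff subspace_scale)
      have "Q (Q w - \<mu>2 *\<^sub>R w) = \<mu>1 *\<^sub>R (Q w - \<mu>2 *\<^sub>R w)" "Q (Q w - \<mu>1 *\<^sub>R w) = \<mu>2 *\<^sub>R (Q w - \<mu>1 *\<^sub>R w)"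
        using Q2[OF w] by (simp_all add: Qs ms(1,2)[symmetric] algebra_simps)
      then show "?a \<in> C \<mu>1" "?b \<in> C \<mu>2" using mem sW by (auto simp: C_def Qs subspace_scale subspace_neg simp del: scaleR_minus_left)
      have "?a + ?b = (1 / s * (\<mu>1 - \<mu>2)) *\<^sub>R w" by (simp add: algebra_simps diff_divide_distrib)
      then show "w = ?a + ?b" using s ms by simp
    qed
    have nz: "C \<mu> \<noteq> {0}" if al: "\<forall>w\<in>W. \<exists>a\<in>C \<mu>. \<exists>b\<in>C \<mu>'. w = a + b" for \<mu> \<mu>'
    proof
      assume "C \<mu> = {0}"
      have "Q w = \<mu>' *\<^sub>R w" if w: "w \<in> W" for w
      proof -
        obtain a b where "a \<in> C \<mu>" "b \<in> C \<mu>'" "w = a + b" using al w by blast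
        moreover have "a = 0" using \<open>a \<in> C \<mu>\<close> unfolding \<open>C \<mu> = {0}\<close> by simp
        ultimately show ?thesis by (simp add: C_def)
      qed
      note Q\<mu> = this
      have "br x w = (\<mu>' / r) *\<^sub>R br e w" if w: "w \<in> W" for w
        unfolding XQ[OF w] Q\<mu>[OF w] brs by simp
      then show False using not_proportional by blast
    qed
    have "lie_isomorphic br s4"
    proof (rule orthogonal_planes[of "C \<mu>1" r "C \<mu>2" r])
      show "C \<mu>1 \<noteq> {0}" by (rule nz[of \<mu>1 \<mu>2]) (use sum in blast)
      show "C \<mu>2 \<noteq> {0}" by (rule nz[of \<mu>2 \<mu>1]) (metis sum add.commute)
      show "\<omega> a b = 0" if "a \<in> C \<mu>1" "b \<in> C \<mu>2" for a b
      proof -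
        have "(\<mu>1 - \<mu>2) * \<omega> a b = 0" using Qsa[of a b] that by (simp add: C_def \<omega>s algebra_simps)
        then show ?thesis using s ms by simp
      qed
      show "\<exists>w\<in>W. br x w \<noteq> s *\<^sub>R br e w" for s using not_proportional by blast
      show "\<exists>a\<in>C \<mu>1. \<exists>b\<in>C \<mu>2. w = a + b" if "w \<in> W" for w by (rule sum[OF that])
    qed (use sub D2 eW xW in \<open>auto simp: C_def Qc brs\<close>)
    then show ?thesis by blast
  qed
qed

theorem classification_B:
  "lie_isomorphic br s3 \<or> lie_isomorphic br s4 \<or> (\<exists>\<gamma>>0. lie_isomorphic br (s6 \<gamma>))"
proof (rule trichotomy[OF cp0])
  fix r1 r2 assume r: "r1 \<noteq> r2" "\<And>w. w \<in> W \<Longrightarrow> \<exists>a\<in>L r1. \<exists>b\<in>L r2. w = a + b" "L r1 \<noteq> {0}" "L r2 \<noteq> {0}"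
  interpret sp: g2_split br \<phi> z e \<omega> x c r1 r2 by unfold_locales (use ca0 cp0 r in auto)
  have "lie_isomorphic br s4"
  proof (rule orthogonal_planes[of "L r1" r1 "L r2" r2])
    show "\<exists>w\<in>W. br x w \<noteq> s *\<^sub>R br e w" for s using not_proportional by blast
  qed (use r L_W L_D2 L_sub L_e L_x sp.\<omega>_orth in auto)
  then show ?thesis by blast
qed (use complex_poly_case double_case_B in blast)+

end

section \<open>Assembly of the classification\<close>

context g2_A
begin

theorem classification_A:
  "lie_isomorphic br s1 \<or> lie_isomorphic br s2 \<or> lie_isomorphic br s3 \<or> lie_isomorphic br s5 \<or>
   (\<exists>\<gamma>>0. lie_isomorphic br (s6 \<gamma>)) \<or> lie_isomorphic br s7 \<or> lie_isomorphic br s8 \<or> lie_isomorphic br s9 \<or>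
   lie_isomorphic br s10 \<or> lie_isomorphic br s11"
proof (cases "\<exists>u\<in>W. \<exists>v\<in>W. cp (br u v) \<noteq> 0")
  case True
  then show ?thesis using P_case by blast
next
  case False
  then have cp0: "cp (br u v) = 0" if "u \<in> W" "v \<in> W" for u v using that by blast
  interpret t: g2_torus br \<phi> z e \<omega> x c by unfold_locales (use ca0 cp0 in auto)
  show ?thesis
  proof (rule trichotomy[OF cp0])
    fix r1 r2 assume r: "r1 \<noteq> r2" "\<And>w. w \<in> W \<Longrightarrow> \<exists>a\<in>L r1. \<exists>b\<in>L r2. w = a + b" "L r1 \<noteq> {0}" "L r2 \<noteq> {0}"
    interpret sp: g2_split_A br \<phi> z e \<omega> x c r1 r2 by unfold_locales (use ca0 cp0 r in auto)
    show ?thesis using sp.split_A_False ..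
  next
    fix \<tau> \<delta> assume "\<tau>\<^sup>2 < 4 * \<delta>" "\<And>w. w \<in> W \<Longrightarrow> br e (br e (br e (br e w))) = \<tau> *\<^sub>R br e (br e w) - \<delta> *\<^sub>R w"
    then show ?thesis using t.complex_poly_case by blast
  next
    fix r assume "r \<noteq> 0" "\<And>w. w \<in> W \<Longrightarrow> br e (br e (br e (br e w) - r *\<^sub>R w)) = r *\<^sub>R (br e (br e w) - r *\<^sub>R w)"
    then show ?thesis using double_case[OF _ _ cp0] by blast
  qed
qed

end

context g2
begin

theorem classification:
  assumes "\<not> lie_nilpotent br"
  shows "lie_isomorphic br s1 \<or> lie_isomorphic br s2 \<or> lie_isomorphic br s3 \<or> lie_isomorphic br s4 \<or>
    lie_isomorphic br s5 \<or> (\<exists>\<gamma>>0. lie_isomorphic br (s6 \<gamma>)) \<or> lie_isomorphic br s7 \<or> lie_isomorphic br s8 \<or>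
    lie_isomorphic br s9 \<or> lie_isomorphic br s10 \<or> lie_isomorphic br s11"
proof -
  obtain e where e: "Range e \<noteq> {0}" "\<forall>e'. dim (Range e') \<le> dim (Range e)"
    using non_nilpotent_element[OF assms] by metis
  obtain \<omega> where \<omega>: "closed_form \<omega>" "\<forall>w\<in>Range e. \<omega> e w = 0" "\<forall>x y. br x y \<in> Null e \<longrightarrow> \<omega> x y = \<phi> z x y"
    using adapted_form[of e] by metis
  interpret ad: g2_adapted br \<phi> z e \<omega> by unfold_locales (use e \<omega> in auto)
  have d4: "dim (Range e) = 4" using ad.dim_Range ad.Range2_False by blast
  obtain x c where x: "x \<in> Null e" "frame [x, e, z]" "span {x, e, z} = Null e" "br x e = c *\<^sub>R z" "\<omega> x e \<noteq> 0"
    by (rule ad.Null3[OF d4])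
  interpret ca: g2_cartan br \<phi> z e \<omega> x c by unfold_locales (rule d4 x)+
  show ?thesis
  proof (cases "\<exists>s t. (\<forall>w\<in>Range e. \<exists>n. (br (s *\<^sub>R e + t *\<^sub>R x) ^^ n) w = 0) \<and> (s \<noteq> 0 \<or> t \<noteq> 0)")
    case False
    interpret g2_B br \<phi> z e \<omega> x c by unfold_locales (use False in blast)+
    show ?thesis using classification_B by blast
  next
    case True
    then obtain s t where st: "\<And>w. w \<in> Range e \<Longrightarrow> \<exists>n. (br (s *\<^sub>R e + t *\<^sub>R x) ^^ n) w = 0" "s \<noteq> 0 \<or> t \<noteq> 0" by blast
    \<comment> \<open>\<open>ad e\<close> is injective on \<open>W\<close>, so a nilpotent
      combination must involve \<open>x\<close> and can replace it in the basis of the Cartan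
      subalgebra.\<close>
    have t: "t \<noteq> 0"
    proof
      assume "t = 0"
      then have s: "s \<noteq> 0" using st by simp
      obtain w where w: "w \<in> Range e" "w \<noteq> 0" using ca.W_nz by blast
      obtain n where n: "(br (s *\<^sub>R e) ^^ n) w = 0" using st(1)[OF w(1)] \<open>t = 0\<close> by auto
      define B where "B = br (s *\<^sub>R e)"
      have B: "B u = s *\<^sub>R br e u" for u by (simp add: B_def brs)
      have "(B ^^ j) w \<in> Range e \<and> (B ^^ j) w \<noteq> 0" for j
      proof (induction j)
        case (Suc j)
        have "(B ^^ Suc j) w = s *\<^sub>R br e ((B ^^ j) w)" unfolding funpow.simps comp_def by (rule B)
        then show ?case
          using Suc s ca.eW ad.inj_e[of "(B ^^ j) w"] subspace_scale[OF ad.sW] by auto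
      qed (use w in simp)
      then show False using n unfolding B_def by blast
    qed
    define x' where "x' = s *\<^sub>R e + t *\<^sub>R x"
    have sN: "subspace (Null e)" by (rule ad.sN)
    interpret c': g2_cartan br \<phi> z e \<omega> x' "t * c"
    proof unfold_locales
      show "dim (Range e) = 4" by (rule d4)
      show "x' \<in> Null e" using x self_Null sN by (auto simp: x'_def intro!: subspace_add subspace_scale)
      have xx: "x = (1 / t) *\<^sub>R (x' - s *\<^sub>R e)" using t by (simp add: x'_def)
      have mem: "x' \<in> span {x', e, z}" "e \<in> span {x', e, z}" "z \<in> span {x', e, z}" by (auto intro: span_base)
      then have "x \<in> span {x', e, z}" using xx by (metis span_scale span_diff)
      then have sp: "{x, e, z} \<subseteq> span {x', e, z}" using mem by auto
      then show "frame [x', e, z]" by (intro frame_change[OF x(2)]) auto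
      have "x' \<in> span {x, e, z}" unfolding x'_def by (intro span_add span_scale span_base) auto
      then have "span {x', e, z} \<subseteq> span {x, e, z}" by (intro span_minimal) (auto intro: span_base)
      moreover have "span {x, e, z} \<subseteq> span {x', e, z}" using sp by (intro span_minimal) auto
      ultimately show "span {x', e, z} = Null e" using x(3) by auto
      show "br x' e = (t * c) *\<^sub>R z" by (simp add: x'_def brs x(4))
      show "\<omega> x' e \<noteq> 0" using x(5) t by (simp add: x'_def ad.\<omega>s)
    qed
    interpret g2_A br \<phi> z e \<omega> x' "t * c" by unfold_locales (use st in \<open>simp add: x'_def\<close>)
    show ?thesis using classification_A by blast
  qed
qed

end

section \<open>Existence of closed definite forms\<close>

lemma dim_bij_image:
  fixes f :: "'a::real_vector \<Rightarrow> 'b::real_vector"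
  assumes "linear f" "inj f" shows "dim (f ` S) = dim S"
proof -
  obtain B where B: "B \<subseteq> S" "independent B" "S \<subseteq> span B" "card B = dim S" by (rule basis_exists)
  have "independent (f ` B)"
    by (rule linear_independent_injective_image[OF assms(1) B(2)]) (use assms(2) in \<open>auto intro: inj_on_subset\<close>)
  moreover have "f ` S \<subseteq> span (f ` B)" using B(3) linear_span_image[OF assms(1), of B] by blast
  ultimately have "card (f ` B) = dim (f ` S)" using B(1) by (intro basis_card_eq_dim) auto
  moreover have "card (f ` B) = card B" by (rule card_image[OF inj_on_subset[OF assms(2) subset_UNIV]])
  ultimately show ?thesis using B(4) by simp
qed

lemma definite_three_form_pullback:
  fixes f :: "'a::real_vector \<Rightarrow> 'b::real_vector"
  assumes f: "linear f" and g: "linear g" "\<And>x. g (f x) = x" "\<And>y. f (g y) = y" and \<phi>: "definite_three_form \<phi>"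
  shows "definite_three_form (\<lambda>x y z. \<phi> (f x) (f y) (f z))"
proof -
  let ?\<psi> = "\<lambda>x y z. \<phi> (f x) (f y) (f z)"
  have t: "three_form \<phi>" and rank: "\<And>w. w \<noteq> 0 \<Longrightarrow> two_form_rank (\<phi> w) = 6" using \<phi> by (auto simp: definite_three_form_def)
  have lin: "linear (\<lambda>x. \<phi> x y z)" "linear (\<lambda>y. \<phi> x y z)" "linear (\<phi> x y)" for x y z
    using t by (auto simp: three_form_def)
  have "three_form ?\<psi>"
    using t linear_compose[OF f lin(1)] linear_compose[OF f lin(2)] linear_compose[OF f lin(3)]
    by (auto simp: three_form_def o_def)
  moreover have "two_form_rank (?\<psi> w) = 6" if "w \<noteq> 0" for w
  proof -
    have inj: "inj f" by (metis g(2) injI)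
    have "f w \<noteq> 0" using that g(2) linear_0[OF g(1)] by metis
    moreover have "f ` {x. \<forall>y. ?\<psi> w x y = 0} = {x. \<forall>y. \<phi> (f w) x y = 0}"
      using g(2,3) by (auto simp: image_iff) metis+
    then have "dim {x. \<forall>y. ?\<psi> w x y = 0} = dim {x. \<forall>y. \<phi> (f w) x y = 0}"
      using dim_bij_image[OF f inj] by metis
    moreover have "f ` UNIV = UNIV" using g(3) by (metis surjI)
    then have "dim (UNIV :: 'a set) = dim (UNIV :: 'b set)" using dim_bij_image[OF f inj] by metis
    ultimately show ?thesis using rank[of "f w"] by (simp add: two_form_rank_def)
  qed
  ultimately show ?thesis by (simp add: definite_three_form_def)
qed

section \<open>The standard form and the seven-dimensional cross product\<close>

definition minor :: "real^7 \<Rightarrow> real^7 \<Rightarrow> 7 \<Rightarrow> 7 \<Rightarrow> real" where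
  "minor x y i j = x $ i * y $ j - x $ j * y $ i"

definition wedge3 :: "7 \<Rightarrow> 7 \<Rightarrow> 7 \<Rightarrow> real^7 \<Rightarrow> real^7 \<Rightarrow> real^7 \<Rightarrow> real" where
  "wedge3 i j k x y z = x $ i * minor y z j k - x $ j * minor y z i k + x $ k * minor y z i j"

definition g2_form :: "real^7 \<Rightarrow> real^7 \<Rightarrow> real^7 \<Rightarrow> real" where
  "g2_form x y z = wedge3 1 2 3 x y z + wedge3 1 4 5 x y z + wedge3 1 6 7 x y z + wedge3 2 4 6 x y z
     - wedge3 2 5 7 x y z - wedge3 3 4 7 x y z - wedge3 3 5 6 x y z"

text \<open>The cross product of imaginary octonions in the coordinates of
  \<open>g2_form\<close>.\<close>

definition cross7 :: "real^7 \<Rightarrow> real^7 \<Rightarrow> real^7" where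
  "cross7 x y = (let m = minor x y in vector
     [m 2 3 + m 4 5 + m 6 7, - m 1 3 + m 4 6 - m 5 7, m 1 2 - m 4 7 - m 5 6, - m 1 5 - m 2 6 + m 3 7,
      m 1 4 + m 2 7 + m 3 6, - m 1 7 + m 2 4 - m 3 5, m 1 6 - m 2 5 - m 3 4])"

lemma g2_form_cross: "g2_form x y z = cross7 x y \<bullet> z"
  by (simp add: g2_form_def cross7_def Let_def inner_vec_def sum_7 vector_7 wedge3_def minor_def algebra_simps)

text \<open>The Lagrange identity: a zero cross product means equality in the Cauchy-Schwarz
  inequality, hence linear dependence. This is the source of definiteness.\<close>

lemma cross7_norm: "cross7 x y \<bullet> cross7 x y = (x \<bullet> x) * (y \<bullet> y) - (x \<bullet> y) * (x \<bullet> y)"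
  by (simp add: cross7_def Let_def inner_vec_def sum_7 vector_7 minor_def algebra_simps)

lemma cross7_zero: assumes "x \<noteq> 0" "cross7 x y = 0" shows "y \<in> span {x}"
proof -
  define k where "k = (x \<bullet> y) / (x \<bullet> x)"
  have k: "k * (x \<bullet> x) = x \<bullet> y" using assms(1) by (simp add: k_def)
  have "(x \<bullet> x) * ((y - k *\<^sub>R x) \<bullet> (y - k *\<^sub>R x)) = (x \<bullet> x) * (y \<bullet> y) - 2 * (k * (x \<bullet> x)) * (x \<bullet> y) + (k * (x \<bullet> x)) * (k * (x \<bullet> x))"
    by (simp add: inner_diff inner_commute[of y x] algebra_simps)
  also have "\<dots> = 0" using cross7_norm[of x y] assms(2) unfolding k by simp
  finally have "y = k *\<^sub>R x" using assms(1) by simp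
  then show ?thesis by (simp add: span_base span_scale)
qed

lemma three_form_g2_form: "three_form g2_form"
  unfolding three_form_def
  by (auto intro!: linearI simp: g2_form_def wedge3_def minor_def algebra_simps)

lemma definite_g2_form: "definite_three_form g2_form"
proof -
  have "two_form_rank (g2_form w) = 6" if w: "w \<noteq> 0" for w
  proof -
    have "{x. \<forall>y. g2_form w x y = 0} = span {w}"
    proof
      show "span {w} \<subseteq> {x. \<forall>y. g2_form w x y = 0}"
        by (auto simp: span_singleton g2_form_def wedge3_def minor_def algebra_simps)
      show "{x. \<forall>y. g2_form w x y = 0} \<subseteq> span {w}"
        using cross7_zero[OF w] by (auto simp: g2_form_cross)
    qed
    then show ?thesis using w by (simp add: two_form_rank_def dim_span dim_singleton)
  qed
  then show ?thesis using three_form_g2_form by (simp add: definite_three_form_def)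
qed

text \<open>The components of \<open>G\<close> form a coframe in which the desired form is standard,
  and \<open>T\<close> is its expansion in the original coframe. Abstracting \<open>T\<close> over
  the monomials lets \<open>d\<close> be computed monomial by monomial.\<close>

lemma admits_closed_G2I:
  fixes G :: "real^7 \<Rightarrow> real^7"
  assumes G: "\<And>x y. G (x + y) = G x + G y" "\<And>r x. G (r *\<^sub>R x) = r *\<^sub>R G x" "\<And>x. G x = 0 \<Longrightarrow> x = 0"
    and T: "\<And>x y z. g2_form (G x) (G y) (G z) = T (\<lambda>i j k. wedge3 i j k x y z)"
    and closed: "\<And>x y z w. ce_d3 br (\<lambda>x y z. T (\<lambda>i j k. wedge3 i j k x y z)) x y z w = 0"
  shows "admits_closed_G2 br"
proof -
  have G': "linear G" by (rule linearI) (rule G)+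
  obtain g where "linear g" "\<And>x. g (G x) = x" "\<And>x. G (g x) = x"
    using linear_injective_isomorphism[OF G'] G(3) by (auto simp: linear_injective_0[OF G'])
  from definite_three_form_pullback[OF G' this definite_g2_form] show ?thesis
    unfolding T using closed by (auto simp: admits_closed_G2_def)
qed

text \<open>The 4-form \<open>A \<and> e^i \<and> e^j\<close> for a 2-form \<open>A\<close>.\<close>

definition wedge22 ::
  "(real^7 \<Rightarrow> real^7 \<Rightarrow> real) \<Rightarrow> 7 \<Rightarrow> 7 \<Rightarrow> real^7 \<Rightarrow> real^7 \<Rightarrow> real^7 \<Rightarrow> real^7 \<Rightarrow> real" where
  "wedge22 A i j x y z w = A x y * minor z w i j - A x z * minor y w i j + A x w * minor y z i j
     + A y z * minor x w i j - A y w * minor x z i j + A z w * minor x y i j"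

definition wedge4 :: "7 \<Rightarrow> 7 \<Rightarrow> 7 \<Rightarrow> 7 \<Rightarrow> real^7 \<Rightarrow> real^7 \<Rightarrow> real^7 \<Rightarrow> real^7 \<Rightarrow> real" where
  "wedge4 i j k l = wedge22 (\<lambda>x y. minor x y i j) k l"

text \<open>The Leibniz rule for \<open>d\<close>, where \<open>d e^i\<close> is minus the i-th
  coordinate of the bracket.\<close>

lemma ce_d3_wedge3:
  "ce_d3 br (wedge3 i j k) x y z w =
    wedge22 (\<lambda>x y. - br x y $ i) j k x y z w - wedge22 (\<lambda>x y. - br x y $ j) i k x y z w
      + wedge22 (\<lambda>x y. - br x y $ k) i j x y z w"
  by (simp add: ce_d3_def wedge3_def wedge22_def algebra_simps)

lemma ce_d3_arith:
  "ce_d3 br (\<lambda>x y z. f x y z + g x y z) x y z w = ce_d3 br f x y z w + ce_d3 br g x y z w"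
  "ce_d3 br (\<lambda>x y z. f x y z - g x y z) x y z w = ce_d3 br f x y z w - ce_d3 br g x y z w"
  "ce_d3 br (\<lambda>x y z. - f x y z) x y z w = - ce_d3 br f x y z w"
  "ce_d3 br (\<lambda>x y z. s * f x y z) x y z w = s * ce_d3 br f x y z w"
  by (simp_all add: ce_d3_def algebra_simps)

lemma wedge22_arith:
  "wedge22 (\<lambda>x y. f x y + g x y) i j x y z w = wedge22 f i j x y z w + wedge22 g i j x y z w"
  "wedge22 (\<lambda>x y. f x y - g x y) i j x y z w = wedge22 f i j x y z w - wedge22 g i j x y z w"
  "wedge22 (\<lambda>x y. - f x y) i j x y z w = - wedge22 f i j x y z w"
  "wedge22 (\<lambda>x y. s * f x y) i j x y z w = s * wedge22 f i j x y z w"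
  "wedge22 (\<lambda>x y. 0) i j x y z w = 0"
  "wedge22 (\<lambda>x y. minor x y k l) i j x y z w = wedge4 k l i j x y z w"
  by (simp_all add: wedge22_def wedge4_def algebra_simps)

text \<open>The type \<open>7\<close> has no usable order for the simplifier, so indices are sorted by their rank.\<close>

definition rank7 :: "7 \<Rightarrow> nat" where
  "rank7 i = (if i = 1 then 1 else if i = 2 then 2 else if i = 3 then 3 else if i = 4 then 4 else
     if i = 5 then 5 else if i = 6 then 6 else 7)"

lemma rank7 [simp]: "rank7 1 = 1" "rank7 2 = 2" "rank7 3 = 3" "rank7 4 = 4" "rank7 5 = 5" "rank7 6 = 6" "rank7 7 = 7"
  by (simp_all add: rank7_def)

lemma wedge4_sort:
  "rank7 j < rank7 i \<Longrightarrow> wedge4 i j k l x y z w = - wedge4 j i k l x y z w"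
  "rank7 k < rank7 j \<Longrightarrow> wedge4 i j k l x y z w = - wedge4 i k j l x y z w"
  "rank7 l < rank7 k \<Longrightarrow> wedge4 i j k l x y z w = - wedge4 i j l k x y z w"
  "wedge4 i i k l x y z w = 0" "wedge4 i j j l x y z w = 0" "wedge4 i j k k x y z w = 0"
  by (simp_all add: wedge4_def wedge22_def minor_def algebra_simps)

lemma structure_eqs7_minor: "structure_eqs7 D x y = - vector (D (minor x y))"
  unfolding structure_eqs7_def minor_def[abs_def] ..

lemmas closed_form_simps = ce_d3_arith ce_d3_wedge3 algebra_defs structure_eqs7_minor vector_uminus_component vector_7
  wedge22_arith wedge4_sort

lemmas g2_form_simps = g2_form_def wedge3_def minor_def vector_7

lemma s1_admits: "admits_closed_G2 s1"
  by (rule admits_closed_G2I[where G = "\<lambda>x. vector [x $ 1, x $ 2, - x $ 4, x $ 3, - x $ 5, 2 * x $ 6, x $ 7]"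
    and T = "\<lambda>e. - e 1 2 4 - e 1 3 5 + 2 * e 1 6 7 + 2 * e 2 3 6 + e 2 5 7 - e 3 4 7 - 2 * e 4 5 6"],
    (auto simp: vec_eq_iff forall_7 vector_7 algebra_simps)[3],
    simp add: g2_form_simps algebra_simps, simp add: closed_form_simps algebra_simps)

lemma s2_admits: "admits_closed_G2 s2"
  by (rule admits_closed_G2I[where G = "\<lambda>x. vector [x $ 1, x $ 2, x $ 5, x $ 3, x $ 6, x $ 7, - x $ 4]"
    and T = "\<lambda>e. e 1 2 5 + e 1 3 6 + e 1 4 7 + e 2 3 7 - e 2 4 6 + e 3 4 5 - e 5 6 7"],
    (auto simp: vec_eq_iff forall_7 vector_7 algebra_simps)[3],
    simp add: g2_form_simps algebra_simps, simp add: closed_form_simps algebra_simps)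

lemma s3_admits: "admits_closed_G2 s3"
  by (rule admits_closed_G2I[where G = "\<lambda>x. vector [x $ 1, x $ 2, x $ 6, x $ 3, x $ 5, x $ 7, - x $ 4]"
    and T = "\<lambda>e. e 1 2 6 + e 1 3 5 + e 1 4 7 + e 2 3 7 - e 2 4 5 + e 3 4 6 + e 5 6 7"],
    (auto simp: vec_eq_iff forall_7 vector_7 algebra_simps)[3],
    simp add: g2_form_simps algebra_simps, simp add: closed_form_simps algebra_simps)

lemma s4_admits: "admits_closed_G2 s4"
  by (rule admits_closed_G2I[where G = "\<lambda>x. vector [x $ 1 + x $ 4, x $ 2 + x $ 3, x $ 5 + x $ 6, x $ 2 - x $ 3, x $ 5 - x $ 6, - x $ 7, x $ 1 - x $ 4]"
    and T = "\<lambda>e. 2 * e 1 2 5 + 2 * e 1 2 6 - 2 * e 1 3 5 + 2 * e 1 3 6 - 2 * e 1 4 7 + 2 * e 2 3 7 - 2 * e 2 4 5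
      + 2 * e 2 4 6 - 2 * e 3 4 5 - 2 * e 3 4 6 - 2 * e 5 6 7"],
    (auto simp: vec_eq_iff forall_7 vector_7 algebra_simps)[3],
    simp add: g2_form_simps algebra_simps, simp add: closed_form_simps algebra_simps)

lemma s5_admits: "admits_closed_G2 s5"
  by (rule admits_closed_G2I[where G = "\<lambda>x. vector [x $ 1, x $ 2, x $ 6, x $ 3, x $ 7, x $ 5, - x $ 4]"
    and T = "\<lambda>e. e 1 2 6 + e 1 3 7 + e 1 4 5 + e 2 3 5 - e 2 4 7 + e 3 4 6 - e 5 6 7"],
    (auto simp: vec_eq_iff forall_7 vector_7 algebra_simps)[3],
    simp add: g2_form_simps algebra_simps, simp add: closed_form_simps algebra_simps)

lemma s6_admits: "admits_closed_G2 (s6 \<alpha>)"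
  by (rule admits_closed_G2I[where G = "\<lambda>x. vector [x $ 1, x $ 2, x $ 5, x $ 3, x $ 6, - x $ 7, x $ 4]"
    and T = "\<lambda>e. e 1 2 5 + e 1 3 6 + e 1 4 7 - e 2 3 7 + e 2 4 6 - e 3 4 5 + e 5 6 7"],
    (auto simp: vec_eq_iff forall_7 vector_7 algebra_simps)[3],
    simp add: g2_form_simps algebra_simps, simp add: closed_form_simps algebra_simps)

lemma s7_s6: "s7 = s6 0" by (simp add: s6_def s7_def)

lemma s7_admits: "admits_closed_G2 s7" unfolding s7_s6 by (rule s6_admits)

text \<open>Since \<open>d e^7 = e^34\<close>, the monomial \<open>6 e^567\<close> contributes
  \<open>6 e^3456\<close>. The unequal scales 2 and 1 in \<open>G\<close> leave the monomials
  \<open>3 e^146\<close> and \<open>- 3 e^236\<close>, with \<open>3 = 4 - 1\<close>, whose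
  differentials cancel it.\<close>

lemma s8_admits: "admits_closed_G2 s8"
  by (rule admits_closed_G2I[where G = "\<lambda>x. vector [2 * x $ 1 + 2 * x $ 2, x $ 1 - x $ 2, - x $ 5, x $ 3 + x $ 4, 6 * x $ 7, - x $ 6, - 2 * x $ 3 + 2 * x $ 4]"
    and T = "\<lambda>e. 4 * e 1 2 5 - 5 * e 1 3 6 + 3 * e 1 4 6 + 24 * e 1 4 7 - 3 * e 2 3 6 + 24 * e 2 3 7 + 5 * e 2 4 6
      + 4 * e 3 4 5 + 6 * e 5 6 7"],
    (auto simp: vec_eq_iff forall_7 vector_7 algebra_simps)[3],
    simp add: g2_form_simps algebra_simps, simp add: closed_form_simps algebra_simps)

lemma s9_admits: "admits_closed_G2 s9"
  by (rule admits_closed_G2I[where G = "\<lambda>x. vector [x $ 1, x $ 2, x $ 5, x $ 3, - 2 * x $ 7, x $ 6, x $ 4]"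
    and T = "\<lambda>e. e 1 2 5 - 2 * e 1 3 7 - e 1 4 6 + e 2 3 6 - 2 * e 2 4 7 - e 3 4 5 - 2 * e 5 6 7"],
    (auto simp: vec_eq_iff forall_7 vector_7 algebra_simps)[3],
    simp add: g2_form_simps algebra_simps, simp add: closed_form_simps algebra_simps)

lemma sqrt3_simps: "sqrt 3 * sqrt 3 = 3" "sqrt 3 * (sqrt 3 * a) = 3 * a"
  by simp_all

text \<open>Both are homogeneous linear systems of determinant
  \<open>sqrt 3 * sqrt 3 + 1 = 4\<close>.\<close>

lemma sqrt3_cancel:
  "sqrt 3 * a = b \<Longrightarrow> sqrt 3 * b + a = 0 \<Longrightarrow> a = 0 \<and> b = 0"
  "sqrt 3 * a + b = 0 \<Longrightarrow> sqrt 3 * b = a \<Longrightarrow> a = 0 \<and> b = 0"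
  by (auto simp: sqrt3_simps dest: sym)

lemma s10_admits: "admits_closed_G2 s10"
  by (rule admits_closed_G2I[where G = "\<lambda>x. vector [x $ 1, x $ 2, - x $ 3, sqrt 3 * x $ 4 - x $ 5, sqrt 3 * x $ 5 + x $ 4, x $ 7, 2 * x $ 6]"
    and T = "\<lambda>e. - e 1 2 3 + 4 * e 1 4 5 - 2 * e 1 6 7 - 2 * e 2 4 6 + sqrt 3 * e 2 4 7 - (2 * sqrt 3) * e 2 5 6
      - e 2 5 7 + (2 * sqrt 3) * e 3 4 6 + e 3 4 7 - 2 * e 3 5 6 + sqrt 3 * e 3 5 7"],
    (auto simp: vec_eq_iff forall_7 vector_7 algebra_simps dest: sqrt3_cancel)[3],
    simp add: g2_form_simps algebra_simps sqrt3_simps, simp add: closed_form_simps algebra_simps sqrt3_simps)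

lemma s11_admits: "admits_closed_G2 s11"
  by (rule admits_closed_G2I[where G = "\<lambda>x. vector [x $ 1, x $ 2, - x $ 3, sqrt 3 * x $ 4 + x $ 5, sqrt 3 * x $ 5 - x $ 4, - x $ 7, - 2 * x $ 6]"
    and T = "\<lambda>e. - e 1 2 3 + 4 * e 1 4 5 - 2 * e 1 6 7 - 2 * e 2 4 6 - sqrt 3 * e 2 4 7 + (2 * sqrt 3) * e 2 5 6
      - e 2 5 7 - (2 * sqrt 3) * e 3 4 6 + e 3 4 7 - 2 * e 3 5 6 - sqrt 3 * e 3 5 7"],
    (auto simp: vec_eq_iff forall_7 vector_7 algebra_simps dest: sqrt3_cancel)[3],
    simp add: g2_form_simps algebra_simps sqrt3_simps, simp add: closed_form_simps algebra_simps sqrt3_simps)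

section \<open>Isomorphism invariance\<close>

lemma lie_isomorphicE:
  assumes "lie_isomorphic br br'"
  obtains f g where "linear f" "linear g" "\<And>x. g (f x) = x" "\<And>y. f (g y) = y"
    "\<And>x y. f (br x y) = br' (f x) (f y)" "\<And>x y. g (br' x y) = br (g x) (g y)"
proof -
  obtain f where f: "linear f" "bij f" "\<And>x y. f (br x y) = br' (f x) (f y)"
    using assms by (auto simp: lie_isomorphic_def)
  define g where "g = inv f"
  have gf: "g (f x) = x" and fg: "f (g y) = y" for x y
    using f(2) by (simp_all add: g_def bij_is_inj bij_is_surj surj_f_inv_f)
  have "linear g"
  proof (rule linearI)
    show "g (x + y) = g x + g y" for x y by (metis gf fg linear_add[OF f(1)])
    show "g (r *\<^sub>R x) = r *\<^sub>R g x" for r x by (metis gf fg linear_cmul[OF f(1)])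
  qed
  moreover have "g (br' x y) = br (g x) (g y)" for x y by (metis gf fg f(3))
  ultimately show thesis using that f gf fg by blast
qed

lemma lie_isomorphicI:
  assumes "linear f" "\<And>x. g (f x) = x" "\<And>y. f (g y) = y" "\<And>x y. f (br x y) = br' (f x) (f y)"
  shows "lie_isomorphic br br'"
proof -
  have "bij f" by (rule o_bij[of g]) (auto simp: fun_eq_iff assms)
  then show ?thesis using assms unfolding lie_isomorphic_def by blast
qed

lemma lie_isomorphic_sym: "lie_isomorphic br br' \<Longrightarrow> lie_isomorphic br' br"
  by (erule lie_isomorphicE) (rule lie_isomorphicI)

lemma lie_isomorphic_trans: "lie_isomorphic br br' \<Longrightarrow> lie_isomorphic br' br'' \<Longrightarrow> lie_isomorphic br br''"
  unfolding lie_isomorphic_def by (metis (no_types, lifting) bij_comp comp_apply linear_compose)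

lemma lie_algebra_isomorphic:
  assumes "lie_isomorphic br br'" "lie_algebra br" shows "lie_algebra br'"
proof -
  obtain f g where f: "linear f" "linear g" "\<And>x. g (f x) = x" "\<And>y. f (g y) = y"
    "\<And>x y. f (br x y) = br' (f x) (f y)" "\<And>x y. g (br' x y) = br (g x) (g y)"
    using lie_isomorphicE[OF assms(1)] by metis
  have br': "br' x y = f (br (g x) (g y))" for x y by (simp add: f)
  have bil: "bilinear br" using assms(2) by (simp add: lie_algebra_def)
  have "bilinear br'"
    unfolding bilinear_def br'
    by (auto intro!: linearI simp: linear_add[OF f(2)] linear_add[OF f(1)] linear_cmul[OF f(2)] linear_cmul[OF f(1)]
        bilinear_ladd[OF bil] bilinear_radd[OF bil] bilinear_lmul[OF bil] bilinear_rmul[OF bil] simp del: f(5))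
  moreover have "br' x x = 0" for x using assms(2) by (simp add: br' lie_algebra_def linear_0[OF f(1)] del: f(5))
  moreover have "br' x (br' y z) + br' y (br' z x) + br' z (br' x y) = 0" for x y z
  proof -
    have "f (br (g x) (br (g y) (g z)) + br (g y) (br (g z) (g x)) + br (g z) (br (g x) (g y))) = 0"
      using assms(2) by (simp add: lie_algebra_def linear_0[OF f(1)])
    then show ?thesis by (simp add: linear_add[OF f(1)] f)
  qed
  ultimately show ?thesis by (simp add: lie_algebra_def)
qed

lemma bracket_span_image:
  assumes "linear f" "\<And>x y. f (br x y) = br' (f x) (f y)"
  shows "f ` bracket_span br A B = bracket_span br' (f ` A) (f ` B)"
proof -
  have "f ` {br x y |x y. x \<in> A \<and> y \<in> B} = {br' x y |x y. x \<in> f ` A \<and> y \<in> f ` B}"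
  proof (intro set_eqI iffI)
    fix v assume "v \<in> {br' x y |x y. x \<in> f ` A \<and> y \<in> f ` B}"
    then obtain a b where "a \<in> A" "b \<in> B" "v = f (br a b)" by (auto simp: assms(2))
    then show "v \<in> f ` {br x y |x y. x \<in> A \<and> y \<in> B}" by blast
  next
    fix v assume "v \<in> f ` {br x y |x y. x \<in> A \<and> y \<in> B}"
    then obtain a b where "a \<in> A" "b \<in> B" "v = br' (f a) (f b)" by (auto simp: assms(2))
    then show "v \<in> {br' x y |x y. x \<in> f ` A \<and> y \<in> f ` B}" by blast
  qed
  then show ?thesis unfolding bracket_span_def linear_span_image[OF assms(1), symmetric] by simp
qed

lemma lie_solvable_nilpotent_isomorphic:
  assumes "lie_isomorphic br br'"
  shows "lie_solvable br \<Longrightarrow> lie_solvable br'" "lie_nilpotent br \<Longrightarrow> lie_nilpotent br'"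
proof -
  obtain f g where f: "linear f" "linear g" "\<And>x. g (f x) = x" "\<And>y. f (g y) = y"
    "\<And>x y. f (br x y) = br' (f x) (f y)" "\<And>x y. g (br' x y) = br (g x) (g y)"
    using lie_isomorphicE[OF assms] by metis
  have U: "f ` UNIV = UNIV" using f(4) by (metis surjI)
  have 0: "f ` {0} = {0}" using linear_0[OF f(1)] by simp
  have 1: "f ` (((\<lambda>A. bracket_span br A A) ^^ k) UNIV) = ((\<lambda>A. bracket_span br' A A) ^^ k) UNIV" for k
  proof (induction k)
    case (Suc k)
    show ?case unfolding funpow.simps comp_def bracket_span_image[where br = br and br' = br', OF f(1,5)] U Suc ..
  qed (simp add: U)
  show "lie_solvable br'" if h: "lie_solvable br"
  proof -
    obtain k where k: "((\<lambda>A. bracket_span br A A) ^^ k) UNIV = {0}" using h unfolding lie_solvable_def by blast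
    have "((\<lambda>A. bracket_span br' A A) ^^ k) UNIV = {0}" using 1[of k] unfolding k 0 by (rule sym)
    then show ?thesis unfolding lie_solvable_def by (rule exI[of _ k])
  qed
  have 2: "f ` (((\<lambda>A. bracket_span br UNIV A) ^^ k) UNIV) = ((\<lambda>A. bracket_span br' UNIV A) ^^ k) UNIV" for k
  proof (induction k)
    case (Suc k)
    show ?case unfolding funpow.simps comp_def bracket_span_image[where br = br and br' = br', OF f(1,5)] U Suc ..
  qed (simp add: U)
  show "lie_nilpotent br'" if h: "lie_nilpotent br"
  proof -
    obtain k where k: "((\<lambda>A. bracket_span br UNIV A) ^^ k) UNIV = {0}" using h unfolding lie_nilpotent_def by blast
    have "((\<lambda>A. bracket_span br' UNIV A) ^^ k) UNIV = {0}" using 2[of k] unfolding k 0 by (rule sym)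
    then show ?thesis unfolding lie_nilpotent_def by (rule exI[of _ k])
  qed
qed

lemma admits_closed_G2_isomorphic:
  assumes "lie_isomorphic br br'" "admits_closed_G2 br'"
  shows "admits_closed_G2 br"
proof -
  obtain f g where f: "linear f" "linear g" "\<And>x. g (f x) = x" "\<And>y. f (g y) = y"
    "\<And>x y. f (br x y) = br' (f x) (f y)" "\<And>x y. g (br' x y) = br (g x) (g y)"
    using lie_isomorphicE[OF assms(1)] by metis
  obtain \<phi> where \<phi>: "definite_three_form \<phi>" "\<And>x y z w. ce_d3 br' \<phi> x y z w = 0"
    using assms(2) by (auto simp: admits_closed_G2_def)
  have "ce_d3 br (\<lambda>x y z. \<phi> (f x) (f y) (f z)) x y z w = 0" for x y z w
    using \<phi>(2)[of "f x" "f y" "f z" "f w"] by (simp add: ce_d3_def f(5))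
  then show ?thesis
    unfolding admits_closed_G2_def using definite_three_form_pullback[OF f(1-4) \<phi>(1)] by blast
qed

lemma is_contactization7_isomorphic:
  "lie_isomorphic br br' \<Longrightarrow> is_contactization7 br' \<Longrightarrow> is_contactization7 br"
  unfolding is_contactization7_def using lie_isomorphic_trans by blast

text \<open>The model is taken in coordinates for the basis that defines
  \<open>linear_trace\<close>, so the two traces agree term by term.\<close>

lemma real7_model:
  fixes br :: "'a::real_vector \<Rightarrow> 'a \<Rightarrow> 'a"
  assumes "lie_algebra br" "dim (UNIV :: 'a set) = 7"
  obtains br' :: "real^7 \<Rightarrow> real^7 \<Rightarrow> real^7" where "lie_isomorphic br br'"
    "lie_unimodular br \<Longrightarrow> \<forall>x. op_trace (br' x) = 0"
proof -
  define B :: "'a set" where "B = extend_basis {}"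
  have B: "independent B" "span B = UNIV"
    using independent_extend_basis[OF independent_empty] span_extend_basis[OF independent_empty] by (simp_all add: B_def)
  have "card B = 7" using B assms(2) by (metis dim_eq_card span_UNIV)
  then have fin: "finite B" by (metis card.infinite zero_neq_numeral)
  then obtain \<beta> where \<beta>: "bij_betw \<beta> (UNIV :: 7 set) B"
    using finite_same_card_bij[of "UNIV :: 7 set" B] \<open>card B = 7\<close> by auto
  have \<beta>B: "\<beta> i \<in> B" for i using \<beta> by (auto simp: bij_betw_def)
  have \<beta>inj: "\<beta> i = \<beta> j \<longleftrightarrow> i = j" for i j using \<beta> by (auto simp: bij_betw_def inj_eq)
  define f :: "'a \<Rightarrow> real^7" where "f v = (\<chi> i. representation B v (\<beta> i))" for v
  define g :: "real^7 \<Rightarrow> 'a" where "g x = (\<Sum>i\<in>UNIV. x $ i *\<^sub>R \<beta> i)" for x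
  have f: "linear f"
    by (rule linearI) (simp_all add: f_def vec_eq_iff representation_add representation_scale B)
  have g: "linear g"
    by (rule linearI) (simp_all add: g_def scaleR_add_left sum.distrib scaleR_sum_right)
  have gf: "g (f v) = v" for v
  proof -
    have "g (f v) = (\<Sum>b\<in>B. representation B v b *\<^sub>R b)"
      unfolding g_def f_def using sum.reindex_bij_betw[OF \<beta>, of "\<lambda>b. representation B v b *\<^sub>R b"] by simp
    also have "\<dots> = v" by (rule sum_representation_eq) (use B fin in auto)
    finally show ?thesis .
  qed
  have f\<beta>: "f (\<beta> i) = axis i 1" for i
    using B \<beta>B by (auto simp: f_def vec_eq_iff axis_def representation_basis \<beta>inj)
  have fg: "f (g x) = x" for x
  proof -
    have "f (g x) = (\<Sum>i\<in>UNIV. x $ i *\<^sub>R axis i 1)" by (simp add: g_def linear_sum[OF f] linear_cmul[OF f] f\<beta>)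
    then show ?thesis by (simp add: vec_eq_iff axis_def sum.delta' if_distrib cong: if_cong)
  qed
  define br' where "br' x y = f (br (g x) (g y))" for x y
  have "lie_isomorphic br br'" by (rule lie_isomorphicI[OF f gf fg]) (simp add: br'_def gf)
  moreover have "op_trace (br' x) = linear_trace (br (g x))" for x
  proof -
    have g\<beta>: "g (axis i 1) = \<beta> i" for i using gf f\<beta> by metis
    have "op_trace (br' x) = (\<Sum>i\<in>UNIV. br' x (axis i 1) $ i)"
      by (simp add: op_trace_def Basis_vec_def sum.UNION_disjoint axis_eq_axis inner_axis)
    also have "\<dots> = (\<Sum>i\<in>UNIV. representation B (br (g x) (\<beta> i)) (\<beta> i))" by (simp add: br'_def g\<beta>) (simp add: f_def)
    also have "\<dots> = (\<Sum>b\<in>B. representation B (br (g x) b) b)" by (rule sum.reindex_bij_betw[OF \<beta>])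
    finally show ?thesis by (simp add: linear_trace_def B_def)
  qed
  ultimately show thesis using that[of br'] by (auto simp: lie_unimodular_def)
qed

theorem closed_G2_classification:
  fixes br :: "'a::real_vector \<Rightarrow> 'a \<Rightarrow> 'a"
  assumes lie: "lie_algebra br" and d: "dim (UNIV :: 'a set) = 7" and uni: "lie_unimodular br" and sol: "lie_solvable br"
    and nil: "\<not> lie_nilpotent br" and cen: "lie_center br \<noteq> {0}" and ad: "admits_closed_G2 br"
  shows "lie_isomorphic br s1 \<or> lie_isomorphic br s2 \<or> lie_isomorphic br s3 \<or> lie_isomorphic br s4 \<or>
    lie_isomorphic br s5 \<or> (\<exists>\<alpha>>0. lie_isomorphic br (s6 \<alpha>)) \<or> lie_isomorphic br s7 \<or> lie_isomorphic br s8 \<or>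
    lie_isomorphic br s9 \<or> lie_isomorphic br s10 \<or> lie_isomorphic br s11"
proof -
  obtain br' :: "real^7 \<Rightarrow> real^7 \<Rightarrow> real^7" where iso: "lie_isomorphic br br'" and tr: "\<forall>x. op_trace (br' x) = 0"
    using real7_model[OF lie d] uni by metis
  note iso' = lie_isomorphic_sym[OF iso]
  have lie': "lie_algebra br'" by (rule lie_algebra_isomorphic[OF iso lie])
  obtain f where f: "linear f" "inj f" "\<And>y. \<exists>x. f x = y" "\<And>x y. f (br x y) = br' (f x) (f y)"
    using iso unfolding lie_isomorphic_def bij_def by (metis surjD)
  have "0 \<in> lie_center br" using lie by (simp add: lie_center_def lie_algebra_def bilinear_lzero)
  then obtain z where z: "z \<noteq> 0" "\<And>x. br z x = 0" using cen unfolding lie_center_def by blast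
  obtain \<phi> where \<phi>: "definite_three_form \<phi>" "\<And>x y z w. ce_d3 br' \<phi> x y z w = 0"
    using admits_closed_G2_isomorphic[OF iso' ad] by (auto simp: admits_closed_G2_def)
  have "f z \<noteq> 0" using z(1) f(1,2) linear_injective_0 by blast
  moreover have "br' (f z) y = 0" for y using f(3)[of y] f(4)[of z] z(2) linear_0[OF f(1)] by metis
  ultimately interpret g2 br' \<phi> "f z"
    by (intro g2.intro lie.intro g2_axioms.intro lie')
      (use tr \<phi> lie_solvable_nilpotent_isomorphic(1)[OF iso sol] in auto)
  have "\<not> lie_nilpotent br'" using lie_solvable_nilpotent_isomorphic(2)[OF iso'] nil by blast
  from classification[OF this] show ?thesis using lie_isomorphic_trans[OF iso] by blast
qed

section \<open>Contactizations\<close>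

lemma linear_real7_functional:
  fixes \<theta> :: "real^7 \<Rightarrow> real"
  assumes "linear \<theta>" shows "\<theta> w = (\<Sum>i\<in>UNIV. w $ i * \<theta> (axis i 1))"
proof -
  have "w = (\<Sum>i\<in>UNIV. w $ i *\<^sub>R axis i 1)" by (simp add: vec_eq_iff axis_def if_distrib cong: if_cong)
  then have "\<theta> w = \<theta> (\<Sum>i\<in>UNIV. w $ i *\<^sub>R axis i 1)" by simp
  then show ?thesis by (simp add: linear_sum[OF assms] linear_cmul[OF assms])
qed

text \<open>The contact form of a contactization is a linear form \<open>\<theta>\<close> for which \<open>\<theta>([x, y])\<close> has one-dimensional kernel.\<close>

lemma not_contactization:
  fixes s :: "real^7 \<Rightarrow> real^7 \<Rightarrow> real^7"
  assumes k: "k \<noteq> 0" "\<And>y. s k y = 0"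
    and ker: "\<And>t :: 7 \<Rightarrow> real. \<exists>v. v \<notin> span {k} \<and> (\<forall>y. (\<Sum>i\<in>UNIV. s v y $ i * t i) = 0)"
  shows "\<not> is_contactization7 s"
proof
  assume "is_contactization7 s"
  then obtain brh :: "real^6 \<Rightarrow> real^6 \<Rightarrow> real^6" and \<omega> where h: "symplectic_lie_algebra brh \<omega>"
    and iso: "lie_isomorphic s (central_extension brh \<omega>)" by (auto simp: is_contactization7_def)
  show False
  proof (rule lie_isomorphicE[OF iso])
    fix f g
    assume f: "linear f" "linear g" "\<And>x. g (f x) = x" "\<And>y. f (g y) = y"
      "\<And>x y. f (s x y) = central_extension brh \<omega> (f x) (f y)" "\<And>x y. g (central_extension brh \<omega> x y) = s (g x) (g y)"
    have lin: "linear (\<lambda>x. snd (f x))" using linear_compose[OF f(1) linear_snd] by (simp add: o_def)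
    \<comment> \<open>The last coordinate of a bracket in the extension is
      \<open>- \<omega>\<close>, so such a vector projects into the radical of the symplectic
      form.\<close>
    have fst0: "fst (f v) = 0" if v: "\<And>y. snd (f (s v y)) = 0" for v
    proof (rule ccontr)
      assume "fst (f v) \<noteq> 0"
      then obtain u where "\<omega> (fst (f v)) u \<noteq> 0" using h by (auto simp: symplectic_lie_algebra_def)
      then show False using v[of "g (u, 0)"] by (simp add: f(4,5) central_extension_def)
    qed
    obtain v where v: "v \<notin> span {k}" "\<And>y. (\<Sum>i\<in>UNIV. s v y $ i * snd (f (axis i 1))) = 0"
      using ker[of "\<lambda>i. snd (f (axis i 1))"] by blast
    have "fst (f v) = 0" 
      by (intro fst0) (subst linear_real7_functional[OF lin], rule v(2))
    moreover have "fst (f k) = 0" by (intro fst0) (simp add: k linear_0[OF f(1)])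
    ultimately have "snd (f v) *\<^sub>R f k = snd (f k) *\<^sub>R f v" by (simp add: prod_eq_iff)
    then have "f (snd (f v) *\<^sub>R k) = f (snd (f k) *\<^sub>R v)" by (simp add: linear_cmul[OF f(1)])
    then have eq: "snd (f v) *\<^sub>R k = snd (f k) *\<^sub>R v" using f(3) by metis
    have "f k \<noteq> 0" using k f(3) linear_0[OF f(2)] by metis
    then have "snd (f k) \<noteq> 0" using \<open>fst (f k) = 0\<close> by (simp add: prod_eq_iff)
    moreover have "snd (f k) *\<^sub>R v \<in> span {k}" unfolding eq[symmetric] by (simp add: span_base span_scale)
    ultimately have "v \<in> span {k}" using span_scale[of "snd (f k) *\<^sub>R v" "{k}" "1 / snd (f k)"] by simp
    then show False using v by simp
  qed
qed

text \<open>For a linear form with coordinates \<open>t\<close>, the vector \<open>v t\<close> is a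
  second element of the kernel; its last coordinate 0 keeps it off the central axis.\<close>

lemma not_contactization_axis:
  fixes s :: "real^7 \<Rightarrow> real^7 \<Rightarrow> real^7" and v :: "(7 \<Rightarrow> real) \<Rightarrow> real^7"
  assumes "\<And>y. s (axis 7 1) y = 0" and v: "\<And>t. v t $ 7 = 0" "\<And>t. v t \<noteq> 0"
    and ker: "\<And>t y. (\<Sum>i\<in>UNIV. s (v t) y $ i * t i) = 0"
  shows "\<not> is_contactization7 s"
proof (rule not_contactization[of "axis 7 1"])
  show "axis 7 1 \<noteq> (0 :: real^7)" by (simp add: axis_eq_0_iff)
  fix t :: "7 \<Rightarrow> real"
  have "v t \<notin> span {axis 7 1}" using v[of t] by (auto simp: span_singleton)
  then show "\<exists>v. v \<notin> span {axis 7 1} \<and> (\<forall>y. (\<Sum>i\<in>UNIV. s v y $ i * t i) = 0)" using ker by blast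
qed (rule assms)

lemma axis_7:
  "axis 7 (1::real) = (vector [0, 0, 0, 0, 0, 0, 1] :: real^7)"
  by (simp add: vec_eq_iff forall_7 vector_7 axis_def)

lemmas not_contact_simps = algebra_defs structure_eqs7_def vector_uminus_component vector_7 sum_7

lemma not_contactization_s1: "\<not> is_contactization7 s1"
  by (rule not_contactization_axis[where v = "\<lambda>t. vector [1, 0, 0, 0, 0, 0, 0]"])
    (auto simp: not_contact_simps vec_eq_iff forall_7 axis_7 sum_squares_eq_zero_iff algebra_simps)

text \<open>On the span of the first two axes only brackets with the sixth vector are non-zero, so a
  single equation has to be solved for two unknowns.\<close>

lemma not_contactization_s2: "\<not> is_contactization7 s2"
  by (rule not_contactization_axis[where v = "\<lambda>t. if t 1 = 0 \<and> t 2 = 0 then vector [1, 0, 0, 0, 0, 0, 0]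
      else vector [t 2, t 1, 0, 0, 0, 0, 0]"])
    (auto simp: not_contact_simps vec_eq_iff forall_7 axis_7 sum_squares_eq_zero_iff algebra_simps)

text \<open>Brackets with the fifth and sixth vectors give two equations. The second witness solves
  them in three unknowns, with \<open>t 1 * t 1 + t 2 * t 2\<close> as the determinant.\<close>

lemma not_contactization_s3: "\<not> is_contactization7 s3"
  by (rule not_contactization_axis[where v = "\<lambda>t. if t 1 = 0 \<and> t 2 = 0 then vector [1, 0, 0, 0, 0, 0, 0]
      else vector [t 2 * t 4 + t 1 * t 3, t 2 * t 3 - t 1 * t 4, t 1 * t 1 + t 2 * t 2, 0, 0, 0, 0]"])
    (auto simp: not_contact_simps vec_eq_iff forall_7 axis_7 sum_squares_eq_zero_iff algebra_simps)

lemma not_contactization_s4: "\<not> is_contactization7 s4"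
  by (rule not_contactization_axis[where v = "\<lambda>t. if t 2 = 0 \<and> t 3 = 0 then vector [0, 1, 0, 0, 0, 0, 0]
      else vector [0, t 2, - t 3, 0, 0, 0, 0]"])
    (auto simp: not_contact_simps vec_eq_iff forall_7 axis_7 sum_squares_eq_zero_iff algebra_simps)

lemma not_contactization_s5: "\<not> is_contactization7 s5"
  by (rule not_contactization_axis[where v = "\<lambda>t. vector [0, 0, 0, 0, 0, 1, 0]"])
    (auto simp: not_contact_simps vec_eq_iff forall_7 axis_7 sum_squares_eq_zero_iff algebra_simps)

lemma not_contactization_s6: "\<not> is_contactization7 (s6 \<alpha>)"
  by (rule not_contactization_axis[where v = "\<lambda>t. vector [0, 0, 0, 0, 0, 1, 0]"])
    (auto simp: not_contact_simps vec_eq_iff forall_7 axis_7 sum_squares_eq_zero_iff algebra_simps)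

lemma not_contactization_s7: "\<not> is_contactization7 s7" unfolding s7_s6 by (rule not_contactization_s6)

lemma not_contactization_s8: "\<not> is_contactization7 s8"
  by (rule not_contactization_axis[where v = "\<lambda>t. if t 1 = 0 \<and> t 2 = 0 then vector [1, 0, 0, 0, 0, 0, 0]
      else vector [t 2, t 1, 0, 0, 0, 0, 0]"])
    (auto simp: not_contact_simps vec_eq_iff forall_7 axis_7 sum_squares_eq_zero_iff algebra_simps)

lemma not_contactization_s9: "\<not> is_contactization7 s9"
  by (rule not_contactization_axis[where v = "\<lambda>t. if t 1 = 0 \<and> t 2 = 0 then vector [1, 0, 0, 0, 0, 0, 0]
      else vector [t 1, t 2, 0, 0, 0, 0, 0]"])
    (auto simp: not_contact_simps vec_eq_iff forall_7 axis_7 sum_squares_eq_zero_iff algebra_simps)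

section \<open>Contact structures of s10 and s11\<close>

definition drop7 :: "real^7 \<Rightarrow> real^6" where
  "drop7 x = vector [x $ 1, x $ 2, x $ 3, x $ 4, x $ 5, x $ 6]"

definition lift6 :: "real^6 \<Rightarrow> real^7" where
  "lift6 x = vector [x $ 1, x $ 2, x $ 3, x $ 4, x $ 5, x $ 6, 0]"

lemma forall_6: "(\<forall>i::6. P i) \<longleftrightarrow> P 1 \<and> P 2 \<and> P 3 \<and> P 4 \<and> P 5 \<and> P 6"
proof -
  have "x = 1 \<or> x = 2 \<or> x = 3 \<or> x = 4 \<or> x = 5 \<or> x = 6" for x :: 6
  proof (induct x)
    case (of_int z)
    then have "z = 0 \<or> z = 1 \<or> z = 2 \<or> z = 3 \<or> z = 4 \<or> z = 5" by fastforce
    then show ?case by auto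
  qed
  then show ?thesis by metis
qed

lemma vector_6:
  "(vector [a, b, c, d, e, f] :: real^6) $ 1 = a"
  "(vector [a, b, c, d, e, f] :: real^6) $ 2 = b"
  "(vector [a, b, c, d, e, f] :: real^6) $ 3 = c"
  "(vector [a, b, c, d, e, f] :: real^6) $ 4 = d"
  "(vector [a, b, c, d, e, f] :: real^6) $ 5 = e"
  "(vector [a, b, c, d, e, f] :: real^6) $ 6 = f"
  unfolding vector_def by simp_all

lemma drop7_linear: "linear drop7"
  unfolding drop7_def[abs_def] by (rule linearI) (simp_all add: vec_eq_iff forall_6 vector_6)

lemma lift6_linear: "linear lift6"
  unfolding lift6_def[abs_def] by (rule linearI) (simp_all add: vec_eq_iff forall_7 vector_7)

lemma drop7_lift6: "drop7 (lift6 x) = x"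
  by (simp add: drop7_def lift6_def vec_eq_iff forall_6 vector_6 vector_7)

lemma lift6_drop7: "lift6 (drop7 x) = x - x $ 7 *\<^sub>R axis 7 1"
  unfolding axis_7 by (simp add: drop7_def lift6_def vec_eq_iff forall_7 vector_6 vector_7)

text \<open>\<open>s\<close> is the central extension of its quotient by the seventh axis, with
  minus the seventh coordinate of the bracket as cocycle. The seventh coordinate of the Jacobi
  identity is closedness of this cocycle.\<close>

lemma contactization_criterion:
  fixes s :: "real^7 \<Rightarrow> real^7 \<Rightarrow> real^7"
  assumes lie: "lie_algebra s" and cen: "\<And>y. s (axis 7 1) y = 0"
    and nd: "\<And>x. (\<And>y. s x y $ 7 = 0) \<Longrightarrow> x \<in> span {axis 7 1}"
  shows "is_contactization7 s"
proof -
  interpret lie s by (rule lie.intro[OF lie])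
  note lifts = linear_add[OF lift6_linear] linear_cmul[OF lift6_linear]
  note drops = linear_add[OF drop7_linear] linear_cmul[OF drop7_linear] linear_0[OF drop7_linear]
  have cen': "s y (axis 7 1) = 0" for y using anti[of y "axis 7 1"] cen by simp
  have ld: "s (lift6 (drop7 x)) y = s x y" "s y (lift6 (drop7 x)) = s y x" for x y
    by (simp_all add: lift6_drop7 brs cen cen')
  define h where "h x y = drop7 (s (lift6 x) (lift6 y))" for x y
  define \<omega> where "\<omega> x y = - s (lift6 x) (lift6 y) $ 7" for x y
  have bil: "bilinear h" "bilinear \<omega>"
    by (auto simp: bilinear_def h_def \<omega>_def lifts drops brs intro!: linearI)
  have jac: "s x (s y w) + s y (s w x) + s w (s x y) = 0" for x y w using lie by (simp add: lie_algebra_def)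
  have "lie_algebra h"
    unfolding lie_algebra_def
  proof (intro conjI allI)
    fix x y w
    show "h x (h y w) + h y (h w x) + h w (h x y) = 0"
      using arg_cong[OF jac[of "lift6 x" "lift6 y" "lift6 w"], of drop7] by (simp add: h_def ld drops)
  qed (use bil in \<open>simp_all add: h_def drops\<close>)
  moreover have "two_form \<omega>" using bil by (simp add: two_form_def \<omega>_def)
  moreover have "ce_d2 h \<omega> x y w = 0" for x y w
    using arg_cong[OF jac[of "lift6 x" "lift6 y" "lift6 w"], of "\<lambda>v. v $ 7"]
      anti[of "s (lift6 x) (lift6 y)" "lift6 w"] anti[of "s (lift6 x) (lift6 w)" "lift6 y"]
      anti[of "s (lift6 y) (lift6 w)" "lift6 x"] anti[of "lift6 w" "lift6 x"]
    by (simp add: ce_d2_def h_def \<omega>_def ld brs)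
  moreover have "\<exists>y. \<omega> x y \<noteq> 0" if "x \<noteq> 0" for x
  proof (rule ccontr)
    assume "\<not> ?thesis"
    then have "s (lift6 x) y $ 7 = 0" for y using ld(2)[of "lift6 x" y] by (metis \<omega>_def neg_equal_0_iff_equal)
    then have "lift6 x \<in> span {axis 7 1}" by (rule nd)
    then obtain a where a: "lift6 x = a *\<^sub>R axis 7 1" by (auto simp: span_singleton)
    then have "lift6 x $ 7 = a" by simp
    then have "a = 0" by (simp add: lift6_def vector_7)
    then have "x = 0" using a drop7_lift6[of x] by (simp add: drops)
    then show False using that by simp
  qed
  ultimately have "symplectic_lie_algebra h \<omega>" by (simp add: symplectic_lie_algebra_def)
  moreover have "lie_isomorphic s (central_extension h \<omega>)"
  proof (rule lie_isomorphicI[where f = "\<lambda>x. (drop7 x, x $ 7)" and g = "\<lambda>u. lift6 (fst u) + snd u *\<^sub>R axis 7 1"])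
    show "linear (\<lambda>x. (drop7 x, x $ 7))" by (rule linearI) (simp_all add: drops)
    have "drop7 (axis 7 1) = 0" unfolding axis_7 by (simp add: drop7_def vec_eq_iff forall_6 vector_6 vector_7)
    then show "(drop7 (lift6 (fst u) + snd u *\<^sub>R axis 7 1), (lift6 (fst u) + snd u *\<^sub>R axis 7 1) $ 7) = u" for u
      by (simp add: drops drop7_lift6) (simp add: lift6_def vector_7)
    show "lift6 (fst (drop7 x, x $ 7)) + snd (drop7 x, x $ 7) *\<^sub>R axis 7 1 = x" for x by (simp add: lift6_drop7)
  qed (simp add: central_extension_def h_def \<omega>_def ld)
  ultimately show ?thesis unfolding is_contactization7_def by blast
qed

lemma contactization_s10: assumes "lie_algebra s10" shows "is_contactization7 s10"
proof (rule contactization_criterion[OF assms])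
  fix x :: "real^7" assume h: "\<And>y. s10 x y $ 7 = 0"
  have "x $ 1 = 0" "x $ 6 = 0" "x $ 2 + sqrt 3 * x $ 3 = 0 \<and> sqrt 3 * x $ 2 = x $ 3" "sqrt 3 * x $ 4 + x $ 5 = 0 \<and> sqrt 3 * x $ 5 = x $ 4"
    using h[of "axis 6 1"] h[of "axis 1 1"] h[of "axis 5 1"] h[of "axis 4 1"] h[of "axis 2 1"] h[of "axis 3 1"]
    by (simp_all add: s10_def structure_eqs7_def vector_uminus_component vector_7 axis_def)
  moreover from this have "x $ 2 = 0 \<and> x $ 3 = 0" "x $ 4 = 0 \<and> x $ 5 = 0"
    using sqrt3_cancel(1)[of "x $ 2" "x $ 3"] sqrt3_cancel(2)[of "x $ 4" "x $ 5"] by simp_all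
  ultimately have "x = x $ 7 *\<^sub>R axis 7 1" unfolding axis_7 by (simp add: vec_eq_iff forall_7 vector_7)
  then show "x \<in> span {axis 7 1}" by (metis span_base span_scale singletonI)
qed (simp add: s10_def s11_def structure_eqs7_def vector_7 vec_eq_iff forall_7 axis_7)

lemma contactization_s11: assumes "lie_algebra s11" shows "is_contactization7 s11"
proof (rule contactization_criterion[OF assms])
  fix x :: "real^7" assume h: "\<And>y. s11 x y $ 7 = 0"
  have "x $ 1 = 0" "x $ 6 = 0" "sqrt 3 * x $ 3 = x $ 2 \<and> sqrt 3 * x $ 2 + x $ 3 = 0" "sqrt 3 * x $ 4 = x $ 5 \<and> sqrt 3 * x $ 5 + x $ 4 = 0"
    using h[of "axis 6 1"] h[of "axis 1 1"] h[of "axis 5 1"] h[of "axis 4 1"] h[of "axis 2 1"] h[of "axis 3 1"]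
    by (simp_all add: s11_def structure_eqs7_def vector_uminus_component vector_7 axis_def)
  moreover from this have "x $ 2 = 0 \<and> x $ 3 = 0" "x $ 4 = 0 \<and> x $ 5 = 0"
    using sqrt3_cancel(1)[of "x $ 3" "x $ 2"] sqrt3_cancel(1)[of "x $ 4" "x $ 5"] by simp_all
  ultimately have "x = x $ 7 *\<^sub>R axis 7 1" unfolding axis_7 by (simp add: vec_eq_iff forall_7 vector_7)
  then show "x \<in> span {axis 7 1}" by (metis span_base span_scale singletonI)
qed (simp add: s10_def s11_def structure_eqs7_def vector_7 vec_eq_iff forall_7 axis_7)

theorem theorem4p1:
  fixes br :: "'a::real_vector \<Rightarrow> 'a \<Rightarrow> 'a"
  assumes "lie_algebra br"
    and "dim (UNIV :: 'a set) = 7"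
    and "lie_unimodular br"
    and "lie_solvable br"
    and "\<not> lie_nilpotent br"
    and "lie_center br \<noteq> {0}"
  shows "(admits_closed_G2 br \<longleftrightarrow>
            lie_isomorphic br s1 \<or> lie_isomorphic br s2 \<or> lie_isomorphic br s3 \<or>
            lie_isomorphic br s4 \<or> lie_isomorphic br s5 \<or>
            (\<exists>\<alpha>>0. lie_isomorphic br (s6 \<alpha>)) \<or>
            lie_isomorphic br s7 \<or> lie_isomorphic br s8 \<or> lie_isomorphic br s9 \<or>
            lie_isomorphic br s10 \<or> lie_isomorphic br s11) \<and>
         (admits_closed_G2 br \<longrightarrow>
            (is_contactization7 br \<longleftrightarrow> lie_isomorphic br s10 \<or> lie_isomorphic br s11))"
proof -
  have admits: "admits_closed_G2 br \<longleftrightarrow>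
            lie_isomorphic br s1 \<or> lie_isomorphic br s2 \<or> lie_isomorphic br s3 \<or>
            lie_isomorphic br s4 \<or> lie_isomorphic br s5 \<or>
            (\<exists>\<alpha>>0. lie_isomorphic br (s6 \<alpha>)) \<or>
            lie_isomorphic br s7 \<or> lie_isomorphic br s8 \<or> lie_isomorphic br s9 \<or>
            lie_isomorphic br s10 \<or> lie_isomorphic br s11" (is "_ \<longleftrightarrow> ?R")
  proof
    assume "admits_closed_G2 br"
    then show ?R by (rule closed_G2_classification[OF assms])
  next
    assume ?R
    then show "admits_closed_G2 br"
      using admits_closed_G2_isomorphic s1_admits s2_admits s3_admits s4_admits s5_admits s6_admits s7_admits s8_admits
        s9_admits s10_admits s11_admits by blast
  qed
  moreover have "is_contactization7 br \<longleftrightarrow> lie_isomorphic br s10 \<or> lie_isomorphic br s11" if ?R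
  proof
    assume c: "is_contactization7 br"
    have "\<not> lie_isomorphic br s" if "\<not> is_contactization7 s" for s :: "real^7 \<Rightarrow> real^7 \<Rightarrow> real^7"
      using is_contactization7_isomorphic[OF lie_isomorphic_sym c] that by blast
    then show "lie_isomorphic br s10 \<or> lie_isomorphic br s11"
      using \<open>?R\<close> not_contactization_s1 not_contactization_s2 not_contactization_s3 not_contactization_s4 not_contactization_s5
        not_contactization_s6 not_contactization_s7 not_contactization_s8 not_contactization_s9 by blast
  next
    assume "lie_isomorphic br s10 \<or> lie_isomorphic br s11"
    then show "is_contactization7 br"
      using lie_algebra_isomorphic[OF _ assms(1)] contactization_s10 contactization_s11 is_contactization7_isomorphic by blast
  qed
  ultimately show ?thesis by blast
qed

end
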